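(* Let $n\ge1$ and let $\alpha\in\mathbb{N}_0^n\setminus\{(0,\dots,0)\}$ be any multi-index. Then the Gaussian Riesz transform $R_\alpha^*=D^{*\alpha}(\mathcal{L}+I)^{-|\alpha|/2}$ is bounded from $\mathcal{H}^1(\gamma)$ to $L^1(\gamma)$; that is, there is a constant $C>0$ such that $\|R_\alpha^*f\|_{L^1(\gamma)}\le C\|f\|_{\mathcal{H}^1(\gamma)}$ for every $f\in\mathcal{H}^1(\gamma)$.
   Context: Measure and operator. On $\mathbb{R}^n$ let $d\gamma(x)=\pi^{-n/2}e^{-|x|^2}dx$; $L^p(\gamma)=L^p(\mathbb{R}^n,\gamma)$ with norm $\|\cdot\|_p$. Let $\delta_i^*=-\frac{1}{\sqrt2}e^{|x|^2}\frac{\partial}{\partial x_i}\left(e^{-|x|^2}\,\cdot\right)$ be the formal adjoint on $L^2(\gamma)$ of $\delta_i=\frac1{\sqrt2}\frac{\partial}{\partial x_i}$, and $D^{*\alpha}=\delta_1^{*\alpha_1}\cdots\delta_n^{*\alpha_n}$, $|\alpha|=\sum_i\alpha_i$. Let $\mathcal{L}$ be the closure on $L^2(\gamma)$ of the Ornstein-Uhlenbeck operator $L=-\frac12\Delta+x\cdot\nabla=\sum_i\delta_i^*\delta_i$ defined on $C_c^\infty(\mathbb{R}^n)$. It is positive self-adjoint, and the normalized Hermite polynomials $\{h_\beta\}_{\beta\in\mathbb{N}_0^n}$ form an orthonormal basis of $L^2(\gamma)$ with $\mathcal{L}h_\beta=|\beta|h_\beta$; $(\mathcal{L}+I)^{-|\alpha|/2}$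 is defined spectrally, $I$ being the identity on $L^2(\gamma)$. The transform. $R_\alpha^*=D^{*\alpha}(\mathcal{L}+I)^{-|\alpha|/2}$ is bounded on $L^2(\gamma)$ and is known to be bounded from $L^1(\gamma)$ into $L^{1,\infty}(\gamma)$ (weak $L^1$); this (unique continuous) extension gives meaning to $R_\alpha^*f$ for $f\in\mathcal{H}^1(\gamma)\subseteq L^1(\gamma)$. Admissible balls. A Euclidean ball $B=B(c_B,r_B)$ is admissible if $r_B\le m(|c_B|)$, where $m(s)=1$ for $0\le s\le1$ and $m(s)=1/s$ for $s>1$. Hardy space. For $r\in(1,\infty]$, a Gaussian $(1,r)$-atom is either the constant function $1$ or a function $a\in L^r(\gamma)$ supported in an admissible ball $B$ with $\int a\,d\gamma=0$ and $\|a\|_r\le\gamma(B)^{\frac1r-1}$. The space $\mathcal{H}^{1,r}(\gamma)$ consists of all $f\in L^1(\gamma)$ admitting a decomposition $f=\sum_j\lambda_ja_j$ with $a_j$ Gaussian $(1,r)$-atoms and $\sum_j|\lambda_j|<\infty$ ($\lambda_j\in\mathbb{C}$); its norm is the infimum of $\sum_j|\lambda_j|$ over all such representations. These spaces are known to coincide for all $1<r\le\infty$ with equivalent norms, and any one of them is denoted $\mathcal{H}^1(\gamma)$. *)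

theory Defs
  imports "HOL-Probability.Probability"
begin

definition gauss :: "(real ^ 'n::finite) measure" where
  "gauss = density lborel
     (\<lambda>x. ennreal (pi powr (- real CARD('n) / 2) * exp (- (norm x)\<^sup>2)))"


section \<open>Lebesgue spaces of the Gauss measure\<close>

text \<open>Elements of \<open>L\<^sup>p\<close> are represented by Borel functions; all notions below that concern
  elements of \<open>L\<^sup>p\<close> are invariant under changes on null sets. The exponent ranges over
  \<open>1 \<le> p \<le> \<infinity>\<close>.\<close>

definition Lp :: "ereal \<Rightarrow> (real ^ 'n::finite \<Rightarrow> complex) set" where
  "Lp p = {f. f \<in> borel_measurable gauss \<and>
     (if p = \<infinity> then esssup gauss (\<lambda>x. ereal (norm (f x))) < \<infinity>
      else integrable gauss (\<lambda>x. norm (f x) powr real_of_ereal p))}"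

definition Lp_norm :: "ereal \<Rightarrow> (real ^ 'n::finite \<Rightarrow> complex) \<Rightarrow> real" where
  "Lp_norm p f =
     (if p = \<infinity> then real_of_ereal (esssup gauss (\<lambda>x. ereal (norm (f x))))
      else (LINT x|gauss. norm (f x) powr real_of_ereal p) powr (1 / real_of_ereal p))"

definition L2_inner :: "(real ^ 'n::finite \<Rightarrow> complex) \<Rightarrow> (real ^ 'n \<Rightarrow> complex) \<Rightarrow> complex" where
  "L2_inner f g = (LINT x|gauss. f x * cnj (g x))"

definition weak_L1_norm :: "(real ^ 'n::finite \<Rightarrow> complex) \<Rightarrow> ennreal" where
  "weak_L1_norm f = (SUP t\<in>{0<..}. ennreal t * emeasure gauss {x. norm (f x) > t})"


section \<open>Test functions, weak derivatives and the adjoint derivatives\<close>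

definition partial :: "'n \<Rightarrow> (real ^ 'n::finite \<Rightarrow> complex) \<Rightarrow> real ^ 'n \<Rightarrow> complex" where
  "partial i f x = vector_derivative (\<lambda>t. f (x + t *\<^sub>R axis i 1)) (at 0)"

text \<open>\<open>C\<^sub>c\<^sup>\<infinity>\<close>: every iterated partial derivative is (Frechet) differentiable, and the
  function vanishes off a bounded set.\<close>

definition test_function :: "(real ^ 'n::finite \<Rightarrow> complex) \<Rightarrow> bool" where
  "test_function \<phi> \<longleftrightarrow>
     (\<forall>is. foldr partial is \<phi> differentiable_on UNIV) \<and> bounded {x. \<phi> x \<noteq> 0}"

definition locally_integrable :: "(real ^ 'n::finite \<Rightarrow> complex) \<Rightarrow> bool" where
  "locally_integrable f \<longleftrightarrow> (\<forall>K. compact K \<longrightarrow> set_integrable lborel K f)"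

definition weak_partial ::
    "'n \<Rightarrow> (real ^ 'n::finite \<Rightarrow> complex) \<Rightarrow> (real ^ 'n \<Rightarrow> complex) \<Rightarrow> bool" where
  "weak_partial i u v \<longleftrightarrow> locally_integrable u \<and> locally_integrable v \<and>
     (\<forall>\<phi>. test_function \<phi> \<longrightarrow>
        (LINT x|lborel. u x * partial i \<phi> x) = - (LINT x|lborel. v x * \<phi> x))"

text \<open>\<open>delta_star i u v\<close> means \<open>v = \<delta>\<^sub>i\<^sup>* u\<close>, the derivative being taken in the weak sense because
  \<open>u\<close> is only assumed to be a (locally integrable) function.\<close>

definition delta_star ::
    "'n \<Rightarrow> (real ^ 'n::finite \<Rightarrow> complex) \<Rightarrow> (real ^ 'n \<Rightarrow> complex) \<Rightarrow> bool" where
  "delta_star i u v \<longleftrightarrow>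
     (\<exists>w. weak_partial i (\<lambda>x. complex_of_real (exp (- (norm x)\<^sup>2)) * u x) w \<and>
          v = (\<lambda>x. complex_of_real (- (1 / sqrt 2) * exp ((norm x)\<^sup>2)) * w x))"

fun delta_star_list ::
    "'n list \<Rightarrow> (real ^ 'n::finite \<Rightarrow> complex) \<Rightarrow> (real ^ 'n \<Rightarrow> complex) \<Rightarrow> bool" where
  "delta_star_list [] u v \<longleftrightarrow> v = u"
| "delta_star_list (i # is) u v \<longleftrightarrow> (\<exists>w. delta_star_list is u w \<and> delta_star i w v)"

text \<open>\<open>D_star \<alpha> u v\<close> means \<open>v = D\<^sup>*\<^sup>\<alpha> u\<close>. The index type \<open>'n\<close> carries no order; the operators
  \<open>\<delta>\<^sub>i\<^sup>*\<close> commute, and the identity is required for every order of composition in which each \<open>\<delta>\<^sub>i\<^sup>*\<close>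
  occurs \<open>\<alpha> i\<close> times.\<close>

definition D_star ::
    "('n \<Rightarrow> nat) \<Rightarrow> (real ^ 'n::finite \<Rightarrow> complex) \<Rightarrow> (real ^ 'n \<Rightarrow> complex) \<Rightarrow> bool" where
  "D_star \<alpha> u v \<longleftrightarrow> (\<forall>is. (\<forall>i. count_list is i = \<alpha> i) \<longrightarrow> delta_star_list is u v)"


section \<open>The Ornstein--Uhlenbeck operator and the Riesz transform\<close>

definition OU :: "(real ^ 'n::finite \<Rightarrow> complex) \<Rightarrow> real ^ 'n \<Rightarrow> complex" where
  "OU \<phi> x = - (1 / 2) * (\<Sum>i\<in>UNIV. partial i (partial i \<phi>) x)
            + (\<Sum>i\<in>UNIV. complex_of_real (x $ i) * partial i \<phi> x)"

text \<open>The graph of the closure on \<open>L\<^sup>2\<close> of \<open>OU\<close> with domain \<open>C\<^sub>c\<^sup>\<infinity>\<close>.\<close>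

definition OU_closure :: "(real ^ 'n::finite \<Rightarrow> complex) \<Rightarrow> (real ^ 'n \<Rightarrow> complex) \<Rightarrow> bool" where
  "OU_closure f g \<longleftrightarrow> f \<in> Lp 2 \<and> g \<in> Lp 2 \<and>
     (\<exists>\<phi> :: nat \<Rightarrow> real ^ 'n \<Rightarrow> complex. (\<forall>k. test_function (\<phi> k)) \<and>
        (\<lambda>k. Lp_norm 2 (\<lambda>x. \<phi> k x - f x)) \<longlonglongrightarrow> 0 \<and>
        (\<lambda>k. Lp_norm 2 (\<lambda>x. OU (\<phi> k) x - g x)) \<longlonglongrightarrow> 0)"

text \<open>\<open>OU_spectral m f u\<close> means \<open>u = m(\<L>) f\<close> for the self-adjoint closure \<open>\<L>\<close>. As \<open>\<L>\<close> has an
  orthonormal basis of eigenfunctions, its spectral calculus multiplies the component in the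
  eigenspace of \<open>\<mu>\<close> by \<open>m \<mu>\<close>: tested against eigenfunctions, this says
  \<open>\<langle>u, h\<rangle> = m \<mu> \<langle>f, h\<rangle>\<close> whenever \<open>\<L> h = \<mu> h\<close>.\<close>

definition OU_spectral ::
    "(real \<Rightarrow> real) \<Rightarrow> (real ^ 'n::finite \<Rightarrow> complex) \<Rightarrow> (real ^ 'n \<Rightarrow> complex) \<Rightarrow> bool" where
  "OU_spectral m f u \<longleftrightarrow> f \<in> Lp 2 \<and> u \<in> Lp 2 \<and>
     (\<forall>\<mu> h. OU_closure h (\<lambda>x. complex_of_real \<mu> * h x) \<longrightarrow>
        L2_inner u h = complex_of_real (m \<mu>) * L2_inner f h)"

text \<open>\<open>riesz_L2 \<alpha> f g\<close> means \<open>g = D\<^sup>*\<^sup>\<alpha> (\<L> + I) powr (-|\<alpha>|/2) f\<close>, for \<open>f\<close> in \<open>L\<^sup>2\<close>.\<close>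

definition riesz_L2 ::
    "('n \<Rightarrow> nat) \<Rightarrow> (real ^ 'n::finite \<Rightarrow> complex) \<Rightarrow> (real ^ 'n \<Rightarrow> complex) \<Rightarrow> bool" where
  "riesz_L2 \<alpha> f g \<longleftrightarrow>
     (\<exists>u. OU_spectral (\<lambda>\<mu>. (\<mu> + 1) powr (- real (\<Sum>i\<in>UNIV. \<alpha> i) / 2)) f u \<and> D_star \<alpha> u g)"

text \<open>The extension of the Riesz transform by continuity from \<open>L\<^sup>2\<close> to \<open>L\<^sup>1\<close>, with values in weak
  \<open>L\<^sup>1\<close>: \<open>riesz \<alpha> f g\<close> holds if some \<open>F k \<in> L\<^sup>2\<close> converge to \<open>f\<close> in \<open>L\<^sup>1\<close> while their transforms
  \<open>G k\<close> converge to \<open>g\<close> in weak \<open>L\<^sup>1\<close>. Because of the known boundedness from \<open>L\<^sup>1\<close> to weak \<open>L\<^sup>1\<close>,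
  \<open>g\<close> is determined almost everywhere by \<open>f\<close> and is the value at \<open>f\<close> of the unique continuous
  extension; see \<open>riesz_eq_extension\<close> below.\<close>

definition riesz ::
    "('n \<Rightarrow> nat) \<Rightarrow> (real ^ 'n::finite \<Rightarrow> complex) \<Rightarrow> (real ^ 'n \<Rightarrow> complex) \<Rightarrow> bool" where
  "riesz \<alpha> f g \<longleftrightarrow> f \<in> Lp 1 \<and> g \<in> borel_measurable gauss \<and>
     (\<exists>F G :: nat \<Rightarrow> real ^ 'n \<Rightarrow> complex.
        (\<forall>k. F k \<in> Lp 2 \<and> G k \<in> borel_measurable gauss \<and> riesz_L2 \<alpha> (F k) (G k)) \<and>
        (\<lambda>k. Lp_norm 1 (\<lambda>x. F k x - f x)) \<longlonglongrightarrow> 0 \<and>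
        (\<lambda>k. weak_L1_norm (\<lambda>x. G k x - g x)) \<longlonglongrightarrow> 0)"


section \<open>The Hardy space\<close>

definition admissible_radius :: "real \<Rightarrow> real" where
  "admissible_radius s = (if s \<le> 1 then 1 else 1 / s)"

definition gaussian_atom :: "ereal \<Rightarrow> (real ^ 'n::finite \<Rightarrow> complex) \<Rightarrow> bool" where
  "gaussian_atom r a \<longleftrightarrow> a = (\<lambda>x. 1) \<or>
     (a \<in> Lp r \<and> (\<exists>c \<rho>. 0 < \<rho> \<and> \<rho> \<le> admissible_radius (norm c) \<and>
        (AE x in gauss. x \<notin> ball c \<rho> \<longrightarrow> a x = 0) \<and>
        (LINT x|gauss. a x) = 0 \<and>
        Lp_norm r a \<le> measure gauss (ball c \<rho>) powr (real_of_ereal (1 / r) - 1)))"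

definition atomic_decomposition ::
    "ereal \<Rightarrow> (real ^ 'n::finite \<Rightarrow> complex) \<Rightarrow> (nat \<Rightarrow> complex) \<Rightarrow>
     (nat \<Rightarrow> real ^ 'n \<Rightarrow> complex) \<Rightarrow> bool" where
  "atomic_decomposition r f c a \<longleftrightarrow>
     (\<forall>j. gaussian_atom r (a j)) \<and> summable (\<lambda>j. norm (c j)) \<and>
     (\<lambda>N. Lp_norm 1 (\<lambda>x. f x - (\<Sum>j<N. c j * a j x))) \<longlonglongrightarrow> 0"

definition hardy :: "ereal \<Rightarrow> (real ^ 'n::finite \<Rightarrow> complex) set" where
  "hardy r = {f \<in> Lp 1. \<exists>c a. atomic_decomposition r f c a}"

definition hardy_norm :: "ereal \<Rightarrow> (real ^ 'n::finite \<Rightarrow> complex) \<Rightarrow> real" where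
  "hardy_norm r f = Inf {\<Sum>j. norm (c j) | c. \<exists>a. atomic_decomposition r f c a}"


section \<open>Consistency of the extension\<close>

lemma prob_space_gauss: "prob_space (gauss :: (real ^ 'n::finite) measure)"
proof
  let ?d = "normal_density 0 (1 / sqrt 2)"
  have d: "?d t = pi powr (- 1 / 2) * exp (- t\<^sup>2)" for t
  proof -
    have e: "2 * pi * (1 / sqrt 2)\<^sup>2 = pi" "2 * (1 / sqrt 2)\<^sup>2 = (1 :: real)"
      by (simp_all add: power_divide)
    moreover have "pi powr (- 1 / 2) = 1 / sqrt pi"
      using powr_minus_divide[of pi "1 / 2"] by (simp add: powr_half_sqrt)
    ultimately show ?thesis
      unfolding normal_density_def diff_zero e by simp
  qed
  have "pi powr (- real CARD('n) / 2) * exp (- (norm x)\<^sup>2) = (\<Prod>b\<in>Basis. ?d (x \<bullet> b))"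
    for x :: "real ^ 'n"
  proof -
    have "(norm x)\<^sup>2 = (\<Sum>b\<in>Basis. (x \<bullet> b)\<^sup>2)"
      unfolding power2_norm_eq_inner by (subst euclidean_inner) (simp add: power2_eq_square)
    moreover have "pi powr (- real CARD('n) / 2) = (pi powr (- 1 / 2)) ^ CARD('n)"
      by (simp add: powr_power)
    ultimately show ?thesis
      by (simp add: d prod.distrib exp_sum[symmetric] sum_negf)
  qed
  then have "emeasure (gauss :: (real ^ 'n) measure) (space gauss) =
      (\<integral>\<^sup>+ x. (\<Prod>b\<in>Basis. ennreal (?d (x \<bullet> b))) \<partial>(lborel :: (real ^ 'n) measure))"
    by (simp add: gauss_def emeasure_density prod_ennreal)
  also have "\<dots> = (\<Prod>b\<in>(Basis :: (real ^ 'n) set). (\<integral>\<^sup>+ t. ennreal (?d t) \<partial>lborel))"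
    by (rule nn_integral_lborel_prod) auto
  also have "(\<integral>\<^sup>+ t. ennreal (?d t) \<partial>lborel) = 1"
    using prob_space.emeasure_space_1[OF prob_space_normal_density[of "1 / sqrt 2" 0]]
    by (simp add: emeasure_density)
  finally show "emeasure (gauss :: (real ^ 'n) measure) (space gauss) = 1"
    by simp
qed

lemma sets_gauss [simp, measurable_cong]: "sets gauss = sets borel"
  and space_gauss [simp]: "space gauss = UNIV"
  by (simp_all add: gauss_def)

lemma Lp_2_subset_1: "f \<in> Lp 2 \<Longrightarrow> f \<in> Lp 1"
proof -
  interpret prob_space "gauss :: (real ^ 'a) measure" by (rule prob_space_gauss)
  assume f: "f \<in> Lp 2"
  then have [measurable]: "f \<in> borel_measurable borel"
    by (simp add: Lp_def cong: measurable_cong_sets)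
  have "integrable gauss (\<lambda>x. norm (f x) powr 1)"
  proof (rule Bochner_Integration.integrable_bound)
    show "integrable gauss (\<lambda>x. 1 + norm (f x) powr 2)"
      using f by (auto simp: Lp_def)
    have "t \<le> 1 + t\<^sup>2" if "0 \<le> t" for t :: real
      using that zero_le_power2[of "t - 1"] by (simp add: power2_diff)
    then show "AE x in gauss. norm (norm (f x) powr 1) \<le> norm (1 + norm (f x) powr 2)"
      by (auto simp: powr_numeral)
  qed simp
  then show ?thesis
    using f by (auto simp: Lp_def one_ereal_def)
qed

lemma weak_L1_normD:
  "0 < t \<Longrightarrow> ennreal t * emeasure gauss {x. norm (f x) > t} \<le> weak_L1_norm f"
  unfolding weak_L1_norm_def by (rule SUP_upper) auto

lemma riesz_eq_extension:
  fixes T :: "(real ^ 'n::finite \<Rightarrow> complex) \<Rightarrow> real ^ 'n \<Rightarrow> complex"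
  assumes meas: "\<And>f. f \<in> Lp 1 \<Longrightarrow> T f \<in> borel_measurable gauss"
    and bounded: "\<And>f h. f \<in> Lp 1 \<Longrightarrow> h \<in> Lp 1 \<Longrightarrow>
      weak_L1_norm (\<lambda>x. T f x - T h x) \<le> ennreal (A * Lp_norm 1 (\<lambda>x. f x - h x))"
    and extends: "\<And>f g. riesz_L2 \<alpha> f g \<Longrightarrow> AE x in gauss. T f x = g x"
    and fg: "riesz \<alpha> f g"
  shows "AE x in gauss. T f x = g x"
proof -
  obtain F G where F: "\<And>k. F k \<in> Lp 2" and R: "\<And>k. riesz_L2 \<alpha> (F k) (G k)"
    and G: "\<And>k. G k \<in> borel_measurable gauss"
    and lim1: "(\<lambda>k. Lp_norm 1 (\<lambda>x. F k x - f x)) \<longlonglongrightarrow> 0"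
    and lim2: "(\<lambda>k. weak_L1_norm (\<lambda>x. G k x - g x)) \<longlonglongrightarrow> 0"
    and f: "f \<in> Lp 1" and g: "g \<in> borel_measurable gauss"
    using fg unfolding riesz_def by blast
  note F1 = Lp_2_subset_1[OF F]
  have [measurable]: "T f \<in> borel_measurable borel" "g \<in> borel_measurable borel"
    "\<And>k. T (F k) \<in> borel_measurable borel" "\<And>k. G k \<in> borel_measurable borel"
    using meas[OF f] meas[OF F1] g G by (simp_all cong: measurable_cong_sets)
  have null: "emeasure gauss {x. norm (T f x - g x) > 2 * t} = 0" if t: "0 < t" for t
  proof -
    let ?E = "emeasure gauss {x. norm (T f x - g x) > 2 * t}"
    let ?b = "\<lambda>k. ennreal (A * Lp_norm 1 (\<lambda>x. F k x - f x)) + weak_L1_norm (\<lambda>x. G k x - g x)"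
    have "ennreal t * ?E \<le> ?b k" for k
    proof -
      let ?P = "{x. norm (T (F k) x - T f x) > t}" and ?Q = "{x. norm (G k x - g x) > t}"
      have "AE x in gauss. x \<in> {x. norm (T f x - g x) > 2 * t} \<longrightarrow> x \<in> ?P \<union> ?Q"
        using extends[OF R[of k]]
      proof eventually_elim
        case (elim x)
        have "norm (T f x - g x) \<le> norm (T (F k) x - T f x) + norm (G k x - g x)"
          using norm_triangle_ineq4[of "G k x - g x" "T (F k) x - T f x"] elim by simp
        then show ?case by auto
      qed
      then have "?E \<le> emeasure gauss (?P \<union> ?Q)"
        by (rule emeasure_mono_AE) measurable
      also have "\<dots> \<le> emeasure gauss ?P + emeasure gauss ?Q"
        by (rule emeasure_subadditive) measurable
      finally have "ennreal t * ?E \<le> ennreal t * emeasure gauss ?P + ennreal t * emeasure gauss ?Q"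
        unfolding distrib_left[symmetric] by (rule mult_left_mono) simp
      also have "\<dots> \<le> ?b k"
        by (intro add_mono order_trans[OF weak_L1_normD[OF t] bounded[OF F1 f, of k]]
            weak_L1_normD[OF t])
      finally show ?thesis .
    qed
    moreover have "?b \<longlonglongrightarrow> ennreal (A * 0) + 0"
      by (intro tendsto_intros lim1 lim2)
    ultimately have "ennreal t * ?E \<le> 0"
      using LIMSEQ_le_const[of ?b "ennreal (A * 0) + 0" "ennreal t * ?E"] by auto
    with t show ?thesis by auto
  qed
  have "AE x in gauss. \<forall>n::nat. norm (T f x - g x) \<le> 2 * (1 / real (Suc n))"
  proof (rule AE_all_countable[THEN iffD2], rule allI)
    fix n :: nat
    show "AE x in gauss. norm (T f x - g x) \<le> 2 * (1 / real (Suc n))"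
      using null[of "1 / real (Suc n)"]
      by (subst AE_iff_measurable[OF _ refl]) (simp_all add: not_le)
  qed
  then show ?thesis
  proof eventually_elim
    case (elim x)
    have "(\<lambda>n. 2 * (1 / real (Suc n))) \<longlonglongrightarrow> 2 * 0"
      by (intro tendsto_intros LIMSEQ_inverse_real_of_nat[unfolded inverse_eq_divide])
    then have "norm (T f x - g x) \<le> 0"
      using elim by (intro LIMSEQ_le_const) auto
    then show ?case by simp
  qed
qed

end

theory Submission
  imports Defs "HOL-Real_Asymp.Real_Asymp"
begin

text \<open>Let \<open>H\<^sub>\<beta>\<close> be the Hermite polynomials, normalised so that \<open>\<delta>\<^sub>i\<^sup>*\<close> maps \<open>H\<^sub>\<beta>\<close> to \<open>H\<close> with \<open>\<beta> i\<close> raised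
  by one. The transform sends \<open>H\<^sub>\<beta>\<close> to \<open>(|\<beta>| + 1) powr (- |\<alpha>| / 2)\<close> times \<open>H\<close> with index \<open>\<alpha> + \<beta>\<close>.
  Orthogonality and \<open>(\<alpha> + \<beta>)! \<le> C (|\<beta>| + 1)\<^sup>k \<beta>!\<close>, where \<open>k = |\<alpha>|\<close>, make it bounded on \<open>L\<^sup>2(\<gamma>)\<close>
  (\<open>riesz_L2_exists\<close>; polynomials are dense by \<open>bounded_in_hspan_closure\<close>).

  Writing the negative power of \<open>\<L> + I\<close> as a Gamma integral over the semigroup represents the
  transform as a limit of integrals over \<open>t \<ge> \<epsilon>\<close> of the kernels of \<open>D\<^sup>*\<^sup>\<alpha> exp (- t \<L>)\<close>
  (\<open>riesz_L2_trunc\<close>). Because \<open>\<delta>\<^sub>i\<^sup>*\<close> carries the factor \<open>exp (|x|\<^sup>2)\<close>, this kernel, multiplied by the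
  Gauss density in \<open>x\<close>, is a translate and dilate of the single function \<open>H\<^sub>\<alpha>(z) exp (- |z|\<^sup>2)\<close>, centred
  at \<open>exp (- t) y\<close> and of width about \<open>min 1 (sqrt t)\<close>. Integrals in \<open>x\<close> with respect to \<open>\<gamma>\<close> are
  therefore estimated by translation invariance on the whole space. Off a large multiple of an
  admissible cube of side \<open>l\<close>, times \<open>t \<le> l\<^sup>2\<close> contribute little since the kernel is concentrated near
  \<open>exp (- t) y\<close>, which admissibility keeps within a multiple of \<open>l\<close> of the cube, and times \<open>t \<ge> l\<^sup>2\<close>
  contribute little because of the cancellation of the atom (\<open>trunc_riesz_off_diagonal\<close>). Together
  with the \<open>L\<^sup>2\<close> bound near the cube this bounds the images of bounded atoms in \<open>L\<^sup>1\<close>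
  (\<open>riesz_bound_bounded_atom\<close>).

  For an exponent \<open>r < \<infinity>\<close> atoms need not be bounded, and atoms in \<open>L\<^sup>q\<close>, \<open>q > 1\<close>, are decomposed. If
  the atom is a step function on a dyadic grid of finite depth, a Calderon--Zygmund decomposition at a
  large height writes it as a bounded atom plus a sum of atoms of smaller depth whose total size is
  at most half of the original one, and induction on the depth gives a bound that does not depend on
  the depth (\<open>step_atoms_uniformly_bounded\<close>). General atoms are telescoping sums of such step
  atoms (\<open>closure_bound_powr_atom\<close>).

  All limits beyond \<open>L\<^sup>2\<close> are taken in the closure of the graph in \<open>L\<^sup>1 \<times> L\<^sup>1\<close> (\<open>riesz_closure\<close>), which
  is contained in the extension of the transform to \<open>L\<^sup>1\<close> because the norm of \<open>L\<^sup>1\<close> dominates that of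
  weak \<open>L\<^sup>1\<close>. An atomic series then has an image that is bounded by the sum of its coefficients.\<close>

section \<open>The Gauss measure and integration by parts\<close>

lemma borel_measurable_gauss [simp]: "borel_measurable gauss = borel_measurable borel"
  by (rule measurable_cong_sets) auto

interpretation gauss: prob_space "gauss :: (real ^ 'n::finite) measure"
  by (rule prob_space_gauss)

definition gauss_const :: "'n::finite itself \<Rightarrow> real" where
  "gauss_const _ = pi powr (- real CARD('n) / 2)"

lemma gauss_const_pos [simp]: "gauss_const TYPE('n::finite) > 0"
  by (simp add: gauss_const_def)

lemma gauss_eq_density:
  "(gauss :: (real ^ 'n::finite) measure) =
     density lborel (\<lambda>x. ennreal (gauss_const TYPE('n) * exp (- (norm x)\<^sup>2)))"
  by (simp add: gauss_def gauss_const_def)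

lemma nn_integral_gauss:
  fixes f :: "real ^ 'n::finite \<Rightarrow> ennreal"
  assumes [measurable]: "f \<in> borel_measurable borel"
  shows "(\<integral>\<^sup>+x. f x \<partial>gauss) =
    (\<integral>\<^sup>+x. ennreal (gauss_const TYPE('n) * exp (- (norm x)\<^sup>2)) * f x \<partial>lborel)"
  unfolding gauss_eq_density by (subst nn_integral_density) auto

lemma AE_gauss_iff: "(AE x in gauss. P x) \<longleftrightarrow> (AE x in (lborel :: (real ^ 'n::finite) measure). P x)"
  unfolding gauss_eq_density by (subst AE_density) auto

lemma integral_gauss:
  fixes f :: "real ^ 'n::finite \<Rightarrow> 'b::{banach, second_countable_topology}"
  assumes [measurable]: "f \<in> borel_measurable borel"
  shows "(LINT x|gauss. f x) = gauss_const TYPE('n) *\<^sub>R (LINT x|lborel. exp (- (norm x)\<^sup>2) *\<^sub>R f x)"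
proof -
  have "(LINT x|gauss. f x) = (LINT x|lborel. (gauss_const TYPE('n) * exp (- (norm x)\<^sup>2)) *\<^sub>R f x)"
    unfolding gauss_eq_density by (subst integral_density) (auto simp: less_imp_le)
  then show ?thesis by (simp flip: scaleR_scaleR)
qed

lemma integrable_gauss_iff:
  fixes f :: "real ^ 'n::finite \<Rightarrow> 'b::{banach, second_countable_topology}"
  assumes [measurable]: "f \<in> borel_measurable borel"
  shows "integrable gauss f \<longleftrightarrow> integrable lborel (\<lambda>x. exp (- (norm x)\<^sup>2) *\<^sub>R f x)"
proof -
  have "integrable gauss f \<longleftrightarrow>
      integrable lborel (\<lambda>x. (gauss_const TYPE('n) * exp (- (norm x)\<^sup>2)) *\<^sub>R f x)"
    unfolding gauss_eq_density by (subst integrable_density) (auto simp: less_imp_le)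
  also have "\<dots> \<longleftrightarrow> integrable lborel (\<lambda>x. exp (- (norm x)\<^sup>2) *\<^sub>R f x)"
  proof -
    have c: "gauss_const TYPE('n) \<noteq> 0" using gauss_const_pos[where 'n='n] by linarith
    show ?thesis
      using integrable_scaleR_right[of "inverse (gauss_const TYPE('n))" lborel
          "\<lambda>x. (gauss_const TYPE('n) * exp (- (norm x)\<^sup>2)) *\<^sub>R f x"]
        integrable_scaleR_right[of "gauss_const TYPE('n)" lborel "\<lambda>x. exp (- (norm x)\<^sup>2) *\<^sub>R f x"] c
      by (auto simp: field_simps)
  qed
  finally show ?thesis .
qed

lemma nn_integral_lborel_affine:
  fixes f :: "real ^ 'n::finite \<Rightarrow> ennreal"
  assumes [measurable]: "f \<in> borel_measurable borel" and "c > 0"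
  shows "(\<integral>\<^sup>+x. f x \<partial>lborel) = ennreal (c ^ CARD('n)) * (\<integral>\<^sup>+x. f (t + c *\<^sub>R x) \<partial>lborel)"
  by (subst lborel_affine[of c t])
     (use \<open>c > 0\<close> in \<open>auto simp: nn_integral_density nn_integral_distr nn_integral_cmult\<close>)

lemma integral_lborel_affine:
  fixes f :: "real ^ 'n::finite \<Rightarrow> 'b::{banach, second_countable_topology}"
  assumes [measurable]: "f \<in> borel_measurable borel" and "c > 0"
  shows "(LINT x|lborel. f x) = c ^ CARD('n) *\<^sub>R (LINT x|lborel. f (t + c *\<^sub>R x))"
  by (subst lborel_affine[of c t])
     (use \<open>c > 0\<close> in \<open>auto simp: integral_density integral_distr\<close>)

lemma integrable_lborel_shift:
  fixes f :: "real ^ 'n::finite \<Rightarrow> 'b::{banach, second_countable_topology}"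
  assumes "integrable lborel f"
  shows "integrable lborel (\<lambda>x. f (t + x))" "(LINT x|lborel. f (t + x)) = (LINT x|lborel. f x)"
proof -
  have m[measurable]: "f \<in> borel_measurable borel" using assms by auto
  have "integrable (distr lborel borel ((+) t)) f"
    using assms by (simp add: lborel_distr_plus)
  then show "integrable lborel (\<lambda>x. f (t + x))"
    by (subst (asm) integrable_distr_eq) auto
  show "(LINT x|lborel. f (t + x)) = (LINT x|lborel. f x)"
    using integral_lborel_affine[OF m, of 1 t] by simp
qed

lemma nn_integral_exp_quadratic_finite:
  assumes "c > 0"
  shows "(\<integral>\<^sup>+x. ennreal (exp (- c * (norm (x :: real ^ 'n::finite))\<^sup>2)) \<partial>lborel) < \<infinity>"
proof -
  have "1 = (\<integral>\<^sup>+x. 1 \<partial>(gauss :: (real ^ 'n::finite) measure))"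
    using gauss.emeasure_space_1 by (simp del: space_gauss)
  also have "\<dots> = (\<integral>\<^sup>+x. ennreal (gauss_const TYPE('n) * exp (- (norm (x :: real ^ 'n))\<^sup>2)) * 1 \<partial>lborel)"
    by (rule nn_integral_gauss) simp
  also have "\<dots> = ennreal (gauss_const TYPE('n)) *
      (\<integral>\<^sup>+x. ennreal (exp (- (norm (x :: real ^ 'n))\<^sup>2)) \<partial>lborel)"
    by (simp add: ennreal_mult nn_integral_cmult less_imp_le)
  finally have 1: "(\<integral>\<^sup>+x. ennreal (exp (- (norm (x :: real ^ 'n))\<^sup>2)) \<partial>lborel) \<noteq> \<infinity>"
    by (auto simp: ennreal_mult_top not_le split: if_splits)
  have "(\<integral>\<^sup>+x. ennreal (exp (- c * (norm (x :: real ^ 'n))\<^sup>2)) \<partial>lborel) =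
    ennreal ((1 / sqrt c) ^ CARD('n)) * 
      (\<integral>\<^sup>+x. ennreal (exp (- c * (norm (0 + (1 / sqrt c) *\<^sub>R x :: real ^ 'n))\<^sup>2)) \<partial>lborel)"
    by (rule nn_integral_lborel_affine) (use assms in auto)
  also have "\<dots> = ennreal ((1 / sqrt c) ^ CARD('n)) * 
      (\<integral>\<^sup>+x. ennreal (exp (- (norm (x :: real ^ 'n))\<^sup>2)) \<partial>lborel)"
    using assms by (simp add: power_mult_distrib power_divide)
  also have "\<dots> < \<infinity>"
    using 1 by (simp add: ennreal_mult_less_top less_top)
  finally show ?thesis .
qed

lemma integrable_exp_quadratic:
  "c > 0 \<Longrightarrow> integrable lborel (\<lambda>x :: real ^ 'n::finite. exp (- c * (norm x)\<^sup>2))"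
  using nn_integral_exp_quadratic_finite[of c, where 'n='n]
  by (intro integrableI_bounded) auto

text \<open>A class of functions that is closed under sums, products and affine changes of variables and
  whose members are integrable against every Gaussian; all polynomials belong to it.\<close>

definition exp_growth :: "(real ^ 'n::finite \<Rightarrow> 'b::real_normed_vector) \<Rightarrow> bool" where
  "exp_growth f \<longleftrightarrow> (\<exists>C a. 0 \<le> C \<and> 0 \<le> a \<and> (\<forall>x. norm (f x) \<le> C * exp (a * norm x)))"

lemma exp_growthI: "(\<And>x. norm (f x) \<le> C * exp (a * norm x)) \<Longrightarrow> exp_growth f"
proof -
  assume *: "\<And>x. norm (f x) \<le> C * exp (a * norm x)"
  have "norm (f x) \<le> \<bar>C\<bar> * exp (\<bar>a\<bar> * norm x)" for x
    by (rule order_trans[OF *]) (intro mult_mono, auto intro: mult_right_mono)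
  then show ?thesis unfolding exp_growth_def by (intro exI[of _ "\<bar>C\<bar>"] exI[of _ "\<bar>a\<bar>"]) auto
qed

lemma exp_growth_bounded: "(\<And>x. norm (f x) \<le> C) \<Longrightarrow> exp_growth f"
  by (rule exp_growthI[of _ C 0]) simp

lemma exp_growth_const: "exp_growth (\<lambda>x. c)"
  by (rule exp_growth_bounded) auto

lemma exp_growth_mono: "exp_growth f \<Longrightarrow> (\<And>x. norm (g x) \<le> norm (f x)) \<Longrightarrow> exp_growth g"
  unfolding exp_growth_def using order_trans by blast

lemma exp_growth_coord: "exp_growth (\<lambda>x :: real ^ 'n::finite. x $ i)"
proof (rule exp_growthI[of _ 1 1])
  fix x :: "real ^ 'n"
  have "\<bar>x $ i\<bar> \<le> norm x" by (rule component_le_norm_cart)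
  also have "\<dots> \<le> exp (norm x)" using exp_ge_add_one_self[of "norm x"] by linarith
  finally show "norm (x $ i) \<le> 1 * exp (1 * norm x)" by simp
qed

lemma exp_growth_add:
  assumes "exp_growth f" "exp_growth g"
  shows "exp_growth (\<lambda>x. f x + g x)"
proof -
  obtain C a where C: "0 \<le> C" "0 \<le> a" "\<And>x. norm (f x) \<le> C * exp (a * norm x)"
    using assms(1) unfolding exp_growth_def by auto
  obtain D b where D: "0 \<le> D" "0 \<le> b" "\<And>x. norm (g x) \<le> D * exp (b * norm x)"
    using assms(2) unfolding exp_growth_def by auto
  show ?thesis
  proof (rule exp_growthI[of _ "C + D" "a + b"])
    fix x
    have "norm (f x) \<le> C * exp ((a + b) * norm x)" 
      by (rule order_trans[OF C(3)]) (use C D in \<open>auto intro!: mult_left_mono mult_right_mono\<close>)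
    moreover have "norm (g x) \<le> D * exp ((a + b) * norm x)" 
      by (rule order_trans[OF D(3)]) (use C D in \<open>auto intro!: mult_left_mono mult_right_mono\<close>)
    ultimately show "norm (f x + g x) \<le> (C + D) * exp ((a + b) * norm x)"
      using norm_triangle_ineq[of "f x" "g x"] by (simp add: algebra_simps)
  qed
qed

lemma exp_growth_times_bound:
  assumes "exp_growth f" "exp_growth g" "\<And>x. norm (h x) \<le> norm (f x) * norm (g x)"
  shows "exp_growth h"
proof -
  obtain C a where C: "0 \<le> C" "0 \<le> a" "\<And>x. norm (f x) \<le> C * exp (a * norm x)"
    using assms(1) unfolding exp_growth_def by auto
  obtain D b where D: "0 \<le> D" "0 \<le> b" "\<And>x. norm (g x) \<le> D * exp (b * norm x)"
    using assms(2) unfolding exp_growth_def by auto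
  show ?thesis
  proof (rule exp_growthI[of _ "C * D" "a + b"])
    fix x
    have "norm (f x) * norm (g x) \<le> (C * exp (a * norm x)) * (D * exp (b * norm x))"
      by (intro mult_mono C D) (use C D in auto)
    then show "norm (h x) \<le> (C * D) * exp ((a + b) * norm x)"
      using assms(3)[of x] by (simp add: algebra_simps exp_add)
  qed
qed

lemma exp_growth_mult:
  fixes f g :: "real ^ 'n::finite \<Rightarrow> 'b::real_normed_algebra"
  shows "exp_growth f \<Longrightarrow> exp_growth g \<Longrightarrow> exp_growth (\<lambda>x. f x * g x)"
  by (erule exp_growth_times_bound) (auto simp: norm_mult_ineq)

lemma exp_growth_scaleR: "exp_growth f \<Longrightarrow> exp_growth g \<Longrightarrow> exp_growth (\<lambda>x. f x *\<^sub>R g x)"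
  by (erule exp_growth_times_bound) auto

lemma exp_growth_sum: "(\<And>i. i \<in> I \<Longrightarrow> exp_growth (f i)) \<Longrightarrow> exp_growth (\<lambda>x. \<Sum>i\<in>I. f i x)"
  by (induction I rule: infinite_finite_induct) (auto intro: exp_growth_const exp_growth_add)

lemma exp_growth_prod:
  fixes f :: "'a \<Rightarrow> real ^ 'n::finite \<Rightarrow> 'b::{real_normed_algebra, comm_ring_1}"
  shows "(\<And>i. i \<in> I \<Longrightarrow> exp_growth (f i)) \<Longrightarrow> exp_growth (\<lambda>x. \<Prod>i\<in>I. f i x)"
  by (induction I rule: infinite_finite_induct) (auto intro: exp_growth_const exp_growth_mult)

lemma exp_growth_affine:
  assumes "exp_growth f" shows "exp_growth (\<lambda>x. f (t + c *\<^sub>R x))"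
proof -
  obtain C a where C: "0 \<le> C" "0 \<le> a" "\<And>x. norm (f x) \<le> C * exp (a * norm x)"
    using assms(1) unfolding exp_growth_def by auto
  show ?thesis
  proof (rule exp_growthI[of _ "C * exp (a * norm t)" "a * \<bar>c\<bar>"])
    fix x :: "real^'a"
    have "norm (f (t + c *\<^sub>R x)) \<le> C * exp (a * norm (t + c *\<^sub>R x))" by (rule C)
    also have "\<dots> \<le> C * exp (a * (norm t + \<bar>c\<bar> * norm x))"
      using C norm_triangle_ineq[of t "c *\<^sub>R x"] by (intro mult_left_mono) (auto intro!: mult_left_mono)
    finally show "norm (f (t + c *\<^sub>R x)) \<le> C * exp (a * norm t) * exp (a * \<bar>c\<bar> * norm x)"
      by (simp add: algebra_simps exp_add)
  qed
qed

lemma exp_growth_norm_power: "exp_growth f \<Longrightarrow> exp_growth (\<lambda>x. norm (f x) ^ m)"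
  by (induction m) (auto intro: exp_growth_const elim: exp_growth_times_bound)

lemma exp_growth_quadratic_bound:
  assumes "exp_growth f" "c > 0"
  shows "\<exists>C\<ge>0. \<forall>x. norm (f x) \<le> C * exp (c * (norm x)\<^sup>2)"
proof -
  obtain C a where C: "0 \<le> C" "0 \<le> a" "\<And>x. norm (f x) \<le> C * exp (a * norm x)"
    using assms(1) unfolding exp_growth_def by auto
  have "norm (f x) \<le> (C * exp (a\<^sup>2 / (4 * c))) * exp (c * (norm x)\<^sup>2)" for x
  proof -
    have "0 \<le> (2 * c * norm x - a)\<^sup>2 / (4 * c)" using assms by simp
    also have "\<dots> = c * (norm x)\<^sup>2 - a * norm x + a\<^sup>2 / (4 * c)"
      using assms by (simp add: power2_eq_square field_simps)
    finally have "C * exp (a * norm x) \<le> C * exp (a\<^sup>2 / (4 * c) + c * (norm x)\<^sup>2)"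
      using C by (intro mult_left_mono) auto
    then show ?thesis using C(3)[of x] by (simp add: exp_add mult.assoc)
  qed
  then show ?thesis using C(1) by (intro exI[of _ "C * exp (a\<^sup>2 / (4 * c))"]) auto
qed

lemma exp_growth_integrable_lborel:
  fixes f :: "real ^ 'n::finite \<Rightarrow> 'b::{banach, second_countable_topology}"
  assumes "exp_growth f" and [measurable]: "f \<in> borel_measurable borel" and "c > 0"
  shows "integrable lborel (\<lambda>x. exp (- c * (norm x)\<^sup>2) *\<^sub>R f x)"
proof -
  obtain C where C: "0 \<le> C" "\<And>x. norm (f x) \<le> C * exp (c/2 * (norm x)\<^sup>2)"
    using exp_growth_quadratic_bound[OF assms(1), of "c/2"] assms(3) by auto
  show ?thesis
  proof (rule Bochner_Integration.integrable_bound)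
    show "integrable lborel (\<lambda>x :: real ^ 'n. C * exp (- (c/2) * (norm x)\<^sup>2))"
      by (intro integrable_mult_right integrable_exp_quadratic) (use assms in auto)
    have "exp (- c * (norm x)\<^sup>2) * norm (f x) \<le> C * exp (- (c/2) * (norm x)\<^sup>2)" for x
    proof -
      have "exp (- c * (norm x)\<^sup>2) * norm (f x) \<le> exp (- c * (norm x)\<^sup>2) * (C * exp (c/2 * (norm x)\<^sup>2))"
        by (intro mult_left_mono C) auto
      also have "\<dots> = C * exp (- c * (norm x)\<^sup>2 + c/2 * (norm x)\<^sup>2)"
        by (simp only: exp_add mult_ac)
      also have "- c * (norm x)\<^sup>2 + c/2 * (norm x)\<^sup>2 = - (c/2) * (norm x)\<^sup>2" by simp
      finally show ?thesis .
    qed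
    then show "AE x in lborel. norm (exp (- c * (norm x)\<^sup>2) *\<^sub>R f x)
        \<le> norm (C * exp (- (c/2) * (norm x)\<^sup>2))"
      using C by (auto simp: abs_mult)
  qed measurable
qed

lemma exp_growth_integrable_gauss:
  fixes f :: "real ^ 'n::finite \<Rightarrow> 'b::{banach, second_countable_topology}"
  assumes "exp_growth f" and "f \<in> borel_measurable borel"
  shows "integrable gauss f"
  using exp_growth_integrable_lborel[OF assms, of 1] integrable_gauss_iff[OF assms(2)] by simp

text \<open>Integrating the fundamental theorem along segments of length one in the direction of the
  derivative turns the integral into that of a difference of two translates, which vanishes by
  translation invariance.\<close>

lemma integral_partial_eq_0:
  fixes F F' :: "real ^ 'n::finite \<Rightarrow> 'b::euclidean_space"
  assumes F: "integrable lborel F" and F': "integrable lborel F'" and cont: "continuous_on UNIV F'"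
    and deriv: "\<And>x. ((\<lambda>t. F (x + t *\<^sub>R axis i 1)) has_vector_derivative F' x) (at 0)"
  shows "(LINT x|lborel. F' x) = 0"
proof -
  define e :: "real ^ 'n" where "e = axis i 1"
  have [measurable]: "F' \<in> borel_measurable borel" "F \<in> borel_measurable borel"
    using F F' by auto
  have dv: "((\<lambda>t. F (x + t *\<^sub>R e)) has_vector_derivative F' (x + t *\<^sub>R e)) (at t)" for x t
  proof -
    have "((\<lambda>u. F ((x + t *\<^sub>R e) + u *\<^sub>R e)) has_vector_derivative F' (x + t *\<^sub>R e)) (at (t - t))"
      using deriv[of "x + t *\<^sub>R e"] by (simp add: e_def)
    then have "((\<lambda>u. F ((x + t *\<^sub>R e) + u *\<^sub>R e)) \<circ> (\<lambda>u. u - t) has_vector_derivative 1 *\<^sub>R F' (x + t *\<^sub>R e)) (at t)"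
      by (intro vector_diff_chain_at) (auto intro!: derivative_eq_intros)
    then show ?thesis by (simp add: o_def algebra_simps)
  qed
  have cont': "continuous_on S (\<lambda>t. F' (x + t *\<^sub>R e))" for S x
    by (rule continuous_on_compose2[OF cont]) (auto intro!: continuous_intros)
  have ftc: "(LINT t:{0..1}|lborel. F' (x + t *\<^sub>R e)) = F (x + e) - F x" for x
    using integral_FTC_Icc[of 0 1 "\<lambda>t. F (x + t *\<^sub>R e)" "\<lambda>t. F' (x + t *\<^sub>R e)"] dv cont'
    by (auto simp: set_lebesgue_integral_def intro: has_vector_derivative_at_within)
  have int: "integrable (lborel \<Otimes>\<^sub>M lborel)
     (\<lambda>(x, t). indicator {0..1} t *\<^sub>R F' (x + t *\<^sub>R e))"
  proof (rule integrableI_bounded)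
    show "(\<lambda>(x, t). indicator {0..1} t *\<^sub>R F' (x + t *\<^sub>R e)) \<in> borel_measurable (lborel \<Otimes>\<^sub>M lborel)"
      by measurable
    have "(\<integral>\<^sup>+p. ennreal (norm (case p of (x, t) \<Rightarrow> indicator {0..1} t *\<^sub>R F' (x + t *\<^sub>R e)))
        \<partial>(lborel \<Otimes>\<^sub>M lborel)) = 
      (\<integral>\<^sup>+t. \<integral>\<^sup>+x. ennreal (indicator {0..1::real} t * norm (F' (x + t *\<^sub>R e))) \<partial>lborel \<partial>lborel)"
      by (subst lborel_pair.nn_integral_snd[symmetric]) (auto simp: case_prod_beta)
    also have "\<dots> = (\<integral>\<^sup>+t. indicator {0..1::real} t * (\<integral>\<^sup>+x. ennreal (norm (F' x)) \<partial>lborel) \<partial>lborel)"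
    proof (intro nn_integral_cong)
      fix t :: real
      have "(\<integral>\<^sup>+x. ennreal (norm (F' x)) \<partial>lborel) = (\<integral>\<^sup>+x. ennreal (norm (F' (x + t *\<^sub>R e))) \<partial>lborel)"
        by (subst nn_integral_lborel_affine[of _ 1 "t *\<^sub>R e"]) (auto simp: add.commute)
      then show "(\<integral>\<^sup>+x. ennreal (indicator {0..1::real} t * norm (F' (x + t *\<^sub>R e))) \<partial>lborel)
         = indicator {0..1::real} t * (\<integral>\<^sup>+x. ennreal (norm (F' x)) \<partial>lborel)"
        by (simp add: ennreal_mult ennreal_indicator nn_integral_cmult)
    qed
    also have "\<dots> = (\<integral>\<^sup>+x. ennreal (norm (F' x)) \<partial>lborel)"
      by (simp add: nn_integral_multc)
    also have "\<dots> < \<infinity>" using F' by (simp add: integrable_iff_bounded)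
    finally show "(\<integral>\<^sup>+p. ennreal (norm (case p of (x, t) \<Rightarrow> indicator {0..1} t *\<^sub>R F' (x + t *\<^sub>R e)))
        \<partial>(lborel \<Otimes>\<^sub>M lborel)) < \<infinity>" .
  qed
  have "(LINT x|lborel. LINT t|lborel. indicator {0..1} t *\<^sub>R F' (x + t *\<^sub>R e)) = 
     (LINT t|lborel. LINT x|lborel. indicator {0..1::real} t *\<^sub>R F' (x + t *\<^sub>R e))"
    using lborel_pair.Fubini_integral[OF int] by simp
  also have "(LINT t|lborel. LINT x|lborel. indicator {0..1::real} t *\<^sub>R F' (x + t *\<^sub>R e)) = 
     (LINT t|lborel. indicator {0..1::real} t *\<^sub>R (LINT x|lborel. F' x))"
  proof -
    have "(LINT x|lborel. F' (x + t *\<^sub>R e)) = (LINT x|lborel. F' x)" for t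
      using integrable_lborel_shift(2)[OF F', of "t *\<^sub>R e"] by (simp add: add.commute)
    then show ?thesis by simp
  qed
  also have "\<dots> = (LINT x|lborel. F' x)" by simp
  finally have "(LINT x|lborel. F' x) = (LINT x|lborel. F (x + e) - F x)"
    by (simp add: ftc[unfolded set_lebesgue_integral_def])
  also have "\<dots> = 0"
    using integrable_lborel_shift[OF F, of e] F by (simp add: add.commute Bochner_Integration.integral_diff)
  finally show ?thesis .
qed

lemma exp_norm_has_vector_derivative:
  "((\<lambda>t. exp (- (norm (x + t *\<^sub>R axis i 1 :: real ^ 'n::finite))\<^sup>2)) has_vector_derivative 
     - 2 * x $ i * exp (- (norm x)\<^sup>2)) (at 0)"
proof -
  have "((\<lambda>y::real ^ 'n. exp (- (y \<bullet> y))) has_derivative (\<lambda>h. exp (- (x \<bullet> x)) * (- (2 * (x \<bullet> h))))) (at (x + 0 *\<^sub>R axis i 1))"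
    by (auto intro!: derivative_eq_intros simp: inner_commute)
  moreover have "((\<lambda>t. x + t *\<^sub>R axis i 1) has_derivative (\<lambda>t. t *\<^sub>R axis i 1)) (at 0)"
    by (auto intro!: derivative_eq_intros)
  ultimately have "((\<lambda>y. exp (- (y \<bullet> y))) \<circ> (\<lambda>t. x + t *\<^sub>R axis i 1) has_derivative
     (\<lambda>h. exp (- (x \<bullet> x)) * (- (2 * (x \<bullet> h)))) \<circ> (\<lambda>t. t *\<^sub>R axis i 1)) (at 0)"
    by (intro diff_chain_at) auto
  then show ?thesis
    by (simp add: has_vector_derivative_def o_def power2_norm_eq_inner inner_axis algebra_simps)
qed

text \<open>Integration by parts: the derivative of the density \<open>exp (- |x|\<^sup>2)\<close> contributes the factor
  \<open>2 x\<^sub>i\<close>.\<close>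

lemma gauss_ibp:
  fixes f f' :: "real ^ 'n::finite \<Rightarrow> 'b::euclidean_space"
  assumes f: "exp_growth f" and f': "exp_growth f'" and cont: "continuous_on UNIV f" "continuous_on UNIV f'"
    and deriv: "\<And>x. ((\<lambda>t. f (x + t *\<^sub>R axis i 1)) has_vector_derivative f' x) (at 0)"
  shows "(LINT x|gauss. f' x) = (LINT x|gauss. (2 * x $ i) *\<^sub>R f x)"
proof -
  have [measurable]: "f \<in> borel_measurable borel" "f' \<in> borel_measurable borel"
    using cont by (auto intro: borel_measurable_continuous_onI)
  have g: "exp_growth (\<lambda>x. (2 * x $ i) *\<^sub>R f x)"
    by (intro exp_growth_scaleR exp_growth_mult f exp_growth_const exp_growth_coord)
  note i1 = exp_growth_integrable_lborel[OF f, of 1]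
    and i2 = exp_growth_integrable_lborel[OF f', of 1]
    and i3 = exp_growth_integrable_lborel[OF g, of 1]
  have "(LINT x|lborel. exp (- (norm x)\<^sup>2) *\<^sub>R f' x - exp (- (norm x)\<^sup>2) *\<^sub>R ((2 * x $ i) *\<^sub>R f x)) = 0"
  proof (rule integral_partial_eq_0[where F = "\<lambda>x. exp (- (norm x)\<^sup>2) *\<^sub>R f x"])
    show "integrable lborel (\<lambda>x. exp (- (norm x)\<^sup>2) *\<^sub>R f x)" using i1 by simp
    show "integrable lborel (\<lambda>x. exp (- (norm x)\<^sup>2) *\<^sub>R f' x - exp (- (norm x)\<^sup>2) *\<^sub>R ((2 * x $ i) *\<^sub>R f x))"
      using i2 i3 by simp
    show "continuous_on UNIV (\<lambda>x. exp (- (norm x)\<^sup>2) *\<^sub>R f' x - exp (- (norm x)\<^sup>2) *\<^sub>R ((2 * x $ i) *\<^sub>R f x))"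
      by (intro continuous_intros cont)
    fix x
    show "((\<lambda>t. exp (- (norm (x + t *\<^sub>R axis i 1))\<^sup>2) *\<^sub>R f (x + t *\<^sub>R axis i 1)) has_vector_derivative
        exp (- (norm x)\<^sup>2) *\<^sub>R f' x - exp (- (norm x)\<^sup>2) *\<^sub>R (2 * x $ i) *\<^sub>R f x) (at 0)"
      using bounded_bilinear.has_vector_derivative[OF bounded_bilinear_scaleR
          exp_norm_has_vector_derivative[of x i] deriv[of x]]
      by (simp add: algebra_simps)
  qed
  then have "(LINT x|lborel. exp (- (norm x)\<^sup>2) *\<^sub>R f' x) = (LINT x|lborel. exp (- (norm x)\<^sup>2) *\<^sub>R ((2 * x $ i) *\<^sub>R f x))"
    using i2 i3 by (simp add: Bochner_Integration.integral_diff)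
  then show ?thesis by (simp add: integral_gauss)
qed

section \<open>Hermite polynomials\<close>

text \<open>The normalisation is the one for which the operators \<open>\<delta>\<^sub>i\<^sup>*\<close> raise the index by one without
  any factor; the square of the norm of the \<open>m\<close>-th polynomial is then \<open>m!\<close>.\<close>

fun hermite1 :: "nat \<Rightarrow> real \<Rightarrow> real" where
  "hermite1 0 t = 1"
| "hermite1 (Suc m) t = sqrt 2 * t * hermite1 m t - real m * hermite1 (m - 1) t"

lemma sqrt2_sqrt2 [simp]: "sqrt 2 * (sqrt 2 * a) = 2 * a"
  by (simp flip: mult.assoc)

lemma hermite1_has_derivative:
  "(hermite1 m has_real_derivative sqrt 2 * real m * hermite1 (m - 1) t) (at t)"
proof (induction m rule: less_induct)
  case (less m)
  show ?case
  proof (cases m)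
    case 0
    then have "hermite1 m = (\<lambda>t. 1)" by auto
    then show ?thesis using 0 by simp
  next
    case (Suc k)
    have eq: "hermite1 m = (\<lambda>t. sqrt 2 * t * hermite1 k t - real k * hermite1 (k - 1) t)"
      using Suc by auto
    have d1: "(hermite1 k has_real_derivative sqrt 2 * real k * hermite1 (k - 1) t) (at t)"
      using less[of k] Suc by auto
    have d2: "(hermite1 (k - 1) has_real_derivative sqrt 2 * real (k - 1) * hermite1 (k - 1 - 1) t) (at t)"
      using less[of "k - 1"] Suc by auto
    have "(hermite1 m has_real_derivative
        sqrt 2 * hermite1 k t + sqrt 2 * t * (sqrt 2 * real k * hermite1 (k - 1) t)
         - real k * (sqrt 2 * real (k - 1) * hermite1 (k - 1 - 1) t)) (at t)"
      unfolding eq by (rule derivative_eq_intros d1 d2 refl | simp)+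
    moreover have "sqrt 2 * hermite1 k t + sqrt 2 * t * (sqrt 2 * real k * hermite1 (k - 1) t)
         - real k * (sqrt 2 * real (k - 1) * hermite1 (k - 1 - 1) t) = sqrt 2 * real m * hermite1 (m - 1) t"
      using Suc by (cases k) (simp_all add: algebra_simps)
    ultimately show ?thesis by simp
  qed
qed

abbreviation raise :: "('n \<Rightarrow> nat) \<Rightarrow> 'n \<Rightarrow> 'n \<Rightarrow> nat" where
  "raise \<beta> i \<equiv> \<beta>(i := Suc (\<beta> i))"

abbreviation lower :: "('n \<Rightarrow> nat) \<Rightarrow> 'n \<Rightarrow> 'n \<Rightarrow> nat" where
  "lower \<beta> i \<equiv> \<beta>(i := \<beta> i - 1)"

definition hermite :: "('n::finite \<Rightarrow> nat) \<Rightarrow> real ^ 'n \<Rightarrow> real" where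
  "hermite \<beta> x = (\<Prod>i\<in>UNIV. hermite1 (\<beta> i) (x $ i))"

lemma hermite_0 [simp]: "hermite (\<lambda>i. 0) x = 1"
  by (simp add: hermite_def)

lemma hermite_update:
  "hermite (\<beta>(i := m)) x = hermite1 m (x $ i) * (\<Prod>j\<in>UNIV - {i}. hermite1 (\<beta> j) (x $ j))"
  unfolding hermite_def by (subst prod.remove[of _ i]) (auto intro!: prod.cong)

lemma hermite_split:
  "hermite \<beta> x = hermite1 (\<beta> i) (x $ i) * (\<Prod>j\<in>UNIV - {i}. hermite1 (\<beta> j) (x $ j))"
  using hermite_update[of \<beta> i "\<beta> i"] by simp

lemma hermite_raise:
  "hermite (raise \<beta> i) x = sqrt 2 * x $ i * hermite \<beta> x - real (\<beta> i) * hermite (lower \<beta> i) x"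
  unfolding hermite_split[of \<beta> x i] hermite_update by (simp add: algebra_simps)

lemma hermite_has_derivative:
  "(hermite \<beta> has_derivative (\<lambda>h. \<Sum>i\<in>UNIV. h $ i * (sqrt 2 * real (\<beta> i) * hermite (lower \<beta> i) x))) (at x)"
proof -
  have "((\<lambda>x. hermite1 (\<beta> i) (x $ i)) has_derivative
      (\<lambda>h. h $ i * (sqrt 2 * real (\<beta> i) * hermite1 (\<beta> i - 1) (x $ i)))) (at x)" for i
    using DERIV_compose_FDERIV[OF hermite1_has_derivative, where g = "\<lambda>x. x $ i" and x = x and g' = "\<lambda>h. h $ i"]
    by (simp add: bounded_linear_imp_has_derivative bounded_linear_vec_nth)
  then have "((\<lambda>x. \<Prod>i\<in>UNIV. hermite1 (\<beta> i) (x $ i)) has_derivative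
     (\<lambda>h. \<Sum>i\<in>UNIV. (h $ i * (sqrt 2 * real (\<beta> i) * hermite1 (\<beta> i - 1) (x $ i))) *
         (\<Prod>j\<in>UNIV - {i}. hermite1 (\<beta> j) (x $ j)))) (at x)"
    by (intro has_derivative_prod) auto
  then show ?thesis unfolding hermite_update
    by (simp add: hermite_def[abs_def] mult.assoc)
qed

lemma hermite_continuous [continuous_intros]:
  "continuous_on S f \<Longrightarrow> continuous_on S (\<lambda>x. hermite \<beta> (f x))"
  by (rule continuous_on_compose2[of UNIV "hermite \<beta>"])
     (auto intro!: continuous_at_imp_continuous_on has_derivative_continuous hermite_has_derivative)

lemma hermite_measurable [measurable]: "hermite \<beta> \<in> borel_measurable borel"
  by (intro borel_measurable_continuous_onI continuous_intros)

lemma hermite_line_derivative: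
  "((\<lambda>t. hermite \<beta> (x + (c * t) *\<^sub>R axis i 1)) has_vector_derivative
     c * (sqrt 2 * real (\<beta> i) * hermite (lower \<beta> i) x)) (at 0)"
proof -
  let ?D = "\<lambda>h. \<Sum>i\<in>UNIV. h $ i * (sqrt 2 * real (\<beta> i) * hermite (lower \<beta> i) x)"
  have "(hermite \<beta> has_derivative ?D) (at (x + (c * 0) *\<^sub>R axis i 1))"
    using hermite_has_derivative[of \<beta> x] by simp
  moreover have "((\<lambda>t. x + (c * t) *\<^sub>R axis i 1) has_derivative (\<lambda>t. (c * t) *\<^sub>R axis i 1)) (at 0)"
    by (auto intro!: derivative_eq_intros)
  ultimately have "(hermite \<beta> \<circ> (\<lambda>t. x + (c * t) *\<^sub>R axis i 1) has_derivative
     ?D \<circ> (\<lambda>t. (c * t) *\<^sub>R axis i 1)) (at 0)"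
    by (intro diff_chain_at) auto
  moreover have "?D ((c * t) *\<^sub>R axis i 1) = t * (c * (sqrt 2 * real (\<beta> i) * hermite (lower \<beta> i) x))" for t
    by (simp add: axis_def if_distrib if_distribR cong: if_cong)
  ultimately show ?thesis by (simp add: has_vector_derivative_def o_def)
qed

lemma exp_growth_hermite1: "exp_growth (\<lambda>x :: real ^ 'n::finite. hermite1 m (x $ i))"
proof (induction m rule: less_induct)
  case (less m)
  show ?case
  proof (cases m)
    case 0
    then show ?thesis by (simp add: exp_growth_const)
  next
    case (Suc k)
    have "exp_growth (\<lambda>x :: real ^ 'n. sqrt 2 * x $ i * hermite1 k (x $ i) + (- real k) * hermite1 (k - 1) (x $ i))"
      using less[of k] less[of "k - 1"] Suc
      by (intro exp_growth_add exp_growth_mult exp_growth_const exp_growth_coord) auto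
    then show ?thesis using Suc by simp
  qed
qed

lemma exp_growth_hermite: "exp_growth (hermite \<beta>)"
  unfolding hermite_def by (intro exp_growth_prod exp_growth_hermite1)

definition mfact :: "('n::finite \<Rightarrow> nat) \<Rightarrow> real" where
  "mfact \<beta> = (\<Prod>i\<in>UNIV. fact (\<beta> i))"

lemma mfact_pos [simp]: "mfact \<beta> > 0"
  by (simp add: mfact_def prod_pos)

lemma mfact_raise: "mfact (raise \<beta> i) = real (Suc (\<beta> i)) * mfact \<beta>"
  unfolding mfact_def by (subst (1 2) prod.remove[of _ i]) (auto intro!: prod.cong)

lemma raise_cases:
  fixes \<beta> :: "'n::finite \<Rightarrow> nat"
  assumes "\<beta> \<noteq> (\<lambda>i. 0)"
  obtains \<gamma> i where "\<beta> = raise \<gamma> i"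
proof -
  obtain i where "\<beta> i \<noteq> 0" using assms by auto
  then have "\<beta> = raise (lower \<beta> i) i" by auto
  then show ?thesis using that by blast
qed

lemma sum_raise: "sum (raise \<beta> i) (UNIV :: 'n::finite set) = Suc (sum \<beta> UNIV)"
  by (subst (1 2) sum.remove[of _ i]) (auto intro!: sum.cong)

lemma multiindex_induct [case_names zero raise]:
  fixes \<beta> :: "'n::finite \<Rightarrow> nat"
  assumes "P (\<lambda>i. 0)" and "\<And>\<beta> i. P \<beta> \<Longrightarrow> P (raise \<beta> i)"
  shows "P \<beta>"
proof (induction "sum \<beta> UNIV" arbitrary: \<beta>)
  case 0
  then have "\<beta> = (\<lambda>i. 0)" by auto
  then show ?case using assms(1) by simp
next
  case (Suc n)
  then have "\<beta> \<noteq> (\<lambda>i. 0)" by auto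
  then obtain \<gamma> i where "\<beta> = raise \<gamma> i" by (rule raise_cases)
  then show ?case using Suc sum_raise[of \<gamma> i] assms(2)[of \<gamma> i] by auto
qed

lemma integrable_hermite_prod: "integrable gauss (\<lambda>x. hermite \<beta> x * hermite \<beta>' x)"
  by (intro exp_growth_integrable_gauss exp_growth_mult exp_growth_hermite) measurable

lemma integral_hermite_raise:
  "(LINT x|gauss. hermite (raise \<beta> i) x * hermite \<beta>' x) =
     real (\<beta>' i) * (LINT x|gauss. hermite \<beta> x * hermite (lower \<beta>' i) x)"
proof -
  let ?f = "\<lambda>x. hermite \<beta> x * hermite \<beta>' x"
  let ?f' = "\<lambda>x. hermite \<beta> x * (sqrt 2 * real (\<beta>' i) * hermite (lower \<beta>' i) x)
     + (sqrt 2 * real (\<beta> i) * hermite (lower \<beta> i) x) * hermite \<beta>' x"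
  note g = exp_growth_add exp_growth_mult exp_growth_const exp_growth_hermite exp_growth_coord
  have "(LINT x|gauss. ?f' x) = (LINT x|gauss. (2 * x $ i) *\<^sub>R ?f x)"
  proof (rule gauss_ibp)
    fix x
    show "((\<lambda>t. ?f (x + t *\<^sub>R axis i 1)) has_vector_derivative ?f' x) (at 0)"
      using has_vector_derivative_mult[OF hermite_line_derivative[of \<beta> x 1 i] hermite_line_derivative[of \<beta>' x 1 i]]
      by simp
  qed (intro g continuous_intros)+
  then have "0 = (LINT x|gauss. (2 * x $ i) * ?f x) - (LINT x|gauss. ?f' x)" by simp
  also have "\<dots> = (LINT x|gauss. (2 * x $ i) * ?f x - ?f' x)"
    by (intro Bochner_Integration.integral_diff[symmetric] exp_growth_integrable_gauss g) measurable
  also have "\<dots> = (LINT x|gauss. sqrt 2 * (hermite (raise \<beta> i) x * hermite \<beta>' x)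
      - sqrt 2 * real (\<beta>' i) * (hermite \<beta> x * hermite (lower \<beta>' i) x))"
    unfolding hermite_raise by (intro Bochner_Integration.integral_cong) (auto simp: algebra_simps)
  also have "\<dots> = sqrt 2 * ((LINT x|gauss. hermite (raise \<beta> i) x * hermite \<beta>' x)
      - real (\<beta>' i) * (LINT x|gauss. hermite \<beta> x * hermite (lower \<beta>' i) x))"
    using integrable_hermite_prod
    by (subst Bochner_Integration.integral_diff) (auto simp: right_diff_distrib)
  finally show ?thesis by simp
qed

text \<open>Raising an index in one factor is, by parts, lowering it in the other factor
  (\<open>integral_hermite_raise\<close>).\<close>

lemma hermite_orthogonal:
  "(LINT x|gauss. hermite \<beta> x * hermite \<beta>' x) = (if \<beta> = \<beta>' then mfact \<beta> else 0)"
proof (induction \<beta> arbitrary: \<beta>' rule: multiindex_induct)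
  case zero
  show ?case
  proof (cases "\<beta>' = (\<lambda>i. 0)")
    case True
    then show ?thesis using gauss.prob_space by (simp add: mfact_def)
  next
    case False
    then obtain \<gamma> i where \<gamma>: "\<beta>' = raise \<gamma> i" by (rule raise_cases)
    have "(LINT x|gauss. hermite \<beta>' x * hermite (\<lambda>i. 0) x) = 0"
      unfolding \<gamma> integral_hermite_raise by simp
    then show ?thesis using False by auto
  qed
next
  case (raise \<beta> i)
  show ?case
  proof (cases "\<beta>' i")
    case 0
    then have ne: "raise \<beta> i \<noteq> \<beta>'" by auto
    show ?thesis unfolding integral_hermite_raise if_not_P[OF ne] using 0 by simp
  next
    case (Suc m)
    then have "raise \<beta> i = \<beta>' \<longleftrightarrow> \<beta> = lower \<beta>' i"
      by (auto simp: fun_eq_iff)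
    moreover have "real (\<beta>' i) * mfact \<beta> = mfact \<beta>'" if "raise \<beta> i = \<beta>'"
      unfolding that[symmetric] mfact_raise by simp
    ultimately show ?thesis unfolding integral_hermite_raise raise.IH[of "lower \<beta>' i"]
      by auto
  qed
qed

text \<open>A Gauss measure on the product space is invariant under the rotation
  \<open>(x, z) \<mapsto> (s x - r z, r x + s z)\<close>, and rotations preserve the degree; averaging over \<open>z\<close> keeps
  the component that depends on \<open>x\<close> alone. The proof is by induction on the total degree: the
  three term recurrence for a raised index produces a factor \<open>z\<^sub>i\<close>, which integration by parts
  removes. The lemma replaces generating functions in the computation of the Mehler kernel.\<close>

lemma hermite_rotation:
  fixes x :: "real ^ 'n::finite"
  assumes rs: "r\<^sup>2 + s\<^sup>2 = 1"
  shows "(LINT z|gauss. hermite \<alpha> (s *\<^sub>R x - r *\<^sub>R z) * hermite \<beta> (r *\<^sub>R x + s *\<^sub>R z)) =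
     s ^ sum \<alpha> UNIV * r ^ sum \<beta> UNIV * hermite (\<lambda>i. \<alpha> i + \<beta> i) x"
proof (induction "sum \<alpha> UNIV + sum \<beta> UNIV" arbitrary: \<alpha> \<beta> rule: less_induct)
  case less
  define v w :: "real ^ 'n \<Rightarrow> real ^ 'n"
    where "v z = s *\<^sub>R x + (- r) *\<^sub>R z" and "w z = r *\<^sub>R x + s *\<^sub>R z" for z
  define I where "I \<alpha> \<beta> = (LINT z|gauss. hermite \<alpha> (v z) * hermite \<beta> (w z))" for \<alpha> \<beta>
  let ?J = "\<lambda>\<alpha> \<beta>. s ^ sum \<alpha> UNIV * r ^ sum \<beta> UNIV * hermite (\<lambda>i. \<alpha> i + \<beta> i) x"
  have IH: "I \<gamma> \<delta> = ?J \<gamma> \<delta>" if "sum \<gamma> UNIV + sum \<delta> UNIV < sum \<alpha> UNIV + sum \<beta> UNIV" for \<gamma> \<delta>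
    using less[OF that] by (simp add: I_def v_def w_def)
  note g = exp_growth_add exp_growth_mult exp_growth_const exp_growth_coord
    exp_growth_affine[OF exp_growth_hermite, of _ "s *\<^sub>R x" "- r", folded v_def]
    exp_growth_affine[OF exp_growth_hermite, of _ "r *\<^sub>R x" s, folded w_def]
  have [measurable]: "v \<in> borel_measurable borel" "w \<in> borel_measurable borel"
    unfolding v_def w_def by measurable
  have vw_cont: "continuous_on UNIV v" "continuous_on UNIV w"
    unfolding v_def w_def by (intro continuous_intros)+
  have int: "integrable gauss (\<lambda>z. hermite \<gamma> (v z) * hermite \<delta> (w z))" for \<gamma> \<delta>
    by (intro exp_growth_integrable_gauss g) measurable
  have coord_int: "integrable gauss (\<lambda>z. z $ i * (hermite \<gamma> (v z) * hermite \<delta> (w z)))" for \<gamma> \<delta> i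
    by (intro exp_growth_integrable_gauss g) measurable
  have ibp: "sqrt 2 * (LINT z|gauss. z $ i * (hermite \<gamma> (v z) * hermite \<delta> (w z))) =
      s * real (\<delta> i) * I \<gamma> (lower \<delta> i) - r * real (\<gamma> i) * I (lower \<gamma> i) \<delta>" for \<gamma> \<delta> i
  proof -
    let ?f' = "\<lambda>z. hermite \<gamma> (v z) * (s * (sqrt 2 * real (\<delta> i) * hermite (lower \<delta> i) (w z)))
       + (- r * (sqrt 2 * real (\<gamma> i) * hermite (lower \<gamma> i) (v z))) * hermite \<delta> (w z)"
    have "(LINT z|gauss. ?f' z) = (LINT z|gauss. (2 * z $ i) *\<^sub>R (hermite \<gamma> (v z) * hermite \<delta> (w z)))"
    proof (rule gauss_ibp)
      fix z
      show "((\<lambda>t. hermite \<gamma> (v (z + t *\<^sub>R axis i 1)) * hermite \<delta> (w (z + t *\<^sub>R axis i 1)))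
         has_vector_derivative ?f' z) (at 0)"
        using has_vector_derivative_mult[OF hermite_line_derivative[of \<gamma> "v z" "- r" i]
            hermite_line_derivative[of \<delta> "w z" s i]]
        by (simp add: v_def w_def algebra_simps)
    qed (intro g continuous_intros vw_cont)+
    moreover have "(LINT z|gauss. ?f' z) = sqrt 2 * (s * real (\<delta> i) * I \<gamma> (lower \<delta> i) - r * real (\<gamma> i) * I (lower \<gamma> i) \<delta>)"
    proof -
      have "(LINT z|gauss. ?f' z) = (LINT z|gauss. (sqrt 2 * s * real (\<delta> i)) * (hermite \<gamma> (v z) * hermite (lower \<delta> i) (w z))
         - (sqrt 2 * r * real (\<gamma> i)) * (hermite (lower \<gamma> i) (v z) * hermite \<delta> (w z)))"
        by (intro Bochner_Integration.integral_cong) (auto simp: algebra_simps)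
      also have "\<dots> = (sqrt 2 * s * real (\<delta> i)) * I \<gamma> (lower \<delta> i) - (sqrt 2 * r * real (\<gamma> i)) * I (lower \<gamma> i) \<delta>"
        using int by (subst Bochner_Integration.integral_diff) (auto simp: I_def)
      finally show ?thesis by (simp add: algebra_simps)
    qed
    moreover have "(LINT z|gauss. (2 * z $ i) *\<^sub>R (hermite \<gamma> (v z) * hermite \<delta> (w z))) =
        2 * (LINT z|gauss. z $ i * (hermite \<gamma> (v z) * hermite \<delta> (w z)))"
      by (simp add: mult.assoc)
    ultimately have "2 * (LINT z|gauss. z $ i * (hermite \<gamma> (v z) * hermite \<delta> (w z))) =
        sqrt 2 * (s * real (\<delta> i) * I \<gamma> (lower \<delta> i) - r * real (\<gamma> i) * I (lower \<gamma> i) \<delta>)" by argo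
    then have "sqrt 2 * (2 * (LINT z|gauss. z $ i * (hermite \<gamma> (v z) * hermite \<delta> (w z)))) =
        2 * (s * real (\<delta> i) * I \<gamma> (lower \<delta> i) - r * real (\<gamma> i) * I (lower \<gamma> i) \<delta>)"
      by (simp only: sqrt2_sqrt2)
    then have "2 * (sqrt 2 * (LINT z|gauss. z $ i * (hermite \<gamma> (v z) * hermite \<delta> (w z)))) =
        2 * (s * real (\<delta> i) * I \<gamma> (lower \<delta> i) - r * real (\<gamma> i) * I (lower \<gamma> i) \<delta>)"
      by (simp only: mult.left_commute)
    then show ?thesis by (simp only: mult_cancel_left) simp
  qed
  have low1: "s * (real (\<gamma> i) * I (lower \<gamma> i) \<delta>) =
      real (\<gamma> i) * (s ^ sum \<gamma> UNIV * r ^ sum \<delta> UNIV * hermite (lower (\<lambda>i. \<gamma> i + \<delta> i) i) x)"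
    if "sum \<gamma> UNIV + sum \<delta> UNIV < sum \<alpha> UNIV + sum \<beta> UNIV" for \<gamma> \<delta> i
  proof (cases "\<gamma> i")
    case (Suc m)
    have "raise (lower \<gamma> i) i = \<gamma>" using Suc by auto
    then have sum: "sum \<gamma> UNIV = Suc (sum (lower \<gamma> i) UNIV)" using sum_raise[of "lower \<gamma> i" i] by simp
    have "(\<lambda>j. (lower \<gamma> i) j + \<delta> j) = lower (\<lambda>j. \<gamma> j + \<delta> j) i" using Suc by auto
    then show ?thesis using IH[of "lower \<gamma> i" \<delta>] that sum by (simp add: mult_ac)
  qed simp
  have low2: "r * (real (\<delta> i) * I \<gamma> (lower \<delta> i)) =
      real (\<delta> i) * (s ^ sum \<gamma> UNIV * r ^ sum \<delta> UNIV * hermite (lower (\<lambda>i. \<gamma> i + \<delta> i) i) x)"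
    if "sum \<gamma> UNIV + sum \<delta> UNIV < sum \<alpha> UNIV + sum \<beta> UNIV" for \<gamma> \<delta> i
  proof (cases "\<delta> i")
    case (Suc m)
    have "raise (lower \<delta> i) i = \<delta>" using Suc by auto
    then have sum: "sum \<delta> UNIV = Suc (sum (lower \<delta> i) UNIV)" using sum_raise[of "lower \<delta> i" i] by simp
    have "(\<lambda>j. \<gamma> j + (lower \<delta> i) j) = lower (\<lambda>j. \<gamma> j + \<delta> j) i" using Suc by auto
    then show ?thesis using IH[of \<gamma> "lower \<delta> i"] that sum by (simp add: mult_ac)
  qed simp
  have r2: "r * (r * a) = a - s * (s * a)" for a
  proof -
    have "r * (r * a) + s * (s * a) = (r\<^sup>2 + s\<^sup>2) * a" by (simp add: power2_eq_square algebra_simps)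
    then show ?thesis using rs by simp
  qed
  have "I \<alpha> \<beta> = ?J \<alpha> \<beta>"
  proof (cases "\<beta> = (\<lambda>i. 0)")
    case False
    then obtain \<delta> i where \<beta>: "\<beta> = raise \<delta> i" by (rule raise_cases)
    have lt: "sum \<alpha> UNIV + sum \<delta> UNIV < sum \<alpha> UNIV + sum \<beta> UNIV"
      using sum_raise[of \<delta> i] \<beta> by simp
    have "I \<alpha> \<beta> = (LINT z|gauss. (sqrt 2 * r * x $ i) * (hermite \<alpha> (v z) * hermite \<delta> (w z))
         + (s * sqrt 2) * (z $ i * (hermite \<alpha> (v z) * hermite \<delta> (w z)))
         - real (\<delta> i) * (hermite \<alpha> (v z) * hermite (lower \<delta> i) (w z)))"
      unfolding I_def \<beta> hermite_raise
      by (intro Bochner_Integration.integral_cong) (auto simp: w_def algebra_simps)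
    also have "\<dots> = (sqrt 2 * r * x $ i) * I \<alpha> \<delta> + s * (sqrt 2 * (LINT z|gauss. z $ i * (hermite \<alpha> (v z) * hermite \<delta> (w z))))
         - real (\<delta> i) * I \<alpha> (lower \<delta> i)"
      using int coord_int 
      by (subst Bochner_Integration.integral_diff, simp, simp, subst Bochner_Integration.integral_add)
         (auto simp: I_def)
    also have "\<dots> = sqrt 2 * r * x $ i * I \<alpha> \<delta> - r * (s * (real (\<alpha> i) * I (lower \<alpha> i) \<delta>))
         - r * (r * (real (\<delta> i) * I \<alpha> (lower \<delta> i)))"
      unfolding ibp r2 by (simp add: algebra_simps)
    also have "\<dots> = s ^ sum \<alpha> UNIV * r ^ Suc (sum \<delta> UNIV) * hermite (raise (\<lambda>i. \<alpha> i + \<delta> i) i) x"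
      unfolding low1[OF lt] low2[OF lt] IH[OF lt] hermite_raise[of "\<lambda>i. \<alpha> i + \<delta> i"]
      by (simp add: algebra_simps)
    also have "raise (\<lambda>i. \<alpha> i + \<delta> i) i = (\<lambda>j. \<alpha> j + \<beta> j)" using \<beta> by auto
    also have "Suc (sum \<delta> UNIV) = sum \<beta> UNIV" using sum_raise[of \<delta> i] \<beta> by simp
    finally show ?thesis .
  next
    case \<beta>0: True
    show ?thesis
    proof (cases "\<alpha> = (\<lambda>i. 0)")
      case False
      then obtain \<gamma> i where \<alpha>: "\<alpha> = raise \<gamma> i" by (rule raise_cases)
      have lt: "sum \<gamma> UNIV + sum \<beta> UNIV < sum \<alpha> UNIV + sum \<beta> UNIV"
        using sum_raise[of \<gamma> i] \<alpha> by simp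
      have "I \<alpha> \<beta> = (LINT z|gauss. (sqrt 2 * s * x $ i) * (hermite \<gamma> (v z) * hermite \<beta> (w z))
           - (r * sqrt 2) * (z $ i * (hermite \<gamma> (v z) * hermite \<beta> (w z)))
           - real (\<gamma> i) * (hermite (lower \<gamma> i) (v z) * hermite \<beta> (w z)))"
        unfolding I_def \<alpha> hermite_raise
        by (intro Bochner_Integration.integral_cong) (auto simp: v_def algebra_simps)
      also have "\<dots> = (sqrt 2 * s * x $ i) * I \<gamma> \<beta> - r * (sqrt 2 * (LINT z|gauss. z $ i * (hermite \<gamma> (v z) * hermite \<beta> (w z))))
           - real (\<gamma> i) * I (lower \<gamma> i) \<beta>"
        using int coord_int 
        by (subst Bochner_Integration.integral_diff, simp, simp, subst Bochner_Integration.integral_diff)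
           (auto simp: I_def)
      also have "\<dots> = sqrt 2 * s * x $ i * I \<gamma> \<beta> - s * (r * (real (\<beta> i) * I \<gamma> (lower \<beta> i)))
           - s * (s * (real (\<gamma> i) * I (lower \<gamma> i) \<beta>))"
        unfolding ibp using r2[of "real (\<gamma> i) * I (lower \<gamma> i) \<beta>"] by (simp add: algebra_simps)
      also have "\<dots> = s ^ Suc (sum \<gamma> UNIV) * r ^ sum \<beta> UNIV * hermite (raise (\<lambda>i. \<gamma> i + \<beta> i) i) x"
        unfolding low1[OF lt] low2[OF lt] IH[OF lt] hermite_raise[of "\<lambda>i. \<gamma> i + \<beta> i"]
        by (simp add: algebra_simps)
      also have "raise (\<lambda>i. \<gamma> i + \<beta> i) i = (\<lambda>j. \<alpha> j + \<beta> j)" using \<alpha> by auto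
      also have "Suc (sum \<gamma> UNIV) = sum \<alpha> UNIV" using sum_raise[of \<gamma> i] \<alpha> by simp
      finally show ?thesis .
    next
      case True
      then show ?thesis using \<beta>0 gauss.prob_space by (simp add: I_def)
    qed
  qed
  then show ?case by (simp add: I_def v_def w_def)
qed

section \<open>Density of the Hermite polynomials\<close>

text \<open>The \<open>p\<close>-th power of the norm in \<open>L\<^sup>p\<close>, without the root. Values in \<open>[0, \<infinity>]\<close> make it
  meaningful for all Borel functions, and constants in quasi-triangle inequalities are harmless
  below.\<close>

definition gnorm :: "nat \<Rightarrow> (real ^ 'n::finite \<Rightarrow> 'b::real_normed_vector) \<Rightarrow> ennreal" where
  "gnorm p f = (\<integral>\<^sup>+x. ennreal (norm (f x) ^ p) \<partial>gauss)"

lemma power_add_le_two: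
  fixes a b :: real
  assumes "0 \<le> a" "0 \<le> b"
  shows "(a + b) ^ p \<le> 2 ^ p * (a ^ p + b ^ p)"
proof -
  have "(a + b) ^ p \<le> (2 * max a b) ^ p" using assms by (intro power_mono) auto
  also have "\<dots> = 2 ^ p * (max a b) ^ p" by (rule power_mult_distrib)
  also have "\<dots> \<le> 2 ^ p * (a ^ p + b ^ p)" using assms by (auto simp: max_def)
  finally show ?thesis .
qed

lemma gnorm_triangle:
  fixes f g :: "real ^ 'n::finite \<Rightarrow> 'b::{real_normed_vector, second_countable_topology}"
  assumes [measurable]: "f \<in> borel_measurable borel" "g \<in> borel_measurable borel"
    and "\<And>x. norm (h x) \<le> norm (f x) + norm (g x)"
  shows "gnorm p h \<le> 2 ^ p * (gnorm p f + gnorm p g)"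
proof -
  have "gnorm p h \<le> (\<integral>\<^sup>+x. ennreal (2 ^ p * (norm (f x) ^ p + norm (g x) ^ p)) \<partial>gauss)"
    unfolding gnorm_def
  proof (intro nn_integral_mono ennreal_leI)
    fix x
    have "norm (h x) ^ p \<le> (norm (f x) + norm (g x)) ^ p" by (intro power_mono assms) auto
    also have "\<dots> \<le> 2 ^ p * (norm (f x) ^ p + norm (g x) ^ p)" by (intro power_add_le_two) auto
    finally show "norm (h x) ^ p \<le> 2 ^ p * (norm (f x) ^ p + norm (g x) ^ p)" .
  qed
  also have "\<dots> = 2 ^ p * (gnorm p f + gnorm p g)"
    unfolding gnorm_def by (simp add: ennreal_mult nn_integral_cmult nn_integral_add flip: ennreal_power)
  finally show ?thesis .
qed

lemma gnorm_minus_commute: "gnorm p (\<lambda>x. f x - g x) = gnorm p (\<lambda>x. g x - f x)"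
  unfolding gnorm_def by (simp add: norm_minus_commute)

lemma gnorm_exp_growth_finite:
  fixes f :: "real ^ 'n::finite \<Rightarrow> 'b::{real_normed_vector, second_countable_topology}"
  assumes "exp_growth f" and [measurable]: "f \<in> borel_measurable borel"
  shows "gnorm p f < \<infinity>"
proof -
  have "integrable gauss (\<lambda>x. norm (f x) ^ p)"
    by (intro exp_growth_integrable_gauss exp_growth_norm_power assms) measurable
  then show ?thesis unfolding gnorm_def by (simp add: integrable_iff_bounded)
qed

lemma gnorm_dominated_tendsto_0:
  fixes f :: "nat \<Rightarrow> real ^ 'n::finite \<Rightarrow> 'b::{real_normed_vector, second_countable_topology}"
    and g :: "real ^ 'n \<Rightarrow> real"
  assumes [measurable]: "\<And>k. f k \<in> borel_measurable borel" "g \<in> borel_measurable borel"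
    and g: "exp_growth g" and bound: "\<And>k x. norm (f k x) \<le> g x"
    and lim: "AE x in gauss. (\<lambda>k. f k x) \<longlonglongrightarrow> 0" and p: "p > 0"
  shows "(\<lambda>k. gnorm p (f k)) \<longlonglongrightarrow> 0"
proof -
  have "(\<lambda>k. gnorm p (f k)) \<longlonglongrightarrow> (\<integral>\<^sup>+x. (0::ennreal) \<partial>(gauss :: (real ^ 'n) measure))"
    unfolding gnorm_def
  proof (rule nn_integral_dominated_convergence)
    show "(\<integral>\<^sup>+x. ennreal (norm (g x) ^ p) \<partial>gauss) < \<infinity>"
      using gnorm_exp_growth_finite[OF g] by (simp add: gnorm_def)
    show "AE x in gauss. ennreal (norm (f k x) ^ p) \<le> ennreal (norm (g x) ^ p)" for k
    proof (intro always_eventually allI ennreal_leI power_mono)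
      show "norm (f k x) \<le> norm (g x)" for x
        using bound[of k x] by simp
    qed simp
    show "AE x in gauss. (\<lambda>k. ennreal (norm (f k x) ^ p)) \<longlonglongrightarrow> 0"
      using lim
    proof eventually_elim
      case (elim x)
      have "(\<lambda>k. norm (f k x) ^ p) \<longlonglongrightarrow> norm (0 :: 'b) ^ p"
        by (intro tendsto_intros elim)
      from tendsto_ennrealI[OF this] show ?case using p by (simp add: power_0_left)
    qed
  qed (auto simp del: borel_measurable_gauss simp: borel_measurable_gauss)
  then show ?thesis by simp
qed

text \<open>The complex linear span of the Hermite polynomials, that is, the polynomials.\<close>

inductive_set hspan :: "(real ^ 'n::finite \<Rightarrow> complex) set" where
  zero: "(\<lambda>x. 0) \<in> hspan"
| add1: "p \<in> hspan \<Longrightarrow> (\<lambda>x. p x + hermite \<beta> x *\<^sub>R c) \<in> hspan"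

lemma hspan_add: "q \<in> hspan \<Longrightarrow> p \<in> hspan \<Longrightarrow> (\<lambda>x. p x + q x) \<in> hspan"
proof (induction rule: hspan.induct)
  case (add1 q \<beta> c)
  then show ?case using hspan.add1[of "\<lambda>x. p x + q x" \<beta> c] by (simp add: add.assoc)
qed simp

lemma hspan_hermite: "(\<lambda>x. hermite \<beta> x *\<^sub>R c) \<in> hspan"
  using hspan.add1[OF hspan.zero, of \<beta> c] by simp

lemma hspan_const: "(\<lambda>x. c) \<in> hspan"
  using hspan_hermite[of "\<lambda>i. 0" c] by simp

lemma hspan_scaleR: "p \<in> hspan \<Longrightarrow> (\<lambda>x. a *\<^sub>R p x) \<in> hspan"
proof (induction rule: hspan.induct)
  case (add1 p \<beta> c)
  then show ?case using hspan.add1[of "\<lambda>x. a *\<^sub>R p x" \<beta> "a *\<^sub>R c"] by (simp add: algebra_simps)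
qed (simp add: hspan.zero)

lemma hspan_coord: "p \<in> hspan \<Longrightarrow> (\<lambda>x. x $ i *\<^sub>R p x) \<in> hspan"
proof (induction rule: hspan.induct)
  case (add1 p \<beta> c)
  have *: "x $ i * hermite \<beta> x = hermite (raise \<beta> i) x / sqrt 2 + real (\<beta> i) * hermite (lower \<beta> i) x / sqrt 2" for x
    by (simp add: hermite_raise field_simps)
  have "(\<lambda>x. x $ i *\<^sub>R p x + (hermite (raise \<beta> i) x *\<^sub>R ((1 / sqrt 2) *\<^sub>R c) +
      hermite (lower \<beta> i) x *\<^sub>R ((real (\<beta> i) / sqrt 2) *\<^sub>R c))) \<in> hspan"
    by (intro hspan_add hspan_hermite add1)
  also have "(\<lambda>x. x $ i *\<^sub>R p x + (hermite (raise \<beta> i) x *\<^sub>R ((1 / sqrt 2) *\<^sub>R c) +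
      hermite (lower \<beta> i) x *\<^sub>R ((real (\<beta> i) / sqrt 2) *\<^sub>R c))) = (\<lambda>x. x $ i *\<^sub>R (p x + hermite \<beta> x *\<^sub>R c))"
    unfolding scaleR_add_right scaleR_scaleR * scaleR_add_left
    by (simp add: mult_ac divide_inverse)
  finally show ?case .
qed (simp add: hspan.zero)

lemma hspan_coord_power: "p \<in> hspan \<Longrightarrow> (\<lambda>x. (x $ i) ^ m *\<^sub>R p x) \<in> hspan"
proof (induction m)
  case (Suc m)
  then show ?case using hspan_coord[of "\<lambda>x. (x $ i) ^ m *\<^sub>R p x" i] by simp
qed simp

lemma hspan_sum: "(\<And>k. k \<in> I \<Longrightarrow> p k \<in> hspan) \<Longrightarrow> (\<lambda>x. \<Sum>k\<in>I. p k x) \<in> hspan"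
  by (induction I rule: infinite_finite_induct) (auto intro: hspan.zero hspan_add)

lemma hspan_measurable: "p \<in> hspan \<Longrightarrow> p \<in> borel_measurable borel"
  by (induction rule: hspan.induct)
     (auto intro!: borel_measurable_add borel_measurable_scaleR hermite_measurable)

lemma hspan_exp_growth: "p \<in> hspan \<Longrightarrow> exp_growth p"
  by (induction rule: hspan.induct)
     (intro exp_growth_const exp_growth_add exp_growth_scaleR exp_growth_hermite | assumption)+

definition hspan_closure :: "(real ^ 'n::finite \<Rightarrow> complex) set" where
  "hspan_closure = {f \<in> borel_measurable borel. \<forall>e>0. \<exists>p\<in>hspan. gnorm 2 (\<lambda>x. f x - p x) < ennreal e}"

lemma hspan_closure_measurable: "f \<in> hspan_closure \<Longrightarrow> f \<in> borel_measurable borel"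
  by (simp add: hspan_closure_def)

lemma hspan_closureD: "f \<in> hspan_closure \<Longrightarrow> e > 0 \<Longrightarrow> \<exists>p\<in>hspan. gnorm 2 (\<lambda>x. f x - p x) < ennreal e"
  by (simp add: hspan_closure_def)

lemma hspan_subset_closure: "p \<in> hspan \<Longrightarrow> p \<in> hspan_closure"
  unfolding hspan_closure_def
  using hspan_measurable by (auto intro!: bexI[of _ p] simp: gnorm_def)

lemma ennreal_four_times_less: "0 < e \<Longrightarrow> a < ennreal (e / 8) \<Longrightarrow> b < ennreal (e / 8) \<Longrightarrow> 2 ^ 2 * (a + b) < ennreal e"
proof -
  assume e: "0 < e" and ab: "a < ennreal (e / 8)" "b < ennreal (e / 8)"
  obtain a' b' where ab': "a = ennreal a'" "b = ennreal b'" "0 \<le> a'" "0 \<le> b'"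
    using ab by (metis ennreal_cases ennreal_less_top order_less_trans not_less_iff_gr_or_eq)
  then have "a' < e / 8" "b' < e / 8" using ab e by (auto simp: ennreal_less_iff)
  then have "ennreal (4 * (a' + b')) < ennreal e" using e by (intro ennreal_lessI) auto
  moreover have "2 ^ 2 * (a + b) = ennreal (4 * (a' + b'))"
    using ab' by (simp add: ennreal_mult)
  ultimately show ?thesis by (simp only:)
qed

lemma hspan_closure_limit:
  assumes f: "f \<in> borel_measurable borel"
    and lim: "\<And>e. e > 0 \<Longrightarrow> \<exists>g\<in>hspan_closure. gnorm 2 (\<lambda>x. f x - g x) < ennreal e"
  shows "f \<in> hspan_closure"
  unfolding hspan_closure_def
proof (intro CollectI conjI allI impI f)
  fix e :: real assume e: "e > 0"
  obtain g where g: "g \<in> hspan_closure" "gnorm 2 (\<lambda>x. f x - g x) < ennreal (e / 8)"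
    using lim[of "e / 8"] e by auto
  obtain p where p: "p \<in> hspan" "gnorm 2 (\<lambda>x. g x - p x) < ennreal (e / 8)"
    using hspan_closureD[OF g(1), of "e / 8"] e by auto
  note [measurable] = f hspan_closure_measurable[OF g(1)] hspan_measurable[OF p(1)]
  have "gnorm 2 (\<lambda>x. f x - p x) \<le> 2 ^ 2 * (gnorm 2 (\<lambda>x. f x - g x) + gnorm 2 (\<lambda>x. g x - p x))"
  proof (rule gnorm_triangle)
    show "norm (f x - p x) \<le> norm (f x - g x) + norm (g x - p x)" for x
      using norm_triangle_ineq[of "f x - g x" "g x - p x"] by simp
  qed measurable
  also have "\<dots> < ennreal e" by (rule ennreal_four_times_less[OF e g(2) p(2)])
  finally show "\<exists>p\<in>hspan. gnorm 2 (\<lambda>x. f x - p x) < ennreal e" using p(1) by blast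
qed

lemma hspan_closure_seq_limit:
  assumes f: "f \<in> borel_measurable borel" and g: "\<And>k. g k \<in> hspan_closure"
    and lim: "(\<lambda>k. gnorm 2 (\<lambda>x. f x - g k x)) \<longlonglongrightarrow> 0"
  shows "f \<in> hspan_closure"
proof (rule hspan_closure_limit[OF f])
  fix e :: real assume "e > 0"
  then have "eventually (\<lambda>k. gnorm 2 (\<lambda>x. f x - g k x) < ennreal e) sequentially"
    by (intro order_tendstoD[OF lim]) simp
  then show "\<exists>g\<in>hspan_closure. gnorm 2 (\<lambda>x. f x - g x) < ennreal e"
    using g by (auto simp: eventually_sequentially)
qed

lemma hspan_closure_add:
  assumes f: "f \<in> hspan_closure" and g: "g \<in> hspan_closure"
  shows "(\<lambda>x. f x + g x) \<in> hspan_closure"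
  unfolding hspan_closure_def
proof (intro CollectI conjI allI impI)
  show "(\<lambda>x. f x + g x) \<in> borel_measurable borel"
    using f g by (auto intro!: borel_measurable_add dest: hspan_closure_measurable)
  fix e :: real assume e: "e > 0"
  obtain p where p: "p \<in> hspan" "gnorm 2 (\<lambda>x. f x - p x) < ennreal (e / 8)"
    using hspan_closureD[OF f, of "e / 8"] e by auto
  obtain q where q: "q \<in> hspan" "gnorm 2 (\<lambda>x. g x - q x) < ennreal (e / 8)"
    using hspan_closureD[OF g, of "e / 8"] e by auto
  note [measurable] = hspan_closure_measurable[OF f] hspan_closure_measurable[OF g]
     hspan_measurable[OF p(1)] hspan_measurable[OF q(1)]
  have "gnorm 2 (\<lambda>x. (f x + g x) - (p x + q x)) \<le> 2 ^ 2 * (gnorm 2 (\<lambda>x. f x - p x) + gnorm 2 (\<lambda>x. g x - q x))"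
  proof (rule gnorm_triangle)
    show "norm (f x + g x - (p x + q x)) \<le> norm (f x - p x) + norm (g x - q x)" for x
      by (rule norm_diff_triangle_ineq)
  qed measurable
  also have "\<dots> < ennreal e" by (rule ennreal_four_times_less[OF e p(2) q(2)])
  finally show "\<exists>p\<in>hspan. gnorm 2 (\<lambda>x. f x + g x - p x) < ennreal e"
    using hspan_add[OF q(1) p(1)] by (intro bexI[of _ "\<lambda>x. p x + q x"])
qed

lemma hspan_closure_scaleR:
  assumes f: "f \<in> hspan_closure"
  shows "(\<lambda>x. a *\<^sub>R f x) \<in> hspan_closure"
proof (cases "a = 0")
  case True then show ?thesis using hspan_subset_closure[OF hspan.zero] by simp
next
  case False
  show ?thesis
  unfolding hspan_closure_def
  proof (intro CollectI conjI allI impI)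
    show "(\<lambda>x. a *\<^sub>R f x) \<in> borel_measurable borel"
      using f by (auto dest: hspan_closure_measurable)
    fix e :: real assume e: "e > 0"
    obtain p where p: "p \<in> hspan" "gnorm 2 (\<lambda>x. f x - p x) < ennreal (e / a\<^sup>2)"
      using hspan_closureD[OF f, of "e / a\<^sup>2"] e False by auto
    note [measurable] = hspan_closure_measurable[OF f] hspan_measurable[OF p(1)]
    have "gnorm 2 (\<lambda>x. a *\<^sub>R f x - a *\<^sub>R p x) = ennreal (a\<^sup>2) * gnorm 2 (\<lambda>x. f x - p x)"
      unfolding gnorm_def
      by (simp add: nn_integral_cmult[symmetric] ennreal_mult[symmetric] power_mult_distrib flip: scaleR_diff_right)
    also have "\<dots> < ennreal (a\<^sup>2) * ennreal (e / a\<^sup>2)"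
      using p(2) False by (intro ennreal_mult_strict_left_mono) auto
    also have "\<dots> = ennreal e" using False e by (simp flip: ennreal_mult)
    finally show "\<exists>p\<in>hspan. gnorm 2 (\<lambda>x. a *\<^sub>R f x - p x) < ennreal e"
      using hspan_scaleR[OF p(1), of a] by (intro bexI[of _ "\<lambda>x. a *\<^sub>R p x"])
  qed
qed

text \<open>Bounded functions \<open>g\<close> for which multiplication by \<open>g\<close> maps polynomials into the closure of
  the polynomials. They form an algebra that contains sines of the coordinates, which is how the
  approximation by polynomials is passed from compact sets to the whole space.\<close>

definition hspan_multiplier :: "(real ^ 'n::finite \<Rightarrow> real) \<Rightarrow> bool" where
  "hspan_multiplier g \<longleftrightarrow> g \<in> borel_measurable borel \<and> (\<exists>M. \<forall>x. \<bar>g x\<bar> \<le> M) \<and>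
     (\<forall>p\<in>hspan. (\<lambda>x. g x *\<^sub>R p x) \<in> hspan_closure)"

lemma hspan_multiplier_const: "hspan_multiplier (\<lambda>x. a)"
  unfolding hspan_multiplier_def using hspan_subset_closure hspan_closure_scaleR by auto

lemma hspan_multiplier_scale:
  assumes "hspan_multiplier g" shows "hspan_multiplier (\<lambda>x. a * g x)"
proof -
  obtain M where M: "\<And>x. \<bar>g x\<bar> \<le> M" and [measurable]: "g \<in> borel_measurable borel"
    using assms unfolding hspan_multiplier_def by auto
  have "\<bar>a * g x\<bar> \<le> \<bar>a\<bar> * M" for x using M[of x] by (simp add: abs_mult mult_left_mono)
  moreover have "(\<lambda>x. (a * g x) *\<^sub>R p x) \<in> hspan_closure" if "p \<in> hspan" for p
    using hspan_closure_scaleR[of "\<lambda>x. g x *\<^sub>R p x" a] assms that unfolding hspan_multiplier_def by auto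
  ultimately show ?thesis unfolding hspan_multiplier_def by auto
qed

lemma hspan_multiplier_add:
  assumes "hspan_multiplier f" "hspan_multiplier g" shows "hspan_multiplier (\<lambda>x. f x + g x)"
proof -
  obtain M where M: "\<And>x. \<bar>g x\<bar> \<le> M" and [measurable]: "g \<in> borel_measurable borel"
    using assms(2) unfolding hspan_multiplier_def by auto
  obtain N where N: "\<And>x. \<bar>f x\<bar> \<le> N" and [measurable]: "f \<in> borel_measurable borel"
    using assms(1) unfolding hspan_multiplier_def by auto
  have "\<bar>f x + g x\<bar> \<le> N + M" for x using M[of x] N[of x] by linarith
  moreover have "(\<lambda>x. (f x + g x) *\<^sub>R p x) \<in> hspan_closure" if "p \<in> hspan" for p
    using hspan_closure_add[of "\<lambda>x. f x *\<^sub>R p x" "\<lambda>x. g x *\<^sub>R p x"] assms that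
    unfolding hspan_multiplier_def by (auto simp: scaleR_add_left)
  ultimately show ?thesis unfolding hspan_multiplier_def by auto
qed

lemma hspan_multiplier_sum:
  "(\<And>i. i \<in> I \<Longrightarrow> hspan_multiplier (f i)) \<Longrightarrow> hspan_multiplier (\<lambda>x. \<Sum>i\<in>I. f i x)"
  by (induction I rule: infinite_finite_induct) (auto intro: hspan_multiplier_const hspan_multiplier_add)

text \<open>The Taylor series of \<open>sin (a x\<^sub>i)\<close> converges pointwise and is dominated by \<open>exp |a x\<^sub>i|\<close>, hence
  converges in the mean against a Gaussian.\<close>

lemma hspan_multiplier_sin:
  fixes g :: "real ^ 'n::finite \<Rightarrow> real"
  assumes g: "hspan_multiplier g"
  shows "hspan_multiplier (\<lambda>x. g x * sin (a * x $ i))"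
proof -
  obtain M where M: "\<And>x. \<bar>g x\<bar> \<le> M" and [measurable]: "g \<in> borel_measurable borel"
    using g unfolding hspan_multiplier_def by auto
  have "\<bar>g x * sin (a * x $ i)\<bar> \<le> M" for x
    using mult_mono[OF M[of x] abs_sin_le_one[of "a * x $ i"]] M[of x] by (simp add: abs_mult)
  moreover have "(\<lambda>x. (g x * sin (a * x $ i)) *\<^sub>R p x) \<in> hspan_closure" if p: "p \<in> hspan" for p
  proof -
    define S where "S N y = (\<Sum>m<N. sin_coeff m * y ^ m)" for N and y :: real
    have S_bound: "\<bar>S N y\<bar> \<le> exp \<bar>y\<bar>" for N y
    proof -
      have "\<bar>S N y\<bar> \<le> (\<Sum>m<N. \<bar>y\<bar> ^ m /\<^sub>R fact m)"
        unfolding S_def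
      proof (rule order_trans[OF sum_abs], rule sum_mono)
        fix m show "\<bar>sin_coeff m * y ^ m\<bar> \<le> \<bar>y\<bar> ^ m /\<^sub>R fact m"
          by (simp add: sin_coeff_def abs_mult power_abs divide_inverse mult.commute)
      qed
      also have "\<dots> \<le> exp \<bar>y\<bar>"
        unfolding exp_def by (intro sum_le_suminf summable_exp_generic) auto
      finally show ?thesis .
    qed
    have S_lim: "(\<lambda>N. S N y) \<longlonglongrightarrow> sin y" for y
      using sin_converges[of y] unfolding S_def sums_def by simp
    have [measurable]: "p \<in> borel_measurable borel" using p by (rule hspan_measurable)
    have [measurable]: "(\<lambda>x :: real ^ 'n. S N (a * x $ i)) \<in> borel_measurable borel" for N
      unfolding S_def by measurable
    show ?thesis
    proof (rule hspan_closure_seq_limit[where g = "\<lambda>N x. g x *\<^sub>R (S N (a * x $ i) *\<^sub>R p x)"])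
      fix N
      have "(\<lambda>x. \<Sum>m<N. (sin_coeff m * a ^ m) *\<^sub>R ((x $ i) ^ m *\<^sub>R p x)) \<in> hspan"
        by (intro hspan_sum hspan_scaleR hspan_coord_power p)
      also have "(\<lambda>x. \<Sum>m<N. (sin_coeff m * a ^ m) *\<^sub>R ((x $ i) ^ m *\<^sub>R p x)) = (\<lambda>x. S N (a * x $ i) *\<^sub>R p x)"
        by (simp add: S_def scaleR_sum_left power_mult_distrib mult.assoc)
      finally show "(\<lambda>x. g x *\<^sub>R (S N (a * x $ i) *\<^sub>R p x)) \<in> hspan_closure"
        using g unfolding hspan_multiplier_def by auto
    next
      let ?d = "\<lambda>x. M * (2 * exp \<bar>a * x $ i\<bar>) * norm (p x)"
      show "(\<lambda>N. gnorm 2 (\<lambda>x. (g x * sin (a * x $ i)) *\<^sub>R p x - g x *\<^sub>R (S N (a * x $ i) *\<^sub>R p x))) \<longlonglongrightarrow> 0"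
      proof (rule gnorm_dominated_tendsto_0[where g = ?d])
        have "exp_growth (\<lambda>x :: real ^ 'n. exp \<bar>a * x $ i\<bar>)"
        proof (rule exp_growthI[of _ 1 "\<bar>a\<bar>"])
          fix x :: "real ^ 'n"
          show "norm (exp \<bar>a * x $ i\<bar>) \<le> 1 * exp (\<bar>a\<bar> * norm x)"
            using component_le_norm_cart[of x i] by (simp add: abs_mult mult_left_mono)
        qed
        moreover have "exp_growth (\<lambda>x. norm (p x))"
          by (rule exp_growth_mono[OF hspan_exp_growth[OF p]]) simp
        ultimately show "exp_growth ?d"
          by (intro exp_growth_mult exp_growth_const)
        show "norm ((g x * sin (a * x $ i)) *\<^sub>R p x - g x *\<^sub>R S N (a * x $ i) *\<^sub>R p x) \<le> ?d x" for N x
        proof -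
          have "norm ((g x * sin (a * x $ i)) *\<^sub>R p x - g x *\<^sub>R S N (a * x $ i) *\<^sub>R p x) =
              \<bar>g x\<bar> * \<bar>sin (a * x $ i) - S N (a * x $ i)\<bar> * norm (p x)"
            by (simp add: abs_mult flip: scaleR_diff_left right_diff_distrib)
          also have "\<dots> \<le> ?d x"
          proof (intro mult_right_mono mult_mono M)
            have "\<bar>sin (a * x $ i)\<bar> \<le> exp \<bar>a * x $ i\<bar>"
              using abs_sin_le_one[of "a * x $ i"] exp_ge_add_one_self[of "\<bar>a * x $ i\<bar>"] by linarith
            then show "\<bar>sin (a * x $ i) - S N (a * x $ i)\<bar> \<le> 2 * exp \<bar>a * x $ i\<bar>"
              using S_bound[of N "a * x $ i"] by linarith
            show "0 \<le> M" using M[of x] by linarith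
          qed auto
          finally show ?thesis .
        qed
        have "(\<lambda>N. (g x * sin (a * x $ i)) *\<^sub>R p x - g x *\<^sub>R S N (a * x $ i) *\<^sub>R p x) \<longlonglongrightarrow>
           (g x * sin (a * x $ i)) *\<^sub>R p x - g x *\<^sub>R sin (a * x $ i) *\<^sub>R p x" for x
          by (intro tendsto_intros S_lim)
        then show "AE x in gauss. (\<lambda>N. (g x * sin (a * x $ i)) *\<^sub>R p x - g x *\<^sub>R S N (a * x $ i) *\<^sub>R p x) \<longlonglongrightarrow> 0"
          by simp
        show "(\<lambda>x. (g x * sin (a * x $ i)) *\<^sub>R p x - g x *\<^sub>R S N (a * x $ i) *\<^sub>R p x) \<in> borel_measurable borel" for N
          by measurable
        show "?d \<in> borel_measurable borel" by measurable
      qed simp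
    qed measurable
  qed
  ultimately show ?thesis unfolding hspan_multiplier_def by auto
qed

text \<open>A bounded substitute for the identity: its values stay in the cube of half side \<open>a\<close>, and it
  tends to the identity as \<open>a\<close> tends to infinity.\<close>

definition sin_box :: "real \<Rightarrow> real ^ 'n::finite \<Rightarrow> real ^ 'n" where
  "sin_box a x = (\<chi> i. a * sin (x $ i / a))"

lemma sin_box_continuous: "a > 0 \<Longrightarrow> continuous_on UNIV (sin_box a)"
  unfolding sin_box_def by (intro continuous_on_vec_lambda continuous_intros) auto

lemma hspan_multiplier_polynomial:
  fixes q :: "real ^ 'n::finite \<Rightarrow> real"
  assumes "real_polynomial_function q" "hspan_multiplier g"
  shows "hspan_multiplier (\<lambda>x. g x * q (sin_box a x))"
  using assms
proof (induction arbitrary: g rule: real_polynomial_function.induct)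
  case (linear f)
  note g = linear(2)
  interpret bounded_linear f by fact
  have f: "f v = (\<Sum>i\<in>UNIV. v $ i * f (axis i 1))" for v
  proof -
    have "f v = f (\<Sum>i\<in>UNIV. (v $ i) *\<^sub>R axis i 1)"
      by (simp add: basis_expansion flip: scalar_mult_eq_scaleR)
    then show ?thesis by (simp add: sum scaleR)
  qed
  have "hspan_multiplier (\<lambda>x. \<Sum>i\<in>UNIV. (a * f (axis i 1)) * (g x * sin ((1 / a) * x $ i)))"
    by (intro hspan_multiplier_sum hspan_multiplier_scale hspan_multiplier_sin g)
  also have "(\<lambda>x. \<Sum>i\<in>UNIV. (a * f (axis i 1)) * (g x * sin ((1 / a) * x $ i))) = (\<lambda>x. g x * f (sin_box a x))"
    by (subst f) (auto simp: sin_box_def sum_distrib_left mult_ac fun_eq_iff)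
  finally show ?case .
next
  case (const c)
  then show ?case using hspan_multiplier_scale[of g c] by (simp add: mult.commute)
next
  case (add f h)
  then show ?case using hspan_multiplier_add[of "\<lambda>x. g x * f (sin_box a x)" "\<lambda>x. g x * h (sin_box a x)"]
    by (simp add: algebra_simps)
next
  case (mult f h)
  then show ?case using mult.IH(2)[OF mult.IH(1)[OF mult.prems]] by (simp add: mult.assoc)
qed

text \<open>After composition with \<open>sin_box a\<close> only values on a compact cube matter, where Stone--Weierstrass
  provides polynomials; polynomials in sines are multipliers. Then \<open>a\<close> tends to infinity.\<close>

lemma bounded_continuous_in_hspan_closure:
  fixes \<psi> :: "real ^ 'n::finite \<Rightarrow> real"
  assumes cont: "continuous_on UNIV \<psi>" and M: "\<And>x. \<bar>\<psi> x\<bar> \<le> M"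
  shows "(\<lambda>x. \<psi> x *\<^sub>R c) \<in> hspan_closure"
proof -
  have M0: "0 \<le> M" using M[of 0] by linarith
  have [measurable]: "\<psi> \<in> borel_measurable borel" using cont by (rule borel_measurable_continuous_onI)
  have sb[measurable]: "sin_box a \<in> borel_measurable borel" if "a > 0" for a :: real
    using sin_box_continuous[OF that] by (rule borel_measurable_continuous_onI)
  have step: "(\<lambda>x. \<psi> (sin_box a x) *\<^sub>R c) \<in> hspan_closure" if a: "a > 0" for a
  proof (rule hspan_closure_limit)
    show "(\<lambda>x. \<psi> (sin_box a x) *\<^sub>R c) \<in> borel_measurable borel"
      using sb[OF a] by measurable
    fix e :: real assume e: "e > 0"
    define d where "d = sqrt (e / 2) / (norm c + 1)"
    have d: "d > 0" using e by (simp add: d_def add_nonneg_pos)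
    let ?K = "cbox (\<chi> i. - a) (\<chi> i. a) :: (real ^ 'n) set"
    obtain q where q: "real_polynomial_function q" "\<And>x. x \<in> ?K \<Longrightarrow> \<bar>\<psi> x - q x\<bar> < d"
      using Stone_Weierstrass_real_polynomial_function[of ?K \<psi> d] d cont
      by (auto intro: continuous_on_subset compact_cbox)
    have in_K: "sin_box a x \<in> ?K" for x
    proof -
      have "\<bar>a * sin (x $ i / a)\<bar> \<le> a" for i
        using mult_left_mono[OF abs_sin_le_one[of "x $ i / a"], of a] a by (simp add: abs_mult)
      then show ?thesis unfolding sin_box_def mem_box_cart by (simp add: abs_le_iff minus_le_iff)
    qed
    have qm: "hspan_multiplier (\<lambda>x. q (sin_box a x))"
      using hspan_multiplier_polynomial[OF q(1) hspan_multiplier_const[of 1], of a] by simp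
    then have 1: "(\<lambda>x. q (sin_box a x) *\<^sub>R c) \<in> hspan_closure"
      using hspan_const[of c] unfolding hspan_multiplier_def by auto
    have "gnorm 2 (\<lambda>x. \<psi> (sin_box a x) *\<^sub>R c - q (sin_box a x) *\<^sub>R c) \<le> (\<integral>\<^sup>+x. ennreal (e / 2) \<partial>(gauss :: (real ^ 'n) measure))"
      unfolding gnorm_def
    proof (intro nn_integral_mono ennreal_leI)
      fix x :: "real ^ 'n"
      have "norm (\<psi> (sin_box a x) *\<^sub>R c - q (sin_box a x) *\<^sub>R c) = \<bar>\<psi> (sin_box a x) - q (sin_box a x)\<bar> * norm c"
        by (simp flip: scaleR_diff_left)
      also have "\<dots> \<le> d * (norm c + 1)" using q(2)[OF in_K[of x]] d by (intro mult_mono) auto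
      also have "\<dots> = sqrt (e / 2)" using norm_ge_zero[of c] by (simp add: d_def add_nonneg_eq_0_iff)
      finally have "(norm (\<psi> (sin_box a x) *\<^sub>R c - q (sin_box a x) *\<^sub>R c))\<^sup>2 \<le> (sqrt (e / 2))\<^sup>2"
        by (intro power_mono) auto
      then show "(norm (\<psi> (sin_box a x) *\<^sub>R c - q (sin_box a x) *\<^sub>R c))\<^sup>2 \<le> e / 2" using e by simp
    qed
    also have "\<dots> = ennreal (e / 2)" using gauss.emeasure_space_1[where 'n='n] by simp
    also have "\<dots> < ennreal e" using e by (simp add: ennreal_less_iff)
    finally show "\<exists>g\<in>hspan_closure. gnorm 2 (\<lambda>x. \<psi> (sin_box a x) *\<^sub>R c - g x) < ennreal e"
      using 1 by (intro bexI[of _ "\<lambda>x. q (sin_box a x) *\<^sub>R c"])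
  qed
  have lim: "(\<lambda>k. sin_box (real (Suc k)) x) \<longlonglongrightarrow> x" for x :: "real ^ 'n"
  proof -
    have "(\<lambda>k. real (Suc k) * sin (t / real (Suc k))) \<longlonglongrightarrow> t" for t :: real
      by real_asymp
    then show ?thesis unfolding sin_box_def by (intro vec_tendstoI) simp
  qed
  show ?thesis
  proof (rule hspan_closure_seq_limit)
    show "(\<lambda>x. \<psi> (sin_box (real (Suc k)) x) *\<^sub>R c) \<in> hspan_closure" for k by (intro step) simp
    show "(\<lambda>k. gnorm 2 (\<lambda>x. \<psi> x *\<^sub>R c - \<psi> (sin_box (real (Suc k)) x) *\<^sub>R c)) \<longlonglongrightarrow> 0"
    proof (rule gnorm_dominated_tendsto_0[where g = "\<lambda>x. 2 * M * norm c"])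
      show "norm (\<psi> x *\<^sub>R c - \<psi> (sin_box (real (Suc k)) x) *\<^sub>R c) \<le> 2 * M * norm c" for k x
      proof -
        have "\<bar>\<psi> x - \<psi> (sin_box (real (Suc k)) x)\<bar> \<le> 2 * M"
          using M[of x] M[of "sin_box (real (Suc k)) x"] by linarith
        then show ?thesis by (simp add: mult_right_mono flip: scaleR_diff_left)
      qed
      have "(\<lambda>k. \<psi> (sin_box (real (Suc k)) x)) \<longlonglongrightarrow> \<psi> x" for x
        using continuous_on_tendsto_compose[OF cont lim] by simp
      then have "(\<lambda>k. \<psi> x *\<^sub>R c - \<psi> (sin_box (real (Suc k)) x) *\<^sub>R c) \<longlonglongrightarrow> \<psi> x *\<^sub>R c - \<psi> x *\<^sub>R c" for x
        by (intro tendsto_intros) 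
      then show "AE x in gauss. (\<lambda>k. \<psi> x *\<^sub>R c - \<psi> (sin_box (real (Suc k)) x) *\<^sub>R c) \<longlonglongrightarrow> 0" by simp
      show "(\<lambda>x. \<psi> x *\<^sub>R c - \<psi> (sin_box (real (Suc k)) x) *\<^sub>R c) \<in> borel_measurable borel" for k
        using sb[of "real (Suc k)"] by measurable
    qed (auto intro: exp_growth_const)
  qed measurable
qed

text \<open>Projecting onto a ball in the plane preserves both continuity and the bound.\<close>

lemma continuous_approximation:
  fixes f :: "real ^ 'n::finite \<Rightarrow> complex"
  assumes f: "f \<in> borel_measurable borel" and M: "\<And>x. norm (f x) \<le> M"
  obtains g where "\<And>k. continuous_on UNIV (g k)" "\<And>k x. norm (g k x) \<le> M"
    "AE x in gauss. (\<lambda>k. g k x) \<longlonglongrightarrow> f x"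
proof -
  have M0: "0 \<le> M" using M[of 0] norm_ge_zero order_trans by blast
  have "f \<in> borel_measurable lebesgue" using f by (simp add: measurable_completion)
  then have "f measurable_on UNIV" by (rule lebesgue_measurable_imp_measurable_on) simp
  then obtain N g where N: "negligible N" and g: "\<And>k. continuous_on UNIV (g k)"
    and lim: "\<And>x. x \<notin> N \<Longrightarrow> (\<lambda>k. g k x) \<longlonglongrightarrow> f x"
    unfolding measurable_on_def by auto
  let ?c = "closest_point (cball (0::complex) M)"
  have cc: "continuous_on UNIV ?c"
    using M0 by (intro continuous_on_closest_point) auto
  show ?thesis
  proof (rule that[of "\<lambda>k x. ?c (g k x)"])
    show "continuous_on UNIV (\<lambda>x. ?c (g k x))" for k
      by (rule continuous_on_compose2[OF cc g]) auto
    show "norm (?c (g k x)) \<le> M" for k x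
      using closest_point_in_set[of "cball (0::complex) M" "g k x"] M0 by auto
    have "AE x in lebesgue. x \<notin> N" using N
      by (simp add: negligible_iff_null_sets AE_not_in)
    then have "AE x in lborel. x \<notin> N" by (simp add: AE_completion_iff)
    then show "AE x in gauss. (\<lambda>k. ?c (g k x)) \<longlonglongrightarrow> f x"
      unfolding AE_gauss_iff
    proof eventually_elim
      case (elim x)
      have "(\<lambda>k. ?c (g k x)) \<longlonglongrightarrow> ?c (f x)"
        using continuous_on_tendsto_compose[OF cc lim[OF elim]] by simp
      also have "?c (f x) = f x" using M[of x] by (intro closest_point_self) auto
      finally show ?case .
    qed
  qed
qed

theorem bounded_in_hspan_closure:
  fixes f :: "real ^ 'n::finite \<Rightarrow> complex"
  assumes f[measurable]: "f \<in> borel_measurable borel" and M: "\<And>x. norm (f x) \<le> M"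
  shows "f \<in> hspan_closure"
proof -
  obtain g where g: "\<And>k. continuous_on UNIV (g k)" "\<And>k x. norm (g k x) \<le> M"
    and lim: "AE x in gauss. (\<lambda>k. g k x) \<longlonglongrightarrow> f x"
    using continuous_approximation[OF f M] by blast
  have [measurable]: "g k \<in> borel_measurable borel" for k
    using g(1) by (rule borel_measurable_continuous_onI)
  show ?thesis
  proof (rule hspan_closure_seq_limit[where g = g])
    show "g k \<in> hspan_closure" for k
    proof -
      have "(\<lambda>x. Re (g k x) *\<^sub>R 1 + Im (g k x) *\<^sub>R \<i>) \<in> hspan_closure"
        using g[of k] abs_Re_le_cmod abs_Im_le_cmod order_trans
        by (intro hspan_closure_add bounded_continuous_in_hspan_closure[where M = M] continuous_intros) blast+
      also have "(\<lambda>x. Re (g k x) *\<^sub>R 1 + Im (g k x) *\<^sub>R \<i>) = g k"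
        by (auto simp: complex_eq_iff)
      finally show ?thesis .
    qed
    show "(\<lambda>k. gnorm 2 (\<lambda>x. f x - g k x)) \<longlonglongrightarrow> 0"
    proof (rule gnorm_dominated_tendsto_0[where g = "\<lambda>x. 2 * M"])
      show "norm (f x - g k x) \<le> 2 * M" for k x
        using norm_triangle_ineq4[of "f x" "g k x"] M[of x] g(2)[of k x] by linarith
      show "AE x in gauss. (\<lambda>k. f x - g k x) \<longlonglongrightarrow> 0"
        using lim
      proof eventually_elim
        case (elim x)
        then show ?case using tendsto_diff[OF tendsto_const[of "f x"] elim] by simp
      qed
    qed (auto intro: exp_growth_const)
  qed measurable
qed

section \<open>Completeness and pairings\<close>

text \<open>Compares the mean of \<open>|h|\<close> with a higher power on the set where \<open>|h| > \<delta>\<close>; since \<open>\<gamma>\<close> is a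
  probability measure, smallness of a higher power implies smallness in the mean.\<close>

lemma gnorm_1_le:
  fixes h :: "real ^ 'n::finite \<Rightarrow> complex"
  assumes [measurable]: "h \<in> borel_measurable borel" and d: "\<delta> > 0"
  shows "gnorm 1 h \<le> ennreal \<delta> + ennreal (1 / \<delta> ^ m) * gnorm (Suc m) h"
proof -
  have "gnorm 1 h \<le> (\<integral>\<^sup>+x. ennreal \<delta> + ennreal (1 / \<delta> ^ m) * ennreal (norm (h x) ^ Suc m) \<partial>gauss)"
    unfolding gnorm_def
  proof (rule nn_integral_mono)
    fix x
    have "norm (h x) \<le> \<delta> + (1 / \<delta> ^ m) * norm (h x) ^ Suc m"
    proof (cases "norm (h x) \<le> \<delta>")
      case True then show ?thesis using d by (simp add: add_increasing2)
    next
      case False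
      then have "norm (h x) * \<delta> ^ m \<le> norm (h x) * norm (h x) ^ m"
        using d by (intro mult_left_mono power_mono) auto
      then have "norm (h x) \<le> (1 / \<delta> ^ m) * norm (h x) ^ Suc m"
        using d by (simp add: field_simps)
      then show ?thesis using d by simp
    qed
    then have "ennreal (norm (h x)) \<le> ennreal (\<delta> + (1 / \<delta> ^ m) * norm (h x) ^ Suc m)"
      by (rule ennreal_leI)
    also have "\<dots> = ennreal \<delta> + ennreal (1 / \<delta> ^ m) * ennreal (norm (h x) ^ Suc m)"
      using d by (simp add: ennreal_plus ennreal_mult[symmetric] del: power_Suc)
    finally show "ennreal (norm (h x) ^ 1) \<le> ennreal \<delta> + ennreal (1 / \<delta> ^ m) * ennreal (norm (h x) ^ Suc m)"
      by simp
  qed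
  also have "\<dots> = ennreal \<delta> + ennreal (1 / \<delta> ^ m) * gnorm (Suc m) h"
    unfolding gnorm_def using gauss.emeasure_space_1[where 'n='n]
    by (simp add: nn_integral_add nn_integral_cmult)
  finally show ?thesis .
qed

lemma ennreal_tendsto_0I:
  fixes X :: "'a \<Rightarrow> ennreal"
  assumes "\<And>e. e > 0 \<Longrightarrow> \<forall>\<^sub>F k in F. X k \<le> ennreal e"
  shows "(X \<longlongrightarrow> 0) F"
proof (rule order_tendstoI)
  fix a :: ennreal assume "0 < a"
  then obtain b where b: "0 < b" "b < a" using dense by blast
  have "b < top" using b(2) top_greatest order_less_le_trans by blast
  then have "b = ennreal (enn2real b)" "0 < enn2real b"
    using b(1) by (simp_all add: enn2real_positive_iff)
  with assms[of "enn2real b"] have "\<forall>\<^sub>F k in F. X k \<le> b" by simp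
  then show "\<forall>\<^sub>F k in F. X k < a" by eventually_elim (use b in auto)
qed auto

lemma gnorm_fatou:
  fixes u :: "nat \<Rightarrow> real ^ 'n::finite \<Rightarrow> complex"
  assumes [measurable]: "\<And>k. u k \<in> borel_measurable borel" "v \<in> borel_measurable borel"
    and lim: "AE x in gauss. (\<lambda>k. u k x) \<longlonglongrightarrow> v x"
    and le: "\<forall>\<^sub>F k in sequentially. gnorm p (u k) \<le> C"
  shows "gnorm p v \<le> C"
proof -
  have "gnorm p v = (\<integral>\<^sup>+x. liminf (\<lambda>k. ennreal (norm (u k x) ^ p)) \<partial>gauss)"
    unfolding gnorm_def
  proof (intro nn_integral_cong_AE)
    show "AE x in gauss. ennreal (norm (v x) ^ p) = liminf (\<lambda>k. ennreal (norm (u k x) ^ p))"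
      using lim
    proof eventually_elim
      case (elim x)
      have "(\<lambda>k. norm (u k x) ^ p) \<longlonglongrightarrow> norm (v x) ^ p" by (intro tendsto_intros elim)
      from lim_imp_Liminf[OF _ tendsto_ennrealI[OF this]] show ?case by simp
    qed
  qed
  also have "\<dots> \<le> liminf (\<lambda>k. gnorm p (u k))"
    unfolding gnorm_def by (intro nn_integral_liminf) measurable
  also have "\<dots> \<le> limsup (\<lambda>k. gnorm p (u k))" by (intro Liminf_le_Limsup) simp
  also have "\<dots> \<le> C" using le by (intro Limsup_bounded) auto
  finally show ?thesis .
qed

lemma tendsto_integral_L1_nn:
  fixes w :: "nat \<Rightarrow> 'a \<Rightarrow> complex"
  assumes "\<And>k. integrable M (w k)" "integrable M z"
    and "(\<lambda>k. \<integral>\<^sup>+x. norm (w k x - z x) \<partial>M) \<longlonglongrightarrow> 0"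
  shows "(\<lambda>k. integral\<^sup>L M (w k)) \<longlonglongrightarrow> integral\<^sup>L M z"
  by (rule tendsto_L1_int) (use assms in auto)

text \<open>The Riesz--Fischer argument: a rapidly Cauchy subsequence converges almost everywhere, and
  Fatou's lemma identifies the limit in the mean.\<close>

lemma gnorm_complete:
  fixes f :: "nat \<Rightarrow> real ^ 'n::finite \<Rightarrow> complex"
  assumes [measurable]: "\<And>k. f k \<in> borel_measurable borel"
    and cauchy: "\<And>e. e > 0 \<Longrightarrow> \<exists>N. \<forall>i\<ge>N. \<forall>j\<ge>N. gnorm (Suc m) (\<lambda>x. f i x - f j x) \<le> ennreal e"
  shows "\<exists>g. g \<in> borel_measurable borel \<and> (\<lambda>k. gnorm (Suc m) (\<lambda>x. f k x - g x)) \<longlonglongrightarrow> 0"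
proof -
  \<comment> \<open>With this rate \<open>gnorm_1_le\<close>, at \<open>\<delta> = 2\<^sup>-\<^sup>k\<close>, makes the steps of the subsequence summable in the mean.\<close>
  let ?e = "\<lambda>k. (1/2) ^ k * ((1/2) ^ k) ^ m :: real"
  have "\<forall>k. \<exists>N. \<forall>i\<ge>N. \<forall>j\<ge>N. gnorm (Suc m) (\<lambda>x. f i x - f j x) \<le> ennreal (?e k)"
    using cauchy by simp
  then obtain N where N: "\<And>k i j. i \<ge> N k \<Longrightarrow> j \<ge> N k \<Longrightarrow> gnorm (Suc m) (\<lambda>x. f i x - f j x) \<le> ennreal (?e k)"
    by metis
  define r where "r k = (\<Sum>i\<le>k. N i + 1)" for k
  have r_ge: "r k \<ge> N k" for k
    unfolding r_def using member_le_sum[of k "{..k}" "\<lambda>i. N i + 1"] by simp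
  have r_Suc: "r (Suc k) \<ge> r k" for k unfolding r_def by simp
  have r_lin: "r k \<ge> k" for k unfolding r_def by (induction k) auto
  have D: "gnorm 1 (\<lambda>x. f (r (Suc k)) x - f (r k) x) \<le> ennreal (2 * (1/2) ^ k)" for k
  proof -
    have "gnorm 1 (\<lambda>x. f (r (Suc k)) x - f (r k) x) \<le>
      ennreal ((1/2) ^ k) + ennreal (1 / ((1/2) ^ k) ^ m) * gnorm (Suc m) (\<lambda>x. f (r (Suc k)) x - f (r k) x)"
      by (rule gnorm_1_le) auto
    also have "\<dots> \<le> ennreal ((1/2) ^ k) + ennreal (1 / ((1/2) ^ k) ^ m) * ennreal (?e k)"
      using r_ge[of k] r_Suc[of k] by (intro add_left_mono mult_left_mono N) auto
    also have "\<dots> = ennreal (2 * (1/2) ^ k)"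
      by (simp flip: ennreal_plus ennreal_mult)
    finally show ?thesis .
  qed
  have "(\<integral>\<^sup>+x. (\<Sum>k. ennreal (norm (f (r (Suc k)) x - f (r k) x))) \<partial>gauss) =
     (\<Sum>k. gnorm 1 (\<lambda>x. f (r (Suc k)) x - f (r k) x))"
    unfolding gnorm_def by (subst nn_integral_suminf) auto
  also have "\<dots> \<le> (\<Sum>k. ennreal (2 * (1/2) ^ k))"
    by (intro suminf_le D) auto
  also have "\<dots> = ennreal (\<Sum>k. 2 * (1/2) ^ k)"
    by (intro suminf_ennreal2 summable_mult) auto
  also have "\<dots> < \<infinity>" by simp
  finally have "AE x in gauss. (\<Sum>k. ennreal (norm (f (r (Suc k)) x - f (r k) x))) \<noteq> \<infinity>"
    by (intro nn_integral_noteq_infinite) auto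
  then have conv: "AE x in gauss. convergent (\<lambda>k. f (r k) x)"
  proof eventually_elim
    case (elim x)
    have "summable (\<lambda>k. norm (f (r (Suc k)) x - f (r k) x))"
      using elim by (intro summable_suminf_not_top) auto
    then have "summable (\<lambda>k. f (r (Suc k)) x - f (r k) x)" by (rule summable_norm_cancel)
    then have "convergent (\<lambda>n. \<Sum>k<n. f (r (Suc k)) x - f (r k) x)"
      by (simp add: summable_iff_convergent)
    then have "convergent (\<lambda>n. f (r n) x - f (r 0) x)"
      by (subst (asm) sum_lessThan_telescope)
    then have "convergent (\<lambda>n. (f (r n) x - f (r 0) x) + f (r 0) x)"
      by (intro convergent_add convergent_const)
    then show ?case by simp
  qed
  define g where "g x = lim (\<lambda>k. f (r k) x)" for x
  have [measurable]: "g \<in> borel_measurable borel" unfolding g_def by measurable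
  have "(\<lambda>k. gnorm (Suc m) (\<lambda>x. f k x - g x)) \<longlonglongrightarrow> 0"
  proof (rule ennreal_tendsto_0I)
    fix e :: real assume "e > 0"
    then obtain N where N: "\<And>i j. i \<ge> N \<Longrightarrow> j \<ge> N \<Longrightarrow> gnorm (Suc m) (\<lambda>x. f i x - f j x) \<le> ennreal e"
      using cauchy by blast
    show "\<forall>\<^sub>F k in sequentially. gnorm (Suc m) (\<lambda>x. f k x - g x) \<le> ennreal e"
    proof (intro eventually_sequentiallyI)
      fix i assume i: "i \<ge> N"
      show "gnorm (Suc m) (\<lambda>x. f i x - g x) \<le> ennreal e"
      proof (rule gnorm_fatou[where u = "\<lambda>k x. f i x - f (r k) x"])
        show "AE x in gauss. (\<lambda>k. f i x - f (r k) x) \<longlonglongrightarrow> f i x - g x"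
          using conv
        proof eventually_elim
          case (elim x)
          then have "(\<lambda>k. f (r k) x) \<longlonglongrightarrow> g x" unfolding g_def by (simp add: convergent_LIMSEQ_iff)
          then show ?case by (intro tendsto_diff tendsto_const)
        qed
        show "\<forall>\<^sub>F k in sequentially. gnorm (Suc m) (\<lambda>x. f i x - f (r k) x) \<le> ennreal e"
        proof (intro eventually_sequentiallyI)
          fix k assume "k \<ge> N"
          then show "gnorm (Suc m) (\<lambda>x. f i x - f (r k) x) \<le> ennreal e"
            using i r_lin[of k] by (intro N) auto
        qed
      qed measurable
    qed
  qed
  then show ?thesis using \<open>g \<in> _\<close> by blast
qed

lemma gnorm_1_tendsto_0:
  fixes f :: "nat \<Rightarrow> real ^ 'n::finite \<Rightarrow> complex"
  assumes [measurable]: "\<And>k. f k \<in> borel_measurable borel"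
    and lim: "(\<lambda>k. gnorm 2 (f k)) \<longlonglongrightarrow> 0"
  shows "(\<lambda>k. gnorm 1 (f k)) \<longlonglongrightarrow> 0"
proof (rule ennreal_tendsto_0I)
  fix e :: real assume e: "e > 0"
  have "\<forall>\<^sub>F k in sequentially. gnorm 2 (f k) < ennreal ((e/2) * (e/2))"
    using e by (intro order_tendstoD[OF lim]) simp
  then show "\<forall>\<^sub>F k in sequentially. gnorm 1 (f k) \<le> ennreal e"
  proof eventually_elim
    case (elim k)
    have "gnorm 1 (f k) \<le> ennreal (e/2) + ennreal (1 / (e/2) ^ 1) * gnorm (Suc 1) (f k)"
      using e by (intro gnorm_1_le) auto
    also have "\<dots> \<le> ennreal (e/2) + ennreal (1 / (e/2) ^ 1) * ennreal ((e/2) * (e/2))"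
      using elim by (intro add_left_mono mult_left_mono) (auto simp: numeral_2_eq_2)
    also have "\<dots> = ennreal e" using e by (simp flip: ennreal_mult ennreal_plus)
    finally show ?case .
  qed
qed

lemma integrable_L2_product:
  fixes u h :: "real ^ 'n::finite \<Rightarrow> complex"
  assumes [measurable]: "u \<in> borel_measurable borel" "h \<in> borel_measurable borel"
    and fin: "gnorm 2 u < \<infinity>" "gnorm 2 h < \<infinity>"
  shows "integrable gauss (\<lambda>x. u x * h x)"
proof (rule Bochner_Integration.integrable_bound)
  have "integrable gauss (\<lambda>x. (norm (u x))\<^sup>2)" "integrable gauss (\<lambda>x. (norm (h x))\<^sup>2)"
    using fin by (auto simp: integrable_iff_bounded gnorm_def)
  then show "integrable gauss (\<lambda>x. (norm (u x))\<^sup>2 + (norm (h x))\<^sup>2)" by simp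
  have "norm (u x) * norm (h x) \<le> (norm (u x))\<^sup>2 + (norm (h x))\<^sup>2" for x
  proof -
    have "0 \<le> (norm (u x) - norm (h x))\<^sup>2 + (norm (u x))\<^sup>2 + (norm (h x))\<^sup>2" by simp
    then show ?thesis by (simp add: power2_diff)
  qed
  then show "AE x in gauss. norm (u x * h x) \<le> norm ((norm (u x))\<^sup>2 + (norm (h x))\<^sup>2)"
    by (auto simp: norm_mult)
qed measurable

lemma L2_pairing_tendsto:
  fixes u :: "nat \<Rightarrow> real ^ 'n::finite \<Rightarrow> complex"
  assumes [measurable]: "\<And>k. u k \<in> borel_measurable borel" "v \<in> borel_measurable borel" "h \<in> borel_measurable borel"
    and fin: "\<And>k. gnorm 2 (u k) < \<infinity>" "gnorm 2 v < \<infinity>" "gnorm 2 h < \<infinity>"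
    and lim: "(\<lambda>k. gnorm 2 (\<lambda>x. u k x - v x)) \<longlonglongrightarrow> 0"
  shows "(\<lambda>k. LINT x|gauss. u k x * h x) \<longlonglongrightarrow> (LINT x|gauss. v x * h x)"
proof -
  note int = integrable_L2_product[OF _ _ fin(1,3)] integrable_L2_product[OF _ _ fin(2,3)]
  define H where "H = enn2real (gnorm 2 h) + 1"
  have H: "gnorm 2 h \<le> ennreal H" "H > 0"
  proof -
    have "gnorm 2 h = ennreal (enn2real (gnorm 2 h))" using fin(3) by simp
    also have "\<dots> \<le> ennreal H" unfolding H_def by (intro ennreal_leI) simp
    finally show "gnorm 2 h \<le> ennreal H" .
    show "H > 0" unfolding H_def by (simp add: add_nonneg_pos)
  qed
  have bd: "(\<integral>\<^sup>+x. ennreal (norm ((u k x - v x) * h x)) \<partial>gauss) \<le> ennreal \<delta> * ennreal H + ennreal (1 / \<delta>) * gnorm 2 (\<lambda>x. u k x - v x)"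
    if d: "\<delta> > 0" for \<delta> k
  proof -
    have "(\<integral>\<^sup>+x. ennreal (norm ((u k x - v x) * h x)) \<partial>gauss) \<le>
      (\<integral>\<^sup>+x. ennreal \<delta> * ennreal ((norm (h x))\<^sup>2) + ennreal (1 / \<delta>) * ennreal ((norm (u k x - v x))\<^sup>2) \<partial>gauss)"
    proof (rule nn_integral_mono)
      fix x
      let ?a = "norm (u k x - v x)" let ?b = "norm (h x)"
      have "0 \<le> (?a - \<delta> * ?b)\<^sup>2 / \<delta>" using d by simp
      also have "\<dots> = (1 / \<delta>) * ?a\<^sup>2 + \<delta> * ?b\<^sup>2 - 2 * (?a * ?b)"
        using d by (simp add: power2_eq_square field_simps)
      finally have "?a * ?b \<le> \<delta> * ?b\<^sup>2 + (1 / \<delta>) * ?a\<^sup>2"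
        using mult_nonneg_nonneg[OF norm_ge_zero norm_ge_zero, of "u k x - v x" "h x"] by linarith
      then have "ennreal (norm ((u k x - v x) * h x)) \<le> ennreal (\<delta> * ?b\<^sup>2 + (1 / \<delta>) * ?a\<^sup>2)"
        by (intro ennreal_leI) (simp add: norm_mult)
      then show "ennreal (norm ((u k x - v x) * h x)) \<le> ennreal \<delta> * ennreal (?b\<^sup>2) + ennreal (1 / \<delta>) * ennreal (?a\<^sup>2)"
        using d by (simp add: ennreal_mult[symmetric] ennreal_plus[symmetric] del: ennreal_plus)
    qed
    also have "\<dots> = ennreal \<delta> * gnorm 2 h + ennreal (1 / \<delta>) * gnorm 2 (\<lambda>x. u k x - v x)"
      unfolding gnorm_def by (simp add: nn_integral_add nn_integral_cmult)
    also have "\<dots> \<le> ennreal \<delta> * ennreal H + ennreal (1 / \<delta>) * gnorm 2 (\<lambda>x. u k x - v x)"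
      using H by (intro add_right_mono mult_left_mono) auto
    finally show ?thesis .
  qed
  have "(\<lambda>k. \<integral>\<^sup>+x. ennreal (norm ((u k x - v x) * h x)) \<partial>gauss) \<longlonglongrightarrow> 0"
  proof (rule ennreal_tendsto_0I)
    fix e :: real assume e: "e > 0"
    define \<delta> where "\<delta> = e / (2 * H)"
    have d: "\<delta> > 0" using e H by (simp add: \<delta>_def)
    have "\<forall>\<^sub>F k in sequentially. gnorm 2 (\<lambda>x. u k x - v x) < ennreal (\<delta> * (e / 2))"
      using e d by (intro order_tendstoD[OF lim]) simp
    then show "\<forall>\<^sub>F k in sequentially. (\<integral>\<^sup>+x. ennreal (norm ((u k x - v x) * h x)) \<partial>gauss) \<le> ennreal e"
    proof eventually_elim
      case (elim k)
      have "(\<integral>\<^sup>+x. ennreal (norm ((u k x - v x) * h x)) \<partial>gauss) \<le> ennreal \<delta> * ennreal H + ennreal (1 / \<delta>) * gnorm 2 (\<lambda>x. u k x - v x)"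
        by (rule bd[OF d])
      also have "\<dots> \<le> ennreal \<delta> * ennreal H + ennreal (1 / \<delta>) * ennreal (\<delta> * (e / 2))"
        using elim by (intro add_left_mono mult_left_mono) auto
      also have "\<dots> = ennreal e"
        using e d H by (simp add: \<delta>_def flip: ennreal_mult ennreal_plus)
      finally show ?case .
    qed
  qed
  then show ?thesis
    by (intro tendsto_integral_L1_nn int) (simp_all add: left_diff_distrib)
qed

section \<open>Test functions and weak derivatives\<close>

lemma test_function_differentiable: "test_function \<phi> \<Longrightarrow> \<phi> differentiable (at x)"
proof -
  assume "test_function \<phi>"
  then have "foldr partial [] \<phi> differentiable_on UNIV" unfolding test_function_def by blast
  then show ?thesis by (simp add: differentiable_on_def)
qed

lemma test_function_continuous: "test_function \<phi> \<Longrightarrow> continuous_on UNIV \<phi>"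
  using test_function_differentiable
  by (auto intro!: continuous_at_imp_continuous_on differentiable_imp_continuous_within)

lemma test_function_bounded:
  assumes "test_function \<phi>" shows "\<exists>M. \<forall>x. norm (\<phi> x) \<le> M"
proof -
  let ?K = "closure {x. \<phi> x \<noteq> 0}"
  have "compact ?K" using assms by (auto simp: test_function_def compact_closure)
  then have "compact (\<phi> ` ?K)"
    using test_function_continuous[OF assms] by (intro compact_continuous_image) (auto intro: continuous_on_subset)
  then obtain M where M: "\<And>y. y \<in> \<phi> ` ?K \<Longrightarrow> norm y \<le> M"
    using compact_imp_bounded bounded_iff by metis
  have "norm (\<phi> x) \<le> max M 0" for x
  proof (cases "\<phi> x = 0")
    case False
    then have "x \<in> ?K" using closure_subset by fastforce
    then show ?thesis using M[of "\<phi> x"] by auto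
  qed auto
  then show ?thesis by blast
qed

lemma test_function_line_derivative:
  assumes "test_function \<phi>"
  shows "((\<lambda>t. \<phi> (x + t *\<^sub>R axis i 1)) has_vector_derivative partial i \<phi> x) (at 0)"
proof -
  have "(\<lambda>t. x + t *\<^sub>R axis i 1) differentiable (at (0::real))"
    by (intro derivative_intros)
  moreover have "\<phi> differentiable (at (x + 0 *\<^sub>R axis i 1))"
    by (rule test_function_differentiable[OF assms])
  ultimately have "(\<phi> \<circ> (\<lambda>t. x + t *\<^sub>R axis i 1)) differentiable (at 0)"
    by (intro differentiable_chain_at) auto
  then show ?thesis
    unfolding partial_def by (simp add: vector_derivative_works o_def)
qed

lemma test_function_partial:
  assumes "test_function \<phi>" shows "test_function (partial i \<phi>)"
  unfolding test_function_def
proof (intro conjI allI)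
  fix js
  have "foldr partial (js @ [i]) \<phi> differentiable_on UNIV"
    using assms unfolding test_function_def by blast
  then show "foldr partial js (partial i \<phi>) differentiable_on UNIV" by simp
next
  have "partial i \<phi> x = 0" if "x \<notin> closure {x. \<phi> x \<noteq> 0}" for x
  proof -
    have "open (- closure {x. \<phi> x \<noteq> 0})" and "x \<in> - closure {x. \<phi> x \<noteq> 0}"
      using that by auto
    then obtain e where e: "e > 0" "ball x e \<subseteq> - closure {x. \<phi> x \<noteq> 0}"
      by (rule openE)
    have "((\<lambda>t. \<phi> (x + t *\<^sub>R axis i 1)) has_vector_derivative 0) (at 0)"
    proof (rule has_vector_derivative_transform_within[OF has_vector_derivative_const e(1)])
      fix t :: real assume "dist t 0 < e"
      then have "x + t *\<^sub>R axis i 1 \<in> ball x e" by (simp add: dist_norm)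
      then have "x + t *\<^sub>R axis i 1 \<notin> closure {x. \<phi> x \<noteq> 0}" using e(2) by auto
      then have "x + t *\<^sub>R axis i 1 \<notin> {x. \<phi> x \<noteq> 0}"
        using closure_subset[of "{x. \<phi> x \<noteq> 0}"] by (meson subsetD)
      then show "0 = \<phi> (x + t *\<^sub>R axis i 1)" by simp
    qed simp
    then show ?thesis unfolding partial_def by (rule vector_derivative_at)
  qed
  then have "{x. partial i \<phi> x \<noteq> 0} \<subseteq> closure {x. \<phi> x \<noteq> 0}" by blast
  moreover have "bounded (closure {x. \<phi> x \<noteq> 0})" using assms by (simp add: test_function_def bounded_closure)
  ultimately show "bounded {x. partial i \<phi> x \<noteq> 0}" by (rule bounded_subset[rotated])
qed

lemma test_function_measurable: "test_function \<phi> \<Longrightarrow> \<phi> \<in> borel_measurable borel"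
  by (intro borel_measurable_continuous_onI test_function_continuous)

lemma test_function_exp_growth: "test_function \<phi> \<Longrightarrow> exp_growth \<phi>"
  using test_function_bounded exp_growth_bounded by blast

lemma integrable_hermite_test:
  "test_function \<phi> \<Longrightarrow> integrable gauss (\<lambda>x. hermite \<beta> x *\<^sub>R \<phi> x)"
  by (intro exp_growth_integrable_gauss exp_growth_scaleR exp_growth_hermite test_function_exp_growth
      borel_measurable_scaleR hermite_measurable test_function_measurable)

text \<open>The adjointness of \<open>\<delta>\<^sub>i\<close> and \<open>\<delta>\<^sub>i\<^sup>*\<close>, with a test function on one side and a Hermite polynomial
  on the other.\<close>

lemma hermite_test_ibp:
  assumes \<phi>: "test_function \<phi>"
  shows "(LINT x|gauss. hermite \<beta> x *\<^sub>R partial i \<phi> x) =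
    sqrt 2 *\<^sub>R (LINT x|gauss. hermite (raise \<beta> i) x *\<^sub>R \<phi> x)"
proof -
  note t = \<phi> test_function_partial[OF \<phi>]
  note [measurable] = t[THEN test_function_measurable]
  let ?f' = "\<lambda>x. hermite \<beta> x *\<^sub>R partial i \<phi> x + (sqrt 2 * real (\<beta> i) * hermite (lower \<beta> i) x) *\<^sub>R \<phi> x"
  note g = exp_growth_add exp_growth_mult exp_growth_scaleR exp_growth_const exp_growth_hermite
    exp_growth_coord test_function_exp_growth t
  have "(LINT x|gauss. ?f' x) = (LINT x|gauss. (2 * x $ i) *\<^sub>R (hermite \<beta> x *\<^sub>R \<phi> x))"
  proof (rule gauss_ibp)
    fix x
    show "((\<lambda>s. hermite \<beta> (x + s *\<^sub>R axis i 1) *\<^sub>R \<phi> (x + s *\<^sub>R axis i 1)) has_vector_derivative ?f' x) (at 0)"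
      using bounded_bilinear.has_vector_derivative[OF bounded_bilinear_scaleR
          hermite_line_derivative[of \<beta> x 1 i] test_function_line_derivative[OF \<phi>, of x i]]
      by simp
  qed (intro g continuous_intros test_function_continuous)+
  moreover have "(LINT x|gauss. ?f' x) = (LINT x|gauss. hermite \<beta> x *\<^sub>R partial i \<phi> x) +
      (LINT x|gauss. (sqrt 2 * real (\<beta> i) * hermite (lower \<beta> i) x) *\<^sub>R \<phi> x)"
    by (intro Bochner_Integration.integral_add exp_growth_integrable_gauss g) measurable
  ultimately have "(LINT x|gauss. hermite \<beta> x *\<^sub>R partial i \<phi> x) =
     (LINT x|gauss. (2 * x $ i) *\<^sub>R (hermite \<beta> x *\<^sub>R \<phi> x)) - (LINT x|gauss. (sqrt 2 * real (\<beta> i) * hermite (lower \<beta> i) x) *\<^sub>R \<phi> x)"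
    by (simp add: algebra_simps)
  also have "\<dots> = (LINT x|gauss. (2 * x $ i) *\<^sub>R (hermite \<beta> x *\<^sub>R \<phi> x) - (sqrt 2 * real (\<beta> i) * hermite (lower \<beta> i) x) *\<^sub>R \<phi> x)"
    by (intro Bochner_Integration.integral_diff[symmetric] exp_growth_integrable_gauss g) measurable
  also have "\<dots> = (LINT x|gauss. sqrt 2 *\<^sub>R (hermite (raise \<beta> i) x *\<^sub>R \<phi> x))"
    unfolding hermite_raise by (intro Bochner_Integration.integral_cong refl) (simp add: algebra_simps)
  finally show ?thesis by (simp only: integral_scaleR_right)
qed

text \<open>Hermite polynomials are formal eigenfunctions; since they are not compactly supported, the
  equation is transferred to test functions by duality.\<close>

lemma OU_hermite_pairing:
  assumes \<phi>: "test_function \<phi>"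
  shows "(LINT x|gauss. hermite \<beta> x *\<^sub>R OU \<phi> x) = real (sum \<beta> UNIV) *\<^sub>R (LINT x|gauss. hermite \<beta> x *\<^sub>R \<phi> x)"
proof -
  note t = \<phi> test_function_partial[OF \<phi>] test_function_partial[OF test_function_partial[OF \<phi>]]
  note [measurable] = t[THEN test_function_measurable]
  note g = exp_growth_add exp_growth_mult exp_growth_scaleR exp_growth_const exp_growth_hermite
    exp_growth_coord test_function_exp_growth t
  have int1: "integrable gauss (\<lambda>x. x $ i *\<^sub>R (hermite \<beta> x *\<^sub>R partial i \<phi> x))" for i
    by (intro exp_growth_integrable_gauss g) measurable
  have eq: "(LINT x|gauss. (- (1 / 2)) *\<^sub>R (hermite \<beta> x *\<^sub>R partial i (partial i \<phi>) x) + x $ i *\<^sub>R (hermite \<beta> x *\<^sub>R partial i \<phi> x))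
     = real (\<beta> i) *\<^sub>R (LINT x|gauss. hermite \<beta> x *\<^sub>R \<phi> x)" for i
  proof -
    let ?A = "LINT x|gauss. x $ i *\<^sub>R (hermite \<beta> x *\<^sub>R partial i \<phi> x)"
    let ?B = "LINT x|gauss. hermite (lower \<beta> i) x *\<^sub>R partial i \<phi> x"
    have "(LINT x|gauss. hermite \<beta> x *\<^sub>R partial i (partial i \<phi>) x) = 
       sqrt 2 *\<^sub>R (LINT x|gauss. hermite (raise \<beta> i) x *\<^sub>R partial i \<phi> x)"
      by (rule hermite_test_ibp[OF t(2)])
    also have "(LINT x|gauss. hermite (raise \<beta> i) x *\<^sub>R partial i \<phi> x) =
       (LINT x|gauss. sqrt 2 *\<^sub>R (x $ i *\<^sub>R (hermite \<beta> x *\<^sub>R partial i \<phi> x)) - real (\<beta> i) *\<^sub>R (hermite (lower \<beta> i) x *\<^sub>R partial i \<phi> x))"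
      unfolding hermite_raise by (intro Bochner_Integration.integral_cong refl) (simp add: algebra_simps)
    also have "\<dots> = sqrt 2 *\<^sub>R ?A - real (\<beta> i) *\<^sub>R ?B"
      using int1 integrable_hermite_test[OF t(2)] by (subst Bochner_Integration.integral_diff) (auto simp del: scaleR_scaleR)
    also have "?B = sqrt 2 *\<^sub>R (LINT x|gauss. hermite (raise (lower \<beta> i) i) x *\<^sub>R \<phi> x)"
      by (rule hermite_test_ibp[OF \<phi>])
    also have "real (\<beta> i) *\<^sub>R (sqrt 2 *\<^sub>R (LINT x|gauss. hermite (raise (lower \<beta> i) i) x *\<^sub>R \<phi> x)) =
       sqrt 2 *\<^sub>R (real (\<beta> i) *\<^sub>R (LINT x|gauss. hermite \<beta> x *\<^sub>R \<phi> x))"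
    proof (cases "\<beta> i")
      case (Suc m)
      then have "raise (lower \<beta> i) i = \<beta>" by auto
      then show ?thesis by (simp add: mult.commute)
    qed simp
    finally have *: "(LINT x|gauss. hermite \<beta> x *\<^sub>R partial i (partial i \<phi>) x) =
       2 *\<^sub>R ?A - 2 *\<^sub>R (real (\<beta> i) *\<^sub>R (LINT x|gauss. hermite \<beta> x *\<^sub>R \<phi> x))"
      by (simp add: scaleR_diff_right)
    have "(LINT x|gauss. (- (1 / 2)) *\<^sub>R (hermite \<beta> x *\<^sub>R partial i (partial i \<phi>) x) + x $ i *\<^sub>R (hermite \<beta> x *\<^sub>R partial i \<phi> x))
      = (- (1 / 2)) *\<^sub>R (LINT x|gauss. hermite \<beta> x *\<^sub>R partial i (partial i \<phi>) x) + ?A"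
      using int1 integrable_hermite_test[OF t(3)]
      by (subst Bochner_Integration.integral_add) (simp_all del: scaleR_minus_left scaleR_scaleR)
    then show ?thesis unfolding * by (simp add: scaleR_diff_right)
  qed
  have "(LINT x|gauss. hermite \<beta> x *\<^sub>R OU \<phi> x) = (LINT x|gauss.
     (\<Sum>i\<in>UNIV. (- (1 / 2)) *\<^sub>R (hermite \<beta> x *\<^sub>R partial i (partial i \<phi>) x) + x $ i *\<^sub>R (hermite \<beta> x *\<^sub>R partial i \<phi> x)))"
  proof (intro Bochner_Integration.integral_cong refl)
    fix x
    show "hermite \<beta> x *\<^sub>R OU \<phi> x = (\<Sum>i\<in>UNIV. (- (1 / 2)) *\<^sub>R (hermite \<beta> x *\<^sub>R partial i (partial i \<phi>) x) + x $ i *\<^sub>R (hermite \<beta> x *\<^sub>R partial i \<phi> x))"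
      unfolding OU_def sum.distrib by (simp add: scaleR_conv_of_real sum_distrib_left algebra_simps sum_negf)
  qed
  also have "\<dots> = (\<Sum>i\<in>UNIV. real (\<beta> i) *\<^sub>R (LINT x|gauss. hermite \<beta> x *\<^sub>R \<phi> x))"
    using int1 integrable_hermite_test[OF t(3)]
    by (subst Bochner_Integration.integral_sum) (auto simp: eq simp del: scaleR_minus_left scaleR_scaleR)
  finally show ?thesis by (simp add: scaleR_sum_left)
qed

lemma gnorm_2_test_finite: "test_function \<phi> \<Longrightarrow> gnorm 2 \<phi> < \<infinity>"
  by (intro gnorm_exp_growth_finite test_function_exp_growth test_function_measurable)

lemma integrable_of_gnorm:
  fixes u :: "real ^ 'n::finite \<Rightarrow> complex"
  assumes "u \<in> borel_measurable borel" "gnorm 2 u < \<infinity>"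
  shows "integrable gauss u"
proof -
  have "gnorm 2 (\<lambda>x :: real ^ 'n. 1 :: complex) < \<infinity>"
    by (intro gnorm_exp_growth_finite exp_growth_const) auto
  then show ?thesis using integrable_L2_product[OF assms(1) _ assms(2), of "\<lambda>x. 1"] by simp
qed

text \<open>The weak derivative in the definition of \<open>\<delta>\<^sub>i\<^sup>*\<close> refers to Lebesgue measure, and the density of
  the Gauss measure turns it into adjointness on \<open>L\<^sup>2(\<gamma>)\<close>.\<close>

lemma delta_starI:
  fixes u v :: "real ^ 'n::finite \<Rightarrow> complex"
  assumes [measurable]: "u \<in> borel_measurable borel" "v \<in> borel_measurable borel"
    and fin: "gnorm 2 u < \<infinity>" "gnorm 2 v < \<infinity>"
    and eq: "\<And>\<phi>. test_function \<phi> \<Longrightarrow> (LINT x|gauss. u x * partial i \<phi> x) = sqrt 2 *\<^sub>R (LINT x|gauss. v x * \<phi> x)"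
  shows "delta_star i u v"
proof -
  let ?c = "gauss_const TYPE('n)"
  have c0: "?c \<noteq> 0" using gauss_const_pos[where 'n='n] by linarith
  define w where "w x = (- sqrt 2) *\<^sub>R (exp (- (norm x)\<^sup>2) *\<^sub>R v x)" for x
  have loc: "locally_integrable f" if "integrable lborel f" for f :: "real ^ 'n \<Rightarrow> complex"
    unfolding locally_integrable_def set_integrable_def
    using that by (auto intro!: integrable_mult_indicator simp: borel_compact)
  have iu: "integrable lborel (\<lambda>x. exp (- (norm x)\<^sup>2) *\<^sub>R u x)"
    using integrable_of_gnorm[OF _ fin(1)] by (simp add: integrable_gauss_iff)
  have iv: "integrable lborel (\<lambda>x. exp (- (norm x)\<^sup>2) *\<^sub>R v x)"
    using integrable_of_gnorm[OF _ fin(2)] by (simp add: integrable_gauss_iff)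
  have "weak_partial i (\<lambda>x. complex_of_real (exp (- (norm x)\<^sup>2)) * u x) w"
    unfolding weak_partial_def
  proof (intro conjI allI impI)
    show "locally_integrable (\<lambda>x. complex_of_real (exp (- (norm x)\<^sup>2)) * u x)"
      using loc[OF iu] by (simp add: scaleR_conv_of_real)
    show "locally_integrable w"
      unfolding w_def by (intro loc integrable_scaleR_right iv)
    fix \<phi> :: "real ^ 'n \<Rightarrow> complex" assume \<phi>: "test_function \<phi>"
    have [measurable]: "\<phi> \<in> borel_measurable borel" "partial i \<phi> \<in> borel_measurable borel"
      using \<phi> test_function_partial[OF \<phi>] by (auto intro: test_function_measurable)
    have "?c *\<^sub>R (LINT x|lborel. exp (- (norm x)\<^sup>2) *\<^sub>R (u x * partial i \<phi> x)) =
      ?c *\<^sub>R (sqrt 2 *\<^sub>R (LINT x|lborel. exp (- (norm x)\<^sup>2) *\<^sub>R (v x * \<phi> x)))"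
      using eq[OF \<phi>] by (simp add: integral_gauss mult.left_commute)
    then have "(LINT x|lborel. exp (- (norm x)\<^sup>2) *\<^sub>R (u x * partial i \<phi> x)) =
      sqrt 2 *\<^sub>R (LINT x|lborel. exp (- (norm x)\<^sup>2) *\<^sub>R (v x * \<phi> x))"
      using c0 by (simp only: scaleR_cancel_left) blast
    also have "\<dots> = - (LINT x|lborel. w x * \<phi> x)"
      unfolding w_def by (simp flip: integral_scaleR_right integral_minus)
    finally show "(LINT x|lborel. complex_of_real (exp (- (norm x)\<^sup>2)) * u x * partial i \<phi> x) = - (LINT x|lborel. w x * \<phi> x)"
      by (simp add: scaleR_conv_of_real mult.assoc)
  qed
  moreover have "v = (\<lambda>x. complex_of_real (- (1 / sqrt 2) * exp ((norm x)\<^sup>2)) * w x)"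
  proof
    fix x :: "real ^ 'n"
    have "(- (1 / sqrt 2) * exp ((norm x)\<^sup>2)) * (- sqrt 2 * exp (- (norm x)\<^sup>2)) = 1"
      by (simp add: exp_minus)
    then have "((- (1 / sqrt 2) * exp ((norm x)\<^sup>2)) * (- sqrt 2 * exp (- (norm x)\<^sup>2))) *\<^sub>R v x = v x"
      by simp
    then show "v x = complex_of_real (- (1 / sqrt 2) * exp ((norm x)\<^sup>2)) * w x"
      unfolding w_def by (simp add: scaleR_conv_of_real mult.assoc)
  qed
  ultimately show ?thesis unfolding delta_star_def by blast
qed

section \<open>The Riesz transform on L2\<close>

lemma Lp_2_iff: "u \<in> Lp 2 \<longleftrightarrow> u \<in> borel_measurable borel \<and> gnorm 2 u < \<infinity>"
  by (auto simp: Lp_def gnorm_def integrable_iff_bounded powr_numeral)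

lemma Lp_1_iff: "u \<in> Lp 1 \<longleftrightarrow> u \<in> borel_measurable borel \<and> gnorm 1 u < \<infinity>"
  by (auto simp: Lp_def gnorm_def integrable_iff_bounded one_ereal_def)

lemma Lp_ereal_2_iff: "u \<in> Lp (ereal 2) \<longleftrightarrow> u \<in> borel_measurable borel \<and> gnorm 2 u < \<infinity>"
  using Lp_2_iff[of u] by simp

lemma gnorm_2_Lp_norm:
  assumes "u \<in> Lp 2" shows "gnorm 2 u = ennreal ((Lp_norm 2 u)\<^sup>2)"
proof -
  have int: "integrable gauss (\<lambda>x. (norm (u x))\<^sup>2)"
    using assms by (simp add: Lp_def powr_numeral)
  then have "gnorm 2 u = ennreal (LINT x|gauss. (norm (u x))\<^sup>2)"
    unfolding gnorm_def by (intro nn_integral_eq_integral) auto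
  also have "(LINT x|gauss. (norm (u x))\<^sup>2) = (Lp_norm 2 u)\<^sup>2"
    by (simp add: Lp_norm_def powr_numeral powr_half_sqrt)
  finally show ?thesis .
qed

lemma gnorm_1_Lp_norm:
  assumes "u \<in> Lp 1" shows "gnorm 1 u = ennreal (Lp_norm 1 u)"
proof -
  have int: "integrable gauss (\<lambda>x. norm (u x))"
    using assms by (simp add: Lp_def one_ereal_def)
  then have "gnorm 1 u = ennreal (LINT x|gauss. norm (u x))"
    unfolding gnorm_def by (subst nn_integral_eq_integral) auto
  then show ?thesis by (simp add: Lp_norm_def one_ereal_def)
qed

lemma gnorm_diff_finite:
  fixes u v :: "real ^ 'n::finite \<Rightarrow> complex"
  assumes [measurable]: "u \<in> borel_measurable borel" "v \<in> borel_measurable borel"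
    and "gnorm p u < \<infinity>" "gnorm p v < \<infinity>"
  shows "gnorm p (\<lambda>x. u x - v x) < \<infinity>"
proof -
  have "gnorm p (\<lambda>x. u x - v x) \<le> 2 ^ p * (gnorm p u + gnorm p v)"
    by (rule gnorm_triangle) (auto intro: norm_triangle_ineq4)
  also have "\<dots> < \<infinity>" using assms by (auto simp: ennreal_mult_less_top power_less_top_ennreal)
  finally show ?thesis .
qed

lemma gnorm_add_finite:
  fixes u v :: "real ^ 'n::finite \<Rightarrow> complex"
  assumes [measurable]: "u \<in> borel_measurable borel" "v \<in> borel_measurable borel"
    and "gnorm p u < \<infinity>" "gnorm p v < \<infinity>"
  shows "gnorm p (\<lambda>x. u x + v x) < \<infinity>"
proof -
  have "gnorm p (\<lambda>x. u x + v x) \<le> 2 ^ p * (gnorm p u + gnorm p v)"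
    by (rule gnorm_triangle) (auto intro: norm_triangle_ineq)
  also have "\<dots> < \<infinity>" using assms by (auto simp: ennreal_mult_less_top power_less_top_ennreal)
  finally show ?thesis .
qed

lemma Lp_norm_tendsto_gnorm:
  fixes u :: "nat \<Rightarrow> real ^ 'n::finite \<Rightarrow> complex" and v :: "real ^ 'n \<Rightarrow> complex"
  assumes "\<And>k. u k \<in> Lp 2" "v \<in> Lp 2" "(\<lambda>k. Lp_norm 2 (\<lambda>x. u k x - v x)) \<longlonglongrightarrow> 0"
  shows "(\<lambda>k. gnorm 2 (\<lambda>x. u k x - v x)) \<longlonglongrightarrow> 0"
proof -
  have "(\<lambda>x. u k x - v x) \<in> Lp 2" for k
    using assms(1,2) gnorm_diff_finite by (auto simp: Lp_ereal_2_iff intro!: borel_measurable_diff)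
  then have "gnorm 2 (\<lambda>x. u k x - v x) = ennreal ((Lp_norm 2 (\<lambda>x. u k x - v x))\<^sup>2)" for k
    by (rule gnorm_2_Lp_norm)
  moreover have "(\<lambda>k. ennreal ((Lp_norm 2 (\<lambda>x. u k x - v x))\<^sup>2)) \<longlonglongrightarrow> ennreal (0\<^sup>2)"
    by (intro tendsto_ennrealI tendsto_power assms)
  ultimately show ?thesis by simp
qed

lemma OU_test_function:
  assumes "test_function \<phi>"
  shows "OU \<phi> \<in> borel_measurable borel" "exp_growth (OU \<phi>)"
proof -
  note t = test_function_partial[OF assms] test_function_partial[OF test_function_partial[OF assms]]
  have eq: "OU \<phi> = (\<lambda>x. (- (1 / 2)) *\<^sub>R (\<Sum>i\<in>UNIV. partial i (partial i \<phi>) x) + (\<Sum>i\<in>UNIV. x $ i *\<^sub>R partial i \<phi> x))"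
    by (auto simp: OU_def fun_eq_iff scaleR_conv_of_real)
  note [measurable] = t[THEN test_function_measurable]
  show "OU \<phi> \<in> borel_measurable borel" unfolding eq by measurable
  show "exp_growth (OU \<phi>)" unfolding eq
    by (intro exp_growth_add exp_growth_scaleR exp_growth_sum exp_growth_const exp_growth_coord
        test_function_exp_growth t)
qed

lemma gnorm_hermite_finite: "gnorm 2 (\<lambda>x. complex_of_real (hermite \<beta> x)) < \<infinity>"
proof -
  have "exp_growth (\<lambda>x. complex_of_real (hermite \<beta> x))"
    by (rule exp_growth_mono[OF exp_growth_hermite[of \<beta>]]) simp
  then show ?thesis by (intro gnorm_exp_growth_finite) measurable
qed

text \<open>The usual argument for the orthogonality of eigenvectors with different eigenvalues, on an
  approximating sequence of test functions.\<close>

lemma eigenfunction_hermite_pairing: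
  assumes "OU_closure h (\<lambda>x. complex_of_real \<mu> * h x)" and ne: "real (sum \<beta> UNIV) \<noteq> \<mu>"
  shows "(LINT x|gauss. h x * complex_of_real (hermite \<beta> x)) = 0"
proof -
  let ?H = "\<lambda>x. complex_of_real (hermite \<beta> x)"
  obtain \<phi> where \<phi>: "\<And>k. test_function (\<phi> k)"
    and lim1: "(\<lambda>k. Lp_norm 2 (\<lambda>x. \<phi> k x - h x)) \<longlonglongrightarrow> 0"
    and lim2: "(\<lambda>k. Lp_norm 2 (\<lambda>x. OU (\<phi> k) x - complex_of_real \<mu> * h x)) \<longlonglongrightarrow> 0"
    and h: "h \<in> Lp 2" "(\<lambda>x. complex_of_real \<mu> * h x) \<in> Lp 2"
    using assms(1) unfolding OU_closure_def by blast
  have \<phi>2: "\<phi> k \<in> Lp 2" "OU (\<phi> k) \<in> Lp 2" for k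
    using test_function_measurable[OF \<phi>] gnorm_2_test_finite[OF \<phi>] OU_test_function[OF \<phi>]
      gnorm_exp_growth_finite[OF OU_test_function(2)[OF \<phi>] OU_test_function(1)[OF \<phi>]]
    by (auto simp: Lp_ereal_2_iff)
  have m: "?H \<in> borel_measurable borel" by measurable
  have 1: "(\<lambda>k. LINT x|gauss. \<phi> k x * ?H x) \<longlonglongrightarrow> (LINT x|gauss. h x * ?H x)"
    using \<phi>2 h Lp_norm_tendsto_gnorm[OF \<phi>2(1) h(1) lim1] gnorm_hermite_finite m
    by (intro L2_pairing_tendsto) (auto simp: Lp_ereal_2_iff)
  have 2: "(\<lambda>k. LINT x|gauss. OU (\<phi> k) x * ?H x) \<longlonglongrightarrow> (LINT x|gauss. (complex_of_real \<mu> * h x) * ?H x)"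
    using \<phi>2 h Lp_norm_tendsto_gnorm[OF \<phi>2(2) h(2) lim2] gnorm_hermite_finite m
    by (intro L2_pairing_tendsto) (auto simp: Lp_ereal_2_iff)
  have "(LINT x|gauss. OU (\<phi> k) x * ?H x) = of_real (real (sum \<beta> UNIV)) * (LINT x|gauss. \<phi> k x * ?H x)" for k
    using OU_hermite_pairing[OF \<phi>, of \<beta> k] by (simp add: scaleR_conv_of_real mult.commute)
  then have "(\<lambda>k. LINT x|gauss. OU (\<phi> k) x * ?H x) \<longlonglongrightarrow> of_real (real (sum \<beta> UNIV)) * (LINT x|gauss. h x * ?H x)"
    using tendsto_mult_left[OF 1] by simp
  then have "of_real (real (sum \<beta> UNIV)) * (LINT x|gauss. h x * ?H x) = (LINT x|gauss. (complex_of_real \<mu> * h x) * ?H x)"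
    using 2 by (rule LIMSEQ_unique)
  also have "\<dots> = of_real \<mu> * (LINT x|gauss. h x * ?H x)" by (simp add: mult.assoc)
  finally have "of_real (real (sum \<beta> UNIV) - \<mu>) * (LINT x|gauss. h x * ?H x) = 0"
    by (simp only: of_real_diff left_diff_distrib) simp
  then show ?thesis using ne by (simp only: mult_eq_0_iff of_real_eq_0_iff) simp
qed

text \<open>The image of \<open>\<Sum> c \<beta> H \<beta>\<close> under the weighted shift \<open>H \<beta> \<mapsto> t \<beta> H (\<beta> + \<sigma>)\<close>. The Riesz transform
  and all its truncations have this form on polynomials.\<close>

definition hsum :: "(('n \<Rightarrow> nat) \<Rightarrow> real) \<Rightarrow> ('n \<Rightarrow> nat) \<Rightarrow> (('n \<Rightarrow> nat) \<Rightarrow> complex) \<Rightarrow> real ^ 'n::finite \<Rightarrow> complex" where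
  "hsum t \<sigma> c x = (\<Sum>\<beta> | c \<beta> \<noteq> 0. hermite (\<lambda>i. \<beta> i + \<sigma> i) x *\<^sub>R (t \<beta> *\<^sub>R c \<beta>))"

abbreviation hpoly :: "(('n \<Rightarrow> nat) \<Rightarrow> complex) \<Rightarrow> real ^ 'n::finite \<Rightarrow> complex" where
  "hpoly \<equiv> hsum (\<lambda>_. 1) (\<lambda>_. 0)"

lemma hsum_superset:
  "finite B \<Longrightarrow> {\<beta>. c \<beta> \<noteq> 0} \<subseteq> B \<Longrightarrow> hsum t \<sigma> c x = (\<Sum>\<beta>\<in>B. hermite (\<lambda>i. \<beta> i + \<sigma> i) x *\<^sub>R (t \<beta> *\<^sub>R c \<beta>))"
  unfolding hsum_def by (intro sum.mono_neutral_left) auto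

lemma hsum_diff:
  assumes "finite {\<beta>. c \<beta> \<noteq> 0}" "finite {\<beta>. d \<beta> \<noteq> 0}"
  shows "hsum t \<sigma> (\<lambda>\<beta>. c \<beta> - d \<beta>) x = hsum t \<sigma> c x - hsum t \<sigma> d x" "finite {\<beta>. c \<beta> - d \<beta> \<noteq> 0}"
proof -
  let ?B = "{\<beta>. c \<beta> \<noteq> 0} \<union> {\<beta>. d \<beta> \<noteq> 0}"
  have B: "finite ?B" using assms by simp
  have sub: "{\<beta>. c \<beta> - d \<beta> \<noteq> 0} \<subseteq> ?B" by auto
  then show "finite {\<beta>. c \<beta> - d \<beta> \<noteq> 0}" using B by (rule finite_subset)
  show "hsum t \<sigma> (\<lambda>\<beta>. c \<beta> - d \<beta>) x = hsum t \<sigma> c x - hsum t \<sigma> d x"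
    unfolding hsum_superset[OF B sub] hsum_superset[OF B Un_upper1] hsum_superset[OF B Un_upper2]
    by (simp add: sum_subtractf scaleR_diff_right)
qed

lemma hsum_scale_diff: "hsum (\<lambda>\<beta>. t \<beta> - s \<beta>) \<sigma> c x = hsum t \<sigma> c x - hsum s \<sigma> c x"
  unfolding hsum_def by (simp add: sum_subtractf scaleR_diff_right scaleR_diff_left)

lemma hsum_measurable [measurable]: "hsum t \<sigma> c \<in> borel_measurable borel"
  unfolding hsum_def by measurable

lemma hsum_exp_growth: "exp_growth (hsum t \<sigma> c)"
  unfolding hsum_def by (intro exp_growth_sum exp_growth_scaleR exp_growth_hermite exp_growth_const)

lemma hsum_gnorm_finite: "gnorm 2 (hsum t \<sigma> c) < \<infinity>"
  by (intro gnorm_exp_growth_finite hsum_exp_growth hsum_measurable)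

lemma gnorm_hermite_sum:
  assumes J: "finite J"
  shows "gnorm 2 (\<lambda>x. \<Sum>\<gamma>\<in>J. hermite \<gamma> x *\<^sub>R (a \<gamma> :: complex)) = ennreal (\<Sum>\<gamma>\<in>J. (norm (a \<gamma>))\<^sup>2 * mfact \<gamma>)"
proof -
  have eq: "(norm (\<Sum>\<gamma>\<in>J. hermite \<gamma> x *\<^sub>R a \<gamma>))\<^sup>2 = (\<Sum>\<gamma>\<in>J. \<Sum>\<delta>\<in>J. (a \<gamma> \<bullet> a \<delta>) * (hermite \<gamma> x * hermite \<delta> x))" for x
    unfolding power2_norm_eq_inner inner_sum_left inner_sum_right by (simp add: mult_ac inner_commute)
  have int: "integrable gauss (\<lambda>x. \<Sum>\<gamma>\<in>J. \<Sum>\<delta>\<in>J. (a \<gamma> \<bullet> a \<delta>) * (hermite \<gamma> x * hermite \<delta> x))"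
    by (intro Bochner_Integration.integrable_sum integrable_mult_right integrable_hermite_prod)
  have "gnorm 2 (\<lambda>x. \<Sum>\<gamma>\<in>J. hermite \<gamma> x *\<^sub>R a \<gamma>) = ennreal (LINT x|gauss. (\<Sum>\<gamma>\<in>J. \<Sum>\<delta>\<in>J. (a \<gamma> \<bullet> a \<delta>) * (hermite \<gamma> x * hermite \<delta> x)))"
    unfolding gnorm_def eq using int
    by (intro nn_integral_eq_integral) (auto intro!: always_eventually simp flip: eq)
  also have "(LINT x|gauss. (\<Sum>\<gamma>\<in>J. \<Sum>\<delta>\<in>J. (a \<gamma> \<bullet> a \<delta>) * (hermite \<gamma> x * hermite \<delta> x))) =
     (\<Sum>\<gamma>\<in>J. \<Sum>\<delta>\<in>J. (a \<gamma> \<bullet> a \<delta>) * (if \<gamma> = \<delta> then mfact \<gamma> else 0))"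
    by (subst Bochner_Integration.integral_sum, intro Bochner_Integration.integrable_sum integrable_mult_right integrable_hermite_prod,
        subst Bochner_Integration.integral_sum, intro integrable_mult_right integrable_hermite_prod)
       (simp only: integral_mult_right_zero hermite_orthogonal)
  also have "\<dots> = (\<Sum>\<gamma>\<in>J. (norm (a \<gamma>))\<^sup>2 * mfact \<gamma>)"
    using J by (simp add: power2_norm_eq_inner if_distrib[where f = "\<lambda>x. _ * x"] sum.delta' cong: if_cong)
  finally show ?thesis .
qed

text \<open>Shifting the index is injective, so that the shifted polynomials are still orthogonal.\<close>

lemma hsum_gnorm:
  assumes "finite {\<beta>. c \<beta> \<noteq> 0}"
  shows "gnorm 2 (hsum t \<sigma> c) = ennreal (\<Sum>\<beta> | c \<beta> \<noteq> 0. (t \<beta>)\<^sup>2 * (norm (c \<beta>))\<^sup>2 * mfact (\<lambda>i. \<beta> i + \<sigma> i))"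
proof -
  let ?s = "\<lambda>\<beta> i. \<beta> i + \<sigma> i" and ?B = "{\<beta>. c \<beta> \<noteq> 0}"
  define u where "u \<gamma> i = \<gamma> i - \<sigma> i" for \<gamma> i
  have u: "u (?s \<beta>) = \<beta>" for \<beta> by (auto simp: u_def)
  have inj: "inj_on ?s ?B" by (rule inj_on_inverseI[of _ u]) (rule u)
  have eq: "hsum t \<sigma> c = (\<lambda>x. \<Sum>\<gamma>\<in>?s ` ?B. hermite \<gamma> x *\<^sub>R (t (u \<gamma>) *\<^sub>R c (u \<gamma>)))"
    unfolding hsum_def by (subst sum.reindex[OF inj]) (simp add: u)
  have "gnorm 2 (hsum t \<sigma> c) = ennreal (\<Sum>\<gamma>\<in>?s ` ?B. (norm (t (u \<gamma>) *\<^sub>R c (u \<gamma>)))\<^sup>2 * mfact \<gamma>)"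
    unfolding eq using assms by (intro gnorm_hermite_sum) auto
  also have "(\<Sum>\<gamma>\<in>?s ` ?B. (norm (t (u \<gamma>) *\<^sub>R c (u \<gamma>)))\<^sup>2 * mfact \<gamma>) = (\<Sum>\<beta>\<in>?B. (t \<beta>)\<^sup>2 * (norm (c \<beta>))\<^sup>2 * mfact (?s \<beta>))"
    by (subst sum.reindex[OF inj]) (simp add: u power_mult_distrib)
  finally show ?thesis .
qed

lemma hsum_bound:
  assumes c: "finite {\<beta>. c \<beta> \<noteq> 0}" and A: "\<And>\<beta>. (t \<beta>)\<^sup>2 * mfact (\<lambda>i. \<beta> i + \<sigma> i) \<le> A * mfact \<beta>" "0 \<le> A"
  shows "gnorm 2 (hsum t \<sigma> c) \<le> ennreal A * gnorm 2 (hpoly c)"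
proof -
  have "(\<Sum>\<beta> | c \<beta> \<noteq> 0. (t \<beta>)\<^sup>2 * (norm (c \<beta>))\<^sup>2 * mfact (\<lambda>i. \<beta> i + \<sigma> i)) \<le> (\<Sum>\<beta> | c \<beta> \<noteq> 0. A * ((norm (c \<beta>))\<^sup>2 * mfact \<beta>))"
  proof (rule sum_mono)
    fix \<beta> show "(t \<beta>)\<^sup>2 * (norm (c \<beta>))\<^sup>2 * mfact (\<lambda>i. \<beta> i + \<sigma> i) \<le> A * ((norm (c \<beta>))\<^sup>2 * mfact \<beta>)"
      using mult_left_mono[OF A(1)[of \<beta>], of "(norm (c \<beta>))\<^sup>2"] by (simp add: mult_ac)
  qed
  then show ?thesis unfolding hsum_gnorm[OF c] using A(2)
    by (simp add: sum_distrib_left[symmetric] ennreal_mult'[symmetric] ennreal_leI)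
qed

lemma hspan_hsum:
  assumes "p \<in> hspan"
  shows "\<exists>c. finite {\<beta>. c \<beta> \<noteq> 0} \<and> p = hpoly c"
  using assms
proof (induction rule: hspan.induct)
  case zero
  show ?case by (intro exI[of _ "\<lambda>_. 0"]) (auto simp: hsum_def)
next
  case (add1 p \<beta> a)
  then obtain c where c: "finite {\<beta>. c \<beta> \<noteq> 0}" "p = hpoly c" by auto
  let ?d = "c(\<beta> := c \<beta> + a)" and ?B = "insert \<beta> {\<beta>. c \<beta> \<noteq> 0}"
  have B: "finite ?B" using c by simp
  have d: "{\<gamma>. ?d \<gamma> \<noteq> 0} \<subseteq> ?B" by auto
  have "hpoly ?d x = p x + hermite \<beta> x *\<^sub>R a" for x
  proof -
    have "hpoly ?d x = (\<Sum>\<gamma>\<in>?B. hermite \<gamma> x *\<^sub>R ?d \<gamma>)"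
      using hsum_superset[OF B d, of "\<lambda>_. 1" "\<lambda>_. 0" x] by (simp only: add_0_right scaleR_one)
    also have "\<dots> = (\<Sum>\<gamma>\<in>?B. hermite \<gamma> x *\<^sub>R c \<gamma> + (if \<gamma> = \<beta> then hermite \<beta> x *\<^sub>R a else 0))"
      by (intro sum.cong) (auto simp: scaleR_add_right)
    also have "\<dots> = (\<Sum>\<gamma>\<in>?B. hermite \<gamma> x *\<^sub>R c \<gamma>) + hermite \<beta> x *\<^sub>R a"
      using B by (simp only: sum.distrib sum.delta) simp
    also have "(\<Sum>\<gamma>\<in>?B. hermite \<gamma> x *\<^sub>R c \<gamma>) = p x"
      using hsum_superset[OF B subset_insertI, of "\<lambda>_. 1" "\<lambda>_. 0" x] c(2) by simp
    finally show ?thesis .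
  qed
  then have "(\<lambda>x. p x + hermite \<beta> x *\<^sub>R a) = hpoly ?d" by (intro ext) (rule sym)
  then show ?case using finite_subset[OF d B] by (intro exI[of _ ?d] conjI)
qed

lemma hsum_delta_star:
  assumes c: "finite {\<beta>. c \<beta> \<noteq> 0}" and \<phi>: "test_function \<phi>"
  shows "(LINT x|gauss. hsum t \<sigma> c x * partial i \<phi> x) = sqrt 2 *\<^sub>R (LINT x|gauss. hsum t (raise \<sigma> i) c x * \<phi> x)"
proof -
  let ?s = "\<lambda>\<beta> i. \<beta> i + \<sigma> i"
  have up: "(\<lambda>j. \<beta> j + raise \<sigma> i j) = raise (?s \<beta>) i" for \<beta> by auto
  have "(LINT x|gauss. hsum t \<sigma> c x * partial i \<phi> x) =
     (LINT x|gauss. (\<Sum>\<beta> | c \<beta> \<noteq> 0. (t \<beta> *\<^sub>R c \<beta>) * (hermite (?s \<beta>) x *\<^sub>R partial i \<phi> x)))"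
    by (intro Bochner_Integration.integral_cong refl, simp only: hsum_def sum_distrib_right,
        intro sum.cong refl, simp add: scaleR_conv_of_real mult_ac)
  also have "\<dots> = (\<Sum>\<beta> | c \<beta> \<noteq> 0. (t \<beta> *\<^sub>R c \<beta>) * (LINT x|gauss. hermite (?s \<beta>) x *\<^sub>R partial i \<phi> x))"
    by (subst Bochner_Integration.integral_sum)
       (intro integrable_mult_right integrable_hermite_test test_function_partial \<phi>, simp only: integral_mult_right_zero)
  also have "\<dots> = sqrt 2 *\<^sub>R (\<Sum>\<beta> | c \<beta> \<noteq> 0. (t \<beta> *\<^sub>R c \<beta>) * (LINT x|gauss. hermite (raise (?s \<beta>) i) x *\<^sub>R \<phi> x))"
    unfolding hermite_test_ibp[OF \<phi>] scaleR_sum_right by (intro sum.cong refl) (simp add: mult_ac)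
  also have "(\<Sum>\<beta> | c \<beta> \<noteq> 0. (t \<beta> *\<^sub>R c \<beta>) * (LINT x|gauss. hermite (raise (?s \<beta>) i) x *\<^sub>R \<phi> x)) =
     (LINT x|gauss. (\<Sum>\<beta> | c \<beta> \<noteq> 0. (t \<beta> *\<^sub>R c \<beta>) * (hermite (raise (?s \<beta>) i) x *\<^sub>R \<phi> x)))"
    by (subst Bochner_Integration.integral_sum)
       (intro integrable_mult_right integrable_hermite_test \<phi>, simp only: integral_mult_right_zero)
  also have "\<dots> = (LINT x|gauss. hsum t (raise \<sigma> i) c x * \<phi> x)"
    by (intro Bochner_Integration.integral_cong refl, simp only: hsum_def up sum_distrib_right,
        intro sum.cong refl, simp add: scaleR_conv_of_real mult_ac)
  finally show ?thesis .
qed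

lemma hsum_spectral:
  assumes c: "finite {\<beta>. c \<beta> \<noteq> 0}" and h: "OU_closure h (\<lambda>x. complex_of_real \<mu> * h x)"
  shows "L2_inner (hsum (\<lambda>\<beta>. m (real (sum \<beta> UNIV))) (\<lambda>_. 0) c) h = complex_of_real (m \<mu>) * L2_inner (hpoly c) h"
proof -
  have h2: "h \<in> Lp 2" using h by (simp add: OU_closure_def)
  then have [measurable]: "h \<in> borel_measurable borel" and fin: "gnorm 2 (\<lambda>x. cnj (h x)) < \<infinity>"
    by (auto simp: Lp_ereal_2_iff gnorm_def)
  have [measurable]: "cnj \<in> borel_measurable borel"
    by (intro borel_measurable_continuous_onI continuous_intros)
  have int: "integrable gauss (\<lambda>x. complex_of_real (hermite \<beta> x) * cnj (h x))" for \<beta>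
    by (intro integrable_L2_product gnorm_hermite_finite fin) measurable
  have zero: "(LINT x|gauss. complex_of_real (hermite \<beta> x) * cnj (h x)) = 0" if "real (sum \<beta> UNIV) \<noteq> \<mu>" for \<beta>
  proof -
    have "(LINT x|gauss. complex_of_real (hermite \<beta> x) * cnj (h x)) = (LINT x|gauss. cnj (h x * complex_of_real (hermite \<beta> x)))"
      by (simp add: mult.commute)
    also have "\<dots> = cnj (LINT x|gauss. h x * complex_of_real (hermite \<beta> x))" by (rule Bochner_Integration.integral_cnj)
    also have "\<dots> = 0" using eigenfunction_hermite_pairing[OF h that] by simp
    finally show ?thesis .
  qed
  have expand: "L2_inner (hsum t (\<lambda>_. 0) c) h = (\<Sum>\<beta> | c \<beta> \<noteq> 0. (t \<beta> *\<^sub>R c \<beta>) * (LINT x|gauss. complex_of_real (hermite \<beta> x) * cnj (h x)))" for t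
  proof -
    have "L2_inner (hsum t (\<lambda>_. 0) c) h = (LINT x|gauss. (\<Sum>\<beta> | c \<beta> \<noteq> 0. (t \<beta> *\<^sub>R c \<beta>) * (complex_of_real (hermite \<beta> x) * cnj (h x))))"
      unfolding L2_inner_def
      by (intro Bochner_Integration.integral_cong refl, simp only: hsum_def sum_distrib_right,
          intro sum.cong refl, simp add: scaleR_conv_of_real mult_ac)
    also have "\<dots> = (\<Sum>\<beta> | c \<beta> \<noteq> 0. (t \<beta> *\<^sub>R c \<beta>) * (LINT x|gauss. complex_of_real (hermite \<beta> x) * cnj (h x)))"
      by (subst Bochner_Integration.integral_sum)
         (intro integrable_mult_right int, simp only: integral_mult_right_zero)
    finally show ?thesis .
  qed
  show ?thesis unfolding expand sum_distrib_left
  proof (intro sum.cong refl)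
    fix \<beta>
    show "m (real (sum \<beta> UNIV)) *\<^sub>R c \<beta> * (LINT x|gauss. complex_of_real (hermite \<beta> x) * cnj (h x)) =
       complex_of_real (m \<mu>) * (1 *\<^sub>R c \<beta> * (LINT x|gauss. complex_of_real (hermite \<beta> x) * cnj (h x)))"
      using zero[of \<beta>] by (cases "real (sum \<beta> UNIV) = \<mu>") (auto simp: scaleR_conv_of_real mult_ac)
  qed
qed

text \<open>Each raised index costs a factor \<open>\<beta> i + \<sigma> i + 1\<close>, which grows at most linearly in the degree;
  this is exactly compensated by the power of \<open>\<L> + I\<close> in the Riesz transform.\<close>

lemma mfact_shift_bound:
  "sum \<sigma> UNIV \<le> k \<Longrightarrow> mfact (\<lambda>i. \<beta> i + \<sigma> i) \<le> (real (k + 1) * (real (sum \<beta> UNIV) + 1)) ^ sum \<sigma> UNIV * mfact \<beta>"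
proof (induction \<sigma> rule: multiindex_induct)
  case zero
  then show ?case by simp
next
  case (raise \<sigma> i)
  have le: "sum \<sigma> UNIV < k" using raise.prems sum_raise[of \<sigma> i] by simp
  let ?s = "\<lambda>i. \<beta> i + \<sigma> i"
  have "(\<lambda>j. \<beta> j + raise \<sigma> i j) = raise ?s i" by auto
  then have "mfact (\<lambda>j. \<beta> j + raise \<sigma> i j) = real (Suc (\<beta> i + \<sigma> i)) * mfact ?s" by (simp only: mfact_raise[of ?s i])
  also have "\<dots> \<le> (real (k + 1) * (real (sum \<beta> UNIV) + 1)) * ((real (k + 1) * (real (sum \<beta> UNIV) + 1)) ^ sum \<sigma> UNIV * mfact \<beta>)"
  proof (rule mult_mono)
    have "\<beta> i \<le> sum \<beta> UNIV" "\<sigma> i \<le> sum \<sigma> UNIV" by (auto intro: member_le_sum)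
    then have "Suc (\<beta> i + \<sigma> i) \<le> (k + 1) * (sum \<beta> UNIV + 1)" using le by (simp add: algebra_simps)
    then have "real (Suc (\<beta> i + \<sigma> i)) \<le> real ((k + 1) * (sum \<beta> UNIV + 1))" by (rule of_nat_mono)
    then show "real (Suc (\<beta> i + \<sigma> i)) \<le> real (k + 1) * (real (sum \<beta> UNIV) + 1)"
      by (simp only: of_nat_mult of_nat_add of_nat_1)
    show "mfact ?s \<le> (real (k + 1) * (real (sum \<beta> UNIV) + 1)) ^ sum \<sigma> UNIV * mfact \<beta>"
      using raise.IH le by simp
  qed (auto simp: less_imp_le sum_nonneg)
  finally show ?case unfolding sum_raise power_Suc mult.assoc .
qed

definition riesz_mult :: "nat \<Rightarrow> real \<Rightarrow> real" where
  "riesz_mult k \<mu> = (\<mu> + 1) powr (- real k / 2)"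

lemma riesz_mult_bound:
  assumes "sum \<sigma> UNIV \<le> k" and t: "\<bar>t\<bar> \<le> riesz_mult k (real (sum \<beta> UNIV))"
  shows "t\<^sup>2 * mfact (\<lambda>i. \<beta> i + \<sigma> i) \<le> real (k + 1) ^ k * mfact \<beta>"
proof -
  let ?N = "real (sum \<beta> UNIV) + 1"
  have N: "?N \<ge> 1" by (simp add: sum_nonneg)
  have "t\<^sup>2 \<le> (riesz_mult k (real (sum \<beta> UNIV)))\<^sup>2" using t by (rule abs_le_square_iff[THEN iffD1, OF order_trans[OF _ abs_ge_self]])
  also have "\<dots> = 1 / ?N ^ k"
  proof -
    have "(riesz_mult k (real (sum \<beta> UNIV)))\<^sup>2 = ?N powr (- real k)"
      unfolding riesz_mult_def using N by (simp add: power2_eq_square flip: powr_add)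
    also have "\<dots> = 1 / ?N ^ k" using N by (simp add: powr_minus powr_realpow divide_inverse)
    finally show ?thesis .
  qed
  finally have t2: "t\<^sup>2 \<le> 1 / ?N ^ k" .
  have "mfact (\<lambda>i. \<beta> i + \<sigma> i) \<le> (real (k + 1) * ?N) ^ sum \<sigma> UNIV * mfact \<beta>"
    by (rule mfact_shift_bound[OF assms(1)])
  also have "(real (k + 1) * ?N) ^ sum \<sigma> UNIV \<le> (real (k + 1) * ?N) ^ k"
    using assms(1) mult_mono[of 1 "real (k + 1)" 1 ?N] by (intro power_increasing) (auto simp: sum_nonneg)
  finally have "mfact (\<lambda>i. \<beta> i + \<sigma> i) \<le> (real (k + 1) * ?N) ^ k * mfact \<beta>"
    by (simp add: mult_right_mono less_imp_le)
  with t2 have "t\<^sup>2 * mfact (\<lambda>i. \<beta> i + \<sigma> i) \<le> (1 / ?N ^ k) * ((real (k + 1) * ?N) ^ k * mfact \<beta>)"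
    using less_imp_le[OF mfact_pos] by (intro mult_mono) (auto simp: sum_nonneg)
  also have "\<dots> = real (k + 1) ^ k * mfact \<beta>" using N by (simp add: power_mult_distrib)
  finally show ?thesis .
qed

lemma gnorm_2_complete:
  fixes f :: "nat \<Rightarrow> real ^ 'n::finite \<Rightarrow> complex"
  assumes "\<And>k. f k \<in> borel_measurable borel"
    and "\<And>e. e > 0 \<Longrightarrow> \<exists>N. \<forall>i\<ge>N. \<forall>j\<ge>N. gnorm 2 (\<lambda>x. f i x - f j x) \<le> ennreal e"
  shows "\<exists>g. g \<in> borel_measurable borel \<and> (\<lambda>k. gnorm 2 (\<lambda>x. f k x - g x)) \<longlonglongrightarrow> 0"
  using gnorm_complete[of f 1] assms by (simp add: numeral_2_eq_2)

lemma gnorm_limit_finite: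
  fixes f :: "nat \<Rightarrow> real ^ 'n::finite \<Rightarrow> complex"
  assumes [measurable]: "\<And>k. f k \<in> borel_measurable borel" "g \<in> borel_measurable borel"
    and fin: "\<And>k. gnorm p (f k) < \<infinity>" and lim: "(\<lambda>k. gnorm p (\<lambda>x. f k x - g x)) \<longlonglongrightarrow> 0"
  shows "gnorm p g < \<infinity>"
proof -
  have "\<forall>\<^sub>F k in sequentially. gnorm p (\<lambda>x. f k x - g x) < 1"
    by (rule order_tendstoD[OF lim]) simp
  then obtain k where k: "gnorm p (\<lambda>x. f k x - g x) < 1" by (auto simp: eventually_sequentially)
  then have "gnorm p (\<lambda>x. f k x - g x) < \<infinity>" by (rule order_less_trans) simp
  from gnorm_diff_finite[OF _ _ fin[of k] this] show ?thesis by simp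
qed

lemma gnorm_cauchy:
  fixes f :: "nat \<Rightarrow> real ^ 'n::finite \<Rightarrow> complex"
  assumes [measurable]: "\<And>k. f k \<in> borel_measurable borel" "g \<in> borel_measurable borel"
    and lim: "(\<lambda>k. gnorm p (\<lambda>x. f k x - g x)) \<longlonglongrightarrow> 0" and e: "e > (0 :: real)"
  shows "\<exists>N. \<forall>i\<ge>N. \<forall>j\<ge>N. gnorm p (\<lambda>x. f i x - f j x) \<le> ennreal e"
proof -
  define d where "d = e / (2 ^ p * 2)"
  have d: "d > 0" using e by (simp add: d_def)
  then have "\<forall>\<^sub>F k in sequentially. gnorm p (\<lambda>x. f k x - g x) < ennreal d"
    by (intro order_tendstoD[OF lim]) simp
  then obtain N where N: "\<And>k. k \<ge> N \<Longrightarrow> gnorm p (\<lambda>x. f k x - g x) < ennreal d"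
    by (auto simp: eventually_sequentially)
  have "gnorm p (\<lambda>x. f i x - f j x) \<le> ennreal e" if "i \<ge> N" "j \<ge> N" for i j
  proof -
    have "gnorm p (\<lambda>x. f i x - f j x) \<le> 2 ^ p * (gnorm p (\<lambda>x. f i x - g x) + gnorm p (\<lambda>x. f j x - g x))"
    proof (rule gnorm_triangle)
      show "norm (f i x - f j x) \<le> norm (f i x - g x) + norm (f j x - g x)" for x
        using norm_triangle_ineq4[of "f i x - g x" "f j x - g x"] by simp
    qed measurable
    also have "\<dots> \<le> 2 ^ p * (ennreal d + ennreal d)"
      using N[OF that(1)] N[OF that(2)] by (intro mult_left_mono add_mono) auto
    also have "(2 :: ennreal) ^ p = ennreal (2 ^ p)" by (metis ennreal_numeral ennreal_power zero_le_numeral)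
    also have "ennreal (2 ^ p) * (ennreal d + ennreal d) = ennreal (2 ^ p * (d + d))"
      using d by (simp add: ennreal_mult flip: ennreal_plus)
    also have "2 ^ p * (d + d) = e" by (simp add: d_def)
    finally show ?thesis .
  qed
  then show ?thesis by blast
qed

lemma count_list_Cons_raise: "count_list (i # js) = raise (count_list js) i"
  by auto

text \<open>On polynomials the transform is a weighted shift and bounded in \<open>L\<^sup>2\<close>. It is extended by
  completeness for every \<open>\<sigma>\<close> of order at most \<open>|\<alpha>|\<close> at once, since the composition of weak
  derivatives has to be followed one derivative at a time. Approximating polynomials are part of the
  conclusion because the truncated transforms are compared with \<open>g\<close> through them.\<close>

theorem riesz_L2_exists:
  fixes f :: "real ^ 'n::finite \<Rightarrow> complex" and \<alpha> :: "'n \<Rightarrow> nat"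
  assumes f: "f \<in> hspan_closure" and fin: "gnorm 2 f < \<infinity>"
  obtains g c where "riesz_L2 \<alpha> f g" "g \<in> borel_measurable borel" "gnorm 2 g < \<infinity>"
    "\<And>j. finite {\<beta>. c j \<beta> \<noteq> 0}"
    "(\<lambda>j. gnorm 2 (\<lambda>x. hpoly (c j) x - f x)) \<longlonglongrightarrow> 0"
    "(\<lambda>j. gnorm 2 (\<lambda>x. hsum (\<lambda>\<beta>. riesz_mult (sum \<alpha> UNIV) (real (sum \<beta> UNIV))) \<alpha> (c j) x - g x)) \<longlonglongrightarrow> 0"
proof -
  define k where "k = sum \<alpha> UNIV"
  define T where "T \<beta> = riesz_mult k (real (sum \<beta> UNIV))" for \<beta> :: "'n \<Rightarrow> nat"
  note [measurable] = hspan_closure_measurable[OF f]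
  have "\<forall>j. \<exists>c. finite {\<beta>. c \<beta> \<noteq> 0} \<and> gnorm 2 (\<lambda>x. hpoly c x - f x) < ennreal (1 / real (Suc j))"
  proof
    fix j
    obtain p where p: "p \<in> hspan" "gnorm 2 (\<lambda>x. f x - p x) < ennreal (1 / real (Suc j))"
      using hspan_closureD[OF f, of "1 / real (Suc j)"] by auto
    then show "\<exists>c. finite {\<beta>. c \<beta> \<noteq> 0} \<and> gnorm 2 (\<lambda>x. hpoly c x - f x) < ennreal (1 / real (Suc j))"
      using hspan_hsum[OF p(1)] gnorm_minus_commute[of 2 f p] by auto
  qed
  from choice[OF this] obtain c where c0: "\<forall>j. finite {\<beta>. c j \<beta> \<noteq> 0} \<and>
      gnorm 2 (\<lambda>x. hpoly (c j) x - f x) < ennreal (1 / real (Suc j))" ..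
  have c: "\<And>j. finite {\<beta>. c j \<beta> \<noteq> 0}"
    and cf: "\<And>j. gnorm 2 (\<lambda>x. hpoly (c j) x - f x) < ennreal (1 / real (Suc j))"
    using c0 by simp_all
  have lim: "(\<lambda>j. gnorm 2 (\<lambda>x. hpoly (c j) x - f x)) \<longlonglongrightarrow> 0"
  proof (rule tendsto_sandwich[where f = "\<lambda>_. 0" and h = "\<lambda>j. ennreal (1 / real (Suc j))"])
    show "(\<lambda>j. ennreal (1 / real (Suc j))) \<longlonglongrightarrow> 0"
      using tendsto_ennrealI[OF LIMSEQ_inverse_real_of_nat] by (simp add: inverse_eq_divide)
  qed (use cf in \<open>auto intro!: always_eventually less_imp_le\<close>)
  define A where "A = real (k + 1) ^ k"
  have A: "A > 0" by (simp add: A_def)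
  have bound: "(T \<beta>)\<^sup>2 * mfact (\<lambda>i. \<beta> i + \<sigma> i) \<le> A * mfact \<beta>" if "sum \<sigma> UNIV \<le> k" for \<sigma> \<beta>
    unfolding A_def by (rule riesz_mult_bound[OF that]) (simp add: T_def riesz_mult_def)
  have "\<exists>u. u \<in> borel_measurable borel \<and> (\<lambda>j. gnorm 2 (\<lambda>x. hsum T \<sigma> (c j) x - u x)) \<longlonglongrightarrow> 0"
    if s: "sum \<sigma> UNIV \<le> k" for \<sigma>
  proof (rule gnorm_2_complete)
    fix e :: real assume e: "e > 0"
    have "e / A > 0" using e A by simp
    from gnorm_cauchy[OF hsum_measurable \<open>f \<in> borel_measurable borel\<close> lim this]
    obtain N where N: "\<forall>i\<ge>N. \<forall>j\<ge>N.
        gnorm 2 (\<lambda>x. hpoly (c i) x - hpoly (c j) x) \<le> ennreal (e / A)" ..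
    have "gnorm 2 (\<lambda>x. hsum T \<sigma> (c i) x - hsum T \<sigma> (c j) x) \<le> ennreal e" if "i \<ge> N" "j \<ge> N" for i j
    proof -
      have "gnorm 2 (\<lambda>x. hsum T \<sigma> (c i) x - hsum T \<sigma> (c j) x) = gnorm 2 (hsum T \<sigma> (\<lambda>\<beta>. c i \<beta> - c j \<beta>))"
        using hsum_diff(1)[OF c c, of T \<sigma> i j] by (simp add: gnorm_def)
      also have "\<dots> \<le> ennreal A * gnorm 2 (hpoly (\<lambda>\<beta>. c i \<beta> - c j \<beta>))"
        using bound[OF s] A by (intro hsum_bound hsum_diff(2) c) auto
      also have "gnorm 2 (hpoly (\<lambda>\<beta>. c i \<beta> - c j \<beta>)) \<le> ennreal (e / A)"
        using N[rule_format, OF that] hsum_diff(1)[OF c c, of "\<lambda>_. 1" "\<lambda>_. 0" i j] by (simp add: gnorm_def)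
      also have "ennreal A * ennreal (e / A) = ennreal e" using A e by (simp flip: ennreal_mult)
      finally show ?thesis by (simp add: mult_left_mono)
    qed
    then show "\<exists>N. \<forall>i\<ge>N. \<forall>j\<ge>N. gnorm 2 (\<lambda>x. hsum T \<sigma> (c i) x - hsum T \<sigma> (c j) x) \<le> ennreal e"
      by (intro exI[of _ N] allI impI)
  qed measurable
  then have "\<forall>\<sigma>. \<exists>u. sum \<sigma> UNIV \<le> k \<longrightarrow> u \<in> borel_measurable borel \<and> (\<lambda>j. gnorm 2 (\<lambda>x. hsum T \<sigma> (c j) x - u x)) \<longlonglongrightarrow> 0"
    by blast
  from choice[OF this] obtain U where U0: "\<forall>\<sigma>. sum \<sigma> UNIV \<le> k \<longrightarrow>
      U \<sigma> \<in> borel_measurable borel \<and> (\<lambda>j. gnorm 2 (\<lambda>x. hsum T \<sigma> (c j) x - U \<sigma> x)) \<longlonglongrightarrow> 0" ..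
  have U: "\<And>\<sigma>. sum \<sigma> UNIV \<le> k \<Longrightarrow> U \<sigma> \<in> borel_measurable borel"
    and Ulim: "\<And>\<sigma>. sum \<sigma> UNIV \<le> k \<Longrightarrow> (\<lambda>j. gnorm 2 (\<lambda>x. hsum T \<sigma> (c j) x - U \<sigma> x)) \<longlonglongrightarrow> 0"
    using U0 by simp_all
  have Ufin: "gnorm 2 (U \<sigma>) < \<infinity>" if "sum \<sigma> UNIV \<le> k" for \<sigma>
    by (rule gnorm_limit_finite[OF _ U[OF that] hsum_gnorm_finite Ulim[OF that]]) measurable
  have ds: "delta_star i (U \<sigma>) (U (raise \<sigma> i))" if s: "sum (raise \<sigma> i) UNIV \<le> k" for \<sigma> i
  proof (rule delta_starI)
    have s': "sum \<sigma> UNIV \<le> k" using s by (simp only: sum_raise)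
    note u = U[OF s] U[OF s'] Ufin[OF s] Ufin[OF s']
    show "U \<sigma> \<in> borel_measurable borel" "U (raise \<sigma> i) \<in> borel_measurable borel"
      "gnorm 2 (U \<sigma>) < \<infinity>" "gnorm 2 (U (raise \<sigma> i)) < \<infinity>" by (rule u)+
    fix \<phi> :: "real ^ 'n \<Rightarrow> complex" assume \<phi>: "test_function \<phi>"
    note p = test_function_partial[OF \<phi>]
    have 1: "(\<lambda>j. LINT x|gauss. hsum T \<sigma> (c j) x * partial i \<phi> x) \<longlonglongrightarrow> (LINT x|gauss. U \<sigma> x * partial i \<phi> x)"
      by (intro L2_pairing_tendsto hsum_measurable u test_function_measurable p hsum_gnorm_finite
          gnorm_2_test_finite Ulim s')
    have "(\<lambda>j. LINT x|gauss. hsum T (raise \<sigma> i) (c j) x * \<phi> x) \<longlonglongrightarrow> (LINT x|gauss. U (raise \<sigma> i) x * \<phi> x)"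
      by (intro L2_pairing_tendsto hsum_measurable u test_function_measurable \<phi> hsum_gnorm_finite
          gnorm_2_test_finite Ulim s)
    then have "(\<lambda>j. sqrt 2 *\<^sub>R (LINT x|gauss. hsum T (raise \<sigma> i) (c j) x * \<phi> x)) \<longlonglongrightarrow> sqrt 2 *\<^sub>R (LINT x|gauss. U (raise \<sigma> i) x * \<phi> x)"
      by (intro tendsto_intros)
    from LIMSEQ_unique[OF 1[unfolded hsum_delta_star[OF c \<phi>]] this]
    show "(LINT x|gauss. U \<sigma> x * partial i \<phi> x) = sqrt 2 *\<^sub>R (LINT x|gauss. U (raise \<sigma> i) x * \<phi> x)" .
  qed
  have dsl: "delta_star_list js (U (\<lambda>_. 0)) (U (count_list js))" if "sum (count_list js) UNIV \<le> k" for js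
    using that
  proof (induction js)
    case Nil
    have "count_list [] = (\<lambda>_::'n. 0)" by auto
    then show ?case by simp
  next
    case (Cons i js)
    then have s: "sum (raise (count_list js) i) UNIV \<le> k" by (simp only: count_list_Cons_raise)
    then have "sum (count_list js) UNIV \<le> k" by (simp only: sum_raise)
    then have "delta_star_list js (U (\<lambda>_. 0)) (U (count_list js))" by (rule Cons.IH)
    then show ?case using ds[OF s] unfolding count_list_Cons_raise delta_star_list.simps by blast
  qed
  have D: "D_star \<alpha> (U (\<lambda>_. 0)) (U \<alpha>)"
    unfolding D_star_def
  proof (intro allI impI)
    fix js assume "\<forall>i. count_list js i = \<alpha> i"
    then have "count_list js = \<alpha>" by auto
    then show "delta_star_list js (U (\<lambda>_. 0)) (U \<alpha>)" using dsl[of js] by (simp add: k_def)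
  qed
  have u0: "U (\<lambda>_. 0) \<in> Lp 2" unfolding Lp_2_iff using U[of "\<lambda>_. 0"] Ufin[of "\<lambda>_. 0"] by simp
  have spec: "OU_spectral (riesz_mult k) f (U (\<lambda>_. 0))"
    unfolding OU_spectral_def
  proof (intro conjI allI impI u0)
    show "f \<in> Lp 2" unfolding Lp_2_iff using fin by simp
    fix \<mu> and h :: "real ^ 'n \<Rightarrow> complex" assume h: "OU_closure h (\<lambda>x. complex_of_real \<mu> * h x)"
    then have "h \<in> Lp 2" by (simp add: OU_closure_def)
    then have hm[measurable]: "h \<in> borel_measurable borel" and hfin: "gnorm 2 (\<lambda>x. cnj (h x)) < \<infinity>"
      unfolding Lp_2_iff by (auto simp: gnorm_def)
    have [measurable]: "cnj \<in> borel_measurable borel"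
      by (intro borel_measurable_continuous_onI continuous_intros)
    have cm: "(\<lambda>x. cnj (h x)) \<in> borel_measurable borel" by measurable
    have 1: "(\<lambda>j. L2_inner (hsum T (\<lambda>_. 0) (c j)) h) \<longlonglongrightarrow> L2_inner (U (\<lambda>_. 0)) h"
      unfolding L2_inner_def
      by (intro L2_pairing_tendsto hsum_measurable U Ufin cm hfin hsum_gnorm_finite Ulim) auto
    have "(\<lambda>j. L2_inner (hpoly (c j)) h) \<longlonglongrightarrow> L2_inner f h"
      unfolding L2_inner_def
      by (intro L2_pairing_tendsto hsum_measurable cm hfin hsum_gnorm_finite lim fin) auto
    then have "(\<lambda>j. complex_of_real (riesz_mult k \<mu>) * L2_inner (hpoly (c j)) h) \<longlonglongrightarrow>
        complex_of_real (riesz_mult k \<mu>) * L2_inner f h"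
      by (intro tendsto_intros)
    from LIMSEQ_unique[OF 1[unfolded T_def hsum_spectral[OF c h]] this]
    show "L2_inner (U (\<lambda>_. 0)) h = complex_of_real (riesz_mult k \<mu>) * L2_inner f h" .
  qed
  have R: "riesz_L2 \<alpha> f (U \<alpha>)"
    unfolding riesz_L2_def using spec D by (auto simp: riesz_mult_def[abs_def] k_def)
  show ?thesis
  proof (rule that[OF R])
    show "U \<alpha> \<in> borel_measurable borel" "gnorm 2 (U \<alpha>) < \<infinity>" using U[of \<alpha>] Ufin[of \<alpha>] by (simp_all add: k_def)
    show "(\<lambda>j. gnorm 2 (\<lambda>x. hsum (\<lambda>\<beta>. riesz_mult (sum \<alpha> UNIV) (real (sum \<beta> UNIV))) \<alpha> (c j) x - U \<alpha> x)) \<longlonglongrightarrow> 0"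
      using Ulim[of \<alpha>] unfolding T_def k_def by simp
  qed (rule c lim)+
qed

section \<open>The kernel of the truncated transform\<close>

definition hermite_gauss :: "('n::finite \<Rightarrow> nat) \<Rightarrow> real ^ 'n \<Rightarrow> real" where
  "hermite_gauss \<alpha> z = hermite \<alpha> z * exp (- (norm z)\<^sup>2)"

lemma hermite_gauss_measurable [measurable]: "hermite_gauss \<alpha> \<in> borel_measurable borel"
  unfolding hermite_gauss_def by measurable

lemma hermite_gauss_decay:
  assumes c: "c < 1"
  shows "\<exists>C\<ge>0. \<forall>z. \<bar>hermite_gauss \<alpha> z\<bar> \<le> C * exp (- c * (norm z)\<^sup>2)"
proof -
  obtain C where C: "C \<ge> 0" "\<And>z. norm (hermite \<alpha> z) \<le> C * exp ((1 - c) * (norm z)\<^sup>2)"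
    using exp_growth_quadratic_bound[OF exp_growth_hermite, of "1 - c" \<alpha>] c by auto
  have "\<bar>hermite_gauss \<alpha> z\<bar> \<le> C * exp (- c * (norm z)\<^sup>2)" for z
  proof -
    have "\<bar>hermite_gauss \<alpha> z\<bar> \<le> (C * exp ((1 - c) * (norm z)\<^sup>2)) * exp (- (norm z)\<^sup>2)"
      using C(2)[of z] unfolding hermite_gauss_def by (simp add: abs_mult mult_right_mono)
    also have "\<dots> = C * exp ((1 - c) * (norm z)\<^sup>2 + - (norm z)\<^sup>2)" by (simp only: exp_add mult.assoc)
    also have "(1 - c) * (norm z)\<^sup>2 + - (norm z)\<^sup>2 = - c * (norm z)\<^sup>2" by (simp add: algebra_simps)
    finally show ?thesis .
  qed
  then show ?thesis using C(1) by blast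
qed

text \<open>For \<open>r = exp (- t)\<close> and \<open>r\<^sup>2 + s\<^sup>2 = 1\<close> this is the kernel of \<open>D\<^sup>*\<^sup>\<alpha> exp (- t \<L>)\<close> with respect to
  \<open>d\<gamma>(y)\<close>: the Mehler kernel is \<open>s\<^sup>-\<^sup>n exp (|x|\<^sup>2 - |x - r y|\<^sup>2 / s\<^sup>2)\<close>, and \<open>\<delta>\<^sub>i\<^sup>*\<close> in the variable \<open>x\<close>
  differentiates only its factor \<open>exp (- |x - r y|\<^sup>2 / s\<^sup>2)\<close>.\<close>

definition riesz_kernel :: "('n::finite \<Rightarrow> nat) \<Rightarrow> real \<Rightarrow> real \<Rightarrow> real ^ 'n \<Rightarrow> real ^ 'n \<Rightarrow> real" where
  "riesz_kernel \<alpha> r s x y = exp ((norm x)\<^sup>2) * hermite_gauss \<alpha> ((1 / s) *\<^sub>R (x - r *\<^sub>R y)) / s ^ (sum \<alpha> UNIV + CARD('n))"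

text \<open>The substitution \<open>y = r x + s z\<close> reduces the integral to \<open>hermite_rotation\<close>.\<close>

lemma riesz_kernel_hermite:
  fixes x :: "real ^ 'n::finite"
  assumes rs: "r\<^sup>2 + s\<^sup>2 = 1" and s: "s > 0"
  shows "(LINT y|gauss. riesz_kernel \<alpha> r s x y * hermite \<beta> y) = r ^ sum \<beta> UNIV * hermite (\<lambda>i. \<alpha> i + \<beta> i) x"
proof -
  let ?k = "sum \<alpha> UNIV" and ?n = "CARD('n)" and ?c = "gauss_const TYPE('n)"
  have riesz_kernel_m[measurable]: "(\<lambda>y. riesz_kernel \<alpha> r s x y) \<in> borel_measurable borel" unfolding riesz_kernel_def by measurable
  have pt: "exp (- (norm (r *\<^sub>R x + s *\<^sub>R z))\<^sup>2) * (riesz_kernel \<alpha> r s x (r *\<^sub>R x + s *\<^sub>R z) * hermite \<beta> (r *\<^sub>R x + s *\<^sub>R z)) =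
     (1 / s ^ (?k + ?n)) * (exp (- (norm z)\<^sup>2) * (hermite \<alpha> (s *\<^sub>R x - r *\<^sub>R z) * hermite \<beta> (r *\<^sub>R x + s *\<^sub>R z)))" for z
  proof -
    have "x - r *\<^sub>R (r *\<^sub>R x + s *\<^sub>R z) = (1 - r\<^sup>2) *\<^sub>R x - (s * r) *\<^sub>R z"
      by (simp add: algebra_simps power2_eq_square)
    also have "\<dots> = s *\<^sub>R (s *\<^sub>R x - r *\<^sub>R z)"
      using rs by (simp add: algebra_simps power2_eq_square flip: eq_diff_eq)
    finally have arg: "(1 / s) *\<^sub>R (x - r *\<^sub>R (r *\<^sub>R x + s *\<^sub>R z)) = s *\<^sub>R x - r *\<^sub>R z" using s by simp
    have "(norm (s *\<^sub>R x - r *\<^sub>R z))\<^sup>2 + (norm (r *\<^sub>R x + s *\<^sub>R z))\<^sup>2 = (r\<^sup>2 + s\<^sup>2) * (norm x)\<^sup>2 + (r\<^sup>2 + s\<^sup>2) * (norm z)\<^sup>2"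
      unfolding power2_norm_eq_inner
      by (simp add: inner_diff_left inner_diff_right inner_add_left inner_add_right algebra_simps inner_commute power2_eq_square)
    then have "- (norm (r *\<^sub>R x + s *\<^sub>R z))\<^sup>2 + ((norm x)\<^sup>2 + - (norm (s *\<^sub>R x - r *\<^sub>R z))\<^sup>2) = - (norm z)\<^sup>2"
      unfolding rs by simp
    then have "exp (- (norm (r *\<^sub>R x + s *\<^sub>R z))\<^sup>2) * (exp ((norm x)\<^sup>2) * exp (- (norm (s *\<^sub>R x - r *\<^sub>R z))\<^sup>2)) = exp (- (norm z)\<^sup>2)"
      by (simp flip: exp_add)
    then show ?thesis unfolding riesz_kernel_def arg hermite_gauss_def by (simp add: mult_ac)
  qed
  have "(LINT y|gauss. riesz_kernel \<alpha> r s x y * hermite \<beta> y) =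
      ?c * (LINT y|lborel. exp (- (norm y)\<^sup>2) * (riesz_kernel \<alpha> r s x y * hermite \<beta> y))"
    by (subst integral_gauss) auto
  also have "(LINT y|lborel. exp (- (norm y)\<^sup>2) * (riesz_kernel \<alpha> r s x y * hermite \<beta> y)) = s ^ ?n *
      (LINT z|lborel. exp (- (norm (r *\<^sub>R x + s *\<^sub>R z))\<^sup>2) * (riesz_kernel \<alpha> r s x (r *\<^sub>R x + s *\<^sub>R z) * hermite \<beta> (r *\<^sub>R x + s *\<^sub>R z)))"
    by (subst integral_lborel_affine[OF _ s, of _ "r *\<^sub>R x"]) auto
  also have "\<dots> = s ^ ?n * ((1 / s ^ (?k + ?n)) * (LINT z|lborel. exp (- (norm z)\<^sup>2) * (hermite \<alpha> (s *\<^sub>R x - r *\<^sub>R z) * hermite \<beta> (r *\<^sub>R x + s *\<^sub>R z))))"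
    unfolding pt by (simp only: integral_mult_right_zero)
  also have "?c * \<dots> = (1 / s ^ ?k) * (?c * (LINT z|lborel. exp (- (norm z)\<^sup>2) * (hermite \<alpha> (s *\<^sub>R x - r *\<^sub>R z) * hermite \<beta> (r *\<^sub>R x + s *\<^sub>R z))))"
    using s by (simp add: power_add)
  also have "?c * (LINT z|lborel. exp (- (norm z)\<^sup>2) * (hermite \<alpha> (s *\<^sub>R x - r *\<^sub>R z) * hermite \<beta> (r *\<^sub>R x + s *\<^sub>R z))) =
     (LINT z|gauss. hermite \<alpha> (s *\<^sub>R x - r *\<^sub>R z) * hermite \<beta> (r *\<^sub>R x + s *\<^sub>R z))"
    by (subst integral_gauss) auto
  also have "\<dots> = s ^ ?k * r ^ sum \<beta> UNIV * hermite (\<lambda>i. \<alpha> i + \<beta> i) x" by (rule hermite_rotation[OF rs])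
  finally show ?thesis using s by simp
qed

text \<open>The width of the Mehler kernel at time \<open>t\<close>.\<close>

definition spread :: "real \<Rightarrow> real" where "spread t = sqrt (1 - (exp (- t))\<^sup>2)"

lemma spread_props:
  assumes "t > 0" shows "spread t > 0" "spread t \<le> 1" "(exp (- t))\<^sup>2 + (spread t)\<^sup>2 = 1"
proof -
  have "(exp (- t))\<^sup>2 < 1" using assms by (simp add: power_less_one_iff abs_square_less_1)
  then show "spread t > 0" "(exp (- t))\<^sup>2 + (spread t)\<^sup>2 = 1" by (simp_all add: spread_def)
  show "spread t \<le> 1" by (simp add: spread_def)
qed

lemma spread_mono: "0 < e \<Longrightarrow> e \<le> t \<Longrightarrow> spread e \<le> spread t"
  unfolding spread_def by (intro real_sqrt_le_mono diff_left_mono power_mono) auto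

lemma spread_measurable [measurable]: "spread \<in> borel_measurable borel"
  unfolding spread_def by measurable

definition kernel_op :: "('n::finite \<Rightarrow> nat) \<Rightarrow> real \<Rightarrow> (real ^ 'n \<Rightarrow> complex) \<Rightarrow> real ^ 'n \<Rightarrow> complex" where
  "kernel_op \<alpha> t f x = (LINT y|gauss. riesz_kernel \<alpha> (exp (- t)) (spread t) x y *\<^sub>R f y)"

lemma riesz_kernel_measurable [measurable]:
  "(\<lambda>(t, x, y). riesz_kernel \<alpha> (exp (- t)) (spread t) x y) \<in> borel_measurable (borel \<Otimes>\<^sub>M borel \<Otimes>\<^sub>M borel)"
  unfolding riesz_kernel_def by measurable

lemma kernel_op_measurable [measurable]:
  assumes [measurable]: "f \<in> borel_measurable borel"
  shows "(\<lambda>(t, x). kernel_op \<alpha> t f x) \<in> borel_measurable (borel \<Otimes>\<^sub>M borel)"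
  unfolding kernel_op_def riesz_kernel_def by measurable

definition kbound :: "('n::finite \<Rightarrow> nat) \<Rightarrow> real" where
  "kbound \<alpha> = (SOME C. C \<ge> 0 \<and> (\<forall>z. \<bar>hermite_gauss \<alpha> z\<bar> \<le> C))"

lemma kbound: "kbound \<alpha> \<ge> 0" "\<bar>hermite_gauss \<alpha> z\<bar> \<le> kbound \<alpha>"
proof -
  have "\<exists>C. C \<ge> 0 \<and> (\<forall>z. \<bar>hermite_gauss \<alpha> z\<bar> \<le> C)"
    using hermite_gauss_decay[of 0 \<alpha>] by auto
  from someI_ex[OF this] show "kbound \<alpha> \<ge> 0" "\<bar>hermite_gauss \<alpha> z\<bar> \<le> kbound \<alpha>"
    unfolding kbound_def by auto
qed

definition kconst :: "('n::finite \<Rightarrow> nat) \<Rightarrow> real \<Rightarrow> real ^ 'n \<Rightarrow> real" where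
  "kconst \<alpha> e x = exp ((norm x)\<^sup>2) * kbound \<alpha> / spread e ^ (sum \<alpha> UNIV + CARD('n))"

lemma riesz_kernel_le:
  assumes "0 < e" "e \<le> t"
  shows "\<bar>riesz_kernel \<alpha> r (spread t) x y\<bar> \<le> kconst \<alpha> e x"
proof -
  have "spread e > 0" "spread e \<le> spread t" using spread_props[OF assms(1)] spread_mono[OF assms] by auto
  then show ?thesis
    unfolding riesz_kernel_def kconst_def using kbound[of \<alpha>]
    by (auto simp: abs_mult intro!: frac_le mult_mono power_mono mult_nonneg_nonneg)
qed

lemma kconst_nonneg: "0 < e \<Longrightarrow> kconst \<alpha> e x \<ge> 0"
  unfolding kconst_def using kbound[of \<alpha>] spread_props[of e] by auto

lemma riesz_kernel_integrable:
  assumes f: "integrable gauss f" and t: "t > 0"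
  shows "integrable gauss (\<lambda>y. riesz_kernel \<alpha> (exp (- t)) (spread t) x y *\<^sub>R (f y :: complex))"
proof (rule Bochner_Integration.integrable_bound)
  show "integrable gauss (\<lambda>y. kconst \<alpha> t x * norm (f y))" using f by simp
  have [measurable]: "f \<in> borel_measurable borel" using borel_measurable_integrable[OF f] by simp
  show "(\<lambda>y. riesz_kernel \<alpha> (exp (- t)) (spread t) x y *\<^sub>R f y) \<in> borel_measurable gauss"
    unfolding riesz_kernel_def by simp
  show "AE y in gauss. norm (riesz_kernel \<alpha> (exp (- t)) (spread t) x y *\<^sub>R f y) \<le> norm (kconst \<alpha> t x * norm (f y))"
    using riesz_kernel_le[OF t order_refl, of \<alpha> "exp (- t)" x] kconst_nonneg[OF t, of \<alpha> x]
    by (auto simp: abs_mult intro!: mult_right_mono)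
qed

lemma kernel_op_diff:
  assumes "integrable gauss f" "integrable gauss g" "t > 0"
  shows "kernel_op \<alpha> t (\<lambda>x. f x - g x) x = kernel_op \<alpha> t f x - kernel_op \<alpha> t g x"
  unfolding kernel_op_def scaleR_diff_right
  by (intro Bochner_Integration.integral_diff riesz_kernel_integrable assms)

lemma kernel_op_le:
  assumes f: "integrable gauss f" and t: "0 < e" "e \<le> t"
  shows "norm (kernel_op \<alpha> t f x) \<le> kconst \<alpha> e x * (LINT y|gauss. norm (f y))"
proof -
  have "norm (kernel_op \<alpha> t f x) \<le> (LINT y|gauss. norm (riesz_kernel \<alpha> (exp (- t)) (spread t) x y *\<^sub>R f y))"
    unfolding kernel_op_def by (rule integral_norm_bound)
  also have "\<dots> \<le> (LINT y|gauss. kconst \<alpha> e x * norm (f y))"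
  proof (rule integral_mono)
    show "integrable gauss (\<lambda>y. norm (riesz_kernel \<alpha> (exp (- t)) (spread t) x y *\<^sub>R f y))"
      using t by (intro integrable_norm riesz_kernel_integrable f) auto
    show "integrable gauss (\<lambda>y. kconst \<alpha> e x * norm (f y))" using f by simp
    show "norm (riesz_kernel \<alpha> (exp (- t)) (spread t) x y *\<^sub>R f y) \<le> kconst \<alpha> e x * norm (f y)" for y
      using riesz_kernel_le[OF t, of \<alpha> "exp (- t)" x y] by (simp add: mult_right_mono)
  qed
  finally show ?thesis by simp
qed

lemma kernel_op_hsum:
  assumes c: "finite {\<beta>. c \<beta> \<noteq> 0}" and t: "t > 0"
  shows "kernel_op \<alpha> t (hpoly c) x = hsum (\<lambda>\<beta>. exp (- t) ^ sum \<beta> UNIV) \<alpha> c x"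
proof -
  have int: "integrable gauss (\<lambda>y. riesz_kernel \<alpha> (exp (- t)) (spread t) x y * hermite \<beta> y)" for \<beta>
  proof -
    have "integrable gauss (\<lambda>y. complex_of_real (hermite \<beta> y))"
      by (intro integrable_of_real exp_growth_integrable_gauss exp_growth_hermite hermite_measurable)
    from integrable_Re[OF riesz_kernel_integrable[OF this t, of \<alpha> x]] show ?thesis by simp
  qed
  have "kernel_op \<alpha> t (hpoly c) x =
     (LINT y|gauss. (\<Sum>\<beta> | c \<beta> \<noteq> 0. (riesz_kernel \<alpha> (exp (- t)) (spread t) x y * hermite \<beta> y) *\<^sub>R c \<beta>))"
    unfolding kernel_op_def by (intro Bochner_Integration.integral_cong refl) (simp add: hsum_def scaleR_sum_right)
  also have "\<dots> = (\<Sum>\<beta> | c \<beta> \<noteq> 0. (LINT y|gauss. riesz_kernel \<alpha> (exp (- t)) (spread t) x y * hermite \<beta> y) *\<^sub>R c \<beta>)"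
    by (subst Bochner_Integration.integral_sum, intro integrable_scaleR_left int)
       (intro sum.cong refl integral_scaleR_left int)
  also have "\<dots> = (\<Sum>\<beta> | c \<beta> \<noteq> 0. (exp (- t) ^ sum \<beta> UNIV * hermite (\<lambda>i. \<alpha> i + \<beta> i) x) *\<^sub>R c \<beta>)"
    using spread_props[OF t] by (simp only: riesz_kernel_hermite)
  finally show ?thesis unfolding hsum_def by (simp add: add.commute mult.commute)
qed

text \<open>The density of a Gamma distribution. Its Laplace transform at \<open>\<mu>\<close> is \<open>(\<mu> + 1) powr (- k / 2)\<close>,
  which represents the negative power of \<open>\<L> + I\<close> by the semigroup \<open>exp (- t \<L>)\<close>.\<close>

definition gamma_weight :: "nat \<Rightarrow> real \<Rightarrow> real" where
  "gamma_weight k t = t powr (real k / 2 - 1) * exp (- t) / Gamma (real k / 2)"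

lemma gamma_weight_nonneg: "k > 0 \<Longrightarrow> gamma_weight k t \<ge> 0"
  unfolding gamma_weight_def using Gamma_real_pos[of "real k / 2"] by (auto intro!: divide_nonneg_nonneg)

lemma gamma_weight_measurable [measurable]: "gamma_weight k \<in> borel_measurable borel"
  unfolding gamma_weight_def by measurable

lemma nn_integral_gamma_weight:
  assumes k: "k > 0"
  shows "(\<integral>\<^sup>+t. ennreal (indicator {0..} t * gamma_weight k t * exp (- t) ^ m) \<partial>lborel) = ennreal (riesz_mult k (real m))"
proof -
  define a where "a = real k / 2"
  define M where "M = real m + 1"
  define g where "g t = (indicator {0..} t * t powr (a - 1) / exp t :: real)" for t :: real
  have a: "a > 0" using k by (simp add: a_def)
  have M: "M > 0" by (simp add: M_def)
  have G: "Gamma a > 0" using a by (rule Gamma_real_pos)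
  have [measurable]: "g \<in> borel_measurable borel" unfolding g_def by measurable
  have g0: "g t \<ge> 0" for t by (simp add: g_def)
  have eq: "indicator {0..} t * gamma_weight k t * exp (- t) ^ m = (1 / (Gamma a * M powr (a - 1))) * g (0 + M * t)" for t
  proof (cases "t \<ge> 0")
    case True
    have "exp (- t) * exp (- t) ^ m = exp (- (M * t))"
      by (simp add: M_def algebra_simps exp_of_nat_mult[symmetric] flip: exp_add exp_minus)
    then show ?thesis using True M G
      by (simp add: gamma_weight_def g_def a_def[symmetric] powr_mult exp_minus field_simps)
  next
    case False
    then have "\<not> M * t \<ge> 0" using M by (simp add: zero_le_mult_iff)
    then show ?thesis using False by (simp add: g_def)
  qed
  have "(\<integral>\<^sup>+t. ennreal (indicator {0..} t * gamma_weight k t * exp (- t) ^ m) \<partial>lborel) =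
      ennreal (1 / (Gamma a * M powr (a - 1))) * (\<integral>\<^sup>+t. ennreal (g (0 + M * t)) \<partial>lborel)"
  proof -
    have "ennreal ((1 / (Gamma a * M powr (a - 1))) * g (0 + M * t)) =
        ennreal (1 / (Gamma a * M powr (a - 1))) * ennreal (g (0 + M * t))" for t
      using G by (intro ennreal_mult) (auto simp: g0)
    then show ?thesis unfolding eq by (simp only:) (rule nn_integral_cmult, measurable)
  qed
  also have "(\<integral>\<^sup>+t. ennreal (g (0 + M * t)) \<partial>lborel) = ennreal (1 / M) * ennreal (Gamma a)"
  proof -
    have "ennreal (Gamma a) = (\<integral>\<^sup>+t. ennreal (g t) \<partial>lborel)"
      using Gamma_conv_nn_integral_real[OF a] by (simp add: g_def)
    also have "\<dots> = ennreal M * (\<integral>\<^sup>+t. ennreal (g (0 + M * t)) \<partial>lborel)"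
      using M by (subst nn_integral_real_affine[of _ M 0]) auto
    finally have "ennreal (1 / M) * ennreal (Gamma a) = ennreal (1 / M) * (ennreal M * (\<integral>\<^sup>+t. ennreal (g (0 + M * t)) \<partial>lborel))"
      by simp
    also have "\<dots> = (\<integral>\<^sup>+t. ennreal (g (0 + M * t)) \<partial>lborel)"
      using M by (simp flip: mult.assoc ennreal_mult)
    finally show ?thesis by simp
  qed
  also have "ennreal (1 / (Gamma a * M powr (a - 1))) * (ennreal (1 / M) * ennreal (Gamma a)) = ennreal (1 / (M powr (a - 1) * M))"
    using G M by (simp flip: ennreal_mult)
  also have "M powr (a - 1) * M = M powr a" using M powr_add[of M "a - 1" 1] by simp
  also have "1 / M powr a = riesz_mult k (real m)"
    by (simp add: riesz_mult_def a_def M_def powr_minus_divide)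
  finally show ?thesis .
qed

lemma integrable_gamma_weight:
  assumes k: "k > 0"
  shows "integrable lborel (\<lambda>t. indicator {0..} t * gamma_weight k t * exp (- t) ^ m)"
    "(LINT t|lborel. indicator {0..} t * gamma_weight k t * exp (- t) ^ m) = riesz_mult k (real m)"
proof -
  show i: "integrable lborel (\<lambda>t. indicator {0..} t * gamma_weight k t * exp (- t) ^ m)"
    using nn_integral_gamma_weight[OF k, of m] gamma_weight_nonneg[OF k] by (intro integrableI_bounded) (auto simp: abs_mult)
  have "ennreal (LINT t|lborel. indicator {0..} t * gamma_weight k t * exp (- t) ^ m) = ennreal (riesz_mult k (real m))"
    using nn_integral_eq_integral[OF i] nn_integral_gamma_weight[OF k, of m] gamma_weight_nonneg[OF k] by simp
  then show "(LINT t|lborel. indicator {0..} t * gamma_weight k t * exp (- t) ^ m) = riesz_mult k (real m)"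
    using gamma_weight_nonneg[OF k] by (subst (asm) ennreal_inj) (auto intro!: integral_nonneg simp: riesz_mult_def)
qed

text \<open>The eigenvalue of the truncated negative power of \<open>\<L> + I\<close> on polynomials of degree \<open>m\<close>.\<close>

definition trunc_mult :: "nat \<Rightarrow> real \<Rightarrow> nat \<Rightarrow> real" where
  "trunc_mult k e m = (LINT t|lborel. indicator {e..} t * gamma_weight k t * exp (- t) ^ m)"

lemma integrable_gamma_weight_trunc:
  assumes k: "k > 0" and e: "e > 0"
  shows "integrable lborel (\<lambda>t. indicator {e..} t * gamma_weight k t * exp (- t) ^ m)"
proof (rule Bochner_Integration.integrable_bound[OF integrable_gamma_weight(1)[OF k, of m]])
  show "AE t in lborel. norm (indicator {e..} t * gamma_weight k t * exp (- t) ^ m) \<le> norm (indicator {0..} t * gamma_weight k t * exp (- t) ^ m)"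
    using e by (auto simp: abs_mult indicator_def)
qed measurable

lemma trunc_mult_bounds:
  assumes k: "k > 0" and e: "e > 0"
  shows "0 \<le> trunc_mult k e m" "trunc_mult k e m \<le> riesz_mult k (real m)"
proof -
  show "0 \<le> trunc_mult k e m" unfolding trunc_mult_def using gamma_weight_nonneg[OF k] by (intro Bochner_Integration.integral_nonneg) auto
  show "trunc_mult k e m \<le> riesz_mult k (real m)"
    unfolding trunc_mult_def integrable_gamma_weight(2)[OF k, symmetric]
    using gamma_weight_nonneg[OF k] e
    by (intro integral_mono integrable_gamma_weight_trunc integrable_gamma_weight assms) (auto simp: indicator_def)
qed

lemma trunc_mult_tendsto:
  assumes k: "k > 0"
  shows "(\<lambda>j. trunc_mult k (1 / real (Suc j)) m) \<longlonglongrightarrow> riesz_mult k (real m)"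
  unfolding trunc_mult_def integrable_gamma_weight(2)[OF k, symmetric]
proof (rule integral_dominated_convergence[OF _ _ integrable_gamma_weight(1)[OF k, of m]])
  have "(\<lambda>j. indicator {1 / real (Suc j)..} t * gamma_weight k t * exp (- t) ^ m) \<longlonglongrightarrow> indicator {0..} t * gamma_weight k t * exp (- t) ^ m"
    if "t \<noteq> 0" for t :: real
  proof (cases "t > 0")
    case True
    have "(\<lambda>j. 1 / real (Suc j)) \<longlonglongrightarrow> 0" using LIMSEQ_inverse_real_of_nat by (simp add: inverse_eq_divide)
    then have "\<forall>\<^sub>F j in sequentially. 1 / real (Suc j) < t" using True by (rule order_tendstoD)
    then have "\<forall>\<^sub>F j in sequentially. indicator {1 / real (Suc j)..} t * gamma_weight k t * exp (- t) ^ m = indicator {0..} t * gamma_weight k t * exp (- t) ^ m"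
      by (rule eventually_mono) (use True in \<open>auto simp: indicator_def\<close>)
    then show ?thesis by (rule tendsto_eventually)
  next
    case False
    have lt: "t < 1 / real (Suc j)" for j
      by (rule order_less_trans[of t 0]) (use False that in auto)
    have "indicator {1 / real (Suc j)..} t = (0::real)" for j
      using lt[of j] by (simp add: indicator_def)
    then show ?thesis using False that by simp
  qed
  then show "AE t in lborel. (\<lambda>j. indicator {1 / real (Suc j)..} t * gamma_weight k t * exp (- t) ^ m) \<longlonglongrightarrow> indicator {0..} t * gamma_weight k t * exp (- t) ^ m"
    using AE_lborel_singleton[of "0::real"] by (auto elim!: eventually_mono)
  show "AE t in lborel. norm (indicator {1 / real (Suc j)..} t * gamma_weight k t * exp (- t) ^ m) \<le> indicator {0..} t * gamma_weight k t * exp (- t) ^ m" for j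
  proof (intro always_eventually allI)
    fix t :: real
    have "0 < 1 / real (Suc j)" by simp
    then have "1 / real (Suc j) \<le> t \<Longrightarrow> 0 \<le> t" by linarith
    then show "norm (indicator {1 / real (Suc j)..} t * gamma_weight k t * exp (- t) ^ m) \<le> indicator {0..} t * gamma_weight k t * exp (- t) ^ m"
      using gamma_weight_nonneg[OF k, of t] by (simp add: indicator_def abs_mult)
  qed
qed measurable

text \<open>Near \<open>t = 0\<close> the kernel is singular, and the integral over all times need not converge
  absolutely; cutting off at \<open>e\<close> gives an integral operator.\<close>

definition trunc_riesz :: "('n::finite \<Rightarrow> nat) \<Rightarrow> real \<Rightarrow> (real ^ 'n \<Rightarrow> complex) \<Rightarrow> real ^ 'n \<Rightarrow> complex" where
  "trunc_riesz \<alpha> e f x = (LINT t|lborel. (indicator {e..} t * gamma_weight (sum \<alpha> UNIV) t) *\<^sub>R kernel_op \<alpha> t f x)"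

lemma trunc_riesz_measurable [measurable]:
  assumes [measurable]: "f \<in> borel_measurable borel"
  shows "trunc_riesz \<alpha> e f \<in> borel_measurable borel"
  unfolding trunc_riesz_def[abs_def] by measurable

lemma trunc_riesz_integrable:
  fixes \<alpha> :: "'n::finite \<Rightarrow> nat"
  assumes k: "sum \<alpha> UNIV > 0" and e: "e > 0" and f: "integrable gauss f"
  shows "integrable lborel (\<lambda>t. (indicator {e..} t * gamma_weight (sum \<alpha> UNIV) t) *\<^sub>R kernel_op \<alpha> t f x)" (is ?A)
    and "norm (trunc_riesz \<alpha> e f x) \<le> kconst \<alpha> e x * (LINT y|gauss. norm (f y))" (is ?B)
proof -
  let ?N = "LINT y|gauss. norm (f y)" and ?k = "sum \<alpha> UNIV"
  have [measurable]: "f \<in> borel_measurable borel" using borel_measurable_integrable[OF f] by simp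
  have le: "norm ((indicator {e..} t * gamma_weight ?k t) *\<^sub>R kernel_op \<alpha> t f x) \<le> (indicator {e..} t * gamma_weight ?k t * exp (- t) ^ 0) * (kconst \<alpha> e x * ?N)" for t
    using kernel_op_le[OF f e, of t \<alpha> x] gamma_weight_nonneg[OF k, of t] by (auto simp: indicator_def abs_mult intro!: mult_left_mono)
  have int: "integrable lborel (\<lambda>t. (indicator {e..} t * gamma_weight ?k t * exp (- t) ^ 0) * (kconst \<alpha> e x * ?N))"
    by (intro integrable_mult_left integrable_gamma_weight_trunc k e)
  show A: ?A
    by (rule Bochner_Integration.integrable_bound[OF int])
       (measurable, use le in \<open>auto intro: order_trans[OF _ abs_ge_self]\<close>)
  have "norm (trunc_riesz \<alpha> e f x) \<le> (LINT t|lborel. norm ((indicator {e..} t * gamma_weight ?k t) *\<^sub>R kernel_op \<alpha> t f x))"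
    unfolding trunc_riesz_def by (rule integral_norm_bound)
  also have "\<dots> \<le> (LINT t|lborel. (indicator {e..} t * gamma_weight ?k t * exp (- t) ^ 0) * (kconst \<alpha> e x * ?N))"
    by (intro integral_mono integrable_norm A int le)
  also have "\<dots> = trunc_mult ?k e 0 * (kconst \<alpha> e x * ?N)" unfolding trunc_mult_def by (rule integral_mult_left_zero)
  also have "\<dots> \<le> 1 * (kconst \<alpha> e x * ?N)"
    using trunc_mult_bounds(2)[OF k e, of 0] kconst_nonneg[OF e, of \<alpha> x]
    by (intro mult_right_mono) (auto simp: riesz_mult_def)
  finally show ?B by simp
qed

lemma trunc_riesz_diff:
  assumes k: "sum \<alpha> UNIV > 0" and e: "e > 0" and fg: "integrable gauss f" "integrable gauss g"
  shows "trunc_riesz \<alpha> e (\<lambda>x. f x - g x) x = trunc_riesz \<alpha> e f x - trunc_riesz \<alpha> e g x"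
proof -
  have "trunc_riesz \<alpha> e (\<lambda>x. f x - g x) x =
     (LINT t|lborel. (indicator {e..} t * gamma_weight (sum \<alpha> UNIV) t) *\<^sub>R kernel_op \<alpha> t f x - (indicator {e..} t * gamma_weight (sum \<alpha> UNIV) t) *\<^sub>R kernel_op \<alpha> t g x)"
    unfolding trunc_riesz_def
    by (intro Bochner_Integration.integral_cong refl)
       (use e in \<open>auto simp: indicator_def kernel_op_diff[OF fg] scaleR_diff_right\<close>)
  then show ?thesis unfolding trunc_riesz_def using trunc_riesz_integrable(1)[OF k e] fg by simp
qed

lemma trunc_riesz_hsum:
  assumes k: "sum \<alpha> UNIV > 0" and e: "e > 0" and c: "finite {\<beta>. c \<beta> \<noteq> 0}"
  shows "trunc_riesz \<alpha> e (hpoly c) x = hsum (\<lambda>\<beta>. trunc_mult (sum \<alpha> UNIV) e (sum \<beta> UNIV)) \<alpha> c x"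
proof -
  let ?k = "sum \<alpha> UNIV"
  note int = integrable_gamma_weight_trunc[OF k e]
  have "trunc_riesz \<alpha> e (hpoly c) x =
    (LINT t|lborel. (\<Sum>\<beta> | c \<beta> \<noteq> 0. (indicator {e..} t * gamma_weight ?k t * exp (- t) ^ sum \<beta> UNIV) *\<^sub>R (hermite (\<lambda>i. \<beta> i + \<alpha> i) x *\<^sub>R c \<beta>)))"
    unfolding trunc_riesz_def
  proof (intro Bochner_Integration.integral_cong refl)
    fix t
    show "(indicator {e..} t * gamma_weight ?k t) *\<^sub>R kernel_op \<alpha> t (hpoly c) x =
      (\<Sum>\<beta> | c \<beta> \<noteq> 0. (indicator {e..} t * gamma_weight ?k t * exp (- t) ^ sum \<beta> UNIV) *\<^sub>R (hermite (\<lambda>i. \<beta> i + \<alpha> i) x *\<^sub>R c \<beta>))"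
      using e by (cases "t \<ge> e") (simp_all add: kernel_op_hsum[OF c] hsum_def scaleR_sum_right mult_ac)
  qed
  also have "\<dots> = (\<Sum>\<beta> | c \<beta> \<noteq> 0. trunc_mult ?k e (sum \<beta> UNIV) *\<^sub>R (hermite (\<lambda>i. \<beta> i + \<alpha> i) x *\<^sub>R c \<beta>))"
    unfolding trunc_mult_def
    by (subst Bochner_Integration.integral_sum, intro integrable_scaleR_left int)
       (intro sum.cong refl integral_scaleR_left int)
  finally show ?thesis unfolding hsum_def by (simp add: mult.commute)
qed

lemma gnorm_le_split:
  fixes u v :: "real ^ 'n::finite \<Rightarrow> complex"
  assumes [measurable]: "u \<in> borel_measurable borel" "v \<in> borel_measurable borel"
  shows "gnorm p u \<le> 2 ^ p * (gnorm p (\<lambda>x. u x - v x) + gnorm p v)"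
proof (rule gnorm_triangle)
  show "norm (u x) \<le> norm (u x - v x) + norm (v x)" for x
    using norm_triangle_ineq[of "u x - v x" "v x"] by simp
qed measurable

text \<open>On polynomials the truncations converge because the multipliers do. As both sides are bounded
  in \<open>L\<^sup>2\<close> uniformly in the truncation, the convergence carries over to all of \<open>L\<^sup>2\<close>. Pointwise
  continuity of the truncated operators with respect to convergence in the mean, combined with
  Fatou's lemma, gives the bound for functions that are not polynomials.\<close>

theorem riesz_L2_trunc:
  fixes f :: "real ^ 'n::finite \<Rightarrow> complex" and \<alpha> :: "'n \<Rightarrow> nat"
  assumes f: "f \<in> hspan_closure" and fin: "gnorm 2 f < \<infinity>" and k: "sum \<alpha> UNIV > 0"
  obtains g where "riesz_L2 \<alpha> f g" "g \<in> borel_measurable borel"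
    "gnorm 2 g \<le> ennreal (16 * real (sum \<alpha> UNIV + 1) ^ sum \<alpha> UNIV) * gnorm 2 f"
    "(\<lambda>m. gnorm 2 (\<lambda>x. trunc_riesz \<alpha> (1 / real (Suc m)) f x - g x)) \<longlonglongrightarrow> 0"
proof -
  define k where "k = sum \<alpha> UNIV"
  define T where "T \<beta> = riesz_mult k (real (sum \<beta> UNIV))" for \<beta> :: "'n \<Rightarrow> nat"
  define A where "A = real (k + 1) ^ k"
  define ep where "ep m = 1 / real (Suc m)" for m
  have ep: "ep m > 0" for m by (simp add: ep_def)
  have kpos: "k > 0" using assms(3) by (simp add: k_def)
  have A: "A > 0" by (simp add: A_def)
  obtain g c where R: "riesz_L2 \<alpha> f g" and g[measurable]: "g \<in> borel_measurable borel" and gfin: "gnorm 2 g < \<infinity>"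
    and c: "\<And>j. finite {\<beta>. c j \<beta> \<noteq> 0}"
    and lf: "(\<lambda>j. gnorm 2 (\<lambda>x. hpoly (c j) x - f x)) \<longlonglongrightarrow> 0"
    and lg: "(\<lambda>j. gnorm 2 (\<lambda>x. hsum T \<alpha> (c j) x - g x)) \<longlonglongrightarrow> 0"
    using riesz_L2_exists[OF f fin, of \<alpha>] unfolding T_def k_def by blast
  note fm[measurable] = hspan_closure_measurable[OF f]
  define p where "p j = hpoly (c j)" for j
  have [measurable]: "p j \<in> borel_measurable borel" for j unfolding p_def by measurable
  have lp: "(\<lambda>j. gnorm 2 (\<lambda>x. p j x - f x)) \<longlonglongrightarrow> 0" using lf by (simp add: p_def)
  have bound: "(t \<beta>)\<^sup>2 * mfact (\<lambda>i. \<beta> i + \<alpha> i) \<le> A * mfact \<beta>" if "\<bar>t \<beta>\<bar> \<le> T \<beta>" for t \<beta>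
    unfolding A_def using that by (intro riesz_mult_bound) (auto simp: T_def k_def)
  have fint: "integrable gauss f" using integrable_of_gnorm[OF fm fin] .
  have pint: "integrable gauss (p j)" for j
    unfolding p_def by (rule integrable_of_gnorm[OF hsum_measurable hsum_gnorm_finite])
  have Tp: "gnorm 2 (hsum T \<alpha> (c j)) \<le> ennreal A * gnorm 2 (p j)" for j
    unfolding p_def using A by (intro hsum_bound c bound) (auto simp: T_def riesz_mult_def)
  have gle: "gnorm 2 g \<le> ennreal (16 * A) * gnorm 2 f"
  proof (rule LIMSEQ_le_const)
    have "gnorm 2 g \<le> 2 ^ 2 * (gnorm 2 (\<lambda>x. hsum T \<alpha> (c j) x - g x) + ennreal A * (2 ^ 2 * (gnorm 2 (\<lambda>x. p j x - f x) + gnorm 2 f)))" for j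
    proof -
      have "gnorm 2 g \<le> 2 ^ 2 * (gnorm 2 (\<lambda>x. g x - hsum T \<alpha> (c j) x) + gnorm 2 (hsum T \<alpha> (c j)))"
        by (rule gnorm_le_split) measurable
      also have "gnorm 2 (hsum T \<alpha> (c j)) \<le> ennreal A * gnorm 2 (p j)" by (rule Tp)
      also have "gnorm 2 (p j) \<le> 2 ^ 2 * (gnorm 2 (\<lambda>x. p j x - f x) + gnorm 2 f)"
        by (rule gnorm_le_split) measurable
      finally show ?thesis unfolding gnorm_minus_commute[of 2 g]
        by (simp add: mult_left_mono add_left_mono)
    qed
    then show "\<exists>N. \<forall>n\<ge>N. gnorm 2 g \<le> 2 ^ 2 * (gnorm 2 (\<lambda>x. hsum T \<alpha> (c n) x - g x) + ennreal A * (2 ^ 2 * (gnorm 2 (\<lambda>x. p n x - f x) + gnorm 2 f)))"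
      by blast
    have four: "(2::ennreal) ^ 2 < top" using power_less_top_ennreal[of 2 2] by simp
    have "(\<lambda>j. 2 ^ 2 * (gnorm 2 (\<lambda>x. hsum T \<alpha> (c j) x - g x) + ennreal A * (2 ^ 2 * (gnorm 2 (\<lambda>x. p j x - f x) + gnorm 2 f))))
        \<longlonglongrightarrow> 2 ^ 2 * (0 + ennreal A * (2 ^ 2 * (0 + gnorm 2 f)))"
      by (intro ennreal_tendsto_cmult tendsto_add tendsto_const lg lp four) auto
    also have "2 ^ 2 * (0 + ennreal A * (2 ^ 2 * (0 + gnorm 2 f))) = ennreal (16 * A) * gnorm 2 f"
    proof -
      have "ennreal (16 * A) = 16 * ennreal A" using A by (simp add: ennreal_mult)
      moreover have "2 ^ 2 * (0 + ennreal A * (2 ^ 2 * (0 + gnorm 2 f))) = (2 ^ 2 * 2 ^ 2) * ennreal A * gnorm 2 f"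
        by (simp only: add_0_left mult_ac)
      moreover have "2 ^ 2 * 2 ^ 2 = (16 :: ennreal)" by simp
      ultimately show ?thesis by (simp only:)
    qed
    finally show "(\<lambda>j. 2 ^ 2 * (gnorm 2 (\<lambda>x. hsum T \<alpha> (c j) x - g x) + ennreal A * (2 ^ 2 * (gnorm 2 (\<lambda>x. p j x - f x) + gnorm 2 f))))
        \<longlonglongrightarrow> ennreal (16 * A) * gnorm 2 f" .
  qed
  have trunc_hsum: "trunc_riesz \<alpha> (ep m) (hpoly d) = hsum (\<lambda>\<beta>. trunc_mult k (ep m) (sum \<beta> UNIV)) \<alpha> d"
    if "finite {\<beta>. d \<beta> \<noteq> 0}" for d m
    using trunc_riesz_hsum[OF assms(3) ep that] by (auto simp: k_def)
  have trunc_diff: "gnorm 2 (\<lambda>x. trunc_riesz \<alpha> (ep m) (p i) x - trunc_riesz \<alpha> (ep m) (p j) x) \<le> ennreal A * gnorm 2 (\<lambda>x. p i x - p j x)" for m i j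
  proof -
    have eq: "(\<lambda>x. hsum t \<sigma> (c i) x - hsum t \<sigma> (c j) x) = hsum t \<sigma> (\<lambda>\<beta>. c i \<beta> - c j \<beta>)" for t \<sigma>
      using hsum_diff(1)[OF c c] by auto
    have "gnorm 2 (hsum (\<lambda>\<beta>. trunc_mult k (ep m) (sum \<beta> UNIV)) \<alpha> (\<lambda>\<beta>. c i \<beta> - c j \<beta>)) \<le>
        ennreal A * gnorm 2 (hpoly (\<lambda>\<beta>. c i \<beta> - c j \<beta>))"
    proof (intro hsum_bound hsum_diff(2) c bound)
      fix \<beta> :: "'n \<Rightarrow> nat"
      show "\<bar>trunc_mult k (ep m) (sum \<beta> UNIV)\<bar> \<le> T \<beta>"
        using trunc_mult_bounds[OF kpos ep, of m "sum \<beta> UNIV"] by (simp add: T_def)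
    qed (use A in auto)
    then show ?thesis unfolding p_def trunc_hsum[OF c] eq .
  qed
  have trunc_lim: "(\<lambda>j. trunc_riesz \<alpha> (ep m) (p j) x) \<longlonglongrightarrow> trunc_riesz \<alpha> (ep m) f x" for m x
  proof -
    have "(\<lambda>j. gnorm 1 (\<lambda>x. p j x - f x)) \<longlonglongrightarrow> 0" by (intro gnorm_1_tendsto_0 lp) measurable
    then have "(\<lambda>j. ennreal (LINT y|gauss. norm (p j y - f y))) \<longlonglongrightarrow> ennreal 0"
      using pint fint unfolding gnorm_def by (subst (asm) nn_integral_eq_integral) auto
    then have "(\<lambda>j. LINT y|gauss. norm (p j y - f y)) \<longlonglongrightarrow> 0"
      by (subst (asm) tendsto_ennreal_iff) (auto intro!: Bochner_Integration.integral_nonneg)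
    then have "(\<lambda>j. kconst \<alpha> (ep m) x * (LINT y|gauss. norm (p j y - f y))) \<longlonglongrightarrow> kconst \<alpha> (ep m) x * 0"
      by (intro tendsto_intros)
    then have "(\<lambda>j. trunc_riesz \<alpha> (ep m) (p j) x - trunc_riesz \<alpha> (ep m) f x) \<longlonglongrightarrow> 0"
    proof (rule Lim_null_comparison[rotated, OF tendsto_eq_rhs])
      have "norm (trunc_riesz \<alpha> (ep m) (p j) x - trunc_riesz \<alpha> (ep m) f x) \<le> kconst \<alpha> (ep m) x * (LINT y|gauss. norm (p j y - f y))" for j
        unfolding trunc_riesz_diff[OF assms(3) ep pint fint, symmetric]
        by (rule trunc_riesz_integrable(2)[OF assms(3) ep Bochner_Integration.integrable_diff[OF pint fint]])
      then show "\<forall>\<^sub>F j in sequentially. norm (trunc_riesz \<alpha> (ep m) (p j) x - trunc_riesz \<alpha> (ep m) f x) \<le> kconst \<alpha> (ep m) x * (LINT y|gauss. norm (p j y - f y))"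
        by (intro always_eventually allI)
    qed simp
    then show ?thesis by (rule LIM_zero_cancel)
  qed
  have "(\<lambda>m. gnorm 2 (\<lambda>x. trunc_riesz \<alpha> (ep m) f x - g x)) \<longlonglongrightarrow> 0"
  proof (rule ennreal_tendsto_0I)
    fix e :: real assume e: "e > 0"
    define d where "d = e / 48"
    have d: "d > 0" using e by (simp add: d_def)
    have "d / A > 0" using d A by simp
    from gnorm_cauchy[OF _ fm lp this]
    obtain N where N: "\<forall>i\<ge>N. \<forall>j\<ge>N. gnorm 2 (\<lambda>x. p i x - p j x) \<le> ennreal (d / A)" by auto
    have "\<forall>\<^sub>F j in sequentially. gnorm 2 (\<lambda>x. hsum T \<alpha> (c j) x - g x) < ennreal d"
      using d by (intro order_tendstoD[OF lg]) simp
    then obtain N' where N': "\<And>j. j \<ge> N' \<Longrightarrow> gnorm 2 (\<lambda>x. hsum T \<alpha> (c j) x - g x) < ennreal d"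
      by (auto simp: eventually_sequentially)
    define j where "j = max N N'"
    have 3: "gnorm 2 (\<lambda>x. hsum T \<alpha> (c j) x - g x) \<le> ennreal d" using N'[of j] by (simp add: j_def less_imp_le)
    have 1: "gnorm 2 (\<lambda>x. trunc_riesz \<alpha> (ep m) f x - trunc_riesz \<alpha> (ep m) (p j) x) \<le> ennreal d" for m
    proof (rule gnorm_fatou[where u = "\<lambda>i x. trunc_riesz \<alpha> (ep m) (p i) x - trunc_riesz \<alpha> (ep m) (p j) x"])
      show "AE x in gauss. (\<lambda>i. trunc_riesz \<alpha> (ep m) (p i) x - trunc_riesz \<alpha> (ep m) (p j) x) \<longlonglongrightarrow> trunc_riesz \<alpha> (ep m) f x - trunc_riesz \<alpha> (ep m) (p j) x"
        by (intro always_eventually allI tendsto_intros trunc_lim)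
      show "\<forall>\<^sub>F i in sequentially. gnorm 2 (\<lambda>x. trunc_riesz \<alpha> (ep m) (p i) x - trunc_riesz \<alpha> (ep m) (p j) x) \<le> ennreal d"
      proof (rule eventually_sequentiallyI)
        fix i assume "N \<le> i"
        have "gnorm 2 (\<lambda>x. trunc_riesz \<alpha> (ep m) (p i) x - trunc_riesz \<alpha> (ep m) (p j) x) \<le> ennreal A * gnorm 2 (\<lambda>x. p i x - p j x)"
          by (rule trunc_diff)
        also have "\<dots> \<le> ennreal A * ennreal (d / A)"
          using N \<open>N \<le> i\<close> by (intro mult_left_mono) (auto simp: j_def)
        also have "\<dots> = ennreal d" using A d by (simp flip: ennreal_mult)
        finally show "gnorm 2 (\<lambda>x. trunc_riesz \<alpha> (ep m) (p i) x - trunc_riesz \<alpha> (ep m) (p j) x) \<le> ennreal d" .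
      qed
    qed measurable
    let ?E = "\<lambda>m. gnorm 2 (\<lambda>x. trunc_riesz \<alpha> (ep m) (p j) x - hsum T \<alpha> (c j) x)"
    have "?E m = ennreal (\<Sum>\<beta> | c j \<beta> \<noteq> 0. (trunc_mult k (ep m) (sum \<beta> UNIV) - T \<beta>)\<^sup>2 * (norm (c j \<beta>))\<^sup>2 * mfact (\<lambda>i. \<beta> i + \<alpha> i))" for m
      unfolding p_def trunc_hsum[OF c] hsum_scale_diff[symmetric] by (rule hsum_gnorm[OF c])
    moreover have "(\<lambda>m. \<Sum>\<beta> | c j \<beta> \<noteq> 0. (trunc_mult k (ep m) (sum \<beta> UNIV) - T \<beta>)\<^sup>2 * (norm (c j \<beta>))\<^sup>2 * mfact (\<lambda>i. \<beta> i + \<alpha> i))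
      \<longlonglongrightarrow> (\<Sum>\<beta> | c j \<beta> \<noteq> 0. (T \<beta> - T \<beta>)\<^sup>2 * (norm (c j \<beta>))\<^sup>2 * mfact (\<lambda>i. \<beta> i + \<alpha> i))"
      unfolding ep_def by (intro tendsto_intros, unfold T_def) (rule trunc_mult_tendsto[OF kpos])
    ultimately have "?E \<longlonglongrightarrow> 0"
      using tendsto_ennrealI by fastforce
    then have "\<forall>\<^sub>F m in sequentially. ?E m < ennreal d" using d by (intro order_tendstoD) auto
    then show "\<forall>\<^sub>F m in sequentially. gnorm 2 (\<lambda>x. trunc_riesz \<alpha> (ep m) f x - g x) \<le> ennreal e"
    proof (rule eventually_mono)
      fix m assume 2: "?E m < ennreal d"
      let ?tf = "trunc_riesz \<alpha> (ep m) f" and ?tp = "trunc_riesz \<alpha> (ep m) (p j)" and ?h = "hsum T \<alpha> (c j)"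
      have "gnorm 2 (\<lambda>x. ?tf x - g x) \<le> 2 ^ 2 * (gnorm 2 (\<lambda>x. ?tf x - ?tp x) + gnorm 2 (\<lambda>x. ?tp x - g x))"
      proof (rule gnorm_triangle)
        show "norm (?tf x - g x) \<le> norm (?tf x - ?tp x) + norm (?tp x - g x)" for x
          using norm_triangle_ineq[of "?tf x - ?tp x" "?tp x - g x"] by simp
      qed measurable
      also have "gnorm 2 (\<lambda>x. ?tp x - g x) \<le> 2 ^ 2 * (gnorm 2 (\<lambda>x. ?tp x - ?h x) + gnorm 2 (\<lambda>x. ?h x - g x))"
      proof (rule gnorm_triangle)
        show "norm (?tp x - g x) \<le> norm (?tp x - ?h x) + norm (?h x - g x)" for x
          using norm_triangle_ineq[of "?tp x - ?h x" "?h x - g x"] by simp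
      qed measurable
      finally have "gnorm 2 (\<lambda>x. ?tf x - g x) \<le> 2 ^ 2 * (gnorm 2 (\<lambda>x. ?tf x - ?tp x) + 2 ^ 2 * (gnorm 2 (\<lambda>x. ?tp x - ?h x) + gnorm 2 (\<lambda>x. ?h x - g x)))"
        by (simp add: mult_left_mono add_left_mono)
      also have "\<dots> \<le> 2 ^ 2 * (ennreal d + 2 ^ 2 * (ennreal d + ennreal d))"
        using 1[of m] 2 3 by (intro mult_left_mono add_mono) auto
      also have "\<dots> = ennreal (4 * (d + 4 * (d + d)))"
      proof -
        have four: "2 ^ 2 * ennreal x = ennreal (4 * x)" for x by (simp add: ennreal_mult')
        have plus: "ennreal d + ennreal x = ennreal (d + x)" if "0 \<le> x" for x
          by (rule ennreal_plus[symmetric]) (use d that in auto)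
        have "0 \<le> d" "0 \<le> 4 * (d + d)" using d by auto
        then show ?thesis by (simp only: plus four)
      qed
      also have "\<dots> \<le> ennreal e" using e by (intro ennreal_leI) (simp add: d_def)
      finally show "gnorm 2 (\<lambda>x. ?tf x - g x) \<le> ennreal e" .
    qed
  qed
  then show ?thesis using gle by (intro that[OF R g]) (simp_all add: A_def k_def ep_def)
qed

section \<open>Estimates away from the support\<close>

lemma hermite_gauss_has_derivative:
  "(hermite_gauss \<alpha> has_derivative (\<lambda>h. \<Sum>i\<in>UNIV. h $ i * (- sqrt 2 * hermite_gauss (raise \<alpha> i) z))) (at z)"
proof -
  have "((\<lambda>y. exp (- (y \<bullet> y))) has_derivative (\<lambda>h. exp (- (z \<bullet> z)) * (- (2 * (z \<bullet> h))))) (at z)"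
    by (auto intro!: derivative_eq_intros simp: inner_commute)
  from has_derivative_mult[OF hermite_has_derivative[of \<alpha> z] this]
  have "((\<lambda>y. hermite \<alpha> y * exp (- (y \<bullet> y))) has_derivative (\<lambda>h. hermite \<alpha> z * (exp (- (z \<bullet> z)) * (- (2 * (z \<bullet> h)))) +
      (\<Sum>i\<in>UNIV. h $ i * (sqrt 2 * real (\<alpha> i) * hermite (lower \<alpha> i) z)) * exp (- (z \<bullet> z)))) (at z)" .
  also have "(\<lambda>h. hermite \<alpha> z * (exp (- (z \<bullet> z)) * (- (2 * (z \<bullet> h)))) +
      (\<Sum>i\<in>UNIV. h $ i * (sqrt 2 * real (\<alpha> i) * hermite (lower \<alpha> i) z)) * exp (- (z \<bullet> z))) =
      (\<lambda>h. \<Sum>i\<in>UNIV. h $ i * (- sqrt 2 * hermite_gauss (raise \<alpha> i) z))"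
  proof
    fix h :: "real ^ 'a"
    have "hermite \<alpha> z * (exp (- (z \<bullet> z)) * (- (2 * (z \<bullet> h)))) = (\<Sum>i\<in>UNIV. h $ i * (- sqrt 2 * (sqrt 2 * z $ i * hermite \<alpha> z)) * exp (- (z \<bullet> z)))"
      unfolding inner_vec_def sum_distrib_left sum_negf[symmetric] by (intro sum.cong refl) (simp add: mult_ac)
    note * = this
    show "hermite \<alpha> z * (exp (- (z \<bullet> z)) * (- (2 * (z \<bullet> h)))) +
      (\<Sum>i\<in>UNIV. h $ i * (sqrt 2 * real (\<alpha> i) * hermite (lower \<alpha> i) z)) * exp (- (z \<bullet> z)) =
      (\<Sum>i\<in>UNIV. h $ i * (- sqrt 2 * hermite_gauss (raise \<alpha> i) z))"
      unfolding * sum_distrib_right sum.distrib[symmetric] hermite_gauss_def hermite_raise power2_norm_eq_inner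
      by (intro sum.cong refl) (simp add: algebra_simps)
  qed
  finally show ?thesis by (simp add: hermite_gauss_def[abs_def] power2_norm_eq_inner)
qed

lemma hermite_gauss_derivative_bound:
  fixes \<alpha> :: "'n::finite \<Rightarrow> nat"
  shows "\<exists>C\<ge>0. \<forall>z h. \<bar>\<Sum>i\<in>UNIV. h $ i * (- sqrt 2 * hermite_gauss (raise \<alpha> i) z)\<bar> \<le> C * exp (- (1/2) * (norm z)\<^sup>2) * norm h"
proof -
  have "\<forall>i. \<exists>C. C \<ge> 0 \<and> (\<forall>z. \<bar>hermite_gauss (raise \<alpha> i) z\<bar> \<le> C * exp (- (1/2) * (norm z)\<^sup>2))"
    using hermite_gauss_decay[of "1/2"] by auto
  from choice[OF this] obtain C where C: "\<forall>i. C i \<ge> 0 \<and> (\<forall>z. \<bar>hermite_gauss (raise \<alpha> i) z\<bar> \<le> C i * exp (- (1/2) * (norm z)\<^sup>2))" ..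
  have "\<bar>\<Sum>i\<in>UNIV. h $ i * (- sqrt 2 * hermite_gauss (raise \<alpha> i) z)\<bar> \<le> (\<Sum>i\<in>UNIV. sqrt 2 * C i) * exp (- (1/2) * (norm z)\<^sup>2) * norm h" for z h
  proof -
    have "\<bar>\<Sum>i\<in>UNIV. h $ i * (- sqrt 2 * hermite_gauss (raise \<alpha> i) z)\<bar> \<le> (\<Sum>i\<in>UNIV. norm h * (sqrt 2 * (C i * exp (- (1/2) * (norm z)\<^sup>2))))"
    proof (rule order_trans[OF sum_abs], rule sum_mono)
      fix i
      have "\<bar>h $ i * (- sqrt 2 * hermite_gauss (raise \<alpha> i) z)\<bar> = \<bar>h $ i\<bar> * (sqrt 2 * \<bar>hermite_gauss (raise \<alpha> i) z\<bar>)"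
        by (simp add: abs_mult)
      also have "\<dots> \<le> norm h * (sqrt 2 * (C i * exp (- (1/2) * (norm z)\<^sup>2)))"
        using C component_le_norm_cart[of h i] by (intro mult_mono mult_nonneg_nonneg) auto
      finally show "\<bar>h $ i * (- sqrt 2 * hermite_gauss (raise \<alpha> i) z)\<bar> \<le> norm h * (sqrt 2 * (C i * exp (- (1/2) * (norm z)\<^sup>2)))" .
    qed
    also have "\<dots> = (\<Sum>i\<in>UNIV. sqrt 2 * C i) * exp (- (1/2) * (norm z)\<^sup>2) * norm h"
      unfolding sum_distrib_right by (intro sum.cong refl) (simp add: mult_ac)
    finally show ?thesis .
  qed
  moreover have "(\<Sum>i\<in>UNIV. sqrt 2 * C i) \<ge> 0" using C by (intro sum_nonneg) auto
  ultimately show ?thesis by blast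
qed

lemma hermite_gauss_integrals:
  fixes \<alpha> :: "'n::finite \<Rightarrow> nat"
  obtains C where "C \<ge> 0"
    "(\<integral>\<^sup>+z. ennreal \<bar>hermite_gauss \<alpha> z\<bar> \<partial>lborel) \<le> ennreal C"
    "(\<integral>\<^sup>+z. ennreal (norm z * \<bar>hermite_gauss \<alpha> z\<bar>) \<partial>lborel) \<le> ennreal C"
proof -
  have g: "exp_growth (\<lambda>z::real^'n. norm z)"
    by (rule exp_growthI[of _ 1 1]) (use exp_ge_add_one_self order_trans[of _ "1 + _"] in \<open>auto intro: order_trans[OF _ exp_ge_add_one_self]\<close>)
  have 1: "integrable lborel (\<lambda>z. \<bar>hermite_gauss \<alpha> z\<bar>)"
    using exp_growth_integrable_lborel[OF exp_growth_hermite hermite_measurable, of 1 \<alpha>]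
    unfolding hermite_gauss_def by (intro integrable_abs) (simp add: mult.commute)
  have "integrable lborel (\<lambda>z::real^'n. exp (- 1 * (norm z)\<^sup>2) *\<^sub>R (norm z * hermite \<alpha> z))"
    by (intro exp_growth_integrable_lborel exp_growth_mult g exp_growth_hermite) auto
  then have "integrable lborel (\<lambda>z. norm (exp (- 1 * (norm z)\<^sup>2) *\<^sub>R (norm z * hermite \<alpha> z)))" by (rule integrable_norm)
  then have 2: "integrable lborel (\<lambda>z. norm z * \<bar>hermite_gauss \<alpha> z\<bar>)"
    unfolding hermite_gauss_def by (simp add: abs_mult mult_ac)
  define a b where "a = (LINT z|lborel. \<bar>hermite_gauss \<alpha> z\<bar>)" and "b = (LINT z|lborel. norm z * \<bar>hermite_gauss \<alpha> z\<bar>)"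
  have ab: "a \<ge> 0" "b \<ge> 0" unfolding a_def b_def by (intro Bochner_Integration.integral_nonneg; simp)+
  show ?thesis
  proof (rule that[of "a + b"])
    show "(\<integral>\<^sup>+z. ennreal \<bar>hermite_gauss \<alpha> z\<bar> \<partial>lborel) \<le> ennreal (a + b)"
      using nn_integral_eq_integral[OF 1] ab by (simp add: a_def)
    show "(\<integral>\<^sup>+z. ennreal (norm z * \<bar>hermite_gauss \<alpha> z\<bar>) \<partial>lborel) \<le> ennreal (a + b)"
      using nn_integral_eq_integral[OF 2] ab by (simp add: b_def)
  qed (use ab in auto)
qed

text \<open>For small \<open>h\<close> by the mean value theorem and the decay of the gradient, for large \<open>h\<close> by the
  triangle inequality.\<close>

lemma hermite_gauss_translation:
  fixes \<alpha> :: "'n::finite \<Rightarrow> nat"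
  shows "\<exists>C\<ge>0. \<forall>h. (\<integral>\<^sup>+z. ennreal \<bar>hermite_gauss \<alpha> (z + h) - hermite_gauss \<alpha> z\<bar> \<partial>lborel) \<le> ennreal (C * norm h)"
proof -
  obtain A where A: "A \<ge> 0" "\<And>z h. \<bar>\<Sum>i\<in>UNIV. h $ i * (- sqrt 2 * hermite_gauss (raise \<alpha> i) z)\<bar> \<le> A * exp (- (1/2) * (norm z)\<^sup>2) * norm h"
    using hermite_gauss_derivative_bound[of \<alpha>] by auto
  obtain B where B: "B \<ge> 0" "(\<integral>\<^sup>+z. ennreal \<bar>hermite_gauss \<alpha> z\<bar> \<partial>lborel) \<le> ennreal B"
    using hermite_gauss_integrals[of \<alpha>] by metis
  define E where "E = (LINT z|(lborel :: (real ^ 'n) measure). exp (- (1/4) * (norm z)\<^sup>2))"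
  have i: "integrable lborel (\<lambda>z :: real ^ 'n. exp (- (1/4) * (norm z)\<^sup>2))" by (rule integrable_exp_quadratic) simp
  have E: "(\<integral>\<^sup>+z. ennreal (exp (- (1/4) * (norm (z :: real ^ 'n))\<^sup>2)) \<partial>lborel) = ennreal E" "E \<ge> 0"
    unfolding E_def by (intro nn_integral_eq_integral i, simp) (intro Bochner_Integration.integral_nonneg, simp)
  have small: "\<bar>hermite_gauss \<alpha> (z + h) - hermite_gauss \<alpha> z\<bar> \<le> A * exp (1/2) * norm h * exp (- (1/4) * (norm z)\<^sup>2)"
    if h: "norm h \<le> 1" for z h
  proof -
    have "norm (hermite_gauss \<alpha> (z + h) - hermite_gauss \<alpha> z) \<le> norm h * (A * exp (1/2) * exp (- (1/4) * (norm z)\<^sup>2))"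
    proof (rule differentiable_bound_segment[where G = UNIV and f' = "\<lambda>w h. \<Sum>i\<in>UNIV. h $ i * (- sqrt 2 * hermite_gauss (raise \<alpha> i) w)"])
      show "(hermite_gauss \<alpha> has_derivative (\<lambda>h. \<Sum>i\<in>UNIV. h $ i * (- sqrt 2 * hermite_gauss (raise \<alpha> i) w))) (at w within UNIV)" for w
        using hermite_gauss_has_derivative[of \<alpha> w] by simp
      fix \<tau> :: real assume \<tau>: "\<tau> \<in> {0..1}"
      let ?w = "z + \<tau> *\<^sub>R h"
      show "onorm (\<lambda>h. \<Sum>i\<in>UNIV. h $ i * (- sqrt 2 * hermite_gauss (raise \<alpha> i) ?w)) \<le> A * exp (1/2) * exp (- (1/4) * (norm z)\<^sup>2)"
      proof (rule onorm_le)
        fix v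
        have "norm (\<Sum>i\<in>UNIV. v $ i * (- sqrt 2 * hermite_gauss (raise \<alpha> i) ?w)) \<le> A * exp (- (1/2) * (norm ?w)\<^sup>2) * norm v"
          using A(2)[of v ?w] by simp
        also have "\<dots> \<le> A * (exp (1/2) * exp (- (1/4) * (norm z)\<^sup>2)) * norm v"
        proof (intro mult_right_mono mult_left_mono A)
          have "norm (\<tau> *\<^sub>R h) \<le> 1" using \<tau> h mult_mono[of \<tau> 1 "norm h" 1] by auto
          moreover have "norm z \<le> norm ?w + norm (\<tau> *\<^sub>R h)" using norm_triangle_ineq4[of ?w "\<tau> *\<^sub>R h"] by simp
          ultimately have "norm z \<le> norm ?w + 1" by linarith
          then have "(norm z)\<^sup>2 \<le> (norm ?w + 1)\<^sup>2" by (intro power_mono) auto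
          also have "\<dots> \<le> 2 * (norm ?w)\<^sup>2 + 2"
            using zero_le_power2[of "norm ?w - 1"] by (simp add: power2_sum power2_diff)
          finally have "- (1/2) * (norm ?w)\<^sup>2 \<le> 1/2 + - (1/4) * (norm z)\<^sup>2" by linarith
          then show "exp (- (1/2) * (norm ?w)\<^sup>2) \<le> exp (1/2) * exp (- (1/4) * (norm z)\<^sup>2)"
            unfolding exp_add[symmetric] by (rule exp_le_cancel_iff[THEN iffD2])
        qed auto
        finally show "norm (\<Sum>i\<in>UNIV. v $ i * (- sqrt 2 * hermite_gauss (raise \<alpha> i) ?w)) \<le> A * exp (1/2) * exp (- (1/4) * (norm z)\<^sup>2) * norm v"
          by (simp only: mult.assoc)
      qed
    qed auto
    then show ?thesis by (simp add: mult_ac)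
  qed
  define C where "C = A * exp (1/2) * E + 2 * B"
  have "(\<integral>\<^sup>+z. ennreal \<bar>hermite_gauss \<alpha> (z + h) - hermite_gauss \<alpha> z\<bar> \<partial>lborel) \<le> ennreal (C * norm h)" for h
  proof (cases "norm h \<le> 1")
    case True
    have "(\<integral>\<^sup>+z. ennreal \<bar>hermite_gauss \<alpha> (z + h) - hermite_gauss \<alpha> z\<bar> \<partial>lborel) \<le>
        (\<integral>\<^sup>+z. ennreal (A * exp (1/2) * norm h) * ennreal (exp (- (1/4) * (norm (z :: real ^ 'n))\<^sup>2)) \<partial>lborel)"
    proof (rule nn_integral_mono)
      fix z :: "real ^ 'n"
      have "ennreal (A * exp (1/2) * norm h) * ennreal (exp (- (1/4) * (norm z)\<^sup>2)) = ennreal (A * exp (1/2) * norm h * exp (- (1/4) * (norm z)\<^sup>2))"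
        using A(1) by (intro ennreal_mult[symmetric]) auto
      then show "ennreal \<bar>hermite_gauss \<alpha> (z + h) - hermite_gauss \<alpha> z\<bar> \<le> ennreal (A * exp (1/2) * norm h) * ennreal (exp (- (1/4) * (norm z)\<^sup>2))"
        using small[OF True, of z] by (simp only: ennreal_leI)
    qed
    also have "\<dots> = ennreal (A * exp (1/2) * norm h * E)"
      using A E by (subst nn_integral_cmult) (auto simp: ennreal_mult)
    also have "\<dots> \<le> ennreal (C * norm h)"
      using B by (intro ennreal_leI) (simp add: C_def algebra_simps)
    finally show ?thesis .
  next
    case False
    have "(\<integral>\<^sup>+z. ennreal \<bar>hermite_gauss \<alpha> (z + h) - hermite_gauss \<alpha> z\<bar> \<partial>lborel) \<le>
        (\<integral>\<^sup>+z. ennreal \<bar>hermite_gauss \<alpha> (h + 1 *\<^sub>R z)\<bar> + ennreal \<bar>hermite_gauss \<alpha> z\<bar> \<partial>lborel)"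
      by (intro nn_integral_mono) (auto simp: add.commute simp flip: ennreal_plus intro!: ennreal_leI)
    also have "\<dots> = (\<integral>\<^sup>+z. ennreal \<bar>hermite_gauss \<alpha> (h + 1 *\<^sub>R z)\<bar> \<partial>lborel) + (\<integral>\<^sup>+z. ennreal \<bar>hermite_gauss \<alpha> z\<bar> \<partial>lborel)"
      by (rule nn_integral_add) auto
    also have "(\<integral>\<^sup>+z. ennreal \<bar>hermite_gauss \<alpha> (h + 1 *\<^sub>R z)\<bar> \<partial>lborel) = (\<integral>\<^sup>+z. ennreal \<bar>hermite_gauss \<alpha> z\<bar> \<partial>lborel)"
      using nn_integral_lborel_affine[of "\<lambda>z. ennreal \<bar>hermite_gauss \<alpha> z\<bar>" 1 h] by simp
    also have "(\<integral>\<^sup>+z. ennreal \<bar>hermite_gauss \<alpha> z\<bar> \<partial>lborel) + (\<integral>\<^sup>+z. ennreal \<bar>hermite_gauss \<alpha> z\<bar> \<partial>lborel) \<le> ennreal B + ennreal B"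
      using B by (intro add_mono)
    also have "\<dots> \<le> ennreal (C * norm h)"
    proof -
      have "B + B \<le> 2 * B * norm h" using False B mult_left_mono[of 1 "norm h" "2 * B"] by simp
      also have "\<dots> \<le> C * norm h" using A E unfolding C_def by (intro mult_right_mono) auto
      finally show ?thesis using B by (simp flip: ennreal_plus add: ennreal_leI)
    qed
    finally show ?thesis .
  qed
  moreover have "C \<ge> 0" using A B E by (simp add: C_def)
  ultimately show ?thesis by blast
qed

lemma nn_integral_kernel_Tonelli:
  fixes L :: "real ^ 'n::finite \<Rightarrow> real ^ 'n \<Rightarrow> real" and f :: "real ^ 'n \<Rightarrow> complex"
  assumes [measurable]: "(\<lambda>(x, y). L x y) \<in> borel_measurable (borel \<Otimes>\<^sub>M borel)" "f \<in> borel_measurable borel" "X \<in> sets borel"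
    and C: "\<And>y. f y \<noteq> 0 \<Longrightarrow> (\<integral>\<^sup>+x. ennreal \<bar>L x y\<bar> * indicator X x \<partial>gauss) \<le> C"
    and int: "\<And>x. x \<in> X \<Longrightarrow> integrable gauss (\<lambda>y. L x y *\<^sub>R f y)"
  shows "(\<integral>\<^sup>+x. ennreal (norm (LINT y|gauss. L x y *\<^sub>R f y)) * indicator X x \<partial>gauss) \<le> C * gnorm 1 f"
proof -
  interpret pair_sigma_finite "gauss :: (real ^ 'n) measure" "gauss :: (real ^ 'n) measure" ..
  have "(\<integral>\<^sup>+x. ennreal (norm (LINT y|gauss. L x y *\<^sub>R f y)) * indicator X x \<partial>gauss) \<le>
      (\<integral>\<^sup>+x. (\<integral>\<^sup>+y. ennreal (\<bar>L x y\<bar> * norm (f y)) * indicator X x \<partial>gauss) \<partial>gauss)"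
  proof (rule nn_integral_mono)
    fix x :: "real ^ 'n"
    show "ennreal (norm (LINT y|gauss. L x y *\<^sub>R f y)) * indicator X x \<le> (\<integral>\<^sup>+y. ennreal (\<bar>L x y\<bar> * norm (f y)) * indicator X x \<partial>gauss)"
    proof (cases "x \<in> X")
      case True
      have "ennreal (norm (LINT y|gauss. L x y *\<^sub>R f y)) \<le> (\<integral>\<^sup>+y. ennreal (norm (L x y *\<^sub>R f y)) \<partial>gauss)"
        by (rule integral_norm_bound_ennreal[OF int[OF True]])
      then show ?thesis using True by simp
    qed simp
  qed
  also have "\<dots> = (\<integral>\<^sup>+y. (\<integral>\<^sup>+x. ennreal (\<bar>L x y\<bar> * norm (f y)) * indicator X x \<partial>gauss) \<partial>gauss)"
    by (rule Fubini') (simp add: borel_prod, measurable)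
  also have "\<dots> \<le> (\<integral>\<^sup>+y. C * ennreal (norm (f y)) \<partial>gauss)"
  proof (rule nn_integral_mono)
    fix y :: "real ^ 'n"
    show "(\<integral>\<^sup>+x. ennreal (\<bar>L x y\<bar> * norm (f y)) * indicator X x \<partial>gauss) \<le> C * ennreal (norm (f y))"
    proof (cases "f y = 0")
      case False
      have "(\<integral>\<^sup>+x. ennreal (\<bar>L x y\<bar> * norm (f y)) * indicator X x \<partial>gauss) = (\<integral>\<^sup>+x. ennreal (norm (f y)) * (ennreal \<bar>L x y\<bar> * indicator X x) \<partial>gauss)"
        by (intro nn_integral_cong) (simp add: ennreal_mult mult_ac)
      also have "\<dots> = ennreal (norm (f y)) * (\<integral>\<^sup>+x. ennreal \<bar>L x y\<bar> * indicator X x \<partial>gauss)"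
        by (rule nn_integral_cmult) measurable
      also have "\<dots> \<le> ennreal (norm (f y)) * C" by (intro mult_left_mono C False) simp
      finally show ?thesis by (simp add: mult.commute)
    qed simp
  qed
  also have "\<dots> = C * gnorm 1 f" unfolding gnorm_def by (simp add: nn_integral_cmult)
  finally show ?thesis .
qed

text \<open>The factor \<open>exp (|x|\<^sup>2)\<close> of the kernel cancels the density of the Gauss measure in \<open>x\<close>, and what
  remains is translation invariant. Estimates in the mean over \<open>x\<close> are thus uniform
  over the whole space.\<close>

lemma nn_integral_gauss_kernel:
  fixes g :: "real ^ 'n::finite \<Rightarrow> real" and J :: "real ^ 'n \<Rightarrow> ennreal"
  assumes [measurable]: "g \<in> borel_measurable borel" "J \<in> borel_measurable borel" and s: "s > 0"
  shows "(\<integral>\<^sup>+x. ennreal \<bar>exp ((norm x)\<^sup>2) * g ((1 / s) *\<^sub>R (x - b)) / s ^ (k + CARD('n))\<bar> * J x \<partial>gauss) =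
     ennreal (gauss_const TYPE('n) / s ^ k) * (\<integral>\<^sup>+z. ennreal \<bar>g z\<bar> * J (b + s *\<^sub>R z) \<partial>lborel)"
proof -
  let ?c = "gauss_const TYPE('n)"
  have "(\<integral>\<^sup>+x. ennreal \<bar>exp ((norm x)\<^sup>2) * g ((1 / s) *\<^sub>R (x - b)) / s ^ (k + CARD('n))\<bar> * J x \<partial>gauss) =
    (\<integral>\<^sup>+x. ennreal (?c / s ^ (k + CARD('n))) * (ennreal \<bar>g ((1 / s) *\<^sub>R (x - b))\<bar> * J x) \<partial>lborel)"
  proof (subst nn_integral_gauss, measurable, intro nn_integral_cong)
    fix x :: "real ^ 'n"
    have "(?c * exp (- (norm x)\<^sup>2)) * \<bar>exp ((norm x)\<^sup>2) * g ((1 / s) *\<^sub>R (x - b)) / s ^ (k + CARD('n))\<bar> =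
       (?c / s ^ (k + CARD('n))) * \<bar>g ((1 / s) *\<^sub>R (x - b))\<bar>"
      using s by (simp add: abs_mult exp_minus field_simps)
    then have "ennreal (?c * exp (- (norm x)\<^sup>2)) * ennreal \<bar>exp ((norm x)\<^sup>2) * g ((1 / s) *\<^sub>R (x - b)) / s ^ (k + CARD('n))\<bar> =
       ennreal (?c / s ^ (k + CARD('n))) * ennreal \<bar>g ((1 / s) *\<^sub>R (x - b))\<bar>"
      using s by (subst (1 2) ennreal_mult[symmetric]) (auto simp: less_imp_le intro!: divide_nonneg_nonneg)
    then show "ennreal (?c * exp (- (norm x)\<^sup>2)) * (ennreal \<bar>exp ((norm x)\<^sup>2) * g ((1 / s) *\<^sub>R (x - b)) / s ^ (k + CARD('n))\<bar> * J x) =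
       ennreal (?c / s ^ (k + CARD('n))) * (ennreal \<bar>g ((1 / s) *\<^sub>R (x - b))\<bar> * J x)"
      by (simp only: mult.assoc[symmetric])
  qed
  also have "\<dots> = ennreal (?c / s ^ (k + CARD('n))) * (\<integral>\<^sup>+x. ennreal \<bar>g ((1 / s) *\<^sub>R (x - b))\<bar> * J x \<partial>lborel)"
    by (rule nn_integral_cmult) measurable
  also have "(\<integral>\<^sup>+x. ennreal \<bar>g ((1 / s) *\<^sub>R (x - b))\<bar> * J x \<partial>lborel) =
     ennreal (s ^ CARD('n)) * (\<integral>\<^sup>+z. ennreal \<bar>g ((1 / s) *\<^sub>R (b + s *\<^sub>R z - b))\<bar> * J (b + s *\<^sub>R z) \<partial>lborel)"
    by (rule nn_integral_lborel_affine[OF _ s]) measurable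
  also have "(\<lambda>z. (1 / s) *\<^sub>R (b + s *\<^sub>R z - b)) = (\<lambda>z. z)" using s by auto
  finally show ?thesis using s
    by (simp add: mult.assoc[symmetric] ennreal_mult[symmetric] less_imp_le power_add)
qed

text \<open>Moving \<open>y\<close> translates the profile \<open>H\<^sub>\<alpha>(z) exp (- |z|\<^sup>2)\<close>, in units of the width, so that the mean
  regularity of the profile applies. This is used for large times, together with the
  cancellation of an atom.\<close>

lemma riesz_kernel_difference:
  fixes \<alpha> :: "'n::finite \<Rightarrow> nat"
  shows "\<exists>C\<ge>0. \<forall>t>0. \<forall>y c. (\<integral>\<^sup>+x. ennreal \<bar>riesz_kernel \<alpha> (exp (- t)) (spread t) x y - riesz_kernel \<alpha> (exp (- t)) (spread t) x c\<bar> \<partial>gauss)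
      \<le> ennreal (C * norm (y - c) / (spread t * spread t ^ sum \<alpha> UNIV))"
proof -
  obtain C where C: "C \<ge> 0" "\<And>h. (\<integral>\<^sup>+z. ennreal \<bar>hermite_gauss \<alpha> (z + h) - hermite_gauss \<alpha> z\<bar> \<partial>lborel) \<le> ennreal (C * norm h)"
    using hermite_gauss_translation[of \<alpha>] by auto
  let ?c = "gauss_const TYPE('n)" and ?k = "sum \<alpha> UNIV"
  have "(\<integral>\<^sup>+x. ennreal \<bar>riesz_kernel \<alpha> (exp (- t)) (spread t) x y - riesz_kernel \<alpha> (exp (- t)) (spread t) x c\<bar> \<partial>gauss)
      \<le> ennreal ((?c * C) * norm (y - c) / (spread t * spread t ^ ?k))" if t: "t > 0" for t y c
  proof -
    define r s where "r = exp (- t)" and "s = spread t"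
    have s: "s > 0" using spread_props[OF t] by (simp add: s_def)
    have r: "0 \<le> r" "r \<le> 1" using t by (auto simp: r_def)
    define h where "h = (r / s) *\<^sub>R (c - y)"
    have arg: "(1 / s) *\<^sub>R (x - r *\<^sub>R y) = (1 / s) *\<^sub>R (x - r *\<^sub>R c) + h" for x
      by (simp add: h_def algebra_simps divide_inverse)
    have "(\<integral>\<^sup>+x. ennreal \<bar>riesz_kernel \<alpha> r s x y - riesz_kernel \<alpha> r s x c\<bar> \<partial>gauss) =
      (\<integral>\<^sup>+x. ennreal \<bar>exp ((norm x)\<^sup>2) * (\<lambda>z. hermite_gauss \<alpha> (z + h) - hermite_gauss \<alpha> z) ((1 / s) *\<^sub>R (x - r *\<^sub>R c)) / s ^ (?k + CARD('n))\<bar> * 1 \<partial>gauss)"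
      unfolding riesz_kernel_def arg by (intro nn_integral_cong) (simp add: diff_divide_distrib right_diff_distrib)
    also have "\<dots> = ennreal (?c / s ^ ?k) * (\<integral>\<^sup>+z. ennreal \<bar>hermite_gauss \<alpha> (z + h) - hermite_gauss \<alpha> z\<bar> * 1 \<partial>lborel)"
      by (rule nn_integral_gauss_kernel[OF _ _ s]) measurable
    also have "\<dots> \<le> ennreal (?c / s ^ ?k) * ennreal (C * norm h)"
      using C by (intro mult_left_mono) auto
    also have "\<dots> = ennreal ((?c / s ^ ?k) * (C * norm h))"
      using s C by (intro ennreal_mult[symmetric]) (auto simp: less_imp_le)
    also have "\<dots> \<le> ennreal ((?c * C) * norm (y - c) / (s * s ^ ?k))"
    proof (rule ennreal_leI)
      have "norm h \<le> norm (y - c) / s"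
        using r s by (simp add: h_def norm_minus_commute abs_mult divide_right_mono mult_left_le_one_le)
      then have "(?c / s ^ ?k) * (C * norm h) \<le> (?c / s ^ ?k) * (C * (norm (y - c) / s))"
        using C s by (intro mult_left_mono) (auto simp: less_imp_le)
      then show "(?c / s ^ ?k) * (C * norm h) \<le> (?c * C) * norm (y - c) / (s * s ^ ?k)" by (simp add: mult_ac)
    qed
    finally show ?thesis by (simp add: r_def s_def)
  qed
  moreover have "?c * C \<ge> 0" using C by (simp add: less_imp_le)
  ultimately show ?thesis by blast
qed

text \<open>Mass at distance \<open>l\<close> from the centre \<open>exp (- t) y\<close> is estimated by Chebyshev's inequality with
  the first moment of the profile. This is used for small times.\<close>

lemma riesz_kernel_off_diagonal:
  fixes \<alpha> :: "'n::finite \<Rightarrow> nat"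
  shows "\<exists>C\<ge>0. \<forall>t>0. \<forall>l>0. \<forall>y X. X \<in> sets borel \<longrightarrow> (\<forall>x\<in>X. norm (x - exp (- t) *\<^sub>R y) \<ge> l) \<longrightarrow>
      (\<integral>\<^sup>+x. ennreal \<bar>riesz_kernel \<alpha> (exp (- t)) (spread t) x y\<bar> * indicator X x \<partial>gauss) \<le> ennreal (C * spread t / (l * spread t ^ sum \<alpha> UNIV))"
proof -
  obtain C where C: "C \<ge> 0" "(\<integral>\<^sup>+z. ennreal (norm z * \<bar>hermite_gauss \<alpha> z\<bar>) \<partial>lborel) \<le> ennreal C"
    using hermite_gauss_integrals[of \<alpha>] by metis
  let ?c = "gauss_const TYPE('n)" and ?k = "sum \<alpha> UNIV"
  have "(\<integral>\<^sup>+x. ennreal \<bar>riesz_kernel \<alpha> (exp (- t)) (spread t) x y\<bar> * indicator X x \<partial>gauss) \<le> ennreal ((?c * C) * spread t / (l * spread t ^ ?k))"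
    if t: "t > 0" and l: "l > 0" and X[measurable]: "X \<in> sets borel" and far: "\<forall>x\<in>X. norm (x - exp (- t) *\<^sub>R y) \<ge> l" for t l y X
  proof -
    define r s where "r = exp (- t)" and "s = spread t"
    have s: "s > 0" using spread_props[OF t] by (simp add: s_def)
    have "(\<integral>\<^sup>+x. ennreal \<bar>riesz_kernel \<alpha> r s x y\<bar> * indicator X x \<partial>gauss) =
       ennreal (?c / s ^ ?k) * (\<integral>\<^sup>+z. ennreal \<bar>hermite_gauss \<alpha> z\<bar> * indicator X (r *\<^sub>R y + s *\<^sub>R z) \<partial>lborel)"
      unfolding riesz_kernel_def by (rule nn_integral_gauss_kernel[OF _ _ s]) measurable
    also have "\<dots> \<le> ennreal (?c / s ^ ?k) * (\<integral>\<^sup>+z. ennreal (s / l) * ennreal (norm z * \<bar>hermite_gauss \<alpha> z\<bar>) \<partial>lborel)"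
    proof (intro mult_left_mono nn_integral_mono)
      fix z :: "real ^ 'n"
      show "ennreal \<bar>hermite_gauss \<alpha> z\<bar> * indicator X (r *\<^sub>R y + s *\<^sub>R z) \<le> ennreal (s / l) * ennreal (norm z * \<bar>hermite_gauss \<alpha> z\<bar>)"
      proof (cases "r *\<^sub>R y + s *\<^sub>R z \<in> X")
        case True
        then have "l \<le> norm (s *\<^sub>R z)" using far by (force simp: r_def)
        then have "1 \<le> (s / l) * norm z" using s l by (simp add: field_simps)
        then have "\<bar>hermite_gauss \<alpha> z\<bar> \<le> (s / l) * norm z * \<bar>hermite_gauss \<alpha> z\<bar>"
          using mult_right_mono[of 1 "(s / l) * norm z" "\<bar>hermite_gauss \<alpha> z\<bar>"] by simp
        then have "ennreal \<bar>hermite_gauss \<alpha> z\<bar> \<le> ennreal ((s / l) * (norm z * \<bar>hermite_gauss \<alpha> z\<bar>))"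
          by (intro ennreal_leI) (simp add: mult.assoc)
        also have "\<dots> = ennreal (s / l) * ennreal (norm z * \<bar>hermite_gauss \<alpha> z\<bar>)"
          using s l by (intro ennreal_mult) auto
        finally show ?thesis using True by simp
      qed simp
    qed simp
    also have "(\<integral>\<^sup>+z. ennreal (s / l) * ennreal (norm z * \<bar>hermite_gauss \<alpha> z\<bar>) \<partial>lborel) = ennreal (s / l) * (\<integral>\<^sup>+z. ennreal (norm z * \<bar>hermite_gauss \<alpha> z\<bar>) \<partial>lborel)"
      by (rule nn_integral_cmult) measurable
    also have "ennreal (?c / s ^ ?k) * (ennreal (s / l) * (\<integral>\<^sup>+z. ennreal (norm z * \<bar>hermite_gauss \<alpha> z\<bar>) \<partial>lborel))
       \<le> ennreal (?c / s ^ ?k) * (ennreal (s / l) * ennreal C)"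
      using C by (intro mult_left_mono) auto
    also have "\<dots> = ennreal ((?c / s ^ ?k) * ((s / l) * C))"
    proof -
      have "0 \<le> ?c / s ^ ?k" "0 \<le> s / l" using s l by (auto simp: less_imp_le)
      then show ?thesis using C(1) by (simp only: ennreal_mult mult_nonneg_nonneg)
    qed
    also have "(?c / s ^ ?k) * ((s / l) * C) = (?c * C) * s / (l * s ^ ?k)" by (simp add: mult_ac)
    finally show ?thesis by (simp add: r_def s_def)
  qed
  moreover have "?c * C \<ge> 0" using C by (simp add: less_imp_le)
  ultimately show ?thesis by blast
qed

text \<open>As \<open>spread t\<close> squared is \<open>1 - exp (- 2 t)\<close>, the quotient is at most \<open>1 + t\<close>, and exponentials beat
  powers.\<close>

lemma polynomial_times_exp_bounded:
  assumes "p \<ge> 0"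
  shows "\<exists>C\<ge>0. \<forall>t>0. (t / (spread t)\<^sup>2) powr p * exp (- t) \<le> C"
proof -
  obtain N :: nat where N: "p \<le> real N" using real_arch_simple by blast
  have "(t / (spread t)\<^sup>2) powr p * exp (- t) \<le> fact N * exp 1" if t: "t > 0" for t
  proof -
    have s: "(spread t)\<^sup>2 = 1 - exp (- (2 * t))" "(spread t)\<^sup>2 > 0"
      using spread_props[OF t] by (auto simp: exp_double power2_eq_square[symmetric] algebra_simps simp flip: exp_of_nat_mult mult_exp_exp)
    have "1 + 2 * t \<le> exp (2 * t)" by (rule exp_ge_add_one_self)
    then have "exp (- (2 * t)) \<le> 1 / (1 + 2 * t)"
      using t by (simp add: exp_minus field_simps)
    then have "(1 - 1 / (1 + 2 * t)) \<le> (spread t)\<^sup>2" using s by simp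
    moreover have "1 - 1 / (1 + 2 * t) = 2 * t / (1 + 2 * t)" using t by (simp add: field_simps)
    ultimately have "2 * t \<le> (spread t)\<^sup>2 * (1 + 2 * t)" using t by (simp add: field_simps)
    also have "\<dots> \<le> (spread t)\<^sup>2 * (2 * (1 + t))" using s(2) by (intro mult_left_mono) auto
    finally have "t / (spread t)\<^sup>2 \<le> 1 + t" using s(2) by (simp add: field_simps)
    then have "(t / (spread t)\<^sup>2) powr p \<le> (1 + t) powr p"
      using assms t s(2) by (intro powr_mono2) auto
    also have "\<dots> \<le> (1 + t) powr (real N)" using N t by (intro powr_mono) auto
    also have "\<dots> = (1 + t) ^ N" using t by (simp add: powr_realpow)
    also have "\<dots> \<le> fact N * exp (1 + t)"
    proof -
      have "(1 + t) ^ N /\<^sub>R fact N \<le> (\<Sum>n. (1 + t) ^ n /\<^sub>R fact n)"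
        using sum_le_suminf[OF summable_exp_generic, of "{N}" "1 + t"] t by simp
      then have "(1 + t) ^ N / fact N \<le> exp (1 + t)" by (simp add: exp_def divide_inverse mult.commute)
      then show ?thesis by (simp add: field_simps)
    qed
    finally have "(t / (spread t)\<^sup>2) powr p * exp (- t) \<le> (fact N * exp (1 + t)) * exp (- t)" by (intro mult_right_mono) auto
    also have "\<dots> = fact N * exp 1" by (simp add: exp_add exp_minus)
    finally show ?thesis .
  qed
  then show ?thesis by (intro exI[of _ "fact N * exp 1"]) auto
qed

lemma gamma_weight_bounds:
  assumes k: "k > 0"
  shows "\<exists>C\<ge>0. \<forall>t>0. gamma_weight k t * (spread t / spread t ^ k) \<le> C * t powr (- 1/2) \<and> gamma_weight k t * (1 / (spread t * spread t ^ k)) \<le> C * t powr (- 3/2)"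
proof -
  define a where "a = real k / 2"
  have G: "Gamma a > 0" using k by (intro Gamma_real_pos) (simp add: a_def)
  obtain C1 where C1: "C1 \<ge> 0" "\<And>t. t > 0 \<Longrightarrow> (t / (spread t)\<^sup>2) powr (a - 1/2) * exp (- t) \<le> C1"
    using polynomial_times_exp_bounded[of "a - 1/2"] k by (auto simp: a_def)
  obtain C2 where C2: "C2 \<ge> 0" "\<And>t. t > 0 \<Longrightarrow> (t / (spread t)\<^sup>2) powr (a + 1/2) * exp (- t) \<le> C2"
    using polynomial_times_exp_bounded[of "a + 1/2"] k by (auto simp: a_def)
  let ?C = "(C1 + C2) / Gamma a"
  have "gamma_weight k t * (spread t / spread t ^ k) \<le> ?C * t powr (- 1/2) \<and> gamma_weight k t * (1 / (spread t * spread t ^ k)) \<le> ?C * t powr (- 3/2)" if t: "t > 0" for t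
  proof -
    define q where "q = (spread t)\<^sup>2"
    have q: "q > 0" and st: "spread t > 0" using spread_props[OF t] by (auto simp: q_def)
    have s1: "spread t = q powr (1/2)" using st by (simp add: q_def powr_half_sqrt)
    have s2: "spread t ^ k = q powr a"
      using st q by (simp add: s1 a_def powr_powr flip: powr_realpow)
    have div: "(t / q) powr b = t powr b / q powr b" for b using t q by (simp add: powr_divide)
    have t1: "t powr (a - 1) = t powr (- 1/2) * t powr (a - 1/2)"
      and t2: "t powr (a - 1) = t powr (- 3/2) * t powr (a + 1/2)" by (simp_all flip: powr_add)
    have "q powr a = q powr (1/2) * q powr (a - 1/2)" by (simp flip: powr_add)
    then have q1: "q powr (1/2) / q powr a = 1 / q powr (a - 1/2)" using q by simp
    have q2: "q powr (1/2) * q powr a = q powr (a + 1/2)" by (simp add: add.commute flip: powr_add)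
    have e1: "t powr (a - 1) * (q powr (1/2) / q powr a) = t powr (- 1/2) * (t / q) powr (a - 1/2)"
      unfolding div t1 q1 by simp
    have e2: "t powr (a - 1) * (1 / (q powr (1/2) * q powr a)) = t powr (- 3/2) * (t / q) powr (a + 1/2)"
      unfolding div t2 q2 by simp
    have "gamma_weight k t * (spread t / spread t ^ k) = (t powr (a - 1) * (q powr (1/2) / q powr a)) * exp (- t) / Gamma a"
      unfolding s2 unfolding s1 gamma_weight_def a_def by (simp add: mult_ac)
    also have "\<dots> = t powr (- 1/2) * ((t / q) powr (a - 1/2) * exp (- t)) / Gamma a" unfolding e1 by simp
    also have "\<dots> \<le> t powr (- 1/2) * (C1 + C2) / Gamma a"
      using C1(2)[OF t] C2(1) G by (intro divide_right_mono mult_left_mono) (auto simp: q_def)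
    finally have 1: "gamma_weight k t * (spread t / spread t ^ k) \<le> ?C * t powr (- 1/2)" by (simp add: mult_ac)
    have "gamma_weight k t * (1 / (spread t * spread t ^ k)) = (t powr (a - 1) * (1 / (q powr (1/2) * q powr a))) * exp (- t) / Gamma a"
      unfolding s2 unfolding s1 gamma_weight_def a_def by (simp add: mult_ac)
    also have "\<dots> = t powr (- 3/2) * ((t / q) powr (a + 1/2) * exp (- t)) / Gamma a" unfolding e2 by simp
    also have "\<dots> \<le> t powr (- 3/2) * (C1 + C2) / Gamma a"
      using C2(2)[OF t] C1(1) G by (intro divide_right_mono mult_left_mono) (auto simp: q_def)
    finally have 2: "gamma_weight k t * (1 / (spread t * spread t ^ k)) \<le> ?C * t powr (- 3/2)" by (simp add: mult_ac)
    show ?thesis using 1 2 by blast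
  qed
  moreover have "?C \<ge> 0" using C1 C2 G by simp
  ultimately show ?thesis by blast
qed

lemma nn_integral_powr_near_0:
  assumes "l > 0"
  shows "(\<integral>\<^sup>+t. ennreal (t powr (- 1/2)) * indicator {0..l\<^sup>2} t \<partial>lborel) = ennreal (2 * l)"
proof -
  have "((\<lambda>x. x powr (- 1/2)) has_integral ((l\<^sup>2) powr (- 1/2 + 1) / (- 1/2 + 1))) {0..l\<^sup>2}"
    by (rule has_integral_powr_from_0) auto
  moreover have eq: "(l\<^sup>2) powr (- 1/2 + 1) / (- 1/2 + 1) = 2 * l" using assms by (simp add: powr_half_sqrt)
  ultimately have "((\<lambda>x. x powr (- 1/2)) has_integral (2 * l)) {0..l\<^sup>2}" by (simp only: eq)
  then show ?thesis by (rule nn_integral_has_integral_lebesgue'[rotated]) simp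
qed

lemma nn_integral_powr_near_infinity:
  assumes "l > 0"
  shows "(\<integral>\<^sup>+t. ennreal (t powr (- 3/2)) * indicator {l\<^sup>2..} t \<partial>lborel) = ennreal (2 / l)"
proof -
  have "((\<lambda>x. x powr (- 3/2)) has_integral (- ((l\<^sup>2) powr (- 3/2 + 1)) / (- 3/2 + 1))) {l\<^sup>2..}"
    using assms by (intro has_integral_powr_to_inf) auto
  moreover have eq: "- ((l\<^sup>2) powr (- 3/2 + 1)) / (- 3/2 + 1) = 2 / l"
  proof -
    have "- 3/2 + 1 = - (1/2 :: real)" by simp
    moreover have "(l\<^sup>2) powr (- (1/2)) = 1 / (l\<^sup>2) powr (1/2)" by (rule powr_minus_divide)
    moreover have "(l\<^sup>2) powr (1/2) = l" using assms by (simp add: powr_half_sqrt)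
    ultimately show ?thesis by (simp only:) simp
  qed
  ultimately have "((\<lambda>x. x powr (- 3/2)) has_integral (2 / l)) {l\<^sup>2..}" by (simp only: eq)
  then show ?thesis by (rule nn_integral_has_integral_lebesgue'[rotated]) simp
qed

text \<open>The integral over time is split at \<open>t = l\<^sup>2\<close>. Before that the kernel has not yet spread from
  \<open>exp (- t) y\<close> to \<open>X\<close>; after that the mean value zero of \<open>f\<close> permits subtracting the kernel at
  the centre \<open>c\<close>. The two contributions are at most \<open>l\<^sup>-\<^sup>1 \<integral> t\<^sup>-\<^sup>1\<^sup>/\<^sup>2\<close> over \<open>[0, l\<^sup>2]\<close> and \<open>l \<integral> t\<^sup>-\<^sup>3\<^sup>/\<^sup>2\<close>
  over \<open>[l\<^sup>2, \<infinity>)\<close>, both of which are independent of \<open>l\<close>.\<close>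

theorem trunc_riesz_off_diagonal:
  fixes \<alpha> :: "'n::finite \<Rightarrow> nat"
  assumes k: "sum \<alpha> UNIV > 0" and D: "D \<ge> 0"
  shows "\<exists>C\<ge>0. \<forall>l e f c X. l > 0 \<longrightarrow> e > 0 \<longrightarrow> integrable gauss f \<longrightarrow> (LINT y|gauss. f y) = 0 \<longrightarrow>
     (\<forall>y. f y \<noteq> 0 \<longrightarrow> norm (y - c) \<le> D * l) \<longrightarrow> X \<in> sets borel \<longrightarrow>
     (\<forall>y t x. f y \<noteq> 0 \<longrightarrow> 0 < t \<longrightarrow> t \<le> l\<^sup>2 \<longrightarrow> x \<in> X \<longrightarrow> l \<le> norm (x - exp (- t) *\<^sub>R y)) \<longrightarrow>
     (\<integral>\<^sup>+x. ennreal (norm (trunc_riesz \<alpha> e f x)) * indicator X x \<partial>gauss) \<le> ennreal C * gnorm 1 f"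
proof -
  let ?k = "sum \<alpha> UNIV"
  obtain C1 where C1: "C1 \<ge> 0" "\<And>t l y X. t > 0 \<Longrightarrow> l > 0 \<Longrightarrow> X \<in> sets borel \<Longrightarrow> (\<forall>x\<in>X. norm (x - exp (- t) *\<^sub>R y) \<ge> l) \<Longrightarrow>
      (\<integral>\<^sup>+x. ennreal \<bar>riesz_kernel \<alpha> (exp (- t)) (spread t) x y\<bar> * indicator X x \<partial>gauss) \<le> ennreal (C1 * spread t / (l * spread t ^ ?k))"
    using riesz_kernel_off_diagonal[of \<alpha>] by auto
  obtain C2 where C2: "C2 \<ge> 0" "\<And>t y c. t > 0 \<Longrightarrow> (\<integral>\<^sup>+x. ennreal \<bar>riesz_kernel \<alpha> (exp (- t)) (spread t) x y - riesz_kernel \<alpha> (exp (- t)) (spread t) x c\<bar> \<partial>gauss)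
      \<le> ennreal (C2 * norm (y - c) / (spread t * spread t ^ ?k))"
    using riesz_kernel_difference[of \<alpha>] by auto
  obtain C3 where C3: "C3 \<ge> 0" "\<And>t. t > 0 \<Longrightarrow> gamma_weight ?k t * (spread t / spread t ^ ?k) \<le> C3 * t powr (- 1/2)"
      "\<And>t. t > 0 \<Longrightarrow> gamma_weight ?k t * (1 / (spread t * spread t ^ ?k)) \<le> C3 * t powr (- 3/2)"
    using gamma_weight_bounds[OF k] by auto
  define C where "C = 2 * (C1 * C3) + 2 * (C2 * D * C3)"
  have "(\<integral>\<^sup>+x. ennreal (norm (trunc_riesz \<alpha> e f x)) * indicator X x \<partial>gauss) \<le> ennreal C * gnorm 1 f"
    if l: "l > 0" and e: "e > 0" and f: "integrable gauss f" and f0: "(LINT y|gauss. f y) = 0"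
      and supp: "\<forall>y. f y \<noteq> 0 \<longrightarrow> norm (y - c) \<le> D * l" and X[measurable]: "X \<in> sets borel"
      and far: "\<forall>y t x. f y \<noteq> 0 \<longrightarrow> 0 < t \<longrightarrow> t \<le> l\<^sup>2 \<longrightarrow> x \<in> X \<longrightarrow> l \<le> norm (x - exp (- t) *\<^sub>R y)"
    for l e and f :: "real ^ 'n \<Rightarrow> complex" and c X
  proof -
    interpret pair_sigma_finite "gauss :: (real ^ 'n) measure" "lborel :: real measure" ..
    have fm[measurable]: "f \<in> borel_measurable borel" using borel_measurable_integrable[OF f] by simp
    \<comment> \<open>The bound for the kernel operator at time \<open>t\<close>: concentration before \<open>l\<^sup>2\<close>, cancellation after.\<close>
    define B where "B t = (if t \<le> l\<^sup>2 then C1 * spread t / (l * spread t ^ ?k) else C2 * (D * l) / (spread t * spread t ^ ?k))" for t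
    have kopB: "(\<integral>\<^sup>+x. ennreal (norm (kernel_op \<alpha> t f x)) * indicator X x \<partial>gauss) \<le> ennreal (B t) * gnorm 1 f" if t: "t > 0" for t
    proof (cases "t \<le> l\<^sup>2")
      case True
      have "(\<integral>\<^sup>+x. ennreal (norm (kernel_op \<alpha> t f x)) * indicator X x \<partial>gauss) \<le> ennreal (C1 * spread t / (l * spread t ^ ?k)) * gnorm 1 f"
        unfolding kernel_op_def
      proof (rule nn_integral_kernel_Tonelli[OF _ fm X])
        show "(\<lambda>(x, y). riesz_kernel \<alpha> (exp (- t)) (spread t) x y) \<in> borel_measurable (borel \<Otimes>\<^sub>M borel)"
          unfolding riesz_kernel_def by measurable
        show "integrable gauss (\<lambda>y. riesz_kernel \<alpha> (exp (- t)) (spread t) x y *\<^sub>R f y)" for x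
          by (rule riesz_kernel_integrable[OF f t])
        fix y assume "f y \<noteq> 0"
        then show "(\<integral>\<^sup>+x. ennreal \<bar>riesz_kernel \<alpha> (exp (- t)) (spread t) x y\<bar> * indicator X x \<partial>gauss) \<le> ennreal (C1 * spread t / (l * spread t ^ ?k))"
          using far t True by (intro C1 l X) auto
      qed
      then show ?thesis using True by (simp add: B_def)
    next
      case False
      have eq: "kernel_op \<alpha> t f x = (LINT y|gauss. (riesz_kernel \<alpha> (exp (- t)) (spread t) x y - riesz_kernel \<alpha> (exp (- t)) (spread t) x c) *\<^sub>R f y)" for x
        unfolding scaleR_diff_left kernel_op_def using riesz_kernel_integrable[OF f t] f f0 by simp
      have "(\<integral>\<^sup>+x. ennreal (norm (kernel_op \<alpha> t f x)) * indicator X x \<partial>gauss) \<le> ennreal (C2 * (D * l) / (spread t * spread t ^ ?k)) * gnorm 1 f"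
        unfolding eq
      proof (rule nn_integral_kernel_Tonelli[OF _ fm X])
        show "(\<lambda>(x, y). riesz_kernel \<alpha> (exp (- t)) (spread t) x y - riesz_kernel \<alpha> (exp (- t)) (spread t) x c) \<in> borel_measurable (borel \<Otimes>\<^sub>M borel)"
          unfolding riesz_kernel_def by measurable
        show "integrable gauss (\<lambda>y. (riesz_kernel \<alpha> (exp (- t)) (spread t) x y - riesz_kernel \<alpha> (exp (- t)) (spread t) x c) *\<^sub>R f y)" for x
          unfolding scaleR_diff_left using riesz_kernel_integrable[OF f t] f by simp
        fix y assume y: "f y \<noteq> 0"
        have "(\<integral>\<^sup>+x. ennreal \<bar>riesz_kernel \<alpha> (exp (- t)) (spread t) x y - riesz_kernel \<alpha> (exp (- t)) (spread t) x c\<bar> * indicator X x \<partial>gauss)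
            \<le> (\<integral>\<^sup>+x. ennreal \<bar>riesz_kernel \<alpha> (exp (- t)) (spread t) x y - riesz_kernel \<alpha> (exp (- t)) (spread t) x c\<bar> \<partial>gauss)"
          by (intro nn_integral_mono) (auto simp: indicator_def)
        also have "\<dots> \<le> ennreal (C2 * norm (y - c) / (spread t * spread t ^ ?k))" by (rule C2(2)[OF t])
        also have "\<dots> \<le> ennreal (C2 * (D * l) / (spread t * spread t ^ ?k))"
          using supp y C2(1) spread_props[OF t] by (intro ennreal_leI divide_right_mono mult_left_mono) auto
        finally show "(\<integral>\<^sup>+x. ennreal \<bar>riesz_kernel \<alpha> (exp (- t)) (spread t) x y - riesz_kernel \<alpha> (exp (- t)) (spread t) x c\<bar> * indicator X x \<partial>gauss)
            \<le> ennreal (C2 * (D * l) / (spread t * spread t ^ ?k))" .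
      qed
      then show ?thesis using False by (simp add: B_def)
    qed
    let ?w = "\<lambda>t. indicator {e..} t * gamma_weight ?k t"
    have w0: "?w t \<ge> 0" for t using gamma_weight_nonneg[OF k] by simp
    have wB: "ennreal (?w t) * ennreal (B t) \<le>
        ennreal (C1 * C3 / l) * (ennreal (t powr (- 1/2)) * indicator {0..l\<^sup>2} t) + ennreal (C2 * D * C3 * l) * (ennreal (t powr (- 3/2)) * indicator {l\<^sup>2..} t)" for t
    proof (cases "e \<le> t")
      case True
      then have t: "t > 0" using e by simp
      show ?thesis
      proof (cases "t \<le> l\<^sup>2")
        case small: True
        have "ennreal (?w t) * ennreal (B t) = ennreal (gamma_weight ?k t * (C1 * spread t / (l * spread t ^ ?k)))"
        proof -
          have "?w t = gamma_weight ?k t" "B t = C1 * spread t / (l * spread t ^ ?k)" using True small by (simp_all add: B_def)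
          then show ?thesis by (simp only:) (rule ennreal_mult'[symmetric, OF gamma_weight_nonneg[OF k]])
        qed
        also have "gamma_weight ?k t * (C1 * spread t / (l * spread t ^ ?k)) = (C1 / l) * (gamma_weight ?k t * (spread t / spread t ^ ?k))" by simp
        also have "\<dots> \<le> (C1 / l) * (C3 * t powr (- 1/2))" using C3(2)[OF t] C1(1) l by (intro mult_left_mono) auto
        also have "\<dots> = (C1 * C3 / l) * t powr (- 1/2)" by simp
        finally have "ennreal (?w t) * ennreal (B t) \<le> ennreal ((C1 * C3 / l) * t powr (- 1/2))" by (simp add: ennreal_leI)
        also have "\<dots> = ennreal (C1 * C3 / l) * (ennreal (t powr (- 1/2)) * indicator {0..l\<^sup>2} t)"
          using small t C1(1) C3(1) l by (subst ennreal_mult) auto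
        finally show ?thesis by (rule order_trans) (rule add_increasing2, simp_all)
      next
        case large: False
        have "ennreal (?w t) * ennreal (B t) = ennreal (gamma_weight ?k t * (C2 * (D * l) / (spread t * spread t ^ ?k)))"
        proof -
          have "?w t = gamma_weight ?k t" "B t = C2 * (D * l) / (spread t * spread t ^ ?k)" using True large by (simp_all add: B_def)
          then show ?thesis by (simp only:) (rule ennreal_mult'[symmetric, OF gamma_weight_nonneg[OF k]])
        qed
        also have "gamma_weight ?k t * (C2 * (D * l) / (spread t * spread t ^ ?k)) = (C2 * D * l) * (gamma_weight ?k t * (1 / (spread t * spread t ^ ?k)))" by simp
        also have "\<dots> \<le> (C2 * D * l) * (C3 * t powr (- 3/2))" using C3(3)[OF t] C2(1) D l by (intro mult_left_mono) auto
        also have "\<dots> = (C2 * D * C3 * l) * t powr (- 3/2)" by simp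
        finally have "ennreal (?w t) * ennreal (B t) \<le> ennreal ((C2 * D * C3 * l) * t powr (- 3/2))" by (simp add: ennreal_leI)
        also have "\<dots> = ennreal (C2 * D * C3 * l) * (ennreal (t powr (- 3/2)) * indicator {l\<^sup>2..} t)"
          using large t C2(1) C3(1) D l by (subst ennreal_mult) auto
        finally show ?thesis by (rule order_trans) (rule add_increasing, simp_all)
      qed
    qed simp
    have "(\<integral>\<^sup>+x. ennreal (norm (trunc_riesz \<alpha> e f x)) * indicator X x \<partial>gauss) \<le>
      (\<integral>\<^sup>+x. (\<integral>\<^sup>+t. ennreal (?w t) * (ennreal (norm (kernel_op \<alpha> t f x)) * indicator X x) \<partial>lborel) \<partial>gauss)"
    proof (rule nn_integral_mono)
      fix x
      have "ennreal (norm (trunc_riesz \<alpha> e f x)) \<le> (\<integral>\<^sup>+t. ennreal (norm (?w t *\<^sub>R kernel_op \<alpha> t f x)) \<partial>lborel)"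
        unfolding trunc_riesz_def by (rule integral_norm_bound_ennreal[OF trunc_riesz_integrable(1)[OF k e f]])
      also have "\<dots> = (\<integral>\<^sup>+t. ennreal (?w t) * ennreal (norm (kernel_op \<alpha> t f x)) \<partial>lborel)"
        using w0 by (intro nn_integral_cong) (simp only: norm_scaleR abs_of_nonneg ennreal_mult norm_ge_zero)
      finally have "ennreal (norm (trunc_riesz \<alpha> e f x)) \<le> (\<integral>\<^sup>+t. ennreal (?w t) * ennreal (norm (kernel_op \<alpha> t f x)) \<partial>lborel)" .
      then show "ennreal (norm (trunc_riesz \<alpha> e f x)) * indicator X x \<le> (\<integral>\<^sup>+t. ennreal (?w t) * (ennreal (norm (kernel_op \<alpha> t f x)) * indicator X x) \<partial>lborel)"
        by (cases "x \<in> X") auto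
    qed
    also have "\<dots> = (\<integral>\<^sup>+t. (\<integral>\<^sup>+x. ennreal (?w t) * (ennreal (norm (kernel_op \<alpha> t f x)) * indicator X x) \<partial>gauss) \<partial>lborel)"
      by (rule Fubini'[symmetric]) measurable
    also have "\<dots> \<le> (\<integral>\<^sup>+t. (ennreal (C1 * C3 / l) * (ennreal (t powr (- 1/2)) * indicator {0..l\<^sup>2} t) +
         ennreal (C2 * D * C3 * l) * (ennreal (t powr (- 3/2)) * indicator {l\<^sup>2..} t)) * gnorm 1 f \<partial>lborel)"
    proof (rule nn_integral_mono)
      fix t
      have "(\<integral>\<^sup>+x. ennreal (?w t) * (ennreal (norm (kernel_op \<alpha> t f x)) * indicator X x) \<partial>gauss) =
         ennreal (?w t) * (\<integral>\<^sup>+x. ennreal (norm (kernel_op \<alpha> t f x)) * indicator X x \<partial>gauss)"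
        by (rule nn_integral_cmult) measurable
      also have "\<dots> \<le> ennreal (?w t) * (ennreal (B t) * gnorm 1 f)"
      proof (cases "e \<le> t")
        case True
        then show ?thesis using e by (intro mult_left_mono kopB) auto
      qed simp
      also have "\<dots> = (ennreal (?w t) * ennreal (B t)) * gnorm 1 f" by (simp only: mult.assoc)
      also have "\<dots> \<le> (ennreal (C1 * C3 / l) * (ennreal (t powr (- 1/2)) * indicator {0..l\<^sup>2} t) +
         ennreal (C2 * D * C3 * l) * (ennreal (t powr (- 3/2)) * indicator {l\<^sup>2..} t)) * gnorm 1 f"
        by (intro mult_right_mono wB) simp
      finally show "(\<integral>\<^sup>+x. ennreal (?w t) * (ennreal (norm (kernel_op \<alpha> t f x)) * indicator X x) \<partial>gauss) \<le>
        (ennreal (C1 * C3 / l) * (ennreal (t powr (- 1/2)) * indicator {0..l\<^sup>2} t) +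
         ennreal (C2 * D * C3 * l) * (ennreal (t powr (- 3/2)) * indicator {l\<^sup>2..} t)) * gnorm 1 f" .
    qed
    also have "\<dots> = (ennreal (C1 * C3 / l) * ennreal (2 * l) + ennreal (C2 * D * C3 * l) * ennreal (2 / l)) * gnorm 1 f"
      by (subst nn_integral_multc, measurable, subst nn_integral_add, measurable)
         (simp add: nn_integral_cmult nn_integral_powr_near_0[OF l, simplified] nn_integral_powr_near_infinity[OF l, simplified])
    also have "ennreal (C1 * C3 / l) * ennreal (2 * l) + ennreal (C2 * D * C3 * l) * ennreal (2 / l) = ennreal C"
    proof -
      have "ennreal (C1 * C3 / l) * ennreal (2 * l) = ennreal (2 * (C1 * C3))"
        using l C1(1) C3(1) by (subst ennreal_mult[symmetric]) auto
      moreover have "ennreal (C2 * D * C3 * l) * ennreal (2 / l) = ennreal (2 * (C2 * D * C3))"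
        using l C2(1) C3(1) D by (subst ennreal_mult[symmetric]) auto
      moreover have "0 \<le> 2 * (C1 * C3)" "0 \<le> 2 * (C2 * D * C3)" using C1 C2 C3 D by auto
      ultimately show ?thesis unfolding C_def by (simp only: ennreal_plus)
    qed
    finally show ?thesis .
  qed
  moreover have "C \<ge> 0" using C1 C2 C3 D by (simp add: C_def)
  ultimately show ?thesis by blast
qed

section \<open>Linearity\<close>

text \<open>Integrability is what makes the pairing in the definition of a weak derivative additive.\<close>

lemma locally_integrable_times_test:
  assumes u: "locally_integrable u" and \<phi>: "test_function \<phi>"
  shows "integrable lborel (\<lambda>x. u x * \<phi> x)"
proof -
  let ?K = "closure {x. \<phi> x \<noteq> 0}"
  have K: "compact ?K" using \<phi> by (auto simp: test_function_def compact_closure)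
  then have int: "integrable lborel (\<lambda>x. indicator ?K x *\<^sub>R u x)"
    using u by (simp add: locally_integrable_def set_integrable_def)
  obtain M where M: "\<And>x. norm (\<phi> x) \<le> M" using test_function_bounded[OF \<phi>] by auto
  note [measurable] = test_function_measurable[OF \<phi>] borel_measurable_integrable[OF int]
  have eq: "u x * \<phi> x = (indicator ?K x *\<^sub>R u x) * \<phi> x" for x
  proof (cases "\<phi> x = 0")
    case False
    then have "x \<in> ?K" using closure_subset[of "{x. \<phi> x \<noteq> 0}"] by (meson mem_Collect_eq subsetD)
    then show ?thesis by simp
  qed simp
  show ?thesis
    unfolding eq
  proof (rule Bochner_Integration.integrable_bound)
    show "integrable lborel (\<lambda>x. M * norm (indicator ?K x *\<^sub>R u x))" using int by (intro integrable_mult_right integrable_norm)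
    show "AE x in lborel. norm ((indicator ?K x *\<^sub>R u x) * \<phi> x) \<le> norm (M * norm (indicator ?K x *\<^sub>R u x))"
    proof (intro always_eventually allI)
      fix x
      have "norm (indicator ?K x *\<^sub>R u x) * norm (\<phi> x) \<le> norm (indicator ?K x *\<^sub>R u x) * M"
        by (intro mult_left_mono M) auto
      also have "\<dots> \<le> norm (M * norm (indicator ?K x *\<^sub>R u x))" by (simp add: mult.commute abs_mult mult_right_mono)
      finally show "norm ((indicator ?K x *\<^sub>R u x) * \<phi> x) \<le> norm (M * norm (indicator ?K x *\<^sub>R u x))"
        by (simp only: norm_mult)
    qed
  qed measurable
qed

lemma locally_integrable_lincomb:
  assumes "locally_integrable u" "locally_integrable v"
  shows "locally_integrable (\<lambda>x. a * u x + b * v x)"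
  unfolding locally_integrable_def
proof (intro allI impI)
  fix K :: "(real ^ 'a) set" assume K: "compact K"
  have "set_integrable lborel K (\<lambda>x. a * u x)" "set_integrable lborel K (\<lambda>x. b * v x)"
    using assms K unfolding locally_integrable_def set_integrable_def by (simp_all flip: mult_scaleR_right)
  then show "set_integrable lborel K (\<lambda>x. a * u x + b * v x)" by (rule set_integral_add(1))
qed

lemma weak_partial_lincomb:
  assumes u: "weak_partial i u v" and u': "weak_partial i u' v'"
  shows "weak_partial i (\<lambda>x. a * u x + b * u' x) (\<lambda>x. a * v x + b * v' x)"
proof -
  have loc: "locally_integrable u" "locally_integrable v" "locally_integrable u'" "locally_integrable v'"
    using u u' by (auto simp: weak_partial_def)
  show ?thesis
    unfolding weak_partial_def
  proof (intro conjI allI impI locally_integrable_lincomb loc)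
    fix \<phi> :: "real ^ 'a \<Rightarrow> complex" assume \<phi>: "test_function \<phi>"
    have lin: "(LINT x|lborel. (a * f x + b * g x) * \<psi> x) = a * (LINT x|lborel. f x * \<psi> x) + b * (LINT x|lborel. g x * \<psi> x)"
      if "locally_integrable f" "locally_integrable g" "test_function \<psi>" for f g \<psi>
    proof -
      have "(LINT x|lborel. (a * f x + b * g x) * \<psi> x) = (LINT x|lborel. a * (f x * \<psi> x) + b * (g x * \<psi> x))"
        by (intro Bochner_Integration.integral_cong refl) (simp add: algebra_simps)
      also have "\<dots> = a * (LINT x|lborel. f x * \<psi> x) + b * (LINT x|lborel. g x * \<psi> x)"
        using locally_integrable_times_test[OF that(1,3)] locally_integrable_times_test[OF that(2,3)]
        by (subst Bochner_Integration.integral_add) auto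
      finally show ?thesis .
    qed
    have "(LINT x|lborel. u x * partial i \<phi> x) = - (LINT x|lborel. v x * \<phi> x)"
      "(LINT x|lborel. u' x * partial i \<phi> x) = - (LINT x|lborel. v' x * \<phi> x)"
      using u u' \<phi> by (auto simp: weak_partial_def)
    then show "(LINT x|lborel. (a * u x + b * u' x) * partial i \<phi> x) = - (LINT x|lborel. (a * v x + b * v' x) * \<phi> x)"
      by (simp add: lin loc \<phi> test_function_partial)
  qed
qed

lemma delta_star_lincomb:
  assumes "delta_star i u v" "delta_star i u' v'"
  shows "delta_star i (\<lambda>x. a * u x + b * u' x) (\<lambda>x. a * v x + b * v' x)"
proof -
  let ?e = "\<lambda>x. complex_of_real (exp (- (norm x)\<^sup>2))" and ?E = "\<lambda>x. complex_of_real (- (1 / sqrt 2) * exp ((norm x)\<^sup>2))"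
  obtain w w' where w: "weak_partial i (\<lambda>x. ?e x * u x) w" "v = (\<lambda>x. ?E x * w x)"
    and w': "weak_partial i (\<lambda>x. ?e x * u' x) w'" "v' = (\<lambda>x. ?E x * w' x)"
    using assms unfolding delta_star_def by blast
  have "weak_partial i (\<lambda>x. a * (?e x * u x) + b * (?e x * u' x)) (\<lambda>x. a * w x + b * w' x)"
    by (rule weak_partial_lincomb[OF w(1) w'(1)])
  also have "(\<lambda>x. a * (?e x * u x) + b * (?e x * u' x)) = (\<lambda>x. ?e x * (a * u x + b * u' x))"
    by (auto simp: algebra_simps)
  finally have 1: "weak_partial i (\<lambda>x. ?e x * (a * u x + b * u' x)) (\<lambda>x. a * w x + b * w' x)" .
  have "(\<lambda>x. a * v x + b * v' x) = (\<lambda>x. ?E x * (a * w x + b * w' x))"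
    unfolding w w' by (rule ext) (simp only: distrib_left distrib_right mult_ac)
  with 1 show ?thesis unfolding delta_star_def by blast
qed

lemma delta_star_list_lincomb:
  "delta_star_list js u v \<Longrightarrow> delta_star_list js u' v' \<Longrightarrow>
     delta_star_list js (\<lambda>x. a * u x + b * u' x) (\<lambda>x. a * v x + b * v' x)"
proof (induction js arbitrary: v v')
  case (Cons i js)
  obtain w w' where "delta_star_list js u w" "delta_star i w v" "delta_star_list js u' w'" "delta_star i w' v'"
    using Cons.prems by auto
  then show ?case using Cons.IH[of w w'] delta_star_lincomb[of i w v w' v' a b]
    unfolding delta_star_list.simps by blast
qed auto

lemma gnorm_mult_const:
  fixes u :: "real ^ 'n::finite \<Rightarrow> complex"
  assumes [measurable]: "u \<in> borel_measurable borel"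
  shows "gnorm p (\<lambda>x. a * u x) = ennreal (norm a ^ p) * gnorm p u"
  unfolding gnorm_def by (simp add: norm_mult power_mult_distrib ennreal_mult nn_integral_cmult)

lemma Lp_2_lincomb:
  assumes "u \<in> Lp 2" "v \<in> Lp 2" shows "(\<lambda>x. a * u x + b * v x) \<in> Lp 2"
proof -
  have [measurable]: "u \<in> borel_measurable borel" "v \<in> borel_measurable borel" and fin: "gnorm 2 u < \<infinity>" "gnorm 2 v < \<infinity>"
    using assms unfolding Lp_2_iff by auto
  have 1: "gnorm 2 (\<lambda>x. a * u x) < \<infinity>" "gnorm 2 (\<lambda>x. b * v x) < \<infinity>"
    using fin by (simp_all add: gnorm_mult_const ennreal_mult_less_top)
  have "gnorm 2 (\<lambda>x. a * u x + b * v x) < \<infinity>"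
    by (rule gnorm_add_finite[OF _ _ 1]) measurable
  then show ?thesis unfolding Lp_2_iff by (intro conjI) measurable
qed

lemma riesz_L2_lincomb:
  assumes "riesz_L2 \<alpha> f g" "riesz_L2 \<alpha> f' g'"
  shows "riesz_L2 \<alpha> (\<lambda>x. a * f x + b * f' x) (\<lambda>x. a * g x + b * g' x)"
proof -
  let ?m = "\<lambda>\<mu>. (\<mu> + 1) powr (- real (\<Sum>i\<in>UNIV. \<alpha> i) / 2)"
  obtain u u' where u: "OU_spectral ?m f u" "D_star \<alpha> u g" and u': "OU_spectral ?m f' u'" "D_star \<alpha> u' g'"
    using assms unfolding riesz_L2_def by blast
  note L2 = u(1)[unfolded OU_spectral_def, THEN conjunct1] u(1)[unfolded OU_spectral_def, THEN conjunct2, THEN conjunct1]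
    u'(1)[unfolded OU_spectral_def, THEN conjunct1] u'(1)[unfolded OU_spectral_def, THEN conjunct2, THEN conjunct1]
  have "OU_spectral ?m (\<lambda>x. a * f x + b * f' x) (\<lambda>x. a * u x + b * u' x)"
    unfolding OU_spectral_def
  proof (intro conjI allI impI Lp_2_lincomb L2)
    fix \<mu> and h :: "real ^ 'a \<Rightarrow> complex" assume h: "OU_closure h (\<lambda>x. complex_of_real \<mu> * h x)"
    then have "h \<in> Lp 2" by (simp add: OU_closure_def)
    then have hm[measurable]: "h \<in> borel_measurable borel" and hfin: "gnorm 2 (\<lambda>x. cnj (h x)) < \<infinity>"
      unfolding Lp_2_iff by (auto simp: gnorm_def)
    have [measurable]: "cnj \<in> borel_measurable borel"
      by (intro borel_measurable_continuous_onI continuous_intros)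
    have cm: "(\<lambda>x. cnj (h x)) \<in> borel_measurable borel" by measurable
    have lin: "L2_inner (\<lambda>x. a * p x + b * q x) h = a * L2_inner p h + b * L2_inner q h" if "p \<in> Lp 2" "q \<in> Lp 2" for p q
    proof -
      have int: "integrable gauss (\<lambda>x. p x * cnj (h x))" "integrable gauss (\<lambda>x. q x * cnj (h x))"
        using that unfolding Lp_2_iff by (intro integrable_L2_product cm hfin; blast)+
      have "L2_inner (\<lambda>x. a * p x + b * q x) h = (LINT x|gauss. a * (p x * cnj (h x)) + b * (q x * cnj (h x)))"
        unfolding L2_inner_def by (intro Bochner_Integration.integral_cong refl) (simp add: algebra_simps)
      then show ?thesis unfolding L2_inner_def using int by simp
    qed
    have "L2_inner u h = complex_of_real (?m \<mu>) * L2_inner f h" "L2_inner u' h = complex_of_real (?m \<mu>) * L2_inner f' h"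
      using u(1) u'(1) h unfolding OU_spectral_def by blast+
    then show "L2_inner (\<lambda>x. a * u x + b * u' x) h = complex_of_real (?m \<mu>) * L2_inner (\<lambda>x. a * f x + b * f' x) h"
      unfolding lin[OF L2(2,4)] lin[OF L2(1,3)] by (simp only: distrib_left distrib_right mult_ac)
  qed
  moreover have "D_star \<alpha> (\<lambda>x. a * u x + b * u' x) (\<lambda>x. a * g x + b * g' x)"
    using u(2) u'(2) delta_star_list_lincomb unfolding D_star_def by blast
  ultimately show ?thesis unfolding riesz_L2_def by blast
qed

text \<open>A quantitative statement that is stable under linear combinations; \<open>g\<close> is not named because
  only its norm in \<open>L\<^sup>1\<close> matters for the decompositions below.\<close>

definition riesz_bound :: "('n::finite \<Rightarrow> nat) \<Rightarrow> (real ^ 'n \<Rightarrow> complex) \<Rightarrow> real \<Rightarrow> bool" where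
  "riesz_bound \<alpha> f C \<longleftrightarrow> f \<in> Lp 2 \<and> (\<exists>g. riesz_L2 \<alpha> f g \<and> g \<in> borel_measurable borel \<and> gnorm 1 g \<le> ennreal C)"

lemma gnorm_1_triangle:
  fixes u v :: "real ^ 'n::finite \<Rightarrow> complex"
  assumes [measurable]: "u \<in> borel_measurable borel" "v \<in> borel_measurable borel"
  shows "gnorm 1 (\<lambda>x. u x + v x) \<le> gnorm 1 u + gnorm 1 v"
proof -
  have "gnorm 1 (\<lambda>x. u x + v x) \<le> (\<integral>\<^sup>+x. ennreal (norm (u x)) + ennreal (norm (v x)) \<partial>gauss)"
    unfolding gnorm_def by (intro nn_integral_mono) (simp add: norm_triangle_ineq ennreal_leI flip: ennreal_plus)
  then show ?thesis unfolding gnorm_def by (simp add: nn_integral_add)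
qed

lemma riesz_bound_add:
  assumes "riesz_bound \<alpha> f C" "riesz_bound \<alpha> f' C'" "0 \<le> C" "0 \<le> C'"
  shows "riesz_bound \<alpha> (\<lambda>x. f x + f' x) (C + C')"
proof -
  obtain g g' where g: "riesz_L2 \<alpha> f g" "g \<in> borel_measurable borel" "gnorm 1 g \<le> ennreal C"
    and g': "riesz_L2 \<alpha> f' g'" "g' \<in> borel_measurable borel" "gnorm 1 g' \<le> ennreal C'"
    using assms unfolding riesz_bound_def by blast
  have "gnorm 1 (\<lambda>x. g x + g' x) \<le> gnorm 1 g + gnorm 1 g'" by (rule gnorm_1_triangle[OF g(2) g'(2)])
  also have "\<dots> \<le> ennreal C + ennreal C'" by (intro add_mono g g')
  also have "\<dots> = ennreal (C + C')" using assms by simp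
  finally show ?thesis
    using riesz_L2_lincomb[OF g(1) g'(1), of 1 1] Lp_2_lincomb[of f f' 1 1] assms g g'
    unfolding riesz_bound_def by (auto intro!: exI[of _ "\<lambda>x. g x + g' x"])
qed

lemma riesz_bound_scale:
  assumes "riesz_bound \<alpha> f C" shows "riesz_bound \<alpha> (\<lambda>x. a * f x) (norm a * C)"
proof -
  obtain g where g: "riesz_L2 \<alpha> f g" "g \<in> borel_measurable borel" "gnorm 1 g \<le> ennreal C"
    using assms unfolding riesz_bound_def by blast
  have "gnorm 1 (\<lambda>x. a * g x) \<le> ennreal (norm a) * ennreal C"
    unfolding gnorm_mult_const[OF g(2)] using g by (auto intro: mult_left_mono)
  also have "\<dots> = ennreal (norm a * C)" by (simp add: ennreal_mult')
  finally show ?thesis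
    using riesz_L2_lincomb[OF g(1) g(1), of a 0] Lp_2_lincomb[of f f a 0] assms g
    unfolding riesz_bound_def by (auto intro!: exI[of _ "\<lambda>x. a * g x"])
qed

lemma riesz_bound_mono: "riesz_bound \<alpha> f C \<Longrightarrow> C \<le> C' \<Longrightarrow> riesz_bound \<alpha> f C'"
  unfolding riesz_bound_def by (meson ennreal_leI order_trans)

lemma riesz_bound_sum:
  assumes "finite I" "I \<noteq> {}" "\<And>i. i \<in> I \<Longrightarrow> riesz_bound \<alpha> (f i) (C i)" "\<And>i. i \<in> I \<Longrightarrow> 0 \<le> C i"
  shows "riesz_bound \<alpha> (\<lambda>x. \<Sum>i\<in>I. f i x) (\<Sum>i\<in>I. C i)"
  using assms by (induction I rule: finite_ne_induct) (auto intro!: riesz_bound_add sum_nonneg)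

section \<open>Admissible cubes\<close>

text \<open>Half-open, so that a cube is the disjoint union of its \<open>2\<^sup>n\<close> dyadic children.\<close>

definition cube :: "real ^ 'n::finite \<Rightarrow> real \<Rightarrow> (real ^ 'n) set" where
  "cube a l = {x. \<forall>i. a $ i \<le> x $ i \<and> x $ i < a $ i + l}"

lemma cube_measurable [measurable]: "cube a l \<in> sets borel"
proof -
  have "cube a l = (\<Inter>i\<in>UNIV. {x. a $ i \<le> x $ i \<and> x $ i < a $ i + l})" by (auto simp: cube_def)
  also have "\<dots> \<in> sets borel" by measurable
  finally show ?thesis .
qed

lemma cube_corner: "l > 0 \<Longrightarrow> a \<in> cube a l" by (simp add: cube_def)

lemma cube_diam:
  fixes a :: "real ^ 'n::finite"
  assumes "x \<in> cube a l" "y \<in> cube a l"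
  shows "norm (x - y) \<le> real CARD('n) * l"
proof -
  have "norm (x - y) \<le> (\<Sum>i\<in>UNIV. \<bar>(x - y) $ i\<bar>)" by (rule norm_le_l1_cart)
  also have "\<dots> \<le> (\<Sum>i\<in>(UNIV :: 'n set). l)"
  proof (rule sum_mono)
    fix i
    have "a $ i \<le> x $ i" "x $ i < a $ i + l" "a $ i \<le> y $ i" "y $ i < a $ i + l"
      using assms by (auto simp: cube_def)
    then show "\<bar>(x - y) $ i\<bar> \<le> l" by (simp add: abs_le_iff)
  qed
  finally show ?thesis by simp
qed

lemma emeasure_cube:
  fixes a :: "real ^ 'n::finite"
  assumes "l > 0" shows "emeasure lborel (cube a l) = ennreal (l ^ CARD('n))"
proof -
  let ?u = "a + (\<chi> i. l)"
  have le: "a \<bullet> b \<le> ?u \<bullet> b" and diff: "(?u - a) \<bullet> b = l" if "b \<in> Basis" for b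
    using that assms by (auto simp: Basis_vec_def inner_axis inner_add_left)
  have *: "(\<Prod>b\<in>(Basis :: (real ^ 'n) set). (?u - a) \<bullet> b) = l ^ CARD('n)" using diff by simp
  have "box a ?u \<subseteq> cube a l" "cube a l \<subseteq> cbox a ?u"
    by (auto simp: cube_def mem_box_cart less_imp_le)
  then have "emeasure lborel (box a ?u) \<le> emeasure lborel (cube a l)" "emeasure lborel (cube a l) \<le> emeasure lborel (cbox a ?u)"
    by (auto intro!: emeasure_mono)
  moreover have "emeasure lborel (box a ?u) = ennreal (l ^ CARD('n))" "emeasure lborel (cbox a ?u) = ennreal (l ^ CARD('n))"
    using le * by (simp_all add: emeasure_lborel_box_eq emeasure_lborel_cbox_eq)
  ultimately show ?thesis by (simp add: antisym)
qed

text \<open>Compares the densities at two arbitrary points of \<open>E\<close> and \<open>F\<close> and integrates over both.\<close>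

lemma gauss_comparison:
  fixes E F :: "(real ^ 'n::finite) set"
  assumes [measurable]: "E \<in> sets borel" "F \<in> sets borel"
    and le: "\<And>x y. x \<in> E \<Longrightarrow> y \<in> F \<Longrightarrow> (norm y)\<^sup>2 - (norm x)\<^sup>2 \<le> L"
  shows "emeasure gauss E * emeasure lborel F \<le> ennreal (exp L) * emeasure gauss F * emeasure lborel E"
proof -
  let ?d = "\<lambda>x :: real ^ 'n. ennreal (gauss_const TYPE('n) * exp (- (norm x)\<^sup>2))"
  have g: "emeasure gauss A = (\<integral>\<^sup>+x. ?d x * indicator A x \<partial>lborel)" if [measurable]: "A \<in> sets borel" for A
    unfolding gauss_eq_density by (subst emeasure_density) auto
  have pt: "?d x * indicator E x * emeasure lborel F \<le> ennreal (exp L) * emeasure gauss F * indicator E x" for x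
  proof (cases "x \<in> E")
    case True
    have "?d x * emeasure lborel F = (\<integral>\<^sup>+y. ?d x * indicator F y \<partial>lborel)" by (simp add: nn_integral_cmult)
    also have "\<dots> \<le> (\<integral>\<^sup>+y. ennreal (exp L) * (?d y * indicator F y) \<partial>lborel)"
    proof (rule nn_integral_mono)
      fix y
      show "?d x * indicator F y \<le> ennreal (exp L) * (?d y * indicator F y)"
      proof (cases "y \<in> F")
        case y: True
        have "exp (- (norm x)\<^sup>2) \<le> exp (L + - (norm y)\<^sup>2)" using le[OF True y] by simp
        then have "exp (- (norm x)\<^sup>2) \<le> exp L * exp (- (norm y)\<^sup>2)" by (simp only: exp_add)
        then have "gauss_const TYPE('n) * exp (- (norm x)\<^sup>2) \<le> gauss_const TYPE('n) * (exp L * exp (- (norm y)\<^sup>2))"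
          by (intro mult_left_mono) (auto simp: less_imp_le)
        then have "?d x \<le> ennreal (exp L * (gauss_const TYPE('n) * exp (- (norm y)\<^sup>2)))"
          by (intro ennreal_leI) (simp add: mult_ac)
        then show ?thesis using y by (simp add: ennreal_mult')
      qed simp
    qed
    also have "\<dots> = ennreal (exp L) * emeasure gauss F" unfolding g[OF assms(2)] by (rule nn_integral_cmult) measurable
    finally show ?thesis using True by simp
  qed simp
  have "emeasure gauss E * emeasure lborel F = (\<integral>\<^sup>+x. ?d x * indicator E x * emeasure lborel F \<partial>lborel)"
    unfolding g[OF assms(1)] by (rule nn_integral_multc[symmetric]) measurable
  also have "\<dots> \<le> (\<integral>\<^sup>+x. ennreal (exp L) * emeasure gauss F * indicator E x \<partial>lborel)"
    by (intro nn_integral_mono pt)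
  also have "\<dots> = ennreal (exp L) * emeasure gauss F * emeasure lborel E"
    by (rule nn_integral_cmult_indicator) simp
  finally show ?thesis .
qed

text \<open>Admissibility is formulated for all points of the cube instead of the centre, which makes it
  hereditary: the dyadic subcubes of an admissible cube are admissible with the same \<open>K\<close>.\<close>

definition admissible :: "real \<Rightarrow> real ^ 'n::finite \<Rightarrow> real \<Rightarrow> bool" where
  "admissible K a l \<longleftrightarrow> 0 < l \<and> l \<le> K \<and> (\<forall>y\<in>cube a l. l * norm y \<le> K)"

lemma admissible_subcube:
  "admissible K a l \<Longrightarrow> 0 < l' \<Longrightarrow> l' \<le> l \<Longrightarrow> cube a' l' \<subseteq> cube a l \<Longrightarrow> admissible K a' l'"
  unfolding admissible_def by (meson mult_right_mono norm_ge_zero order_trans subsetD)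

text \<open>Since \<open>l |y| \<le> K\<close> on an admissible cube, \<open>|x|\<^sup>2\<close> varies by a bounded amount on its dilates. The
  Gauss density is comparable to a constant there, and \<open>\<gamma>\<close> inherits doubling from Lebesgue measure
  with constants that depend only on \<open>K\<close>, \<open>m\<close> and the dimension.\<close>

lemma gauss_local_doubling:
  fixes a :: "real ^ 'n::finite"
  assumes "K \<ge> 0" "m \<ge> 1"
  obtains C where "C \<ge> 1" "\<And>a l E. admissible K a l \<Longrightarrow> E \<in> sets borel \<Longrightarrow>
      (\<And>x. x \<in> E \<Longrightarrow> norm (x - a) \<le> m * l) \<Longrightarrow> measure gauss E \<le> C * measure gauss (cube (a :: real ^ 'n) l)"
    "\<And>a l a'. admissible K a l \<Longrightarrow> cube a' (l / 2) \<subseteq> cube a l \<Longrightarrow>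
      measure gauss (cube (a :: real ^ 'n) l) \<le> C * measure gauss (cube a' (l / 2))"
proof -
  let ?n = "real CARD('n)" and ?N = "CARD('n)"
  define D where "D = m + ?n"
  define L where "L = D * (2 * K + D * K)* (1 + K)"
  have D: "D \<ge> 1" using assms by (simp add: D_def)
  have sq: "(norm y)\<^sup>2 - (norm x)\<^sup>2 \<le> L" if ad: "admissible K a l" and y: "y \<in> cube a l" and xy: "norm (x - y) \<le> D * l" for a l and x y :: "real ^ 'n"
  proof -
    have l: "0 < l" "l \<le> K" and ly: "l * norm y \<le> K" using ad y by (auto simp: admissible_def)
    have "norm y \<le> norm x + D * l" using xy norm_triangle_ineq2[of y x] by (simp add: norm_minus_commute)
    then have "norm y - norm x \<le> D * l" by simp
    moreover have "norm x \<le> norm y + D * l" using xy norm_triangle_ineq2[of x y] by simp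
    ultimately have "(norm y - norm x) * (norm y + norm x) \<le> (D * l) * (2 * norm y + D * l)"
      using D l by (intro mult_mono) auto
    also have "\<dots> = D * (2 * (l * norm y)) + D * (D * (l * l))" by (simp add: algebra_simps)
    also have "\<dots> \<le> D * (2 * K) + D * (D * (K * K))"
      using D l ly assms by (intro add_mono mult_left_mono mult_mono) auto
    also have "\<dots> \<le> L" using D assms by (simp add: L_def algebra_simps)
    finally show ?thesis by (simp add: power2_eq_square algebra_simps)
  qed
  define C where "C = exp L * (2 * m) ^ ?N + exp L * 2 ^ ?N + 1"
  have "(2 * m) ^ ?N \<ge> 0" using assms by simp
  then have C: "C \<ge> 1" "exp L * (2 * m) ^ ?N \<le> C" "exp L * 2 ^ ?N \<le> C" by (auto simp: C_def)
  have fromE: "measure gauss E \<le> R * measure gauss F"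
    if le: "emeasure gauss E * ennreal v \<le> ennreal (exp L) * emeasure gauss F * emeasure lborel E"
      and vE: "emeasure lborel E \<le> ennreal w" and v: "v > 0" and w: "w \<ge> 0" "exp L * w / v \<le> R"
    for E F :: "(real ^ 'n) set" and v w R
  proof -
    have "emeasure gauss E * ennreal v \<le> ennreal (exp L) * emeasure gauss F * ennreal w"
      using le vE by (meson mult_left_mono order_trans zero_le)
    then have "ennreal (measure gauss E * v) \<le> ennreal (exp L * measure gauss F * w)"
      unfolding gauss.emeasure_eq_measure using v w by (simp add: ennreal_mult)
    then have "measure gauss E * v \<le> exp L * measure gauss F * w"
      using w by (subst (asm) ennreal_le_iff) auto
    then have "measure gauss E \<le> (exp L * w / v) * measure gauss F" using v by (simp add: field_simps)
    also have "\<dots> \<le> R * measure gauss F" using w by (intro mult_right_mono) auto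
    finally show ?thesis .
  qed
  show ?thesis
  proof (rule that[OF C(1)])
    fix a :: "real ^ 'n" and l E
    assume ad: "admissible K a l" and E[measurable]: "E \<in> sets borel" and near: "\<And>x. x \<in> E \<Longrightarrow> norm (x - a) \<le> m * l"
    have l: "0 < l" using ad by (simp add: admissible_def)
    show "measure gauss E \<le> C * measure gauss (cube a l)"
    proof (rule fromE[where v = "l ^ ?N" and w = "(2 * m * l) ^ ?N"])
      show "emeasure gauss E * ennreal (l ^ ?N) \<le> ennreal (exp L) * emeasure gauss (cube a l) * emeasure lborel E"
        unfolding emeasure_cube[OF l, of a, symmetric]
      proof (rule gauss_comparison[OF E cube_measurable])
        fix x y assume x: "x \<in> E" and y: "y \<in> cube a l"
        have "norm (x - y) \<le> norm (x - a) + norm (a - y)" using norm_triangle_ineq[of "x - a" "a - y"] by simp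
        also have "\<dots> \<le> m * l + ?n * l" by (intro add_mono near x cube_diam[OF cube_corner[OF l] y])
        finally have "norm (x - y) \<le> D * l" by (simp add: D_def algebra_simps)
        then show "(norm y)\<^sup>2 - (norm x)\<^sup>2 \<le> L" by (rule sq[OF ad y])
      qed
      have ml: "m * l > 0" using l assms by simp
      have "E \<subseteq> cbox (a - (\<chi> i. m * l)) (a + (\<chi> i. m * l))"
      proof
        fix x assume "x \<in> E"
        then have "\<bar>(x - a) $ i\<bar> \<le> m * l" for i using near component_le_norm_cart[of "x - a" i] by (meson order_trans)
        then show "x \<in> cbox (a - (\<chi> i. m * l)) (a + (\<chi> i. m * l))"
          by (auto simp: mem_box_cart abs_le_iff algebra_simps)
      qed
      then have "emeasure lborel E \<le> emeasure lborel (cbox (a - (\<chi> i. m * l)) (a + (\<chi> i. m * l)))"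
        by (intro emeasure_mono) auto
      also have "\<dots> = ennreal ((2 * m * l) ^ ?N)"
      proof -
        have le: "(a - (\<chi> i. m * l)) \<bullet> b \<le> (a + (\<chi> i. m * l)) \<bullet> b"
          and diff: "((a + (\<chi> i. m * l)) - (a - (\<chi> i. m * l))) \<bullet> b = 2 * m * l" if "b \<in> Basis" for b
          using that ml by (auto simp: Basis_vec_def inner_axis inner_add_left inner_diff_left)
        then show ?thesis using le by (simp add: emeasure_lborel_cbox_eq)
      qed
      finally show "emeasure lborel E \<le> ennreal ((2 * m * l) ^ ?N)" .
      have "exp L * (2 * m * l) ^ ?N / l ^ ?N = exp L * (2 * m) ^ ?N" using l by (simp add: power_mult_distrib)
      then show "exp L * (2 * m * l) ^ ?N / l ^ ?N \<le> C" using C by simp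
    qed (use l assms in auto)
  next
    fix a a' :: "real ^ 'n" and l
    assume ad: "admissible K a l" and sub: "cube a' (l / 2) \<subseteq> cube a l"
    have l: "0 < l" using ad by (simp add: admissible_def)
    show "measure gauss (cube a l) \<le> C * measure gauss (cube a' (l / 2))"
    proof (rule fromE[where v = "(l / 2) ^ ?N" and w = "l ^ ?N"])
      have l2: "0 < l / 2" using l by simp
      show "emeasure gauss (cube a l) * ennreal ((l / 2) ^ ?N) \<le> ennreal (exp L) * emeasure gauss (cube a' (l / 2)) * emeasure lborel (cube a l)"
        unfolding emeasure_cube[OF l2, of a', symmetric]
      proof (rule gauss_comparison[OF cube_measurable cube_measurable])
        fix x y assume x: "x \<in> cube a l" and y: "y \<in> cube a' (l / 2)"
        have yc: "y \<in> cube a l" using sub y by auto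
        have "norm (x - y) \<le> ?n * l" by (rule cube_diam[OF x yc])
        also have "\<dots> \<le> D * l" using l assms by (intro mult_right_mono) (auto simp: D_def)
        finally show "(norm y)\<^sup>2 - (norm x)\<^sup>2 \<le> L" by (rule sq[OF ad yc])
      qed
      show "emeasure lborel (cube a l) \<le> ennreal (l ^ ?N)" using emeasure_cube[OF l, of a] by simp
      have "exp L * l ^ ?N / (l / 2) ^ ?N = exp L * 2 ^ ?N" using l by (simp add: power_divide)
      then show "exp L * l ^ ?N / (l / 2) ^ ?N \<le> C" using C by simp
    qed (use l in auto)
  qed
qed

text \<open>Close to the cube the \<open>L\<^sup>2\<close> bound and doubling suffice, far away \<open>trunc_riesz_off_diagonal\<close> does.
  Admissibility enters the latter: the centre \<open>exp (- t) y\<close> of the kernel has moved from \<open>y\<close> by at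
  most \<open>t |y| \<le> l (l |y|) \<le> K l\<close> when \<open>t \<le> l\<^sup>2\<close>, so that it is still close to the cube.\<close>

theorem riesz_bound_bounded_atom:
  fixes \<alpha> :: "'n::finite \<Rightarrow> nat"
  assumes k: "sum \<alpha> UNIV > 0" and K: "K \<ge> 0"
  obtains C where "C \<ge> 0" "\<And>a l f. admissible K a l \<Longrightarrow> f \<in> borel_measurable borel \<Longrightarrow> (\<And>x. norm (f x) \<le> 1) \<Longrightarrow>
      (\<And>x. f x \<noteq> 0 \<Longrightarrow> x \<in> cube a l) \<Longrightarrow> (LINT x|gauss. f x) = 0 \<Longrightarrow> riesz_bound \<alpha> f (C * measure gauss (cube a l))"
proof -
  let ?n = "real CARD('n)"
  define m where "m = ?n + K + 1"
  have m: "m \<ge> 1" using K by (simp add: m_def)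
  obtain C1 where C1: "C1 \<ge> 1" "\<And>a l E. admissible K a l \<Longrightarrow> E \<in> sets borel \<Longrightarrow>
      (\<And>x. x \<in> E \<Longrightarrow> norm (x - a) \<le> m * l) \<Longrightarrow> measure gauss E \<le> C1 * measure gauss (cube (a :: real ^ 'n) l)"
    using gauss_local_doubling[OF K m, where 'n='n] by metis
  have n0: "?n \<ge> 0" by simp
  from trunc_riesz_off_diagonal[OF k n0] obtain C2 where C2c: "C2 \<ge> 0" "\<forall>l e f c X. l > 0 \<longrightarrow> e > 0 \<longrightarrow> integrable gauss f \<longrightarrow> (LINT y|gauss. f y) = 0 \<longrightarrow>
     (\<forall>y. f y \<noteq> 0 \<longrightarrow> norm (y - c) \<le> ?n * l) \<longrightarrow> X \<in> sets borel \<longrightarrow>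
     (\<forall>y t x. f y \<noteq> 0 \<longrightarrow> 0 < t \<longrightarrow> t \<le> l\<^sup>2 \<longrightarrow> x \<in> X \<longrightarrow> l \<le> norm (x - exp (- t) *\<^sub>R y)) \<longrightarrow>
     (\<integral>\<^sup>+x. ennreal (norm (trunc_riesz \<alpha> e f x)) * indicator X x \<partial>gauss) \<le> ennreal C2 * gnorm 1 f"
    by (elim exE conjE) (rule that; assumption)
  have C2: "C2 \<ge> 0" "\<And>l e f c X. l > 0 \<Longrightarrow> e > 0 \<Longrightarrow> integrable gauss f \<Longrightarrow> (LINT y|gauss. f y) = 0 \<Longrightarrow>
     (\<forall>y. f y \<noteq> 0 \<longrightarrow> norm (y - c) \<le> ?n * l) \<Longrightarrow> X \<in> sets borel \<Longrightarrow>
     (\<forall>y t x. f y \<noteq> 0 \<longrightarrow> 0 < t \<longrightarrow> t \<le> l\<^sup>2 \<longrightarrow> x \<in> X \<longrightarrow> l \<le> norm (x - exp (- t) *\<^sub>R y)) \<Longrightarrow>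
     (\<integral>\<^sup>+x. ennreal (norm (trunc_riesz \<alpha> e f x)) * indicator X x \<partial>gauss) \<le> ennreal C2 * gnorm 1 f"
    by (rule C2c(1)) (rule C2c(2)[THEN spec, THEN spec, THEN spec, THEN spec, THEN spec, THEN mp, THEN mp, THEN mp, THEN mp, THEN mp, THEN mp, THEN mp])
  define A where "A = 16 * real (sum \<alpha> UNIV + 1) ^ sum \<alpha> UNIV"
  have A: "A \<ge> 0" by (simp add: A_def sum_nonneg)
  define C where "C = C1 + A + C2"
  show ?thesis
  proof (rule that[of C])
    show "C \<ge> 0" using C1 C2 A by (simp add: C_def)
    fix a :: "real ^ 'n" and l and f :: "real ^ 'n \<Rightarrow> complex"
    assume ad: "admissible K a l" and fm[measurable]: "f \<in> borel_measurable borel" and f1: "\<And>x. norm (f x) \<le> 1"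
      and supp: "\<And>x. f x \<noteq> 0 \<Longrightarrow> x \<in> cube a l" and f0: "(LINT x|gauss. f x) = 0"
    let ?Q = "cube a l"
    have l: "0 < l" using ad by (simp add: admissible_def)
    have gn: "gnorm p f \<le> emeasure gauss ?Q" if "p > 0" for p
    proof -
      have "gnorm p f \<le> (\<integral>\<^sup>+x. indicator ?Q x \<partial>gauss)"
        unfolding gnorm_def
      proof (rule nn_integral_mono)
        fix x show "ennreal (norm (f x) ^ p) \<le> indicator ?Q x"
        proof (cases "f x = 0")
          case False
          then show ?thesis using supp[OF False] f1[of x] by (simp add: power_le_one)
        qed (use that in \<open>simp add: power_0_left\<close>)
      qed
      then show ?thesis by simp
    qed
    have fin: "gnorm 2 f < \<infinity>" using gn[of 2] by (simp add: gauss.emeasure_eq_measure) (metis ennreal_less_top order_le_less_trans)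
    have fint: "integrable gauss f" by (rule integrable_of_gnorm[OF fm fin])
    obtain g where g: "riesz_L2 \<alpha> f g" and gm[measurable]: "g \<in> borel_measurable borel"
      and g2: "gnorm 2 g \<le> ennreal A * gnorm 2 f"
      and lim: "(\<lambda>m. gnorm 2 (\<lambda>x. trunc_riesz \<alpha> (1 / real (Suc m)) f x - g x)) \<longlonglongrightarrow> 0"
      using riesz_L2_trunc[OF bounded_in_hspan_closure[OF fm f1] fin k] unfolding A_def by blast
    \<comment> \<open>The region far from the cube: at distance of at least \<open>m\<close> sides, where \<open>m = n + K + 1\<close> allows for
      the diameter of the cube, the drift of the kernel and a remaining distance \<open>l\<close>.\<close>
    define X where "X = {x. m * l \<le> norm (x - a)}"
    have [measurable]: "X \<in> sets borel" unfolding X_def by measurable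
    have far: "l \<le> norm (x - exp (- t) *\<^sub>R y)" if y: "f y \<noteq> 0" and t: "0 < t" "t \<le> l\<^sup>2" and x: "x \<in> X" for x y t
    proof -
      have yQ: "y \<in> ?Q" by (rule supp[OF y])
      have "l * norm y \<le> K" using ad yQ by (simp add: admissible_def)
      have "1 - exp (- t) \<le> t" using exp_ge_add_one_self[of "- t"] by simp
      then have "(1 - exp (- t)) * norm y \<le> l\<^sup>2 * norm y" using t by (intro mult_right_mono) auto
      also have "\<dots> = l * (l * norm y)" by (simp add: power2_eq_square)
      also have "\<dots> \<le> l * K" using \<open>l * norm y \<le> K\<close> l by (intro mult_left_mono) auto
      finally have 1: "norm ((1 - exp (- t)) *\<^sub>R y) \<le> l * K" using t by simp
      have "m * l \<le> norm (x - a)" using x by (simp add: X_def)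
      also have "x - a = (x - exp (- t) *\<^sub>R y) + (y - a) - (1 - exp (- t)) *\<^sub>R y" by (simp add: algebra_simps)
      also have "norm \<dots> \<le> norm (x - exp (- t) *\<^sub>R y) + norm (y - a) + norm ((1 - exp (- t)) *\<^sub>R y)"
        by (meson norm_triangle_ineq norm_triangle_ineq4 order_trans add_right_mono)
      also have "\<dots> \<le> norm (x - exp (- t) *\<^sub>R y) + ?n * l + l * K"
        using cube_diam[OF yQ cube_corner[OF l]] 1 by linarith
      finally show ?thesis by (simp add: m_def algebra_simps)
    qed
    have "gnorm 1 g = (\<integral>\<^sup>+x. ennreal (norm (g x)) * indicator X x + ennreal (norm (g x)) * indicator (- X) x \<partial>gauss)"
      unfolding gnorm_def by (intro nn_integral_cong) (auto simp: indicator_def)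
    also have "\<dots> = (\<integral>\<^sup>+x. ennreal (norm (g x)) * indicator X x \<partial>gauss) + (\<integral>\<^sup>+x. ennreal (norm (g x)) * indicator (- X) x \<partial>gauss)"
      by (rule nn_integral_add) measurable
    also have "(\<integral>\<^sup>+x. ennreal (norm (g x)) * indicator (- X) x \<partial>gauss) \<le> ennreal ((C1 + A) * measure gauss ?Q)"
    proof -
      have "(\<integral>\<^sup>+x. ennreal (norm (g x)) * indicator (- X) x \<partial>gauss) \<le> (\<integral>\<^sup>+x. indicator (- X) x + ennreal ((norm (g x))\<^sup>2) \<partial>gauss)"
      proof (rule nn_integral_mono)
        fix x
        have "2 * norm (g x) \<le> (norm (g x))\<^sup>2 + 1" using zero_le_power2[of "norm (g x) - 1"]
          by (simp add: power2_diff)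
        then have "norm (g x) \<le> 1 + (norm (g x))\<^sup>2" using norm_ge_zero[of "g x"] by linarith
        then have "ennreal (norm (g x)) \<le> 1 + ennreal ((norm (g x))\<^sup>2)" by (metis ennreal_1 ennreal_leI ennreal_plus zero_le_one zero_le_power2)
        then show "ennreal (norm (g x)) * indicator (- X) x \<le> indicator (- X) x + ennreal ((norm (g x))\<^sup>2)"
          by (auto simp: indicator_def)
      qed
      also have "\<dots> = emeasure gauss (- X) + gnorm 2 g" unfolding gnorm_def by (subst nn_integral_add) auto
      also have "\<dots> \<le> ennreal (C1 * measure gauss ?Q) + ennreal A * ennreal (measure gauss ?Q)"
      proof (intro add_mono)
        have "measure gauss (- X) \<le> C1 * measure gauss ?Q"
          by (rule C1(2)[OF ad]) (auto simp: X_def)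
        then show "emeasure gauss (- X) \<le> ennreal (C1 * measure gauss ?Q)" by (simp add: gauss.emeasure_eq_measure ennreal_leI)
        show "gnorm 2 g \<le> ennreal A * ennreal (measure gauss ?Q)"
          using gn[of 2] by (intro order_trans[OF g2] mult_left_mono) (auto simp: gauss.emeasure_eq_measure)
      qed
      also have "\<dots> = ennreal ((C1 + A) * measure gauss ?Q)"
        using A C1(1) by (simp add: ennreal_mult'[symmetric] ennreal_plus[symmetric] distrib_right del: ennreal_plus)
      finally show ?thesis .
    qed
    also have "(\<integral>\<^sup>+x. ennreal (norm (g x)) * indicator X x \<partial>gauss) \<le> ennreal (C2 * measure gauss ?Q)"
    proof -
      have C2': "ennreal C2 * gnorm 1 f \<le> ennreal (C2 * measure gauss ?Q)"
        using gn[of 1] C2(1) by (simp add: gauss.emeasure_eq_measure ennreal_mult mult_left_mono)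
      have "(\<integral>\<^sup>+x. ennreal (norm (g x)) * indicator X x \<partial>gauss) \<le> gnorm 1 (\<lambda>x. trunc_riesz \<alpha> (1 / real (Suc j)) f x - g x) + ennreal (C2 * measure gauss ?Q)" for j
      proof -
        let ?T = "trunc_riesz \<alpha> (1 / real (Suc j)) f"
        have "(\<integral>\<^sup>+x. ennreal (norm (g x)) * indicator X x \<partial>gauss) \<le> (\<integral>\<^sup>+x. ennreal (norm (?T x - g x)) + ennreal (norm (?T x)) * indicator X x \<partial>gauss)"
        proof (rule nn_integral_mono)
          fix x
          have "norm (g x) \<le> norm (?T x - g x) + norm (?T x)" using norm_triangle_ineq4[of "?T x" "?T x - g x"] by simp
          then have "ennreal (norm (g x)) \<le> ennreal (norm (?T x - g x)) + ennreal (norm (?T x))"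
            by (metis ennreal_leI ennreal_plus norm_ge_zero)
          then show "ennreal (norm (g x)) * indicator X x \<le> ennreal (norm (?T x - g x)) + ennreal (norm (?T x)) * indicator X x"
            by (auto simp: indicator_def)
        qed
        also have "\<dots> = gnorm 1 (\<lambda>x. ?T x - g x) + (\<integral>\<^sup>+x. ennreal (norm (?T x)) * indicator X x \<partial>gauss)"
          unfolding gnorm_def by (subst nn_integral_add) auto
        also have "(\<integral>\<^sup>+x. ennreal (norm (?T x)) * indicator X x \<partial>gauss) \<le> ennreal C2 * gnorm 1 f"
        proof (rule C2(2)[OF l _ fint f0, where c = a])
          show "\<forall>y. f y \<noteq> 0 \<longrightarrow> norm (y - a) \<le> ?n * l" using cube_diam[OF supp cube_corner[OF l]] by blast
          show "\<forall>y t x. f y \<noteq> 0 \<longrightarrow> 0 < t \<longrightarrow> t \<le> l\<^sup>2 \<longrightarrow> x \<in> X \<longrightarrow> l \<le> norm (x - exp (- t) *\<^sub>R y)" using far by blast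
        qed auto
        finally show ?thesis using C2' by (meson add_left_mono order_trans)
      qed
      moreover have "(\<lambda>j. gnorm 1 (\<lambda>x. trunc_riesz \<alpha> (1 / real (Suc j)) f x - g x) + ennreal (C2 * measure gauss ?Q)) \<longlonglongrightarrow> 0 + ennreal (C2 * measure gauss ?Q)"
        by (intro tendsto_add tendsto_const gnorm_1_tendsto_0 lim) measurable
      ultimately have "(\<integral>\<^sup>+x. ennreal (norm (g x)) * indicator X x \<partial>gauss) \<le> 0 + ennreal (C2 * measure gauss ?Q)"
        by (intro LIMSEQ_le_const) auto
      then show ?thesis by simp
    qed
    also have "ennreal (C2 * measure gauss ?Q) + ennreal ((C1 + A) * measure gauss ?Q) = ennreal (C * measure gauss ?Q)"
      using A C1(1) C2(1) by (subst ennreal_plus[symmetric]) (auto simp: C_def algebra_simps)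
    finally have g1: "gnorm 1 g \<le> ennreal (C * measure gauss ?Q)" by (simp add: add_mono)
    have "f \<in> Lp 2" unfolding Lp_2_iff using fin by simp
    then show "riesz_bound \<alpha> f (C * measure gauss ?Q)" unfolding riesz_bound_def using g g1 gm by blast
  qed
qed

section \<open>Calderon--Zygmund decomposition of dyadic step functions\<close>

text \<open>Dyadic children are indexed by the set of coordinates in which the upper half is taken.\<close>

definition child :: "real ^ 'n::finite \<Rightarrow> real \<Rightarrow> 'n set \<Rightarrow> real ^ 'n" where
  "child a l S = a + (\<chi> i. if i \<in> S then l / 2 else 0)"

lemma child_subset:
  assumes "l > 0" shows "cube (child a l S) (l / 2) \<subseteq> cube a l"
proof
  fix x assume x: "x \<in> cube (child a l S) (l / 2)"
  show "x \<in> cube a l"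
    unfolding cube_def
  proof (intro CollectI allI)
    fix i
    show "a $ i \<le> x $ i \<and> x $ i < a $ i + l"
      using x assms by (cases "i \<in> S") (auto simp: cube_def child_def dest!: spec[of _ i])
  qed
qed

lemma child_unique:
  assumes "l > 0"
  shows "x \<in> cube (child a l S) (l / 2) \<longleftrightarrow> x \<in> cube a l \<and> S = {i. a $ i + l / 2 \<le> x $ i}"
proof
  assume x: "x \<in> cube (child a l S) (l / 2)"
  have "i \<in> S \<longleftrightarrow> a $ i + l / 2 \<le> x $ i" for i
    using x assms by (auto simp: cube_def child_def split: if_splits dest!: spec[of _ i])
  then show "x \<in> cube a l \<and> S = {i. a $ i + l / 2 \<le> x $ i}" using x child_subset[OF assms] by auto
next
  assume x: "x \<in> cube a l \<and> S = {i. a $ i + l / 2 \<le> x $ i}"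
  show "x \<in> cube (child a l S) (l / 2)"
    unfolding cube_def
  proof (intro CollectI allI)
    fix i
    have "a $ i \<le> x $ i" "x $ i < a $ i + l" using x by (auto simp: cube_def)
    moreover have "i \<in> S \<longleftrightarrow> a $ i + l / 2 \<le> x $ i" using x by blast
    ultimately show "child a l S $ i \<le> x $ i \<and> x $ i < child a l S $ i + l / 2"
      by (cases "i \<in> S") (auto simp: child_def)
  qed
qed

lemma sum_children:
  fixes F :: "'b::real_vector"
  assumes "l > 0"
  shows "(\<Sum>S\<in>UNIV. indicat_real (cube (child a l S) (l / 2)) x *\<^sub>R F) = indicat_real (cube a l) x *\<^sub>R F"
proof (cases "x \<in> cube a l")
  case True
  then have "indicat_real (cube (child a l S) (l / 2)) x *\<^sub>R F = (if S = {i. a $ i + l / 2 \<le> x $ i} then F else 0)" for S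
    by (simp add: indicator_def child_unique[OF assms])
  then show ?thesis using True by simp
next
  case False
  then show ?thesis by (simp add: indicator_def child_unique[OF assms])
qed

text \<open>Constancy on the dyadic subcubes of generation \<open>N\<close>. Recursion over the generations fits the
  induction in the stopping time argument.\<close>

primrec dyadic_step :: "nat \<Rightarrow> real ^ 'n::finite \<Rightarrow> real \<Rightarrow> (real ^ 'n \<Rightarrow> 'b) \<Rightarrow> bool" where
  "dyadic_step 0 a l f = (\<exists>v. \<forall>x\<in>cube a l. f x = v)"
| "dyadic_step (Suc N) a l f = (\<forall>S. dyadic_step N (child a l S) (l / 2) f)"

lemma dyadic_step_cong: "l > 0 \<Longrightarrow> (\<And>x. x \<in> cube a l \<Longrightarrow> f x = g x) \<Longrightarrow> dyadic_step N a l f \<Longrightarrow> dyadic_step N a l g"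
proof (induction N arbitrary: a l)
  case (Suc N)
  show ?case unfolding dyadic_step.simps
  proof
    fix S
    show "dyadic_step N (child a l S) (l / 2) g"
      using Suc.prems child_subset[OF Suc.prems(1), of a S] by (intro Suc.IH) auto
  qed
qed auto

lemma dyadic_step_combine: "dyadic_step N a l f \<Longrightarrow> dyadic_step N a l g \<Longrightarrow> dyadic_step N a l (\<lambda>x. h (f x) (g x))"
  by (induction N arbitrary: a l) auto

lemma dyadic_step_const: "dyadic_step N a l (\<lambda>x. c)"
  by (induction N arbitrary: a l) auto

lemma dyadic_step_Suc: "l > 0 \<Longrightarrow> dyadic_step N a l f \<Longrightarrow> dyadic_step (Suc N) a l f"
proof (induction N arbitrary: a l)
  case 0
  then show ?case using child_subset[of l a] by (simp) blast
next
  case (Suc N)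
  have "dyadic_step (Suc N) (child a l S) (l / 2) f" for S
    using Suc.prems by (intro Suc.IH) auto
  then show ?case by (subst dyadic_step.simps) blast
qed

lemma dyadic_step_mono:
  assumes "N \<le> M" "l > 0" "dyadic_step N a l f" shows "dyadic_step M a l f"
  using assms(1)
proof (induction rule: dec_induct)
  case base
  show ?case by (rule assms(3))
next
  case (step M)
  show ?case by (rule dyadic_step_Suc[OF assms(2) step.IH])
qed

lemma dyadic_step_bounded:
  fixes f :: "real ^ 'n::finite \<Rightarrow> 'b::real_normed_vector"
  shows "l > 0 \<Longrightarrow> dyadic_step N a l f \<Longrightarrow> \<exists>M. \<forall>x\<in>cube a l. norm (f x) \<le> M"
proof (induction N arbitrary: a l)
  case (Suc N)
  have "\<forall>S. \<exists>M. \<forall>x\<in>cube (child a l S) (l / 2). norm (f x) \<le> M" using Suc by auto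
  from choice[OF this] obtain M where M: "\<forall>S. \<forall>x\<in>cube (child a l S) (l / 2). norm (f x) \<le> M S" ..
  have "norm (f x) \<le> (\<Sum>S\<in>UNIV. \<bar>M S\<bar>)" if "x \<in> cube a l" for x
  proof -
    let ?S = "{i. a $ i + l / 2 \<le> x $ i}"
    have "x \<in> cube (child a l ?S) (l / 2)" using child_unique[OF Suc.prems(1)] that by blast
    then have "norm (f x) \<le> M ?S" using M by blast
    also have "\<dots> \<le> \<bar>M ?S\<bar>" by simp
    also have "\<dots> \<le> (\<Sum>S\<in>UNIV. \<bar>M S\<bar>)" by (rule member_le_sum) auto
    finally show ?thesis .
  qed
  then show ?case by blast
qed auto

lemma measure_cube_pos:
  fixes a :: "real ^ 'n::finite"
  assumes "l > 0" shows "measure gauss (cube a l) > 0"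
proof (rule ccontr)
  assume "\<not> measure gauss (cube a l) > 0"
  then have "measure gauss (cube a l) = 0" using measure_nonneg[of gauss "cube a l"] by linarith
  then have "cube a l \<in> null_sets gauss" by (intro null_setsI) (auto simp: gauss.emeasure_eq_measure)
  then have "AE x in gauss. x \<notin> cube a l" by (rule AE_not_in)
  then have "AE x in lborel. x \<notin> cube a l" by (simp add: AE_gauss_iff)
  then have "emeasure lborel (cube a l) = 0" by (subst (asm) AE_iff_measurable[of "cube a l"]) auto
  then show False using emeasure_cube[OF assms, of a] assms by (simp add: zero_less_power)
qed

lemma integrable_bounded_gauss:
  fixes f :: "real ^ 'n::finite \<Rightarrow> 'b::{banach, second_countable_topology}"
  assumes "f \<in> borel_measurable borel" "\<And>x. norm (f x) \<le> M"
  shows "integrable gauss f"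
  using assms by (intro gauss.integrable_const_bound[of _ M]) auto

lemma riesz_bound_zero:
  fixes \<alpha> :: "'n::finite \<Rightarrow> nat"
  shows "riesz_bound \<alpha> (\<lambda>x. 0) 0"
proof -
  have z: "(\<lambda>x :: real ^ 'n. 0 :: complex) \<in> hspan_closure" by (rule hspan_subset_closure[OF hspan.zero])
  have f: "gnorm 2 (\<lambda>x :: real ^ 'n. 0 :: complex) < \<infinity>" by (simp add: gnorm_def)
  obtain g where g: "riesz_L2 \<alpha> (\<lambda>x. 0) g" "g \<in> borel_measurable borel" "gnorm 2 g < \<infinity>"
    using riesz_L2_exists[OF z f, of \<alpha>] by blast
  have "gnorm 1 g \<le> ennreal 1 + ennreal (1 / 1 ^ 1) * gnorm (Suc 1) g" by (rule gnorm_1_le[OF g(2)]) simp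
  also have "\<dots> < \<infinity>" using g(3) by (simp add: numeral_2_eq_2)
  finally have "gnorm 1 g \<le> ennreal (enn2real (gnorm 1 g))" by simp
  then have "riesz_bound \<alpha> (\<lambda>x. 0) (enn2real (gnorm 1 g))"
    using g z f unfolding riesz_bound_def Lp_2_iff by auto
  from riesz_bound_scale[OF this, of 0] show ?thesis by simp
qed

lemma powr_sum_le:
  fixes x y q :: real
  assumes "0 \<le> x" "0 \<le> y" "q > 0"
  shows "(x + y) powr q \<le> 2 powr q * (x powr q + y powr q)"
proof -
  have "(x + y) powr q \<le> (2 * max x y) powr q" using assms by (intro powr_mono2) auto
  also have "\<dots> = 2 powr q * max x y powr q" by (rule powr_mult)
  also have "\<dots> \<le> 2 powr q * (x powr q + y powr q)" by (intro mult_left_mono) (auto simp: max_def)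
  finally show ?thesis .
qed

text \<open>Splits according to \<open>x \<le> B\<close>; the bound takes the place of Hoelder's inequality in the
  estimates of means.\<close>

lemma le_add_powr:
  fixes x B q :: real
  assumes "0 \<le> x" "0 < B" "q > 1"
  shows "x \<le> B + B powr (1 - q) * x powr q"
proof (cases "x \<le> B")
  case True then show ?thesis by (simp add: add_increasing2)
next
  case False
  then have x: "x > 0" using assms by linarith
  have "x = x powr (1 - q) * x powr q" using x by (simp flip: powr_add)
  also have "\<dots> \<le> B powr (1 - q) * x powr q"
    using False assms by (intro mult_right_mono powr_mono2') auto
  finally show ?thesis using assms by linarith
qed

text \<open>The average of \<open>|f|\<close> is controlled by that of \<open>|f| powr q\<close> through \<open>le_add_powr\<close>. In the
  decomposition, \<open>b\<close> is a multiple of an atom on the cube and the mean is part of the bounded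
  function.\<close>

lemma cube_mean_bounds:
  fixes f :: "real ^ 'n::finite \<Rightarrow> complex"
  assumes l: "l > 0" and fm[measurable]: "f \<in> borel_measurable borel" and pint: "integrable gauss (\<lambda>x. norm (f x) powr q)"
    and supp: "\<And>x. x \<notin> cube a l \<Longrightarrow> f x = 0" and q: "q > 1" and B: "B > 0"
    and avg: "(LINT x|gauss. norm (f x) powr q) \<le> B powr q * measure gauss (cube a l)"
  defines "m \<equiv> (LINT x|gauss. f x) / of_real (measure gauss (cube a l))"
  defines "b \<equiv> \<lambda>x. f x - indicat_real (cube a l) x *\<^sub>R m"
  shows "norm m \<le> 2 * B" and "(LINT x|gauss. b x) = 0"
    and "(LINT x|gauss. norm (b x) powr q) \<le> (2 powr q * (1 + 2 powr q) * B) powr q * measure gauss (cube a l)"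
    and "(LINT x|gauss. indicat_real (cube a l) x *\<^sub>R m) = (LINT x|gauss. f x)"
proof -
  let ?Q = "cube a l" and ?g = "measure gauss (cube a l)"
  have g: "?g > 0" by (rule measure_cube_pos[OF l])
  have iint: "integrable gauss (indicat_real ?Q)" by (rule integrable_bounded_gauss[of _ 1]) (auto simp: indicator_def)
  have fle: "norm (f x) \<le> B * indicat_real ?Q x + B powr (1 - q) * norm (f x) powr q" for x
    using le_add_powr[of "norm (f x)" B q] B q supp[of x] by (auto simp: indicator_def)
  have fint: "integrable gauss f"
  proof (rule Bochner_Integration.integrable_bound)
    show "integrable gauss (\<lambda>x. B * indicat_real ?Q x + B powr (1 - q) * norm (f x) powr q)"
      using iint pint by simp
    show "AE x in gauss. norm (f x) \<le> norm (B * indicat_real ?Q x + B powr (1 - q) * norm (f x) powr q)"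
      using fle by (auto intro: order_trans[OF _ abs_ge_self])
  qed simp
  have "norm (LINT x|gauss. f x) \<le> (LINT x|gauss. norm (f x))" by (rule integral_norm_bound)
  also have "\<dots> \<le> (LINT x|gauss. B * indicat_real ?Q x + B powr (1 - q) * norm (f x) powr q)"
    by (rule integral_mono[OF _ _ fle]) (use fint iint pint in auto)
  also have "\<dots> = B * ?g + B powr (1 - q) * (LINT x|gauss. norm (f x) powr q)"
    using iint pint by (subst Bochner_Integration.integral_add) auto
  also have "\<dots> \<le> B * ?g + B powr (1 - q) * (B powr q * ?g)" by (intro add_left_mono mult_left_mono avg) auto
  also have "\<dots> = 2 * B * ?g"
  proof -
    have "B powr (1 - q) * B powr q = B" using B by (simp flip: powr_add)
    then have "B powr (1 - q) * (B powr q * ?g) = B * ?g" by (simp flip: mult.assoc)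
    then show ?thesis by simp
  qed
  finally show m: "norm m \<le> 2 * B" unfolding m_def using g by (simp add: norm_divide field_simps)
  show im: "(LINT x|gauss. indicat_real ?Q x *\<^sub>R m) = (LINT x|gauss. f x)"
    using g iint by (simp add: m_def scaleR_conv_of_real)
  show "(LINT x|gauss. b x) = 0"
    unfolding b_def using im fint iint by (subst Bochner_Integration.integral_diff) auto
  have bm[measurable]: "b \<in> borel_measurable borel" unfolding b_def by measurable
  have pt: "norm (b x) powr q \<le> 2 powr q * (norm (f x) powr q + (2 * B) powr q * indicat_real ?Q x)" for x
  proof (cases "x \<in> ?Q")
    case True
    have "norm (b x) powr q \<le> (norm (f x) + norm m) powr q"
      using True q by (intro powr_mono2) (auto simp: b_def norm_triangle_ineq4)
    also have "\<dots> \<le> 2 powr q * (norm (f x) powr q + norm m powr q)" using q by (intro powr_sum_le) auto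
    also have "\<dots> \<le> 2 powr q * (norm (f x) powr q + (2 * B) powr q)"
      using m q by (intro mult_left_mono add_left_mono powr_mono2) auto
    finally show ?thesis using True by simp
  qed (auto simp: b_def supp)
  have "(LINT x|gauss. norm (b x) powr q) \<le> (LINT x|gauss. 2 powr q * (norm (f x) powr q + (2 * B) powr q * indicat_real ?Q x))"
  proof (rule integral_mono[OF _ _ pt])
    show rint: "integrable gauss (\<lambda>x. 2 powr q * (norm (f x) powr q + (2 * B) powr q * indicat_real ?Q x))"
      using pint iint by auto
    show "integrable gauss (\<lambda>x. norm (b x) powr q)"
      by (rule Bochner_Integration.integrable_bound[OF rint])
         (use pt in \<open>auto intro: order_trans[OF _ abs_ge_self]\<close>)
  qed
  also have "\<dots> = 2 powr q * ((LINT x|gauss. norm (f x) powr q) + (2 * B) powr q * ?g)"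
    using pint iint by simp
  also have "\<dots> \<le> 2 powr q * (B powr q * ?g + (2 * B) powr q * ?g)" by (intro mult_left_mono add_right_mono avg) auto
  also have "\<dots> = (2 powr q * (1 + 2 powr q)) * (B powr q * ?g)" using B by (simp add: powr_mult algebra_simps)
  also have "\<dots> \<le> (2 powr q * (1 + 2 powr q)) powr q * (B powr q * ?g)"
  proof (intro mult_right_mono)
    have "1 \<le> 2 powr q" using q by (simp add: ge_one_powr_ge_zero)
    then have "1 * 1 \<le> 2 powr q * (1 + 2 powr q)" by (intro mult_mono) auto
    then have "(2 powr q * (1 + 2 powr q)) powr 1 \<le> (2 powr q * (1 + 2 powr q)) powr q" using q by (intro powr_mono) auto
    then show "2 powr q * (1 + 2 powr q) \<le> (2 powr q * (1 + 2 powr q)) powr q"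
      using \<open>1 * 1 \<le> _\<close> by simp
  qed (use g in auto)
  also have "\<dots> = (2 powr q * (1 + 2 powr q) * B) powr q * ?g" using B by (simp add: powr_mult add_nonneg_nonneg)
  finally show "(LINT x|gauss. norm (b x) powr q) \<le> (2 powr q * (1 + 2 powr q) * B) powr q * ?g" .
qed

lemma indicator_cube_measurable [measurable]: "indicat_real (cube a l) \<in> borel_measurable borel"
  by measurable

text \<open>The bound for atoms that are step functions of depth \<open>N\<close>, where size is measured by the
  exponent \<open>q\<close>. The point is that \<open>A\<close> can be chosen independently of \<open>N\<close>.\<close>

definition step_atoms_bounded :: "('n::finite \<Rightarrow> nat) \<Rightarrow> real \<Rightarrow> real \<Rightarrow> nat \<Rightarrow> real \<Rightarrow> bool" where
  "step_atoms_bounded \<alpha> K q N A \<longleftrightarrow> (\<forall>a l (f :: real ^ 'n \<Rightarrow> complex). admissible K a l \<longrightarrow> f \<in> borel_measurable borel \<longrightarrow>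
     (\<forall>x. x \<notin> cube a l \<longrightarrow> f x = 0) \<longrightarrow> dyadic_step N a l f \<longrightarrow> (LINT x|gauss. f x) = 0 \<longrightarrow>
     (LINT x|gauss. norm (f x) powr q) \<le> measure gauss (cube a l) \<longrightarrow>
     riesz_bound \<alpha> f (A * measure gauss (cube a l)))"

text \<open>Stopping time argument at height \<open>lam\<close>, organised as an induction on the depth: a child whose
  average of \<open>|f| powr q\<close> is at most \<open>lam powr q\<close> is decomposed further, and any other child is
  split into its mean, which doubling keeps below \<open>2 D lam\<close>, and a multiple of an atom of smaller
  depth. The selected cubes have total measure at most \<open>lam powr (- q)\<close> times the integral of
  \<open>|f| powr q\<close>; this is the factor that becomes small for large \<open>lam\<close>.\<close>

lemma Calderon_Zygmund:
  fixes \<alpha> :: "'n::finite \<Rightarrow> nat" and f :: "real ^ 'n \<Rightarrow> complex"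
  assumes q: "q > 1" and lam: "lam \<ge> 1" and A: "A \<ge> 0" and D: "D \<ge> 1"
    and doubling: "\<And>a l a'. admissible K a l \<Longrightarrow> cube a' (l / 2) \<subseteq> cube a l \<Longrightarrow>
      measure gauss (cube (a :: real ^ 'n) l) \<le> D * measure gauss (cube a' (l / 2))"
  defines "E \<equiv> 2 powr q * (1 + 2 powr q) * D"
  assumes "\<And>M. M < N \<Longrightarrow> step_atoms_bounded \<alpha> K q M A"
    and "admissible K a l" and "f \<in> borel_measurable borel"
    and "\<And>x. x \<notin> cube a l \<Longrightarrow> f x = 0" and "dyadic_step N a l f"
    and "(LINT x|gauss. norm (f x) powr q) \<le> lam powr q * measure gauss (cube a l)"
  shows "\<exists>g. g \<in> borel_measurable borel \<and> (\<forall>x. x \<notin> cube a l \<longrightarrow> g x = 0) \<and> (\<forall>x. norm (g x) \<le> 2 * (D * lam)) \<and>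
      (LINT x|gauss. g x) = (LINT x|gauss. f x) \<and>
      riesz_bound \<alpha> (\<lambda>x. f x - g x) (A * (E * lam) * lam powr (- q) * (LINT x|gauss. norm (f x) powr q))"
  using assms(7-)
proof (induction N arbitrary: a l f)
  case 0
  have l: "l > 0" using 0 by (simp add: admissible_def)
  note g = measure_cube_pos[OF l, of a]
  obtain v where v: "\<And>x. x \<in> cube a l \<Longrightarrow> f x = v" using 0(5) by auto
  have eq: "norm (f x) powr q = indicat_real (cube a l) x * norm v powr q" for x
    using v[of x] 0(4)[of x] q by (cases "x \<in> cube a l") auto
  have "(LINT x|gauss. norm (f x) powr q) = measure gauss (cube a l) * norm v powr q"
    unfolding eq by simp
  then have "norm v powr q \<le> lam powr q" using 0(6) g by (simp add: mult.commute)
  then have "\<not> lam < norm v" using q lam powr_less_mono2[of q lam "norm v"] by auto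
  then have "norm (f x) \<le> lam" for x using v[of x] 0(4)[of x] lam by (cases "x \<in> cube a l") auto
  also have "lam \<le> 2 * (D * lam)" using D lam mult_mono[of 1 D lam lam] by simp
  finally have b: "norm (f x) \<le> 2 * (D * lam)" for x .
  have "0 \<le> A * (E * lam) * lam powr (- q) * (LINT x|gauss. norm (f x) powr q)"
    using A D lam by (intro mult_nonneg_nonneg Bochner_Integration.integral_nonneg) (auto simp: E_def)
  then have "riesz_bound \<alpha> (\<lambda>x. f x - f x) (A * (E * lam) * lam powr (- q) * (LINT x|gauss. norm (f x) powr q))"
    using riesz_bound_mono[OF riesz_bound_zero] by simp
  then show ?case using 0(3,4) b by (intro exI[of _ f]) simp
next
  case (Suc N)
  have l: "l > 0" using Suc.prems(2) by (simp add: admissible_def)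
  have fm[measurable]: "f \<in> borel_measurable borel" by (rule Suc.prems(3))
  obtain M where M0: "\<And>x. x \<in> cube a l \<Longrightarrow> norm (f x) \<le> M" using dyadic_step_bounded[OF l Suc.prems(5)] by blast
  have M: "norm (f x) \<le> \<bar>M\<bar>" for x using M0[of x] Suc.prems(4)[of x] by (cases "x \<in> cube a l") auto
  define Q where "Q S = cube (child a l S) (l / 2)" for S
  have Qm[measurable]: "Q S \<in> sets borel" for S unfolding Q_def by measurable
  define F where "F S x = indicat_real (Q S) x *\<^sub>R f x" for S x
  have Fm[measurable]: "F S \<in> borel_measurable borel" for S unfolding F_def by measurable
  have FM: "norm (F S x) \<le> \<bar>M\<bar>" for S x using M[of x] by (auto simp: F_def indicator_def)
  have Fsupp: "x \<notin> Q S \<Longrightarrow> F S x = 0" for S x by (simp add: F_def)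
  have ad: "admissible K (child a l S) (l / 2)" for S
    by (rule admissible_subcube[OF Suc.prems(2)]) (use l child_subset[OF l] in auto)
  have Fstep: "dyadic_step N (child a l S) (l / 2) (F S)" for S
  proof (rule dyadic_step_cong)
    show "dyadic_step N (child a l S) (l / 2) f" using Suc.prems(5) by simp
    show "l / 2 > 0" using l by simp
    show "f x = F S x" if "x \<in> cube (child a l S) (l / 2)" for x using that by (simp add: F_def Q_def)
  qed
  define I where "I S = (LINT x|gauss. norm (F S x) powr q)" for S
  have I0: "I S \<ge> 0" for S unfolding I_def by (intro Bochner_Integration.integral_nonneg) auto
  have sumF: "(\<Sum>S\<in>UNIV. F S x) = f x" for x
    using sum_children[OF l, of a x "f x"] Suc.prems(4)[of x] unfolding F_def Q_def
    by (auto simp: indicator_def)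
  have Fp_int: "integrable gauss (\<lambda>x. norm (F S x) powr q)" for S
    by (rule integrable_bounded_gauss[of _ "\<bar>M\<bar> powr q"]) (use FM q in \<open>auto intro!: powr_mono2\<close>)
  have sumI: "(\<Sum>S\<in>UNIV. I S) = (LINT x|gauss. norm (f x) powr q)"
  proof -
    have eq: "norm (F S x) powr q = indicat_real (Q S) x *\<^sub>R (norm (f x) powr q)" for S x
      using q by (auto simp: F_def indicator_def)
    have "(\<Sum>S\<in>UNIV. norm (F S x) powr q) = norm (f x) powr q" for x
      unfolding eq Q_def sum_children[OF l] using Suc.prems(4)[of x] q by (auto simp: indicator_def)
    then show ?thesis unfolding I_def using Fp_int
      by (subst Bochner_Integration.integral_sum[symmetric]) auto
  qed
  let ?c = "A * (E * lam) * lam powr (- q)"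
  have c0: "?c \<ge> 0" using A D lam by (intro mult_nonneg_nonneg) (auto simp: E_def)
  have "\<exists>g. g \<in> borel_measurable borel \<and> (\<forall>x. x \<notin> Q S \<longrightarrow> g x = 0) \<and> (\<forall>x. norm (g x) \<le> 2 * (D * lam)) \<and>
      (LINT x|gauss. g x) = (LINT x|gauss. F S x) \<and> riesz_bound \<alpha> (\<lambda>x. F S x - g x) (?c * I S)" for S
  proof (cases "I S \<le> lam powr q * measure gauss (Q S)")
    case True
    show ?thesis unfolding Q_def I_def
      by (rule Suc.IH) (use Suc.prems(1) ad Fsupp Fstep True Fm in \<open>auto simp: Q_def I_def\<close>)
  next
    case False
    have l2: "l / 2 > 0" using l by simp
    note gpos = measure_cube_pos[OF l2, of "child a l S", folded Q_def]
    have DL: "D * lam > 0" "D * lam \<ge> 1" using D lam mult_mono[of 1 D 1 lam] by auto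
    have "I S \<le> (\<Sum>S\<in>UNIV. I S)" by (rule member_le_sum) (auto simp: I0)
    also have "\<dots> \<le> lam powr q * measure gauss (cube a l)" unfolding sumI by (rule Suc.prems(6))
    \<comment> \<open>The child is the first on its branch to be selected: the average over the parent is below the height.\<close>
    also have "\<dots> \<le> lam powr q * (D * measure gauss (Q S))"
      unfolding Q_def by (intro mult_left_mono doubling Suc.prems(2) child_subset l) auto
    also have "\<dots> \<le> lam powr q * (D powr q * measure gauss (Q S))"
    proof (intro mult_left_mono mult_right_mono)
      show "D \<le> D powr q" using D q powr_mono[of 1 q D] by simp
    qed auto
    also have "\<dots> = (D * lam) powr q * measure gauss (Q S)" using D lam by (simp add: powr_mult)
    finally have avg: "(LINT x|gauss. norm (F S x) powr q) \<le> (D * lam) powr q * measure gauss (cube (child a l S) (l / 2))"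
      by (simp add: I_def Q_def)
    define m where "m = (LINT x|gauss. F S x) / of_real (measure gauss (Q S))"
    define b where "b x = F S x - indicat_real (Q S) x *\<^sub>R m" for x
    note mb = cube_mean_bounds[OF l2 Fm Fp_int _ q DL(1) avg, folded Q_def, OF Fsupp, folded m_def, folded b_def]
    have bm[measurable]: "b \<in> borel_measurable borel" unfolding b_def by measurable
    define R where "R = E * lam"
    have R: "2 powr q * (1 + 2 powr q) * (D * lam) = R" by (simp add: R_def E_def)
    have R0: "R > 0" unfolding R[symmetric] using DL by (simp add: add_pos_nonneg)
    define b' where "b' x = complex_of_real (1 / R) * b x" for x
    have "riesz_bound \<alpha> b' (A * measure gauss (Q S))"
    proof -
      have "step_atoms_bounded \<alpha> K q N A" by (rule Suc.prems(1)) simp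
      moreover have "b' \<in> borel_measurable borel" unfolding b'_def by measurable
      moreover have "\<forall>x. x \<notin> Q S \<longrightarrow> b' x = 0" by (simp add: b'_def b_def Fsupp)
      moreover have "dyadic_step N (child a l S) (l / 2) b'"
      proof (rule dyadic_step_cong[OF l2])
        show "dyadic_step N (child a l S) (l / 2) (\<lambda>x. complex_of_real (1 / R) * (F S x - m))"
          by (rule dyadic_step_combine[OF Fstep Fstep, of S "\<lambda>y _. complex_of_real (1 / R) * (y - m)"])
        show "complex_of_real (1 / R) * (F S x - m) = b' x" if "x \<in> cube (child a l S) (l / 2)" for x
          using that by (simp add: b'_def b_def Q_def)
      qed
      moreover have "(LINT x|gauss. b' x) = 0" using mb(2) by (simp add: b'_def)
      moreover have "(LINT x|gauss. norm (b' x) powr q) \<le> measure gauss (Q S)"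
      proof -
        have eq: "norm (b' x) powr q = (1 / R) powr q * norm (b x) powr q" for x
        proof -
          have "norm (b' x) = (1 / R) * norm (b x)" using R0 by (simp add: b'_def norm_divide)
          then show ?thesis by (simp only: powr_mult)
        qed
        have "(LINT x|gauss. norm (b' x) powr q) = (1 / R) powr q * (LINT x|gauss. norm (b x) powr q)"
          unfolding eq by simp
        also have "\<dots> \<le> (1 / R) powr q * (R powr q * measure gauss (Q S))"
          using mb(3) unfolding R by (intro mult_left_mono) auto
        also have "\<dots> = measure gauss (Q S)" using R0 by (simp add: powr_divide)
        finally show ?thesis .
      qed
      ultimately show ?thesis using ad[of S] unfolding step_atoms_bounded_def Q_def by blast
    qed
    from riesz_bound_scale[OF this, of "complex_of_real R"]
    have "riesz_bound \<alpha> b (R * (A * measure gauss (Q S)))" using R0 by (simp add: b'_def)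
    moreover have "R * (A * measure gauss (Q S)) \<le> ?c * I S"
    proof -
      have "lam powr (- q) * (lam powr q * measure gauss (Q S)) \<le> lam powr (- q) * I S"
        using False by (intro mult_left_mono) auto
      moreover have "lam powr (- q) * lam powr q = 1" using lam by (simp flip: powr_add)
      ultimately have "measure gauss (Q S) \<le> lam powr (- q) * I S" by (simp flip: mult.assoc)
      then have "(A * R) * measure gauss (Q S) \<le> (A * R) * (lam powr (- q) * I S)"
        using A R0 by (intro mult_left_mono) auto
      then show ?thesis by (simp add: R_def mult_ac)
    qed
    ultimately have "riesz_bound \<alpha> b (?c * I S)" by (rule riesz_bound_mono)
    moreover have "norm (indicat_real (Q S) x *\<^sub>R m) \<le> 2 * (D * lam)" for x
      using mb(1) DL by (auto simp: indicator_def)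
    ultimately show ?thesis using mb(4)
      by (intro exI[of _ "\<lambda>x. indicat_real (Q S) x *\<^sub>R m"]) (simp add: b_def[abs_def])
  qed
  then have "\<forall>S. \<exists>g. g \<in> borel_measurable borel \<and> (\<forall>x. x \<notin> Q S \<longrightarrow> g x = 0) \<and> (\<forall>x. norm (g x) \<le> 2 * (D * lam)) \<and>
      (LINT x|gauss. g x) = (LINT x|gauss. F S x) \<and> riesz_bound \<alpha> (\<lambda>x. F S x - g x) (?c * I S)" by (rule allI)
  from choice[OF this] obtain G where G: "\<forall>S. G S \<in> borel_measurable borel \<and> (\<forall>x. x \<notin> Q S \<longrightarrow> G S x = 0) \<and> (\<forall>x. norm (G S x) \<le> 2 * (D * lam)) \<and>
      (LINT x|gauss. G S x) = (LINT x|gauss. F S x) \<and> riesz_bound \<alpha> (\<lambda>x. F S x - G S x) (?c * I S)" ..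
  have Gm[measurable]: "G S \<in> borel_measurable borel" for S using G by blast
  let ?g = "\<lambda>x. \<Sum>S\<in>UNIV. G S x"
  have DL: "0 \<le> 2 * (D * lam)" using D lam by simp
  show ?case
  proof (intro exI[of _ ?g] conjI allI impI)
    show "?g \<in> borel_measurable borel" by measurable
    show "?g x = 0" if "x \<notin> cube a l" for x
      using that G child_subset[OF l] unfolding Q_def by (intro sum.neutral) blast
    show "norm (?g x) \<le> 2 * (D * lam)" for x
    proof -
      let ?S = "{i. a $ i + l / 2 \<le> x $ i}"
      have "G S x = 0" if "S \<noteq> ?S" for S
        using that G child_unique[OF l, of x a S] unfolding Q_def by blast
      then have "?g x = G ?S x" by (subst sum.mono_neutral_right[of UNIV "{?S}"]) auto
      then show ?thesis using G by metis
    qed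
    have "(LINT x|gauss. ?g x) = (\<Sum>S\<in>UNIV. (LINT x|gauss. F S x))"
      using G by (subst Bochner_Integration.integral_sum) (auto intro!: integrable_bounded_gauss)
    also have "\<dots> = (LINT x|gauss. f x)"
      using integrable_bounded_gauss[OF Fm FM] by (subst Bochner_Integration.integral_sum[symmetric]) (auto simp: sumF)
    finally show "(LINT x|gauss. ?g x) = (LINT x|gauss. f x)" .
    have "riesz_bound \<alpha> (\<lambda>x. \<Sum>S\<in>UNIV. (F S x - G S x)) (\<Sum>S\<in>UNIV. ?c * I S)"
      using G c0 I0 by (intro riesz_bound_sum) auto
    then show "riesz_bound \<alpha> (\<lambda>x. f x - ?g x) (?c * (LINT x|gauss. norm (f x) powr q))"
      by (simp add: sum_subtractf sumF sumI flip: sum_distrib_left)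
  qed
qed

text \<open>By the decomposition an atom of depth \<open>N\<close> costs \<open>2 D lam C\<close> for the bounded function, plus
  \<open>E lam powr (1 - q)\<close> times \<open>A\<close> for the atoms of smaller depth. The height \<open>lam\<close> is chosen to make
  that factor \<open>1/2\<close>, and \<open>A\<close> is then twice the first contribution. Here \<open>q > 1\<close> is essential.\<close>

theorem step_atoms_uniformly_bounded:
  fixes \<alpha> :: "'n::finite \<Rightarrow> nat"
  assumes k: "sum \<alpha> UNIV > 0" and K: "K \<ge> 0" and q: "q > 1"
  obtains A where "A \<ge> 0" "\<And>N. step_atoms_bounded \<alpha> K q N A"
proof -
  obtain D where D: "D \<ge> 1" "\<And>a l a'. admissible K a l \<Longrightarrow> cube a' (l / 2) \<subseteq> cube a l \<Longrightarrow>
      measure gauss (cube (a :: real ^ 'n) l) \<le> D * measure gauss (cube a' (l / 2))"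
    using gauss_local_doubling[OF K order_refl, where 'n = 'n] by metis
  obtain C where C: "C \<ge> 0" "\<And>a l f. admissible K a l \<Longrightarrow> f \<in> borel_measurable borel \<Longrightarrow> (\<And>x. norm (f x) \<le> 1) \<Longrightarrow>
      (\<And>x. f x \<noteq> 0 \<Longrightarrow> x \<in> cube a l) \<Longrightarrow> (LINT x|gauss. f x) = 0 \<Longrightarrow> riesz_bound \<alpha> f (C * measure gauss (cube a l))"
    using riesz_bound_bounded_atom[OF k K] by metis
  define E where "E = 2 powr q * (1 + 2 powr q) * D"
  have E: "E \<ge> 1"
  proof -
    have "1 \<le> 2 powr q" using q by (simp add: ge_one_powr_ge_zero)
    then have "1 * 1 * 1 \<le> 2 powr q * (1 + 2 powr q) * D" using D by (intro mult_mono) auto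
    then show ?thesis by (simp add: E_def)
  qed
  \<comment> \<open>The solution of \<open>E * lam powr (1 - q) = 1/2\<close>.\<close>
  define lam where "lam = (2 * E) powr (1 / (q - 1))"
  have lam: "lam \<ge> 1" unfolding lam_def using E q by (intro ge_one_powr_ge_zero) auto
  have lamE: "E * lam * lam powr (- q) = 1 / 2"
  proof -
    have "lam * lam powr (- q) = lam powr (1 - q)" using lam powr_add[of lam 1 "- q"] by simp
    also have "\<dots> = (2 * E) powr (- 1)"
    proof -
      have "1 / (q - 1) * (1 - q) = - 1" using q by (simp add: field_simps)
      then show ?thesis unfolding lam_def powr_powr by (simp only:)
    qed
    also have "\<dots> = 1 / (2 * E)" using E by (simp add: powr_minus_divide)
    finally have "E * (lam * lam powr (- q)) = E * (1 / (2 * E))" by simp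
    then show ?thesis using E by (simp add: mult.assoc)
  qed
  define A where "A = 4 * (D * lam) * C"
  have A: "A \<ge> 0" using D lam C by (simp add: A_def)
  have "step_atoms_bounded \<alpha> K q N A" for N
  proof (induction N rule: less_induct)
    case (less N)
    show ?case unfolding step_atoms_bounded_def
    proof (intro allI impI)
      fix a :: "real ^ 'n" and l and f :: "real ^ 'n \<Rightarrow> complex"
      assume ad: "admissible K a l" and fm[measurable]: "f \<in> borel_measurable borel"
        and supp: "\<forall>x. x \<notin> cube a l \<longrightarrow> f x = 0" and st: "dyadic_step N a l f" and f0: "(LINT x|gauss. f x) = 0"
        and avg: "(LINT x|gauss. norm (f x) powr q) \<le> measure gauss (cube a l)"
      let ?m = "measure gauss (cube a l)"
      have "1 \<le> lam powr q" using lam q by (simp add: ge_one_powr_ge_zero)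
      then have "?m \<le> lam powr q * ?m" using mult_right_mono[of 1 "lam powr q" ?m] by simp
      then have "(LINT x|gauss. norm (f x) powr q) \<le> lam powr q * ?m" using avg by linarith
      from Calderon_Zygmund[OF q lam A D less.IH ad fm _ st this]
      obtain g where gm[measurable]: "g \<in> borel_measurable borel" and gs: "\<forall>x. x \<notin> cube a l \<longrightarrow> g x = 0"
        and gb: "\<forall>x. norm (g x) \<le> 2 * (D * lam)" and g0: "(LINT x|gauss. g x) = (LINT x|gauss. f x)"
        and rb: "riesz_bound \<alpha> (\<lambda>x. f x - g x) (A * (E * lam) * lam powr (- q) * (LINT x|gauss. norm (f x) powr q))"
        using supp unfolding E_def by blast
      define R where "R = 2 * (D * lam)"
      have R: "R > 0" using D lam by (simp add: R_def)
      have "riesz_bound \<alpha> (\<lambda>x. complex_of_real (1 / R) * g x) (C * ?m)"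
      proof (rule C(2)[OF ad])
        show "norm (complex_of_real (1 / R) * g x) \<le> 1" for x
          using gb[rule_format, of x] R by (simp add: norm_divide R_def[symmetric])
        show "x \<in> cube a l" if "complex_of_real (1 / R) * g x \<noteq> 0" for x using that gs by auto
        show "(LINT x|gauss. complex_of_real (1 / R) * g x) = 0" using g0 f0 by simp
      qed measurable
      from riesz_bound_scale[OF this, of "complex_of_real R"]
      have rg: "riesz_bound \<alpha> g (R * (C * ?m))" using R by simp
      have "A * (E * lam) * lam powr (- q) = A / 2" using lamE by (simp add: mult.assoc)
      moreover have "(A / 2) * (LINT x|gauss. norm (f x) powr q) \<le> (A / 2) * ?m"
        using avg A by (intro mult_left_mono) auto
      ultimately have "A * (E * lam) * lam powr (- q) * (LINT x|gauss. norm (f x) powr q) \<le> (A / 2) * ?m"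
        by (simp only:)
      from riesz_bound_mono[OF rb this] have rb': "riesz_bound \<alpha> (\<lambda>x. f x - g x) ((A / 2) * ?m)" .
      have "riesz_bound \<alpha> (\<lambda>x. g x + (f x - g x)) (R * (C * ?m) + (A / 2) * ?m)"
        using R C(1) A by (intro riesz_bound_add rg rb') auto
      moreover have "R * (C * ?m) + (A / 2) * ?m = A * ?m" by (simp add: A_def R_def algebra_simps)
      ultimately show "riesz_bound \<alpha> f (A * ?m)" by simp
    qed
  qed
  then show ?thesis using A that by blast
qed

section \<open>The closure of the Riesz transform in L1\<close>

text \<open>The closure in \<open>L\<^sup>1 \<times> L\<^sup>1\<close> of the graph of the transform on \<open>L\<^sup>2\<close>. Convergence in \<open>L\<^sup>1\<close> implies
  convergence in weak \<open>L\<^sup>1\<close>, so that this relation is contained in the extension \<open>riesz\<close>; in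
  contrast to weak \<open>L\<^sup>1\<close>, it is a normed setting in which series can be summed. Limits of
  atoms and of atomic series are taken here.\<close>

definition riesz_closure :: "('n::finite \<Rightarrow> nat) \<Rightarrow> (real ^ 'n \<Rightarrow> complex) \<Rightarrow> (real ^ 'n \<Rightarrow> complex) \<Rightarrow> bool" where
  "riesz_closure \<alpha> f g \<longleftrightarrow> f \<in> borel_measurable borel \<and> g \<in> borel_measurable borel \<and>
     (\<forall>e>0. \<exists>F G. F \<in> Lp 2 \<and> riesz_L2 \<alpha> F G \<and> G \<in> borel_measurable borel \<and>
        gnorm 1 (\<lambda>x. F x - f x) < ennreal e \<and> gnorm 1 (\<lambda>x. G x - g x) < ennreal e)"

lemma riesz_closureI: "F \<in> Lp 2 \<Longrightarrow> riesz_L2 \<alpha> F G \<Longrightarrow> G \<in> borel_measurable borel \<Longrightarrow> riesz_closure \<alpha> F G"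
proof -
  assume F: "F \<in> Lp 2" and G: "riesz_L2 \<alpha> F G" and Gm: "G \<in> borel_measurable borel"
  have z: "gnorm 1 (\<lambda>x. f x - f x) = 0" for f :: "real ^ 'a \<Rightarrow> complex" by (simp add: gnorm_def)
  have "F \<in> borel_measurable borel" using F unfolding Lp_2_iff by blast
  then show ?thesis unfolding riesz_closure_def
    by (intro conjI allI impI exI[of _ F] exI[of _ G] F G Gm) (unfold z, auto)
qed

lemma gnorm_1_add_less:
  fixes u v :: "real ^ 'n::finite \<Rightarrow> complex"
  assumes [measurable]: "u \<in> borel_measurable borel" "v \<in> borel_measurable borel"
    and "gnorm 1 u < ennreal e" "gnorm 1 v < ennreal d" "e > 0" "d > 0"
  shows "gnorm 1 (\<lambda>x. u x + v x) < ennreal (e + d)"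
proof -
  have "gnorm 1 (\<lambda>x. u x + v x) \<le> gnorm 1 u + gnorm 1 v" by (rule gnorm_1_triangle[OF assms(1,2)])
  also have "\<dots> < ennreal e + ennreal d" by (rule add_strict_mono[OF assms(3,4)])
  also have "\<dots> = ennreal (e + d)" using assms by simp
  finally show ?thesis .
qed

lemma riesz_closure_add:
  assumes 1: "riesz_closure \<alpha> f g" and 2: "riesz_closure \<alpha> f' g'"
  shows "riesz_closure \<alpha> (\<lambda>x. f x + f' x) (\<lambda>x. g x + g' x)"
proof -
  have m[measurable]: "f \<in> borel_measurable borel" "g \<in> borel_measurable borel" "f' \<in> borel_measurable borel" "g' \<in> borel_measurable borel"
    using 1 2 by (auto simp: riesz_closure_def)
  have "\<exists>F G. F \<in> Lp 2 \<and> riesz_L2 \<alpha> F G \<and> G \<in> borel_measurable borel \<and>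
      gnorm 1 (\<lambda>x. F x - (f x + f' x)) < ennreal e \<and> gnorm 1 (\<lambda>x. G x - (g x + g' x)) < ennreal e" if e: "e > 0" for e
  proof -
    have e2: "e / 2 > 0" using e by simp
    obtain F G where F: "F \<in> Lp 2" "riesz_L2 \<alpha> F G" "G \<in> borel_measurable borel"
        "gnorm 1 (\<lambda>x. F x - f x) < ennreal (e / 2)" "gnorm 1 (\<lambda>x. G x - g x) < ennreal (e / 2)"
      using 1 e2 unfolding riesz_closure_def by blast
    obtain F' G' where F': "F' \<in> Lp 2" "riesz_L2 \<alpha> F' G'" "G' \<in> borel_measurable borel"
        "gnorm 1 (\<lambda>x. F' x - f' x) < ennreal (e / 2)" "gnorm 1 (\<lambda>x. G' x - g' x) < ennreal (e / 2)"
      using 2 e2 unfolding riesz_closure_def by blast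
    have [measurable]: "F \<in> borel_measurable borel" "F' \<in> borel_measurable borel" using F(1) F'(1) unfolding Lp_2_iff by auto
    note [measurable] = F(3) F'(3)
    have "gnorm 1 (\<lambda>x. (F x - f x) + (F' x - f' x)) < ennreal (e / 2 + e / 2)"
      by (rule gnorm_1_add_less[OF _ _ F(4) F'(4) e2 e2]) measurable
    moreover have "gnorm 1 (\<lambda>x. (G x - g x) + (G' x - g' x)) < ennreal (e / 2 + e / 2)"
      by (rule gnorm_1_add_less[OF _ _ F(5) F'(5) e2 e2]) measurable
    moreover have "riesz_L2 \<alpha> (\<lambda>x. F x + F' x) (\<lambda>x. G x + G' x)" using riesz_L2_lincomb[OF F(2) F'(2), of 1 1] by simp
    moreover have "(\<lambda>x. F x + F' x) \<in> Lp 2" using Lp_2_lincomb[OF F(1) F'(1), of 1 1] by simp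
    ultimately show ?thesis
      by (intro exI[of _ "\<lambda>x. F x + F' x"] exI[of _ "\<lambda>x. G x + G' x"]) (simp add: algebra_simps)
  qed
  then show ?thesis unfolding riesz_closure_def by (intro conjI allI impI) measurable
qed

lemma riesz_closure_scale:
  assumes 1: "riesz_closure \<alpha> f g"
  shows "riesz_closure \<alpha> (\<lambda>x. a * f x) (\<lambda>x. a * g x)"
proof -
  have m[measurable]: "f \<in> borel_measurable borel" "g \<in> borel_measurable borel"
    using 1 by (auto simp: riesz_closure_def)
  have "\<exists>F G. F \<in> Lp 2 \<and> riesz_L2 \<alpha> F G \<and> G \<in> borel_measurable borel \<and>
      gnorm 1 (\<lambda>x. F x - a * f x) < ennreal e \<and> gnorm 1 (\<lambda>x. G x - a * g x) < ennreal e" if e: "e > 0" for e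
  proof -
    define d where "d = e / (norm a + 1)"
    have d: "d > 0" using e by (simp add: d_def add_nonneg_pos)
    obtain F G where F: "F \<in> Lp 2" "riesz_L2 \<alpha> F G" "G \<in> borel_measurable borel"
        "gnorm 1 (\<lambda>x. F x - f x) < ennreal d" "gnorm 1 (\<lambda>x. G x - g x) < ennreal d"
      using 1 d unfolding riesz_closure_def by blast
    have [measurable]: "F \<in> borel_measurable borel" using F(1) unfolding Lp_2_iff by auto
    note [measurable] = F(3)
    have le: "ennreal (norm a) * ennreal d < ennreal e"
    proof -
      have "norm a * d < (norm a + 1) * d" using d by (intro mult_strict_right_mono) auto
      also have "\<dots> = e" using norm_ge_zero[of a] by (simp add: d_def add_nonneg_eq_0_iff)
      finally show ?thesis using d e by (simp add: ennreal_less_iff flip: ennreal_mult)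
    qed
    have sc: "gnorm 1 (\<lambda>x. a * u x - a * v x) < ennreal e" if [measurable]: "u \<in> borel_measurable borel" "v \<in> borel_measurable borel"
        and uv: "gnorm 1 (\<lambda>x. u x - v x) < ennreal d" for u v :: "real ^ 'a \<Rightarrow> complex"
    proof -
      have "gnorm 1 (\<lambda>x. a * (u x - v x)) = ennreal (norm a) * gnorm 1 (\<lambda>x. u x - v x)"
        by (subst gnorm_mult_const) simp_all
      also have "\<dots> \<le> ennreal (norm a) * ennreal d" using uv by (intro mult_left_mono) auto
      also have "\<dots> < ennreal e" by (rule le)
      finally show ?thesis by (simp only: right_diff_distrib)
    qed
    have "riesz_L2 \<alpha> (\<lambda>x. a * F x) (\<lambda>x. a * G x)" using riesz_L2_lincomb[OF F(2) F(2), of a 0] by simp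
    moreover have "(\<lambda>x. a * F x) \<in> Lp 2" using Lp_2_lincomb[OF F(1) F(1), of a 0] by simp
    ultimately show ?thesis using sc[OF _ _ F(4)] sc[OF _ _ F(5)]
      by (intro exI[of _ "\<lambda>x. a * F x"] exI[of _ "\<lambda>x. a * G x"]) simp
  qed
  then show ?thesis unfolding riesz_closure_def by (intro conjI allI impI) measurable
qed

definition closure_bound :: "('n::finite \<Rightarrow> nat) \<Rightarrow> (real ^ 'n \<Rightarrow> complex) \<Rightarrow> real \<Rightarrow> bool" where
  "closure_bound \<alpha> f C \<longleftrightarrow> (\<exists>g. riesz_closure \<alpha> f g \<and> gnorm 1 g \<le> ennreal C)"

lemma riesz_bound_imp_closure_bound: "riesz_bound \<alpha> f C \<Longrightarrow> closure_bound \<alpha> f C"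
  unfolding riesz_bound_def closure_bound_def using riesz_closureI by blast

lemma closure_bound_scale:
  assumes "closure_bound \<alpha> f C" shows "closure_bound \<alpha> (\<lambda>x. a * f x) (norm a * C)"
proof -
  obtain g where g: "riesz_closure \<alpha> f g" "gnorm 1 g \<le> ennreal C" using assms by (auto simp: closure_bound_def)
  then have [measurable]: "g \<in> borel_measurable borel" by (simp add: riesz_closure_def)
  have "gnorm 1 (\<lambda>x. a * g x) = ennreal (norm a) * gnorm 1 g"
    by (subst gnorm_mult_const) simp_all
  also have "\<dots> \<le> ennreal (norm a) * ennreal C" using g by (intro mult_left_mono) auto
  also have "\<dots> = ennreal (norm a * C)" by (simp add: ennreal_mult')
  finally show ?thesis using riesz_closure_scale[OF g(1), of a] unfolding closure_bound_def by blast
qed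

lemma closure_bound_mono: "closure_bound \<alpha> f C \<Longrightarrow> C \<le> C' \<Longrightarrow> closure_bound \<alpha> f C'"
  unfolding closure_bound_def by (meson ennreal_leI order_trans)

lemma gnorm_cong_AE: "AE x in gauss. f x = g x \<Longrightarrow> gnorm p f = gnorm p g"
  unfolding gnorm_def by (intro nn_integral_cong_AE) auto

lemma riesz_closure_cong_AE:
  assumes "riesz_closure \<alpha> f g" "AE x in gauss. f x = f' x" "f' \<in> borel_measurable borel"
  shows "riesz_closure \<alpha> f' g"
proof -
  have "gnorm 1 (\<lambda>x. F x - f' x) = gnorm 1 (\<lambda>x. F x - f x)" for F
    using assms(2) by (intro gnorm_cong_AE) auto
  then show ?thesis using assms(1,3) unfolding riesz_closure_def by simp
qed

lemma riesz_closure_sum: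
  assumes "\<And>j. riesz_closure \<alpha> (d j) (g j)"
  shows "riesz_closure \<alpha> (\<lambda>x. \<Sum>j<N. d j x) (\<lambda>x. \<Sum>j<(N::nat). g j x)"
proof (induction N)
  case 0
  have "riesz_closure \<alpha> (\<lambda>x. 0 * d 0 x) (\<lambda>x. 0 * g 0 x)" by (rule riesz_closure_scale[OF assms])
  then show ?case by simp
next
  case (Suc N)
  then show ?case using riesz_closure_add[OF Suc assms[of N]] by simp
qed

lemma gnorm_1_sum_le:
  fixes g :: "nat \<Rightarrow> real ^ 'n::finite \<Rightarrow> complex"
  assumes "\<And>j. g j \<in> borel_measurable borel" "\<And>j. gnorm 1 (g j) \<le> ennreal (C j)" "\<And>j. 0 \<le> C j" "finite J"
  shows "gnorm 1 (\<lambda>x. \<Sum>j\<in>J. g j x) \<le> ennreal (\<Sum>j\<in>J. C j)"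
  using assms(4)
proof (induction J rule: finite_induct)
  case empty
  then show ?case by (simp add: gnorm_def)
next
  case (insert j J)
  have "gnorm 1 (\<lambda>x. g j x + (\<Sum>j\<in>J. g j x)) \<le> gnorm 1 (g j) + gnorm 1 (\<lambda>x. \<Sum>j\<in>J. g j x)"
    by (rule gnorm_1_triangle) (auto intro!: borel_measurable_sum assms(1))
  also have "\<dots> \<le> ennreal (C j) + ennreal (\<Sum>j\<in>J. C j)" by (intro add_mono assms(2) insert.IH)
  also have "\<dots> = ennreal (\<Sum>j\<in>insert j J. C j)" using insert assms(3) by (simp add: sum_nonneg)
  finally show ?case using insert by simp
qed

text \<open>Absolute convergence of the images in \<open>L\<^sup>1\<close> provides a candidate for the image of the sum, and
  the graph is closed.\<close>

theorem closure_bound_series: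
  fixes f :: "real ^ 'n::finite \<Rightarrow> complex"
  assumes f[measurable]: "f \<in> borel_measurable borel" and d: "\<And>j. closure_bound \<alpha> (d j) (C j)"
    and C: "\<And>j. 0 \<le> C j" "summable C"
    and lim: "(\<lambda>N. gnorm 1 (\<lambda>x. f x - (\<Sum>j<N. d j x))) \<longlonglongrightarrow> 0"
  shows "closure_bound \<alpha> f (\<Sum>j. C j)"
proof -
  have "\<forall>j. \<exists>g. riesz_closure \<alpha> (d j) g \<and> gnorm 1 g \<le> ennreal (C j)"
    using d unfolding closure_bound_def by blast
  from choice[OF this] obtain g where g: "\<forall>j. riesz_closure \<alpha> (d j) (g j) \<and> gnorm 1 (g j) \<le> ennreal (C j)" ..
  have [measurable]: "g j \<in> borel_measurable borel" "d j \<in> borel_measurable borel" for j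
    using g by (auto simp: riesz_closure_def)
  define S where "S N x = (\<Sum>j<N. g j x)" for N :: nat and x
  have [measurable]: "S N \<in> borel_measurable borel" for N unfolding S_def by measurable
  have tail: "gnorm 1 (\<lambda>x. S i x - S j x) \<le> ennreal (\<Sum>n\<in>{j..<i}. C n)" if "j \<le> i" for i j
  proof -
    have eq: "(\<lambda>x. S i x - S j x) = (\<lambda>x. \<Sum>n\<in>{j..<i}. g n x)"
      unfolding S_def using that by (intro ext) (simp add: sum_diff_nat_ivl lessThan_atLeast0)
    show ?thesis unfolding eq using g C by (intro gnorm_1_sum_le) auto
  qed
  have "\<exists>G. G \<in> borel_measurable borel \<and> (\<lambda>N. gnorm (Suc 0) (\<lambda>x. S N x - G x)) \<longlonglongrightarrow> 0"
  proof (rule gnorm_complete)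
    fix e :: real assume e: "e > 0"
    obtain N where N: "\<And>m n. m \<ge> N \<Longrightarrow> norm (\<Sum>n\<in>{m..<n}. C n) < e"
      using C(2) e unfolding summable_Cauchy by blast
    have le: "gnorm (Suc 0) (\<lambda>x. S i x - S j x) \<le> ennreal e" if "j \<ge> N" "j \<le> i" for i j
      using tail[OF that(2)] N[OF that(1), of i] by (auto intro: order_trans[OF _ ennreal_leI])
    have "gnorm (Suc 0) (\<lambda>x. S i x - S j x) \<le> ennreal e" if "i \<ge> N" "j \<ge> N" for i j
      using le[of i j] le[of j i] that gnorm_minus_commute[of "Suc 0" "S i" "S j"] by (cases "i \<le> j") auto
    then show "\<exists>N. \<forall>i\<ge>N. \<forall>j\<ge>N. gnorm (Suc 0) (\<lambda>x. S i x - S j x) \<le> ennreal e" by blast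
  qed measurable
  then obtain G where G[measurable]: "G \<in> borel_measurable borel" and Glim: "(\<lambda>N. gnorm 1 (\<lambda>x. S N x - G x)) \<longlonglongrightarrow> 0"
    by auto
  have "riesz_closure \<alpha> f G"
    unfolding riesz_closure_def
  proof (intro conjI allI impI f G)
    fix e :: real assume e: "e > 0"
    then have e2: "e / 2 > 0" by simp
    have "\<forall>\<^sub>F N in sequentially. gnorm 1 (\<lambda>x. f x - (\<Sum>j<N. d j x)) < ennreal (e / 2) \<and> gnorm 1 (\<lambda>x. S N x - G x) < ennreal (e / 2)"
      using e2 by (intro eventually_conj order_tendstoD[OF lim] order_tendstoD[OF Glim]) auto
    then obtain N where N: "gnorm 1 (\<lambda>x. f x - (\<Sum>j<N. d j x)) < ennreal (e / 2)" "gnorm 1 (\<lambda>x. S N x - G x) < ennreal (e / 2)"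
      by (auto simp: eventually_sequentially)
    have "riesz_closure \<alpha> (\<lambda>x. \<Sum>j<N. d j x) (S N)" unfolding S_def using g by (intro riesz_closure_sum) auto
    then obtain F H where F: "F \<in> Lp 2" "riesz_L2 \<alpha> F H" "H \<in> borel_measurable borel"
        "gnorm 1 (\<lambda>x. F x - (\<Sum>j<N. d j x)) < ennreal (e / 2)" "gnorm 1 (\<lambda>x. H x - S N x) < ennreal (e / 2)"
      using e2 unfolding riesz_closure_def by blast
    have [measurable]: "F \<in> borel_measurable borel" using F(1) unfolding Lp_2_iff by auto
    note [measurable] = F(3)
    have N': "gnorm 1 (\<lambda>x. (\<Sum>j<N. d j x) - f x) < ennreal (e / 2)"
      using N(1) gnorm_minus_commute[of 1 f "\<lambda>x. \<Sum>j<N. d j x"] by simp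
    have "gnorm 1 (\<lambda>x. (F x - (\<Sum>j<N. d j x)) + ((\<Sum>j<N. d j x) - f x)) < ennreal (e / 2 + e / 2)"
      by (rule gnorm_1_add_less[OF _ _ F(4) N' e2 e2]) measurable
    moreover have "gnorm 1 (\<lambda>x. (H x - S N x) + (S N x - G x)) < ennreal (e / 2 + e / 2)"
      by (rule gnorm_1_add_less[OF _ _ F(5) N(2) e2 e2]) measurable
    ultimately show "\<exists>F H. F \<in> Lp 2 \<and> riesz_L2 \<alpha> F H \<and> H \<in> borel_measurable borel \<and>
        gnorm 1 (\<lambda>x. F x - f x) < ennreal e \<and> gnorm 1 (\<lambda>x. H x - G x) < ennreal e"
      using F by (intro exI[of _ F] exI[of _ H]) simp
  qed
  moreover have "gnorm 1 G \<le> ennreal (\<Sum>j. C j)"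
  proof -
    have "gnorm 1 G \<le> gnorm 1 (\<lambda>x. S N x - G x) + ennreal (\<Sum>j. C j)" for N
    proof -
      have "gnorm 1 (\<lambda>x. (G x - S N x) + S N x) \<le> gnorm 1 (\<lambda>x. G x - S N x) + gnorm 1 (S N)"
        by (rule gnorm_1_triangle) measurable
      also have "gnorm 1 (S N) \<le> ennreal (\<Sum>j<N. C j)"
        unfolding S_def using g C by (intro gnorm_1_sum_le) auto
      also have "\<dots> \<le> ennreal (\<Sum>j. C j)" using C by (intro ennreal_leI sum_le_suminf) auto
      finally show ?thesis using gnorm_minus_commute[of 1 G "S N"] by (simp add: add_left_mono)
    qed
    moreover have "(\<lambda>N. gnorm 1 (\<lambda>x. S N x - G x) + ennreal (\<Sum>j. C j)) \<longlonglongrightarrow> 0 + ennreal (\<Sum>j. C j)"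
      by (intro tendsto_add tendsto_const Glim)
    ultimately have "gnorm 1 G \<le> 0 + ennreal (\<Sum>j. C j)" by (intro LIMSEQ_le_const) auto
    then show ?thesis by simp
  qed
  ultimately show ?thesis unfolding closure_bound_def by blast
qed

section \<open>Density of the dyadic step functions\<close>

text \<open>On a dyadic cube of generation \<open>N\<close>, whose diameter is at most \<open>n l / 2\<^sup>N\<close>, the function is replaced
  by its value at the corner.\<close>

lemma continuous_step_approximation:
  fixes g :: "real ^ 'n::finite \<Rightarrow> complex"
  assumes "l > 0" and "\<And>x y. x \<in> cube a l \<Longrightarrow> y \<in> cube a l \<Longrightarrow> norm (x - y) \<le> real CARD('n) * l / 2 ^ N \<Longrightarrow> norm (g x - g y) \<le> d"
  shows "\<exists>h. h \<in> borel_measurable borel \<and> (\<forall>x. x \<notin> cube a l \<longrightarrow> h x = 0) \<and> dyadic_step N a l h \<and> (\<forall>x\<in>cube a l. norm (g x - h x) \<le> d)"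
  using assms
proof (induction N arbitrary: a l)
  case 0
  let ?h = "\<lambda>x. indicat_real (cube a l) x *\<^sub>R g a"
  have "norm (g x - ?h x) \<le> d" if "x \<in> cube a l" for x
    using 0(2)[OF that cube_corner[OF 0(1)]] cube_diam[OF that cube_corner[OF 0(1)]] that by simp
  then show ?case by (intro exI[of _ ?h]) auto
next
  case (Suc N)
  have l2: "l / 2 > 0" using Suc.prems by simp
  have "\<forall>S. \<exists>h. h \<in> borel_measurable borel \<and> (\<forall>x. x \<notin> cube (child a l S) (l / 2) \<longrightarrow> h x = 0) \<and> dyadic_step N (child a l S) (l / 2) h \<and>
      (\<forall>x\<in>cube (child a l S) (l / 2). norm (g x - h x) \<le> d)"
  proof
    fix S
    show "\<exists>h. h \<in> borel_measurable borel \<and> (\<forall>x. x \<notin> cube (child a l S) (l / 2) \<longrightarrow> h x = 0) \<and> dyadic_step N (child a l S) (l / 2) h \<and>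
      (\<forall>x\<in>cube (child a l S) (l / 2). norm (g x - h x) \<le> d)"
    proof (rule Suc.IH[OF l2])
      fix x y assume "x \<in> cube (child a l S) (l / 2)" "y \<in> cube (child a l S) (l / 2)" "norm (x - y) \<le> real CARD('n) * (l / 2) / 2 ^ N"
      then show "norm (g x - g y) \<le> d" using child_subset[OF Suc.prems(1), of a S] by (intro Suc.prems(2)) auto
    qed
  qed
  from choice[OF this] obtain h where h: "\<forall>S. h S \<in> borel_measurable borel \<and> (\<forall>x. x \<notin> cube (child a l S) (l / 2) \<longrightarrow> h S x = 0) \<and> dyadic_step N (child a l S) (l / 2) (h S) \<and>
      (\<forall>x\<in>cube (child a l S) (l / 2). norm (g x - h S x) \<le> d)" ..
  let ?H = "\<lambda>x. \<Sum>S\<in>UNIV. h S x"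
  have H: "?H x = h S x" if x: "x \<in> cube (child a l S) (l / 2)" for x S
  proof -
    have "h T x = 0" if "T \<noteq> S" for T
    proof -
      have "x \<notin> cube (child a l T) (l / 2)"
        using x that child_unique[OF Suc.prems(1), of x a S] child_unique[OF Suc.prems(1), of x a T] by simp
      then show ?thesis using h by blast
    qed
    then show ?thesis by (subst sum.mono_neutral_right[of UNIV "{S}"]) auto
  qed
  show ?case
  proof (intro exI[of _ ?H] conjI allI impI ballI)
    show "?H \<in> borel_measurable borel" using h by (intro borel_measurable_sum) auto
    show "?H x = 0" if "x \<notin> cube a l" for x
    proof (intro sum.neutral ballI)
      fix S
      have "x \<notin> cube (child a l S) (l / 2)" using that child_subset[OF Suc.prems(1), of a S] by blast
      then show "h S x = 0" using h by blast
    qed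
    show "dyadic_step (Suc N) a l ?H" unfolding dyadic_step.simps
    proof
      fix S
      show "dyadic_step N (child a l S) (l / 2) ?H"
      proof (rule dyadic_step_cong[OF l2])
        show "dyadic_step N (child a l S) (l / 2) (h S)" using h by blast
        show "h S x = ?H x" if "x \<in> cube (child a l S) (l / 2)" for x using H[OF that] by simp
      qed
    qed
    fix x assume x: "x \<in> cube a l"
    let ?S = "{i. a $ i + l / 2 \<le> x $ i}"
    have xS: "x \<in> cube (child a l ?S) (l / 2)" using x child_unique[OF Suc.prems(1), of x a ?S] by simp
    have "norm (g x - h ?S x) \<le> d" using h xS by blast
    then show "norm (g x - ?H x) \<le> d" unfolding H[OF xS] .
  qed
qed

lemma integrable_powr_diff:
  fixes f g :: "real ^ 'n::finite \<Rightarrow> complex"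
  assumes [measurable]: "f \<in> borel_measurable borel" "g \<in> borel_measurable borel"
    and int: "integrable gauss (\<lambda>x. norm (f x) powr q)" "integrable gauss (\<lambda>x. norm (g x) powr q)" and q: "q > 0"
  shows "integrable gauss (\<lambda>x. norm (f x - g x) powr q)"
    "(LINT x|gauss. norm (f x - g x) powr q) \<le> 2 powr q * ((LINT x|gauss. norm (f x) powr q) + (LINT x|gauss. norm (g x) powr q))"
proof -
  have le: "norm (f x - g x) powr q \<le> 2 powr q * (norm (f x) powr q + norm (g x) powr q)" for x
  proof -
    have "norm (f x - g x) powr q \<le> (norm (f x) + norm (g x)) powr q"
      using q by (intro powr_mono2 norm_triangle_ineq4) auto
    also have "\<dots> \<le> 2 powr q * (norm (f x) powr q + norm (g x) powr q)" using q by (intro powr_sum_le) auto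
    finally show ?thesis .
  qed
  have int2: "integrable gauss (\<lambda>x. 2 powr q * (norm (f x) powr q + norm (g x) powr q))" using int by simp
  show int3: "integrable gauss (\<lambda>x. norm (f x - g x) powr q)"
    by (rule Bochner_Integration.integrable_bound[OF int2]) (use le in auto)
  have "(LINT x|gauss. norm (f x - g x) powr q) \<le> (LINT x|gauss. 2 powr q * (norm (f x) powr q + norm (g x) powr q))"
    by (rule integral_mono[OF int3 int2 le])
  also have "\<dots> = 2 powr q * ((LINT x|gauss. norm (f x) powr q) + (LINT x|gauss. norm (g x) powr q))" using int by simp
  finally show "(LINT x|gauss. norm (f x - g x) powr q) \<le> \<dots>" .
qed

lemma integrable_powr_bounded:
  fixes f :: "real ^ 'n::finite \<Rightarrow> complex"
  assumes [measurable]: "f \<in> borel_measurable borel" and "\<And>x. norm (f x) \<le> M" "q > 0"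
  shows "integrable gauss (\<lambda>x. norm (f x) powr q)"
  by (rule integrable_bounded_gauss[of _ "M powr q"]) (use assms in \<open>auto intro!: powr_mono2\<close>)

lemma integrable_of_powr:
  fixes f :: "real ^ 'n::finite \<Rightarrow> complex"
  assumes [measurable]: "f \<in> borel_measurable borel" and int: "integrable gauss (\<lambda>x. norm (f x) powr q)" and q: "q > 1"
  shows "integrable gauss f"
proof (rule Bochner_Integration.integrable_bound)
  show "integrable gauss (\<lambda>x. 1 + norm (f x) powr q)" using int by simp
  have "norm (f x) \<le> 1 + norm (f x) powr q" for x using le_add_powr[of "norm (f x)" 1 q] q by simp
  then show "AE x in gauss. norm (f x) \<le> norm (1 + norm (f x) powr q)" by (auto intro!: AE_I2 order_trans[OF _ abs_ge_self])
qed simp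

text \<open>Bounded functions are limits of bounded continuous ones, which are uniformly continuous near
  the cube.\<close>

lemma bounded_step_density:
  fixes f :: "real ^ 'n::finite \<Rightarrow> complex"
  assumes l: "l > 0" and fm[measurable]: "f \<in> borel_measurable borel" and M: "\<And>x. norm (f x) \<le> M"
    and supp: "\<And>x. x \<notin> cube a l \<Longrightarrow> f x = 0" and q: "q > 1" and e: "e > 0"
  shows "\<exists>N h. h \<in> borel_measurable borel \<and> (\<forall>x. x \<notin> cube a l \<longrightarrow> h x = 0) \<and> dyadic_step N a l h \<and>
    (LINT x|gauss. norm (f x - h x) powr q) \<le> e"
proof -
  define e' where "e' = e / (2 * 2 powr q)"
  have e': "e' > 0" using e by (simp add: e'_def)
  obtain g where gc: "\<And>k. continuous_on UNIV (g k)" and gM: "\<And>k x. norm (g k x) \<le> M"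
    and glim: "AE x in gauss. (\<lambda>k. g k x) \<longlonglongrightarrow> f x"
    by (rule continuous_approximation[of f M, OF fm M]) (rule that)
  have gm[measurable]: "g k \<in> borel_measurable borel" for k by (rule borel_measurable_continuous_onI[OF gc])
  have diffM: "norm (f x - g k x) \<le> 2 * M" for k x
    using norm_triangle_ineq4[of "f x" "g k x"] M[of x] gM[of k x] by linarith
  have "(\<lambda>k. LINT x|gauss. norm (f x - g k x) powr q) \<longlonglongrightarrow> (LINT x|(gauss :: (real ^ 'n) measure). 0)"
  proof (rule integral_dominated_convergence)
    show "integrable gauss (\<lambda>x :: real ^ 'n. (2 * M) powr q)" by simp
    show "AE x in gauss. norm (norm (f x - g k x) powr q) \<le> (2 * M) powr q" for k
      using diffM[of _ k] q by (intro AE_I2) (auto intro!: powr_mono2)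
    show "AE x in gauss. (\<lambda>k. norm (f x - g k x) powr q) \<longlonglongrightarrow> 0"
      using glim
    proof eventually_elim
      case (elim x)
      have "(\<lambda>k. norm (f x - g k x)) \<longlonglongrightarrow> norm (f x - f x)" by (intro tendsto_intros elim)
      then have "(\<lambda>k. norm (f x - g k x) powr q) \<longlonglongrightarrow> 0 powr q"
        using q by (intro tendsto_powr') (auto simp: tendsto_const)
      then show ?case by simp
    qed
  qed measurable
  then have "\<forall>\<^sub>F k in sequentially. (LINT x|gauss. norm (f x - g k x) powr q) < e'"
    using e' by (intro order_tendstoD) auto
  then obtain k where k: "(LINT x|gauss. norm (f x - g k x) powr q) < e'" by (auto simp: eventually_sequentially)
  define d where "d = e' powr (1 / q)"
  have d: "d > 0" "d powr q = e'" using e' q by (auto simp: d_def powr_powr)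
  let ?R = "cball a (real CARD('n) * l)"
  have sub: "cube a l \<subseteq> ?R" using cube_diam[OF cube_corner[OF l]] by (auto simp: dist_norm)
  have "uniformly_continuous_on ?R (g k)"
    by (rule compact_uniformly_continuous[OF continuous_on_subset[OF gc]]) auto
  then obtain \<delta> where \<delta>: "\<delta> > 0" "\<And>x y. x \<in> ?R \<Longrightarrow> y \<in> ?R \<Longrightarrow> dist y x < \<delta> \<Longrightarrow> dist (g k y) (g k x) < d"
    using d(1) unfolding uniformly_continuous_on_def by metis
  have "(\<lambda>N. real CARD('n) * l / 2 ^ N) \<longlonglongrightarrow> 0" by real_asymp
  then have "\<forall>\<^sub>F N in sequentially. real CARD('n) * l / 2 ^ N < \<delta>" using \<delta>(1) by (rule order_tendstoD)
  then obtain N where N: "real CARD('n) * l / 2 ^ N < \<delta>" by (auto simp: eventually_sequentially)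
  have "norm (g k x - g k y) \<le> d" if "x \<in> cube a l" "y \<in> cube a l" "norm (x - y) \<le> real CARD('n) * l / 2 ^ N" for x y
    using \<delta>(2)[of y x] that sub N by (auto simp: dist_norm subset_iff intro!: less_imp_le)
  from continuous_step_approximation[OF l, of a N "g k" d, OF this]
  obtain h where h: "h \<in> borel_measurable borel" "\<forall>x. x \<notin> cube a l \<longrightarrow> h x = 0" "dyadic_step N a l h" "\<forall>x\<in>cube a l. norm (g k x - h x) \<le> d"
    by blast
  note [measurable] = h(1)
  have pt: "norm (f x - h x) powr q \<le> 2 powr q * (norm (f x - g k x) powr q + e')" for x
  proof (cases "x \<in> cube a l")
    case True
    have "norm (f x - h x) powr q \<le> (norm (f x - g k x) + d) powr q"
    proof (rule powr_mono2)
      have "norm (f x - h x) \<le> norm (f x - g k x) + norm (g k x - h x)" using norm_triangle_ineq[of "f x - g k x" "g k x - h x"] by simp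
      then show "norm (f x - h x) \<le> norm (f x - g k x) + d" using h(4) True by force
    qed (use q in auto)
    also have "\<dots> \<le> 2 powr q * (norm (f x - g k x) powr q + d powr q)" using q d by (intro powr_sum_le) auto
    finally show ?thesis using d by simp
  next
    case False then show ?thesis using h(2) supp e' by simp
  qed
  have int: "integrable gauss (\<lambda>x. 2 powr q * (norm (f x - g k x) powr q + e'))"
    using integrable_powr_bounded[of "\<lambda>x. f x - g k x" "2 * M" q] diffM q by simp
  have "(LINT x|gauss. norm (f x - h x) powr q) \<le> (LINT x|gauss. 2 powr q * (norm (f x - g k x) powr q + e'))"
    by (intro integral_mono Bochner_Integration.integrable_bound[OF int] int pt) (use pt in \<open>auto intro!: AE_I2 order_trans[OF _ abs_ge_self]\<close>)
  also have "\<dots> = 2 powr q * ((LINT x|gauss. norm (f x - g k x) powr q) + e')"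
    using integrable_powr_bounded[of "\<lambda>x. f x - g k x" "2 * M" q] diffM q gauss.prob_space[where 'n = 'n] by simp
  also have "\<dots> \<le> 2 powr q * (e' + e')" using k by (intro mult_left_mono) auto
  also have "\<dots> = e" by (simp add: e'_def)
  finally show ?thesis using h by blast
qed

lemma step_density:
  fixes f :: "real ^ 'n::finite \<Rightarrow> complex"
  assumes l: "l > 0" and fm[measurable]: "f \<in> borel_measurable borel" and int: "integrable gauss (\<lambda>x. norm (f x) powr q)"
    and supp: "\<And>x. x \<notin> cube a l \<Longrightarrow> f x = 0" and q: "q > 1" and e: "e > 0"
  shows "\<exists>N h. h \<in> borel_measurable borel \<and> (\<forall>x. x \<notin> cube a l \<longrightarrow> h x = 0) \<and> dyadic_step N a l h \<and>
    integrable gauss (\<lambda>x. norm (h x) powr q) \<and> (LINT x|gauss. norm (f x - h x) powr q) \<le> e"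
proof -
  define e' where "e' = e / (2 * 2 powr q)"
  have e': "e' > 0" using e by (simp add: e'_def)
  define u where "u k x = (if norm (f x) \<le> real k then f x else 0)" for k x
  have um[measurable]: "u k \<in> borel_measurable borel" for k unfolding u_def by measurable
  have "(\<lambda>k. LINT x|gauss. norm (f x - u k x) powr q) \<longlonglongrightarrow> (LINT x|(gauss :: (real ^ 'n) measure). 0)"
  proof (rule integral_dominated_convergence[OF _ _ int])
    show "AE x in gauss. norm (norm (f x - u k x) powr q) \<le> norm (f x) powr q" for k
      by (intro AE_I2) (auto simp: u_def)
    show "AE x in gauss. (\<lambda>k. norm (f x - u k x) powr q) \<longlonglongrightarrow> 0"
    proof (rule AE_I2)
      fix x
      have "\<forall>\<^sub>F k in sequentially. norm (f x - u k x) powr q = 0"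
        using eventually_ge_at_top[of "nat \<lceil>norm (f x)\<rceil>"]
      proof eventually_elim
        case (elim k)
        then have "norm (f x) \<le> real k" by linarith
        then show ?case by (simp add: u_def)
      qed
      then show "(\<lambda>k. norm (f x - u k x) powr q) \<longlonglongrightarrow> 0" by (rule tendsto_eventually)
    qed
  qed measurable
  then have "\<forall>\<^sub>F k in sequentially. (LINT x|gauss. norm (f x - u k x) powr q) < e'"
    using e' by (intro order_tendstoD) auto
  then obtain k where k: "(LINT x|gauss. norm (f x - u k x) powr q) < e'" by (auto simp: eventually_sequentially)
  have uk: "norm (u k x) \<le> real k" for x by (simp add: u_def)
  have us: "x \<notin> cube a l \<Longrightarrow> u k x = 0" for x using supp by (simp add: u_def)
  obtain N h where h: "h \<in> borel_measurable borel" "\<forall>x. x \<notin> cube a l \<longrightarrow> h x = 0" "dyadic_step N a l h"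
    "(LINT x|gauss. norm (u k x - h x) powr q) \<le> e'"
    using bounded_step_density[OF l um uk us q e'] by blast
  note [measurable] = h(1)
  obtain M where M: "\<And>x. x \<in> cube a l \<Longrightarrow> norm (h x) \<le> M" using dyadic_step_bounded[OF l h(3)] by blast
  have hM: "norm (h x) \<le> \<bar>M\<bar>" for x using M[of x] h(2) by (cases "x \<in> cube a l") auto
  have q0: "q > 0" using q by simp
  note hint = integrable_powr_bounded[OF h(1) hM q0]
  note uint = integrable_powr_bounded[OF um uk q0]
  note fu = integrable_powr_diff[OF fm um int uint q0]
  note uh = integrable_powr_diff[OF um h(1) uint hint q0]
  have hu: "integrable gauss (\<lambda>x. norm (h x - u k x) powr q)" using uh(1) by (simp add: norm_minus_commute)
  have "(LINT x|gauss. norm ((f x - u k x) - (h x - u k x)) powr q) \<le> 2 powr q * ((LINT x|gauss. norm (f x - u k x) powr q) + (LINT x|gauss. norm (h x - u k x) powr q))"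
    by (rule integrable_powr_diff[OF _ _ fu(1) hu q0]) measurable
  also have "\<dots> \<le> 2 powr q * (e' + e')" using k h(4) by (intro mult_left_mono) (auto simp: norm_minus_commute)
  also have "\<dots> = e" by (simp add: e'_def)
  finally show ?thesis using h hint by (intro exI[of _ N] exI[of _ h]) auto
qed

text \<open>Subtracting the mean of the error from a step approximation costs a constant factor and keeps
  it a step function.\<close>

lemma mean_zero_step_density:
  fixes f :: "real ^ 'n::finite \<Rightarrow> complex"
  assumes l: "l > 0" and fm[measurable]: "f \<in> borel_measurable borel" and int: "integrable gauss (\<lambda>x. norm (f x) powr q)"
    and supp: "\<And>x. x \<notin> cube a l \<Longrightarrow> f x = 0" and q: "q > 1" and B: "B > 0" and f0: "(LINT x|gauss. f x) = 0"
  shows "\<exists>h N. h \<in> borel_measurable borel \<and> (\<forall>x. x \<notin> cube a l \<longrightarrow> h x = 0) \<and> dyadic_step N a l h \<and> (LINT x|gauss. h x) = 0 \<and>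
    integrable gauss (\<lambda>x. norm (f x - h x) powr q) \<and> (LINT x|gauss. norm (f x - h x) powr q) \<le> B powr q * measure gauss (cube a l)"
proof -
  define E where "E = 2 powr q * (1 + 2 powr q)"
  have E: "E > 0" by (simp add: E_def add_pos_pos)
  have q0: "q > 0" using q by simp
  have BE: "B / E > 0" using B E by simp
  have "(B / E) powr q * measure gauss (cube a l) > 0" using B E measure_cube_pos[OF l, of a] by simp
  from step_density[OF l fm int supp q this]
  obtain N h where h: "h \<in> borel_measurable borel" "\<forall>x. x \<notin> cube a l \<longrightarrow> h x = 0" "dyadic_step N a l h"
    "integrable gauss (\<lambda>x. norm (h x) powr q)" "(LINT x|gauss. norm (f x - h x) powr q) \<le> (B / E) powr q * measure gauss (cube a l)"
    by blast
  note [measurable] = h(1)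
  define u where "u x = f x - h x" for x
  have um[measurable]: "u \<in> borel_measurable borel" unfolding u_def by measurable
  have uint: "integrable gauss (\<lambda>x. norm (u x) powr q)" unfolding u_def by (rule integrable_powr_diff(1)[OF fm h(1) int h(4) q0])
  have us: "x \<notin> cube a l \<Longrightarrow> u x = 0" for x using supp h(2) by (simp add: u_def)
  define m where "m = (LINT x|gauss. u x) / of_real (measure gauss (cube a l))"
  define b where "b x = u x - indicat_real (cube a l) x *\<^sub>R m" for x
  note mb = cube_mean_bounds[OF l um uint us q BE h(5)[folded u_def], folded m_def, folded b_def E_def]
  have bint: "integrable gauss (\<lambda>x. norm (b x) powr q)"
    unfolding b_def
  proof (rule integrable_powr_diff(1)[OF um _ uint _ q0])
    show "integrable gauss (\<lambda>x. norm (indicat_real (cube a l) x *\<^sub>R m) powr q)"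
      by (rule integrable_powr_bounded[of _ "norm m", OF _ _ q0]) (auto simp: indicator_def)
  qed measurable
  have bm[measurable]: "b \<in> borel_measurable borel" unfolding b_def by measurable
  define k where "k x = h x + indicat_real (cube a l) x *\<^sub>R m" for x
  have fk: "f x - k x = b x" for x by (simp add: k_def b_def u_def)
  have "k = (\<lambda>x. f x - b x)" by (auto simp: k_def b_def u_def)
  then have "(LINT x|gauss. k x) = 0"
    using integrable_of_powr[OF fm int q] integrable_of_powr[OF bm bint q] f0 mb(2) by simp
  moreover have "k \<in> borel_measurable borel" unfolding k_def by measurable
  moreover have "dyadic_step N a l k"
  proof (rule dyadic_step_cong[OF l])
    show "dyadic_step N a l (\<lambda>x. h x + m)" by (rule dyadic_step_combine[OF h(3) h(3), of "\<lambda>y _. y + m"])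
    show "x \<in> cube a l \<Longrightarrow> h x + m = k x" for x by (simp add: k_def)
  qed
  moreover have "\<forall>x. x \<notin> cube a l \<longrightarrow> k x = 0" using h(2) by (simp add: k_def)
  moreover have "(LINT x|gauss. norm (b x) powr q) \<le> B powr q * measure gauss (cube a l)" using mb(3) E by simp
  ultimately show ?thesis using bint by (intro exI[of _ k] exI[of _ N]) (simp add: fk)
qed

text \<open>The inequality \<open>le_add_powr\<close>, integrated over the cube.\<close>

lemma gnorm_1_le_cube:
  fixes u :: "real ^ 'n::finite \<Rightarrow> complex"
  assumes um[measurable]: "u \<in> borel_measurable borel" and int: "integrable gauss (\<lambda>x. norm (u x) powr q)"
    and supp: "\<And>x. x \<notin> cube a l \<Longrightarrow> u x = 0" and q: "q > 1" and B: "B > 0"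
    and le: "(LINT x|gauss. norm (u x) powr q) \<le> B powr q * measure gauss (cube a l)"
  shows "gnorm 1 u \<le> ennreal (2 * B * measure gauss (cube a l))"
proof -
  have pt: "norm (u x) \<le> B * indicat_real (cube a l) x + B powr (1 - q) * norm (u x) powr q" for x
    using le_add_powr[of "norm (u x)" B q] q B supp[of x] by (cases "x \<in> cube a l") auto
  have iint: "integrable gauss (indicat_real (cube a l))" by (rule integrable_bounded_gauss[of _ 1]) (auto simp: indicator_def)
  have int2: "integrable gauss (\<lambda>x. B * indicat_real (cube a l) x + B powr (1 - q) * norm (u x) powr q)"
    using int iint by simp
  have nint: "integrable gauss (\<lambda>x. norm (u x))" using integrable_of_powr[OF um int q] by simp
  have "gnorm 1 u = ennreal (LINT x|gauss. norm (u x))"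
    unfolding gnorm_def using nint by (simp add: nn_integral_eq_integral)
  also have "(LINT x|gauss. norm (u x)) \<le> (LINT x|gauss. B * indicat_real (cube a l) x + B powr (1 - q) * norm (u x) powr q)"
    by (rule integral_mono[OF nint int2 pt])
  also have "\<dots> = B * measure gauss (cube a l) + B powr (1 - q) * (LINT x|gauss. norm (u x) powr q)"
    using int iint by simp
  also have "\<dots> \<le> B * measure gauss (cube a l) + B powr (1 - q) * (B powr q * measure gauss (cube a l))"
    using le by (intro add_left_mono mult_left_mono) auto
  also have "B powr (1 - q) * (B powr q * measure gauss (cube a l)) = B * measure gauss (cube a l)"
    using B by (simp add: mult.assoc[symmetric] flip: powr_add)
  finally show ?thesis by (simp add: ennreal_leI mult_ac)
qed

text \<open>Step approximations with mean value zero and errors of size \<open>2\<^sup>-\<^sup>k\<close> are summed as a telescoping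
  series, starting from \<open>0\<close>. The difference of two consecutive ones is \<open>4 * 2\<^sup>-\<^sup>k\<close> times a step
  atom, and \<open>step_atoms_bounded\<close> is independent of its depth.\<close>

theorem closure_bound_powr_atom:
  fixes f :: "real ^ 'n::finite \<Rightarrow> complex"
  assumes A: "A \<ge> 0" "\<And>N. step_atoms_bounded \<alpha> K q N A" and q: "q > 1" and ad: "admissible K a l"
    and fm[measurable]: "f \<in> borel_measurable borel" and int: "integrable gauss (\<lambda>x. norm (f x) powr q)"
    and supp: "\<And>x. x \<notin> cube a l \<Longrightarrow> f x = 0" and f0: "(LINT x|gauss. f x) = 0"
    and le: "(LINT x|gauss. norm (f x) powr q) \<le> measure gauss (cube a l)"
  shows "closure_bound \<alpha> f (8 * A * measure gauss (cube a l))"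
proof -
  let ?g = "measure gauss (cube a l)"
  have l: "l > 0" using ad by (simp add: admissible_def)
  have q0: "q > 0" using q by simp
  define e :: "nat \<Rightarrow> real" where "e k = (1 / 2) ^ k" for k
  have e: "e k > 0" for k by (simp add: e_def)
  have "\<forall>k. \<exists>h N. h \<in> borel_measurable borel \<and> (\<forall>x. x \<notin> cube a l \<longrightarrow> h x = 0) \<and> dyadic_step N a l h \<and> (LINT x|gauss. h x) = 0 \<and>
    integrable gauss (\<lambda>x. norm (f x - h x) powr q) \<and> (LINT x|gauss. norm (f x - h x) powr q) \<le> e k powr q * ?g \<and> (k = 0 \<longrightarrow> h = (\<lambda>x. 0))" (is "\<forall>k. \<exists>h N. ?P k h N")
  proof
    fix k :: nat
    show "\<exists>h N. ?P k h N"
    proof (cases "k = 0")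
      case True
      then show ?thesis using int le dyadic_step_const[of 0 a l 0] by (intro exI[of _ "\<lambda>x. 0"] exI[of _ 0]) (simp add: e_def)
    next
      case False
      then show ?thesis using mean_zero_step_density[OF l fm int supp q e[of k] f0] by simp
    qed
  qed
  from choice[OF this] obtain h where "\<forall>k. \<exists>N. ?P k (h k) N" ..
  from choice[OF this] obtain N where h: "\<forall>k. ?P k (h k) (N k)" ..
  have hm[measurable]: "h k \<in> borel_measurable borel" for k using h by blast
  define d where "d k x = h (Suc k) x - h k x" for k x
  have dm[measurable]: "d k \<in> borel_measurable borel" for k unfolding d_def by measurable
  have hint: "integrable gauss (h k)" for k
  proof -
    have st: "dyadic_step (N k) a l (h k)" using h by blast
    obtain M where M: "\<And>x. x \<in> cube a l \<Longrightarrow> norm (h k x) \<le> M" using dyadic_step_bounded[OF l st] by blast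
    have "norm (h k x) \<le> \<bar>M\<bar>" for x using M[of x] h by (cases "x \<in> cube a l") auto
    then show ?thesis by (rule integrable_bounded_gauss[OF hm])
  qed
  have db: "closure_bound \<alpha> (d k) (4 * e k * (A * ?g))" for k
  proof -
    define v where "v x = complex_of_real (1 / (4 * e k)) * d k x" for x
    have ek: "4 * e k > 0" using e[of k] by simp
    have dint: "(LINT x|gauss. norm (d k x) powr q) \<le> (4 * e k) powr q * ?g"
    proof -
      have eq: "norm (d k x) = norm ((f x - h k x) - (f x - h (Suc k) x))" for x by (simp add: d_def)
      have "(LINT x|gauss. norm (d k x) powr q) \<le> 2 powr q * ((LINT x|gauss. norm (f x - h k x) powr q) + (LINT x|gauss. norm (f x - h (Suc k) x) powr q))"
        unfolding eq by (rule integrable_powr_diff(2)[OF _ _ _ _ q0]) (use h in auto)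
      also have "\<dots> \<le> 2 powr q * (e k powr q * ?g + e (Suc k) powr q * ?g)"
        using h by (intro mult_left_mono add_mono) auto
      also have "\<dots> \<le> 2 powr q * (e k powr q * ?g + e k powr q * ?g)"
        using q e[of "Suc k"] e[of k] by (intro mult_left_mono add_mono mult_right_mono powr_mono2) (auto simp: e_def)
      also have "\<dots> = 2 * (2 powr q * e k powr q * ?g)" by (simp add: algebra_simps)
      also have "\<dots> \<le> 2 powr q * (2 powr q * e k powr q * ?g)"
        using q powr_mono[of 1 q 2] by (intro mult_right_mono) auto
      also have "\<dots> = (4 * e k) powr q * ?g"
      proof -
        have "2 powr q * 2 powr q = (4 :: real) powr q" by (simp flip: powr_mult)
        then show ?thesis by (simp add: powr_mult mult.assoc[symmetric])
      qed
      finally show ?thesis .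
    qed
    have "step_atoms_bounded \<alpha> K q (max (N k) (N (Suc k))) A" by (rule A)
    moreover have "v \<in> borel_measurable borel" unfolding v_def by measurable
    moreover have "\<forall>x. x \<notin> cube a l \<longrightarrow> v x = 0" using h by (simp add: v_def d_def)
    moreover have "dyadic_step (max (N k) (N (Suc k))) a l v"
    proof -
      have "dyadic_step (max (N k) (N (Suc k))) a l (h k)" by (rule dyadic_step_mono[OF _ l, of "N k"]) (use h in auto)
      moreover have "dyadic_step (max (N k) (N (Suc k))) a l (h (Suc k))" by (rule dyadic_step_mono[OF _ l, of "N (Suc k)"]) (use h in auto)
      ultimately show ?thesis unfolding v_def d_def
        by (rule dyadic_step_combine[where h = "\<lambda>y z. complex_of_real (1 / (4 * e k)) * (z - y)"])
    qed
    moreover have "(LINT x|gauss. v x) = 0" using h hint[of k] hint[of "Suc k"] by (simp add: v_def d_def)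
    moreover have "(LINT x|gauss. norm (v x) powr q) \<le> ?g"
    proof -
      have eq: "norm (v x) powr q = (1 / (4 * e k)) powr q * norm (d k x) powr q" for x
      proof -
        have "norm (v x) = (1 / (4 * e k)) * norm (d k x)" using ek by (simp add: v_def norm_mult norm_divide)
        then show ?thesis by (simp only: powr_mult)
      qed
      have "(LINT x|gauss. norm (v x) powr q) = (1 / (4 * e k)) powr q * (LINT x|gauss. norm (d k x) powr q)"
        unfolding eq by simp
      also have "\<dots> \<le> (1 / (4 * e k)) powr q * ((4 * e k) powr q * ?g)" using dint by (intro mult_left_mono) auto
      also have "\<dots> = ((1 / (4 * e k)) * (4 * e k)) powr q * ?g" by (simp only: powr_mult mult.assoc)
      also have "\<dots> = ?g" using ek by simp
      finally show ?thesis .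
    qed
    ultimately have "riesz_bound \<alpha> v (A * ?g)" using ad unfolding step_atoms_bounded_def by blast
    from closure_bound_scale[OF riesz_bound_imp_closure_bound[OF this], of "complex_of_real (4 * e k)"]
    have "closure_bound \<alpha> (\<lambda>x. complex_of_real (4 * e k) * v x) (norm (complex_of_real (4 * e k)) * (A * ?g))" .
    moreover have "(\<lambda>x. complex_of_real (4 * e k) * v x) = d k"
      using e[of k] by (intro ext) (simp add: v_def)
    moreover have "norm (complex_of_real (4 * e k)) = 4 * e k" using ek by (simp only: norm_of_real abs_of_pos)
    ultimately show ?thesis by (simp only:)
  qed
  have sums: "(\<lambda>k. 4 * e k * (A * ?g)) sums (4 * 2 * (A * ?g))"
    unfolding e_def using geometric_sums[of "1 / 2 :: real"] by (intro sums_mult2 sums_mult) simp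
  have tel: "(\<Sum>k<m. d k x) = h m x" for m x
    using h sum_lessThan_telescope[of "\<lambda>k. h k x" m] by (simp add: d_def)
  have "closure_bound \<alpha> f (\<Sum>k. 4 * e k * (A * ?g))"
  proof (rule closure_bound_series[OF fm db])
    show "0 \<le> 4 * e k * (A * ?g)" for k using e[of k] A by simp
    show "summable (\<lambda>k. 4 * e k * (A * ?g))" using sums by (rule sums_summable)
    have le: "gnorm 1 (\<lambda>x. f x - (\<Sum>k<m. d k x)) \<le> ennreal (2 * e m * ?g)" for m
      unfolding tel by (rule gnorm_1_le_cube[OF _ _ _ q e[of m]]) (use h supp in auto)
    have "(\<lambda>m. ennreal (2 * e m * ?g)) \<longlonglongrightarrow> ennreal (2 * 0 * ?g)"
      unfolding e_def by (intro tendsto_ennrealI tendsto_intros LIMSEQ_power_zero) auto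
    then have "(\<lambda>m. ennreal (2 * e m * ?g)) \<longlonglongrightarrow> 0" by simp
    then show "(\<lambda>m. gnorm 1 (\<lambda>x. f x - (\<Sum>k<m. d k x))) \<longlonglongrightarrow> 0"
      by (rule tendsto_sandwich[OF _ _ tendsto_const, rotated 2]) (use le in auto)
  qed
  then show ?thesis using sums_unique[OF sums] by (simp add: mult.assoc)
qed

section \<open>Gaussian atoms\<close>

text \<open>An admissible ball lies between two cubes of comparable side, so that atoms on balls can be
  treated as atoms on cubes.\<close>

lemma ball_cube_geometry:
  fixes c :: "real ^ 'n::finite"
  assumes \<rho>: "0 < \<rho>" "\<rho> \<le> admissible_radius (norm c)"
  defines "a \<equiv> c - (\<chi> i. \<rho>)"
  shows "ball c \<rho> \<subseteq> cube a (2 * \<rho>)" "admissible (4 * real CARD('n) + 2) a (2 * \<rho>)"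
    "cube c (\<rho> / (2 * real CARD('n))) \<subseteq> ball c \<rho>"
    "x \<in> cube a (2 * \<rho>) \<Longrightarrow> norm (x - c) \<le> 2 * real CARD('n) * \<rho>"
proof -
  let ?n = "real CARD('n)"
  have n: "?n \<ge> 1" by (simp add: Suc_leI)
  show sub: "ball c \<rho> \<subseteq> cube a (2 * \<rho>)"
  proof
    fix x assume "x \<in> ball c \<rho>"
    then have "norm (x - c) < \<rho>" by (simp add: dist_norm norm_minus_commute)
    then have "\<bar>x $ i - c $ i\<bar> < \<rho>" for i
      using component_le_norm_cart[of "x - c" i] by simp
    then have "a $ i \<le> x $ i \<and> x $ i < a $ i + 2 * \<rho>" for i
      using abs_less_iff[of "x $ i - c $ i" \<rho>] by (auto simp: a_def)
    then show "x \<in> cube a (2 * \<rho>)" by (simp add: cube_def)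
  qed
  have c: "c \<in> cube a (2 * \<rho>)" using sub \<rho> by auto
  have diam: "norm (x - c) \<le> 2 * ?n * \<rho>" if "x \<in> cube a (2 * \<rho>)" for x
    using cube_diam[OF that c] by (simp add: mult_ac)
  then show "x \<in> cube a (2 * \<rho>) \<Longrightarrow> norm (x - c) \<le> 2 * ?n * \<rho>" .
  have \<rho>1: "\<rho> \<le> 1"
  proof (cases "norm c \<le> 1")
    case False
    then have "1 / norm c \<le> 1" by (intro divide_le_eq_1_pos[THEN iffD2]) auto
    then show ?thesis using \<rho>(2) False by (simp add: admissible_radius_def)
  qed (use \<rho> in \<open>simp add: admissible_radius_def\<close>)
  have \<rho>c: "\<rho> * norm c \<le> 1"
  proof (cases "norm c \<le> 1")
    case True then show ?thesis using \<rho> \<rho>1 mult_mono[of \<rho> 1 "norm c" 1] by simp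
  next
    case False
    then have "norm c > 0" by linarith
    then show ?thesis using \<rho>(2) False by (simp add: admissible_radius_def pos_le_divide_eq)
  qed
  show "admissible (4 * ?n + 2) a (2 * \<rho>)"
    unfolding admissible_def
  proof (intro conjI ballI)
    show "2 * \<rho> \<le> 4 * ?n + 2" using \<rho>1 n by simp
    fix y assume y: "y \<in> cube a (2 * \<rho>)"
    have "norm y \<le> norm c + norm (y - c)" using norm_triangle_ineq[of c "y - c"] by simp
    also have "\<dots> \<le> norm c + 2 * ?n * \<rho>" using diam[OF y] by simp
    finally have "2 * \<rho> * norm y \<le> 2 * \<rho> * (norm c + 2 * ?n * \<rho>)" using \<rho> by (intro mult_left_mono) auto
    also have "\<dots> = 2 * (\<rho> * norm c) + 4 * ?n * (\<rho> * \<rho>)" by (simp add: algebra_simps)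
    also have "\<dots> \<le> 2 * 1 + 4 * ?n * 1"
    proof (intro add_mono mult_left_mono \<rho>c)
      show "\<rho> * \<rho> \<le> 1" using \<rho> \<rho>1 mult_mono[of \<rho> 1 \<rho> 1] by simp
    qed auto
    finally show "2 * \<rho> * norm y \<le> 4 * ?n + 2" by simp
  qed (use \<rho> in auto)
  show "cube c (\<rho> / (2 * ?n)) \<subseteq> ball c \<rho>"
  proof
    fix x assume x: "x \<in> cube c (\<rho> / (2 * ?n))"
    have "\<rho> / (2 * ?n) > 0" using \<rho> by simp
    from cube_diam[OF x cube_corner[OF this]]
    have "norm (x - c) \<le> \<rho> / 2" by simp
    then show "x \<in> ball c \<rho>" using \<rho> by (simp add: dist_norm norm_minus_commute)
  qed
qed

text \<open>For \<open>r < \<infinity>\<close> the size condition with \<open>q = r\<close> is the hypothesis raised to the power \<open>r\<close>. A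
  bounded atom satisfies the size condition of every exponent, and \<open>q = 2\<close> is taken.\<close>

lemma atom_energy:
  fixes a :: "real ^ 'n::finite \<Rightarrow> complex" and r :: ereal and E :: "(real ^ 'n) set"
  assumes r: "1 < r" and a: "a \<in> Lp r" and [measurable]: "E \<in> sets borel" and supp: "AE x in gauss. x \<notin> E \<longrightarrow> a x = 0"
    and g: "measure gauss E > 0" and norm: "Lp_norm r a \<le> measure gauss E powr (real_of_ereal (1 / r) - 1)"
  defines "q \<equiv> if r = \<infinity> then 2 else real_of_ereal r"
  shows "integrable gauss (\<lambda>x. norm (a x) powr q)"
    "(LINT x|gauss. norm (a x) powr q) \<le> (1 / measure gauss E) powr q * measure gauss E"
proof -
  let ?g = "measure gauss E"
  have am[measurable]: "a \<in> borel_measurable borel" using a by (simp add: Lp_def)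
  have "integrable gauss (\<lambda>x. norm (a x) powr q) \<and> (LINT x|gauss. norm (a x) powr q) \<le> (1 / ?g) powr q * ?g"
  proof (cases r)
    case (real p)
    have p: "p > 1" and qp: "q = p" using r real by (auto simp: q_def)
    have int: "integrable gauss (\<lambda>x. norm (a x) powr p)" using a real by (simp add: Lp_def)
    define I where "I = (LINT x|gauss. norm (a x) powr p)"
    have I: "I \<ge> 0" unfolding I_def by (intro Bochner_Integration.integral_nonneg) auto
    have "1 / r = ereal (1 / p)" using real p by (simp add: one_ereal_def)
    then have "I powr (1 / p) \<le> ?g powr (1 / p - 1)" using norm real by (simp add: Lp_norm_def I_def)
    then have "(I powr (1 / p)) powr p \<le> (?g powr (1 / p - 1)) powr p" using p by (intro powr_mono2) auto
    moreover have "(I powr (1 / p)) powr p = I" using I p by (simp add: powr_powr)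
    moreover have "(?g powr (1 / p - 1)) powr p = (1 / ?g) powr p * ?g"
    proof -
      have "(1 / p - 1) * p = 1 + (- p)" using p by (simp add: field_simps)
      then have "(?g powr (1 / p - 1)) powr p = ?g powr (1 + (- p))" by (simp only: powr_powr)
      also have "\<dots> = ?g * ?g powr (- p)" unfolding powr_add using g by simp
      also have "?g powr (- p) = (1 / ?g) powr p" using g by (simp add: powr_minus powr_divide inverse_eq_divide)
      finally show ?thesis by (simp only: mult.commute)
    qed
    ultimately show ?thesis using int unfolding qp I_def by simp
  next
    case PInf
    have q2: "q = 2" by (simp add: q_def PInf)
    let ?s = "esssup gauss (\<lambda>x. ereal (norm (a x)))"
    have fin: "?s < \<infinity>" using a PInf by (simp add: Lp_def)
    have AEs: "AE x in gauss. ereal (norm (a x)) \<le> ?s" by (rule esssup_AE)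
    have "?s \<noteq> - \<infinity>"
    proof
      assume "?s = - \<infinity>"
      then have "AE x in (gauss :: (real ^ 'n) measure). False" using AEs by (auto elim!: eventually_mono)
      then show False using gauss.AE_False by simp
    qed
    then obtain s where s: "?s = ereal s" using fin by (cases ?s) auto
    have "s \<le> ?g powr (real_of_ereal (1 / \<infinity>) - 1)" using norm s PInf by (simp add: Lp_norm_def)
    also have "real_of_ereal (1 / \<infinity>) - 1 = - 1" by simp
    also have "?g powr (- 1) = 1 / ?g" using g by (simp add: powr_minus inverse_eq_divide)
    finally have sg: "s \<le> 1 / ?g" .
    have AE: "AE x in gauss. norm (a x) powr 2 \<le> (1 / ?g) powr 2 * indicat_real E x"
      using AEs supp
    proof eventually_elim
      case (elim x)
      have "norm (a x) \<le> 1 / ?g" using elim(1) s sg by simp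
      then have "norm (a x) powr 2 \<le> (1 / ?g) powr 2" by (intro powr_mono2) auto
      then show ?case using elim(2) by (auto simp: indicator_def)
    qed
    have iint: "integrable gauss (\<lambda>x. (1 / ?g) powr 2 * indicat_real E x)"
      by (intro integrable_mult_right integrable_bounded_gauss[of _ 1]) (auto simp: indicator_def)
    have int: "integrable gauss (\<lambda>x. norm (a x) powr 2)"
    proof (rule Bochner_Integration.integrable_bound[OF iint])
      show "AE x in gauss. norm (norm (a x) powr 2) \<le> norm ((1 / ?g) powr 2 * indicat_real E x)"
        using AE by eventually_elim (simp add: abs_mult)
    qed measurable
    have "(LINT x|gauss. norm (a x) powr 2) \<le> (LINT x|gauss. (1 / ?g) powr 2 * indicat_real E x)"
      by (rule integral_mono_AE[OF int iint AE])
    then show ?thesis using int by (simp add: q2)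
  next
    case MInf then show ?thesis using r by simp
  qed
  then show "integrable gauss (\<lambda>x. norm (a x) powr q)"
    "(LINT x|gauss. norm (a x) powr q) \<le> (1 / ?g) powr q * ?g" by auto
qed

text \<open>The constant function is bounded, hence covered by the \<open>L\<^sup>2\<close> theory.\<close>

lemma closure_bound_one:
  fixes \<alpha> :: "'n::finite \<Rightarrow> nat"
  shows "\<exists>C\<ge>0. closure_bound \<alpha> (\<lambda>x. 1) C \<and> gnorm 1 (\<lambda>x :: real ^ 'n. 1 :: complex) \<le> ennreal C"
proof -
  let ?o = "\<lambda>x :: real ^ 'n. 1 :: complex"
  have o: "?o \<in> hspan_closure" by (rule bounded_in_hspan_closure[of _ 1]) auto
  have o2: "gnorm 2 ?o < \<infinity>" by (intro gnorm_exp_growth_finite exp_growth_const) auto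
  obtain g where g: "riesz_L2 \<alpha> ?o g" "g \<in> borel_measurable borel" "gnorm 2 g < \<infinity>"
    by (rule riesz_L2_exists[OF o o2, of \<alpha>])
  have "gnorm 1 g \<le> ennreal 1 + ennreal (1 / 1 ^ 1) * gnorm (Suc 1) g" by (rule gnorm_1_le[OF g(2)]) simp
  also have "\<dots> < \<infinity>" using g(3) by (simp add: numeral_2_eq_2)
  finally obtain C where C: "C \<ge> 0" "gnorm 1 g = ennreal C" by (cases "gnorm 1 g") auto
  have "riesz_closure \<alpha> ?o g" using o2 g by (intro riesz_closureI) (auto simp: Lp_ereal_2_iff)
  then have "closure_bound \<alpha> ?o C" using C unfolding closure_bound_def by (intro exI[of _ g]) simp
  moreover have "gnorm 1 ?o = 1" using gauss.emeasure_space_1[where 'n = 'n] by (simp add: gnorm_def)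
  ultimately show ?thesis using C(1)
    by (intro exI[of _ "C + 1"]) (auto intro: closure_bound_mono simp: ennreal_plus)
qed

text \<open>An atom on an admissible ball, divided by \<open>1 / \<gamma>(B)\<close>, is normalised with respect to the
  circumscribed cube, whose measure is comparable to \<open>\<gamma>(B)\<close> by local doubling.\<close>

theorem gaussian_atoms_uniformly_bounded:
  fixes \<alpha> :: "'n::finite \<Rightarrow> nat" and r :: ereal
  assumes k: "sum \<alpha> UNIV > 0" and r: "1 < r"
  obtains C where "C \<ge> 0" "\<And>a :: real ^ 'n \<Rightarrow> complex. gaussian_atom r a \<Longrightarrow>
    a \<in> borel_measurable borel \<and> closure_bound \<alpha> a C \<and> gnorm 1 a \<le> ennreal C"
proof -
  let ?n = "real CARD('n)"
  have n: "?n \<ge> 1" by (simp add: Suc_leI)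
  define K where "K = 4 * ?n + 2"
  have K: "K \<ge> 0" by (simp add: K_def)
  define q where "q = (if r = \<infinity> then 2 else real_of_ereal r)"
  have q: "q > 1" using r by (cases r) (auto simp: q_def)
  obtain A where A: "A \<ge> 0" "\<And>N. step_atoms_bounded \<alpha> K q N A" using step_atoms_uniformly_bounded[OF k K q] by blast
  have m: "4 * ?n\<^sup>2 \<ge> 1" using n one_le_power[of ?n 2] by linarith
  obtain D where D: "D \<ge> 1" "\<And>a l E. admissible K a l \<Longrightarrow> E \<in> sets borel \<Longrightarrow>
      (\<And>x. x \<in> E \<Longrightarrow> norm (x - a) \<le> (4 * ?n\<^sup>2) * l) \<Longrightarrow> measure gauss E \<le> D * measure gauss (cube (a :: real ^ 'n) l)"
    using gauss_local_doubling[OF K m, where 'n = 'n] by metis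
  obtain C1 where C1: "C1 \<ge> 0" "closure_bound \<alpha> (\<lambda>x. 1) C1" "gnorm 1 (\<lambda>x :: real ^ 'n. 1 :: complex) \<le> ennreal C1"
    using closure_bound_one by blast
  define C where "C = C1 + 8 * A * D + 2 * D"
  have C: "C \<ge> 0" "C1 \<le> C" "8 * A * D \<le> C" "2 * D \<le> C" using A C1 D by (auto simp: C_def)
  have "a \<in> borel_measurable borel \<and> closure_bound \<alpha> a C \<and> gnorm 1 a \<le> ennreal C" if atom: "gaussian_atom r a" for a :: "real ^ 'n \<Rightarrow> complex"
  proof (cases "a = (\<lambda>x. 1)")
    case True
    then show ?thesis using closure_bound_mono[OF C1(2) C(2)] order_trans[OF C1(3) ennreal_leI[OF C(2)]] by simp
  next
    case False
    then obtain c \<rho> where aL: "a \<in> Lp r" and \<rho>: "0 < \<rho>" "\<rho> \<le> admissible_radius (norm c)"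
      and supp: "AE x in gauss. x \<notin> ball c \<rho> \<longrightarrow> a x = 0" and a0: "(LINT x|gauss. a x) = 0"
      and nrm: "Lp_norm r a \<le> measure gauss (ball c \<rho>) powr (real_of_ereal (1 / r) - 1)"
      using atom unfolding gaussian_atom_def by blast
    have am[measurable]: "a \<in> borel_measurable borel" using aL by (simp add: Lp_def)
    define b where "b = c - (\<chi> i. \<rho>)"
    note geo = ball_cube_geometry[OF \<rho>, folded b_def K_def]
    let ?Q = "cube b (2 * \<rho>)" and ?g = "measure gauss (ball c \<rho>)"
    have l': "\<rho> / (2 * ?n) > 0" "\<rho> / (2 * ?n) \<le> 2 * \<rho>"
      using \<rho> n by (auto simp: field_simps) (use n in linarith)
    have ad': "admissible K c (\<rho> / (2 * ?n))"
      by (rule admissible_subcube[OF geo(2) l'(1,2)]) (use geo in blast)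
    have pos: "0 < measure gauss (cube c (\<rho> / (2 * ?n)))" by (rule measure_cube_pos[OF l'(1)])
    have sm: "measure gauss (cube c (\<rho> / (2 * ?n))) \<le> ?g" by (intro gauss.finite_measure_mono geo) auto
    have g: "?g > 0" using pos sm by linarith
    have "measure gauss ?Q \<le> D * measure gauss (cube c (\<rho> / (2 * ?n)))"
    proof (rule D(2)[OF ad'])
      fix x assume "x \<in> ?Q"
      then have "norm (x - c) \<le> 2 * ?n * \<rho>" by (rule geo(4))
      also have "\<dots> = (4 * ?n\<^sup>2) * (\<rho> / (2 * ?n))" using n by (simp add: power2_eq_square)
      finally show "norm (x - c) \<le> (4 * ?n\<^sup>2) * (\<rho> / (2 * ?n))" .
    qed simp
    also have "\<dots> \<le> D * ?g" using sm D by (intro mult_left_mono) auto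
    finally have Qg: "measure gauss ?Q \<le> D * ?g" .
    have gQ: "?g \<le> measure gauss ?Q" by (intro gauss.finite_measure_mono geo) auto
    define R where "R = 1 / ?g"
    have R: "R > 0" using g by (simp add: R_def)
    have RQ: "R * measure gauss ?Q \<le> D" using Qg g by (simp add: R_def field_simps)
    have en: "integrable gauss (\<lambda>x. norm (a x) powr q)" "(LINT x|gauss. norm (a x) powr q) \<le> R powr q * ?g"
      using atom_energy[OF r aL _ supp g nrm] by (simp_all add: q_def R_def)
    define u where "u x = indicat_real ?Q x *\<^sub>R a x" for x
    have um[measurable]: "u \<in> borel_measurable borel" unfolding u_def by measurable
    have AE: "AE x in gauss. u x = a x"
      using supp by eventually_elim (use geo(1) in \<open>auto simp: u_def indicator_def\<close>)
    have uint: "integrable gauss (\<lambda>x. norm (u x) powr q)"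
      by (rule Bochner_Integration.integrable_cong_AE_imp[OF en(1)]) (use AE in \<open>auto elim!: eventually_mono\<close>)
    have "(LINT x|gauss. norm (u x) powr q) = (LINT x|gauss. norm (a x) powr q)"
      by (rule integral_cong_AE) (use AE in \<open>auto elim!: eventually_mono\<close>)
    also have "\<dots> \<le> R powr q * measure gauss ?Q" using en(2) gQ by (meson mult_left_mono order_trans powr_ge_zero)
    finally have ule: "(LINT x|gauss. norm (u x) powr q) \<le> R powr q * measure gauss ?Q" .
    have us: "x \<notin> ?Q \<Longrightarrow> u x = 0" for x by (simp add: u_def)
    have u0: "(LINT x|gauss. u x) = 0" using a0 integral_cong_AE[of u gauss a] AE by simp
    define v where "v x = complex_of_real (1 / R) * u x" for x
    have eq: "norm (v x) powr q = (1 / R) powr q * norm (u x) powr q" for x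
    proof -
      have "norm (v x) = (1 / R) * norm (u x)" using R by (simp add: v_def norm_mult norm_divide)
      then show ?thesis by (simp only: powr_mult)
    qed
    have "closure_bound \<alpha> v (8 * A * measure gauss ?Q)"
    proof (rule closure_bound_powr_atom[OF A q geo(2)])
      show "integrable gauss (\<lambda>x. norm (v x) powr q)" unfolding eq using uint by simp
      show "v x = 0" if "x \<notin> ?Q" for x using us[OF that] by (simp add: v_def)
      show "(LINT x|gauss. v x) = 0" using u0 by (simp add: v_def)
      have "(LINT x|gauss. norm (v x) powr q) = (1 / R) powr q * (LINT x|gauss. norm (u x) powr q)"
        unfolding eq by simp
      also have "\<dots> \<le> (1 / R) powr q * (R powr q * measure gauss ?Q)" using ule by (intro mult_left_mono) auto
      also have "\<dots> = ((1 / R) * R) powr q * measure gauss ?Q" by (simp only: powr_mult mult.assoc)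
      also have "\<dots> = measure gauss ?Q" using R by simp
      finally show "(LINT x|gauss. norm (v x) powr q) \<le> measure gauss ?Q" .
      show "v \<in> borel_measurable borel" unfolding v_def by measurable
    qed
    from closure_bound_scale[OF this, of "complex_of_real R"]
    have "closure_bound \<alpha> (\<lambda>x. complex_of_real R * v x) (R * (8 * A * measure gauss ?Q))" using R by simp
    moreover have "(\<lambda>x. complex_of_real R * v x) = u" using R by (intro ext) (simp add: v_def)
    moreover have "R * (8 * A * measure gauss ?Q) \<le> C"
    proof -
      have "(8 * A) * (R * measure gauss ?Q) \<le> (8 * A) * D" using RQ A by (intro mult_left_mono) auto
      then show ?thesis using C(3) by (simp add: mult_ac)
    qed
    ultimately have "closure_bound \<alpha> u C" by (metis closure_bound_mono)
    then have "closure_bound \<alpha> a C"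
      unfolding closure_bound_def using riesz_closure_cong_AE[OF _ AE am] by blast
    moreover have "gnorm 1 a \<le> ennreal C"
    proof -
      have "gnorm 1 a = gnorm 1 u" using AE by (intro gnorm_cong_AE) (auto elim!: eventually_mono)
      also have "\<dots> \<le> ennreal (2 * R * measure gauss ?Q)" by (rule gnorm_1_le_cube[OF um uint us q R ule])
      also have "\<dots> \<le> ennreal C" using RQ C(4) by (intro ennreal_leI) simp
      finally show ?thesis .
    qed
    ultimately show ?thesis using am by blast
  qed
  then show ?thesis using that C(1) by blast
qed

section \<open>Boundedness on the Hardy space\<close>

lemma weak_L1_norm_le:
  assumes [measurable]: "u \<in> borel_measurable borel"
  shows "weak_L1_norm u \<le> gnorm 1 u"
  unfolding weak_L1_norm_def
proof (rule SUP_least)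
  fix t :: real assume "t \<in> {0<..}"
  have "ennreal t * emeasure gauss {x. norm (u x) > t} = (\<integral>\<^sup>+x. ennreal t * indicator {x. norm (u x) > t} x \<partial>gauss)"
    by (subst nn_integral_cmult_indicator) auto
  also have "\<dots> \<le> (\<integral>\<^sup>+x. ennreal (norm (u x)) \<partial>gauss)"
    by (intro nn_integral_mono) (auto simp: indicator_def intro!: ennreal_leI)
  finally show "ennreal t * emeasure gauss {x. norm (u x) > t} \<le> gnorm 1 u" by (simp add: gnorm_def)
qed

lemma Lp_norm_1_le:
  assumes "u \<in> borel_measurable borel" "gnorm 1 u \<le> ennreal C" "C \<ge> 0"
  shows "u \<in> Lp 1" "0 \<le> Lp_norm 1 u" "Lp_norm 1 u \<le> C"
proof -
  show u: "u \<in> Lp 1" using assms le_less_trans[OF assms(2)] by (simp add: Lp_1_iff)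
  show "0 \<le> Lp_norm 1 u" by (simp add: Lp_norm_def)
  show "Lp_norm 1 u \<le> C" using assms(2,3) gnorm_1_Lp_norm[OF u] by simp
qed

lemma riesz_closure_imp_riesz:
  assumes rc: "riesz_closure \<alpha> f g" and f: "f \<in> Lp 1"
  shows "riesz \<alpha> f g"
proof -
  have [measurable]: "f \<in> borel_measurable borel" "g \<in> borel_measurable borel" using rc by (auto simp: riesz_closure_def)
  let ?e = "\<lambda>k. 1 / real (Suc k)"
  have "\<forall>k. \<exists>F G. F \<in> Lp 2 \<and> riesz_L2 \<alpha> F G \<and> G \<in> borel_measurable borel \<and>
        gnorm 1 (\<lambda>x. F x - f x) < ennreal (?e k) \<and> gnorm 1 (\<lambda>x. G x - g x) < ennreal (?e k)"
    using rc unfolding riesz_closure_def by simp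
  from choice[OF this] obtain F where "\<forall>k. \<exists>G. F k \<in> Lp 2 \<and> riesz_L2 \<alpha> (F k) G \<and> G \<in> borel_measurable borel \<and>
        gnorm 1 (\<lambda>x. F k x - f x) < ennreal (?e k) \<and> gnorm 1 (\<lambda>x. G x - g x) < ennreal (?e k)" ..
  from choice[OF this] obtain G where FG: "\<forall>k. F k \<in> Lp 2 \<and> riesz_L2 \<alpha> (F k) (G k) \<and> G k \<in> borel_measurable borel \<and>
        gnorm 1 (\<lambda>x. F k x - f x) < ennreal (?e k) \<and> gnorm 1 (\<lambda>x. G k x - g x) < ennreal (?e k)" ..
  have [measurable]: "F k \<in> borel_measurable borel" "G k \<in> borel_measurable borel" for k
    using FG unfolding Lp_2_iff by auto
  have e0: "?e \<longlonglongrightarrow> 0" by (rule LIMSEQ_Suc[OF lim_1_over_n])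
  have "(\<lambda>k. Lp_norm 1 (\<lambda>x. F k x - f x)) \<longlonglongrightarrow> 0"
  proof (rule tendsto_sandwich[OF _ _ tendsto_const e0])
    have le: "gnorm 1 (\<lambda>x. F k x - f x) \<le> ennreal (?e k)" for k using FG less_imp_le by blast
    show "\<forall>\<^sub>F k in sequentially. 0 \<le> Lp_norm 1 (\<lambda>x. F k x - f x)" "\<forall>\<^sub>F k in sequentially. Lp_norm 1 (\<lambda>x. F k x - f x) \<le> ?e k"
      by (intro always_eventually allI Lp_norm_1_le[OF _ le]; simp)+
  qed
  moreover have "(\<lambda>k. weak_L1_norm (\<lambda>x. G k x - g x)) \<longlonglongrightarrow> 0"
  proof (rule tendsto_sandwich[OF _ _ tendsto_const])
    have "weak_L1_norm (\<lambda>x. G k x - g x) \<le> gnorm 1 (\<lambda>x. G k x - g x)" for k by (rule weak_L1_norm_le) measurable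
    then show "\<forall>\<^sub>F k in sequentially. weak_L1_norm (\<lambda>x. G k x - g x) \<le> ennreal (?e k)"
      using FG by (meson always_eventually less_imp_le order_trans)
    show "(\<lambda>k. ennreal (?e k)) \<longlonglongrightarrow> 0" using tendsto_ennrealI[OF e0] by simp
  qed simp
  ultimately show ?thesis unfolding riesz_def using f FG
    by (intro conjI exI[of _ F] exI[of _ G]) auto
qed

text \<open>Applies \<open>closure_bound_series\<close> to the atomic series. The bound for \<open>f\<close> itself shows that a
  function of Hardy norm zero vanishes almost everywhere.\<close>

lemma atomic_decomposition_bounds:
  fixes f :: "real ^ 'n::finite \<Rightarrow> complex"
  assumes C: "C \<ge> 0" "\<And>a :: real ^ 'n \<Rightarrow> complex. gaussian_atom r a \<Longrightarrow>
    a \<in> borel_measurable borel \<and> closure_bound \<alpha> a C \<and> gnorm 1 a \<le> ennreal C"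
    and f: "f \<in> Lp 1" and dec: "atomic_decomposition r f c a"
  shows "closure_bound \<alpha> f (C * (\<Sum>j. norm (c j)))" "gnorm 1 f \<le> ennreal (C * (\<Sum>j. norm (c j)))"
proof -
  have fm[measurable]: "f \<in> borel_measurable borel" and f1: "gnorm 1 f < \<infinity>" using f Lp_1_iff by auto
  have at: "gaussian_atom r (a j)" for j using dec by (simp add: atomic_decomposition_def)
  have sm: "summable (\<lambda>j. norm (c j))" using dec by (simp add: atomic_decomposition_def)
  define d where "d j x = c j * a j x" for j x
  have [measurable]: "a j \<in> borel_measurable borel" for j using C(2)[OF at[of j]] by simp
  have dm[measurable]: "d j \<in> borel_measurable borel" for j unfolding d_def by measurable
  have dn: "gnorm 1 (d j) \<le> ennreal (norm (c j) * C)" for j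
  proof -
    have "gnorm 1 (d j) = ennreal (norm (c j)) * gnorm 1 (a j)"
      unfolding d_def by (subst gnorm_mult_const) simp_all
    also have "\<dots> \<le> ennreal (norm (c j)) * ennreal C" using C(2)[OF at[of j]] by (intro mult_left_mono) auto
    finally show ?thesis by (simp add: ennreal_mult')
  qed
  have db: "closure_bound \<alpha> (d j) (norm (c j) * C)" for j
    unfolding d_def using C(2)[OF at[of j]] by (intro closure_bound_scale) simp
  have nn: "0 \<le> norm (c j) * C" for j using C by simp
  have S: "gnorm 1 (\<lambda>x. \<Sum>j<N. d j x) \<le> ennreal (\<Sum>j<N. norm (c j) * C)" for N
    by (rule gnorm_1_sum_le[OF dm dn nn]) simp
  have sm': "summable (\<lambda>j. norm (c j) * C)" by (rule summable_mult2[OF sm])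
  have sum: "(\<Sum>j. norm (c j) * C) = C * (\<Sum>j. norm (c j))" using suminf_mult2[OF sm, of C] by (simp add: mult.commute)
  have Lp: "(\<lambda>x. f x - (\<Sum>j<N. d j x)) \<in> Lp 1" for N
  proof -
    have "gnorm 1 (\<lambda>x. f x - (\<Sum>j<N. d j x)) < \<infinity>"
      using S[of N] by (intro gnorm_diff_finite f1) (auto intro: le_less_trans)
    then show ?thesis by (simp add: Lp_1_iff)
  qed
  have lim: "(\<lambda>N. gnorm 1 (\<lambda>x. f x - (\<Sum>j<N. d j x))) \<longlonglongrightarrow> 0"
  proof -
    have "(\<lambda>N. Lp_norm 1 (\<lambda>x. f x - (\<Sum>j<N. d j x))) \<longlonglongrightarrow> 0"
      using dec by (simp add: atomic_decomposition_def d_def)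
    from tendsto_ennrealI[OF this] show ?thesis unfolding gnorm_1_Lp_norm[OF Lp] by simp
  qed
  show "closure_bound \<alpha> f (C * (\<Sum>j. norm (c j)))"
    using closure_bound_series[OF fm db nn sm' lim] sum by simp
  have "gnorm 1 f \<le> gnorm 1 (\<lambda>x. f x - (\<Sum>j<N. d j x)) + ennreal (C * (\<Sum>j. norm (c j)))" for N
  proof -
    have "gnorm 1 (\<lambda>x. (f x - (\<Sum>j<N. d j x)) + (\<Sum>j<N. d j x)) \<le> gnorm 1 (\<lambda>x. f x - (\<Sum>j<N. d j x)) + gnorm 1 (\<lambda>x. \<Sum>j<N. d j x)"
      by (rule gnorm_1_triangle) measurable
    also have "gnorm 1 (\<lambda>x. \<Sum>j<N. d j x) \<le> ennreal (C * (\<Sum>j. norm (c j)))"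
      unfolding sum[symmetric] by (intro order_trans[OF S] ennreal_leI sum_le_suminf sm') (use nn in auto)
    finally show ?thesis by (simp add: add_left_mono)
  qed
  moreover have "(\<lambda>N. gnorm 1 (\<lambda>x. f x - (\<Sum>j<N. d j x)) + ennreal (C * (\<Sum>j. norm (c j)))) \<longlonglongrightarrow> 0 + ennreal (C * (\<Sum>j. norm (c j)))"
    by (intro tendsto_add tendsto_const lim)
  ultimately have "gnorm 1 f \<le> 0 + ennreal (C * (\<Sum>j. norm (c j)))" by (intro LIMSEQ_le_const) auto
  then show "gnorm 1 f \<le> ennreal (C * (\<Sum>j. norm (c j)))" by simp
qed

theorem theorem1p2:
  fixes \<alpha> :: "'n::finite \<Rightarrow> nat" and r :: ereal
  assumes "\<alpha> \<noteq> (\<lambda>i. 0)" and "1 < r"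
  shows "\<exists>C>0. \<forall>f \<in> hardy r. \<exists>g. riesz \<alpha> f g \<and> g \<in> Lp 1 \<and>
           Lp_norm 1 g \<le> C * hardy_norm r f"
proof -
  have k: "sum \<alpha> UNIV > 0"
  proof -
    obtain i where "\<alpha> i \<noteq> 0" using assms(1) by auto
    then show ?thesis using member_le_sum[of i UNIV \<alpha>] by simp
  qed
  obtain C where C: "C \<ge> 0" "\<And>a :: real ^ 'n \<Rightarrow> complex. gaussian_atom r a \<Longrightarrow>
    a \<in> borel_measurable borel \<and> closure_bound \<alpha> a C \<and> gnorm 1 a \<le> ennreal C"
    using gaussian_atoms_uniformly_bounded[OF k assms(2)] by blast
  show ?thesis
  proof (intro exI[of _ "2 * C + 1"] conjI ballI)
    \<comment> \<open>The factor \<open>2\<close> pays for a decomposition that is not optimal; adding \<open>1\<close> makes the constant positive.\<close>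
    show "0 < 2 * C + 1" using C by simp
    fix f :: "real ^ 'n \<Rightarrow> complex" assume fh: "f \<in> hardy r"
    then have f: "f \<in> Lp 1" by (simp add: hardy_def)
    define S where "S = {\<Sum>j. norm (c j) | c. \<exists>a. atomic_decomposition r f c a}"
    define h where "h = hardy_norm r f"
    have hS: "h = Inf S" by (simp add: h_def hardy_norm_def S_def)
    have ne: "S \<noteq> {}" using fh by (auto simp: hardy_def S_def)
    have pos: "0 \<le> s" if "s \<in> S" for s
      using that by (auto simp: S_def atomic_decomposition_def intro!: suminf_nonneg)
    have h0: "h \<ge> 0" unfolding hS using ne pos by (intro cInf_greatest)
    have bound: "closure_bound \<alpha> f (C * s) \<and> gnorm 1 f \<le> ennreal (C * s)" if hs: "h < s" for s
    proof -
      obtain s' where s': "s' \<in> S" "s' < s" using cInf_lessD[OF ne, of s] hs hS by blast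
      then obtain c a where "atomic_decomposition r f c a" "s' = (\<Sum>j. norm (c j))" by (auto simp: S_def)
      then have "closure_bound \<alpha> f (C * s')" "gnorm 1 f \<le> ennreal (C * s')"
        using atomic_decomposition_bounds[OF C f] by auto
      moreover have "C * s' \<le> C * s" using s' C by (intro mult_left_mono) auto
      ultimately show ?thesis by (meson closure_bound_mono ennreal_leI order_trans)
    qed
    show "\<exists>g. riesz \<alpha> f g \<and> g \<in> Lp 1 \<and> Lp_norm 1 g \<le> (2 * C + 1) * hardy_norm r f"
    \<comment> \<open>If \<open>h = 0\<close> there need not be a decomposition of cost at most \<open>2 h\<close>, but then \<open>f\<close> is null.\<close>
    proof (cases "h > 0")
      case True
      then obtain g where g: "riesz_closure \<alpha> f g" "gnorm 1 g \<le> ennreal (C * (2 * h))"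
        using bound[of "2 * h"] by (auto simp: closure_bound_def)
      then have "g \<in> borel_measurable borel" by (simp add: riesz_closure_def)
      note n = Lp_norm_1_le[OF this g(2)]
      have "C * (2 * h) \<le> (2 * C + 1) * h" using True by (simp add: algebra_simps)
      moreover have "Lp_norm 1 g \<le> C * (2 * h)" "g \<in> Lp 1" using n C(1) True by auto
      ultimately show ?thesis using riesz_closure_imp_riesz[OF g(1) f] unfolding h_def[symmetric]
        by (intro exI[of _ g] conjI) auto
    next
      case False
      then have h: "h = 0" using h0 by simp
      have "gnorm 1 f \<le> ennreal e" if e: "e > 0" for e
      proof -
        have "e / (C + 1) > 0" using e C by simp
        then have "gnorm 1 f \<le> ennreal (C * (e / (C + 1)))" using bound h by blast
        also have "\<dots> \<le> ennreal e" using e C by (intro ennreal_leI) (simp add: field_simps)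
        finally show ?thesis .
      qed
      then have "gnorm 1 f = 0" by (metis ennreal_le_epsilon add_0 le_zero_eq)
      have fm[measurable]: "f \<in> borel_measurable borel" using f Lp_1_iff by auto
      have AE: "AE x in gauss. 0 = f x"
        using \<open>gnorm 1 f = 0\<close> unfolding gnorm_def by (subst (asm) nn_integral_0_iff_AE) (auto elim!: eventually_mono)
      obtain g where "riesz_closure \<alpha> f g" using bound[of 1] h by (auto simp: closure_bound_def)
      from riesz_closure_scale[OF this, of 0] have "riesz_closure \<alpha> (\<lambda>x. 0) (\<lambda>x. 0)" by simp
      then have rc: "riesz_closure \<alpha> f (\<lambda>x. 0)" by (rule riesz_closure_cong_AE[OF _ AE fm])
      have "gnorm 1 (\<lambda>x :: real ^ 'n. 0 :: complex) \<le> ennreal 0" by (simp add: gnorm_def)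
      note n = Lp_norm_1_le[OF _ this]
      show ?thesis using riesz_closure_imp_riesz[OF rc f] n h
        by (intro exI[of _ "\<lambda>x. 0"]) (simp add: h_def[symmetric])
    qed
  qed
qed

end
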